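(* Let $p$ be any prime and let $k$ be an integer with $4\mid k$. Suppose that $F\in M_k(U_2(\mathcal{O});\mathbb{Z})$ satisfies $a_F(m,r,s,n)\equiv 0 \pmod p$ for all $(m,r,s,n)$ indexing Fourier coefficients of $F$ with \[0\le m,\ n\le \left[\tfrac{k}{8}\right].\] Then $F\equiv 0\pmod p$, i.e. every Fourier coefficient of $F$ is divisible by $p$.
   Context: Let $\mathcal{O}=\mathbb{Z}[\sqrt{-1}]$ and $\mathbb{H}_2=\{Z\in M_2(\mathbb{C}) : \frac{1}{2i}(Z-{}^t\overline{Z})>0\}$. Let $U_2(\mathcal{O})=\{M\in M_4(\mathcal{O}) : {}^t\overline{M}JM=J\}$ with $J=\begin{pmatrix}0_2&-1_2\\ 1_2&0_2\end{pmatrix}$, acting on $\mathbb{H}_2$ by $M\langle Z\rangle=(AZ+B)(CZ+D)^{-1}$ for $M=\begin{pmatrix}A&B\\C&D\end{pmatrix}$. For an integer $k$, $M_k(U_2(\mathcal{O}))$ denotes the space of symmetric Hermitian modular forms of weight $k$ and character $\det^k$: holomorphic $F:\mathbb{H}_2\to\mathbb{C}$ with $\det(CZ+D)^{-k}F(M\langle Z\rangle)=\det(M)^kF(Z)$ for all $M\in U_2(\mathcal{O})$ and $F({}^tZ)=F(Z)$. Each such $F$ has a Fourier expansion $F(Z)=\sum_{H}a_F(H)e^{2\pi i\,\mathrm{tr}(HZ)}$, $H$ running over positive semidefinite matrices in $\Lambda_2=\{H=(h_{ij})\in \mathrm{Her}_2(\mathbb{Q}(\sqrt{-1})) : h_{ii}\in\mathbb{Z},\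 2h_{12}\in\mathcal{O}\}$. One writes $H=(m,r,s,n)$ for $H=\begin{pmatrix}m&\frac{r+si}{2}\\ \frac{r-si}{2}&n\end{pmatrix}$ ($m,r,s,n\in\mathbb{Z}$) and $a_F(m,r,s,n)=a_F(H)$. For a subring $R\subset\mathbb{C}$, $M_k(U_2(\mathcal{O});R)$ is the set of $F\in M_k(U_2(\mathcal{O}))$ all of whose Fourier coefficients lie in $R$. $[x]$ denotes the integer part of $x$. *)

theory Defs
  imports "HOL-Analysis.Analysis" "HOL-Computational_Algebra.Primes"
begin

definition gaussian_ints :: "complex set" where
  "gaussian_ints = {z. Re z \<in> \<int> \<and> Im z \<in> \<int>}"

definition conj_transpose :: "complex^'n^'m \<Rightarrow> complex^'m^'n" where
  "conj_transpose M = (\<chi> i j. cnj (M $ j $ i))"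

definition hermitian :: "complex^'n^'n \<Rightarrow> bool" where
  "hermitian H \<longleftrightarrow> conj_transpose H = H"

text \<open>The value of the Hermitian form \<open>v \<mapsto> v\<^sup>* H v\<close>; for Hermitian \<open>H\<close> it is real.\<close>

definition herm_form :: "complex^'n^'n \<Rightarrow> complex^'n \<Rightarrow> complex" where
  "herm_form H v = (\<Sum>i\<in>UNIV. \<Sum>j\<in>UNIV. cnj (v $ i) * H $ i $ j * v $ j)"

definition pos_def :: "complex^'n^'n \<Rightarrow> bool" where
  "pos_def H \<longleftrightarrow> hermitian H \<and> (\<forall>v. v \<noteq> 0 \<longrightarrow> 0 < Re (herm_form H v))"

definition pos_semidef :: "complex^'n^'n \<Rightarrow> bool" where
  "pos_semidef H \<longleftrightarrow> hermitian H \<and> (\<forall>v. 0 \<le> Re (herm_form H v))"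

definition hermitian_half_space :: "(complex^2^2) set" where
  "hermitian_half_space =
     {Z. pos_def (\<chi> i j. (Z - conj_transpose Z) $ i $ j / (2 * \<i>))}"

text \<open>Matrices of size 4 are indexed by the four-element type \<open>2 + 2\<close>, so that the
  \<open>2 \<times> 2\<close> blocks \<open>A, B, C, D\<close> are obtained by restricting the index to either summand.\<close>

type_synonym mat4 = "complex^(2 + 2)^(2 + 2)"

definition blockA :: "mat4 \<Rightarrow> complex^2^2" where
  "blockA M = (\<chi> i j. M $ Inl i $ Inl j)"

definition blockB :: "mat4 \<Rightarrow> complex^2^2" where
  "blockB M = (\<chi> i j. M $ Inl i $ Inr j)"

definition blockC :: "mat4 \<Rightarrow> complex^2^2" where
  "blockC M = (\<chi> i j. M $ Inr i $ Inl j)"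

definition blockD :: "mat4 \<Rightarrow> complex^2^2" where
  "blockD M = (\<chi> i j. M $ Inr i $ Inr j)"

definition Jmat :: mat4 where
  "Jmat = (\<chi> a b. case (a, b) of
       (Inl i, Inr j) \<Rightarrow> if i = j then - 1 else 0
     | (Inr i, Inl j) \<Rightarrow> if i = j then 1 else 0
     | _ \<Rightarrow> 0)"

definition U2 :: "mat4 set" where
  "U2 = {M. (\<forall>a b. M $ a $ b \<in> gaussian_ints) \<and> conj_transpose M ** Jmat ** M = Jmat}"

definition aut_factor :: "mat4 \<Rightarrow> complex^2^2 \<Rightarrow> complex^2^2" where
  "aut_factor M Z = blockC M ** Z + blockD M"

definition moebius_act :: "mat4 \<Rightarrow> complex^2^2 \<Rightarrow> complex^2^2" where
  "moebius_act M Z = (blockA M ** Z + blockB M) ** matrix_inv (aut_factor M Z)"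

text \<open>Holomorphy in the four matrix entries, on an open set: the total (real) derivative
  exists at every point and is complex linear.\<close>

definition holomorphic_mat_on :: "(complex^2^2 \<Rightarrow> complex) \<Rightarrow> (complex^2^2) set \<Rightarrow> bool" where
  "holomorphic_mat_on F S \<longleftrightarrow>
     (\<forall>Z\<in>S. \<exists>F'. (F has_derivative F') (at Z) \<and>
        (\<forall>c X. F' (\<chi> i j. c * X $ i $ j) = c * F' X))"

text \<open>Symmetric Hermitian modular forms of weight \<open>k\<close> and character \<open>det\<^sup>k\<close>. Functions are
  total; only their values on the half-space matter.\<close>

definition hermitian_modular_forms :: "int \<Rightarrow> (complex^2^2 \<Rightarrow> complex) set" where
  "hermitian_modular_forms k = {F.
     holomorphic_mat_on F hermitian_half_space \<and>
     (\<forall>M\<in>U2. \<forall>Z\<in>hermitian_half_space.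
        det (aut_factor M Z) powi (- k) * F (moebius_act M Z) = det M powi k * F Z) \<and>
     (\<forall>Z\<in>hermitian_half_space. F (transpose Z) = F Z)}"

text \<open>The entries of such matrices automatically lie in \<open>\<rat>(\<i>)\<close>.\<close>

definition Lambda2 :: "(complex^2^2) set" where
  "Lambda2 = {H. hermitian H \<and> (\<forall>i. H $ i $ i \<in> \<int>) \<and> 2 * H $ 1 $ 2 \<in> gaussian_ints}"

definition fourier_index :: "(complex^2^2) set" where
  "fourier_index = {H \<in> Lambda2. pos_semidef H}"

definition index_mat :: "int \<Rightarrow> int \<Rightarrow> int \<Rightarrow> int \<Rightarrow> complex^2^2" where
  "index_mat m r s n = vector
     [vector [of_int m, (of_int r + of_int s * \<i>) / 2],
      vector [(of_int r - of_int s * \<i>) / 2, of_int n]]"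

text \<open>The sum is unordered, i.e. absolutely convergent. The second conjunct only
  normalises \<open>a\<close> off the index set, so that an expansion determines \<open>a\<close> as a function.\<close>

definition is_fourier_expansion :: "(complex^2^2 \<Rightarrow> complex) \<Rightarrow> (complex^2^2 \<Rightarrow> complex) \<Rightarrow> bool" where
  "is_fourier_expansion F a \<longleftrightarrow>
     (\<forall>Z\<in>hermitian_half_space.
        ((\<lambda>H. a H * exp (2 * of_real pi * \<i> * trace (H ** Z))) has_sum F Z) fourier_index) \<and>
     (\<forall>H. H \<notin> fourier_index \<longrightarrow> a H = 0)"

definition fourier_coeff :: "(complex^2^2 \<Rightarrow> complex) \<Rightarrow> complex^2^2 \<Rightarrow> complex" where
  "fourier_coeff F = (THE a. is_fourier_expansion F a)"

definition hermitian_modular_forms_over :: "int \<Rightarrow> complex set \<Rightarrow> (complex^2^2 \<Rightarrow> complex) set" where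
  "hermitian_modular_forms_over k R =
     {F \<in> hermitian_modular_forms k. \<forall>H\<in>fourier_index. fourier_coeff F H \<in> R}"

end

theory Submission
  imports Defs "HOL-Complex_Analysis.Complex_Analysis"
begin

text \<open>
  Write \<open>F(\<tau>, \<tau>', x, y)\<close> for \<open>F\<close> at the matrix with diagonal \<open>\<tau>, \<tau>'\<close> and off-diagonal entries \<open>x \<plusminus> iy\<close>.
  The coefficients of \<open>e(n\<tau>')\<close> are Jacobi forms \<open>\<phi>\<^sub>n(\<tau>, x, y)\<close> of weight \<open>k\<close> and index \<open>n\<close> in two
  elliptic variables, and the symmetry \<open>a(m,r,s,n) = a(n,r,s,m)\<close> allows induction on \<open>n\<close>: the hypothesis
  together with the induction hypothesis says that \<open>\<phi>\<^sub>n\<close> vanishes modulo \<open>p\<close> up to \<open>q\<close>-order \<open>B\<close>, where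
  \<open>8B > k\<close> and \<open>B \<ge> n\<close>.

  To see that \<open>\<phi>\<^sub>n\<close> then vanishes modulo \<open>p\<close>, put \<open>y = Kx\<close> for a large integer \<open>K\<close> chosen such that the
  lowest coefficient of \<open>\<phi>\<^sub>n\<close> prime to \<open>p\<close> is not cancelled, and specialise \<open>x\<close> to the points
  \<open>(i\<tau> + j)/N\<close> for a large prime \<open>N\<close>. The resulting modular forms of weight \<open>k\<close> are permuted by the
  modular group up to roots of unity. After raising them to the power \<open>12N\<close> and dividing by \<open>\<Delta>\<^sup>k\<^sup>N\<close>, their
  elementary symmetric functions are level one functions of weight 0, with expansions over a ring of
  cyclotomic integers. The order of the form at \<open>(i, j)\<close> modulo a prime above \<open>p\<close> is at least
  \<open>B - n(a - a\<^sup>2) - n(a' - a'\<^sup>2)\<close> with \<open>a = i/N\<close> and \<open>a'\<close> the fractional part of \<open>Ka\<close>, which on average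
  is about \<open>B - n/3 \<ge> 2B/3 > k/12\<close>. Hence the symmetric function of top nonzero degree modulo the prime has
  a zero at infinity modulo that prime, and subtracting powers of a substitute for Klein's \<open>j\<close>
  shows that it vanishes identically modulo the prime, a contradiction.
\<close>

section \<open>Partial fractions of the cotangent and sums over the integers\<close>

text \<open>The bound k/8 comes from three numbers. A form of weight k and level one that vanishes
  modulo a prime to order more than k/12 vanishes modulo that prime. On average each of the losses
  n(a - a^2) and n(a' - a'^2) costs n/6, so the mean order is about B - n/3, and B >= n leaves 2B/3.
  Finally 2B/3 > k/12 says exactly 8B > k.

  The symmetric functions have variable degree because nothing controls the points with i = 0: there
  many indices can share an exponent and the form may vanish modulo the prime, so the product of all
  conjugates could be congruent to zero from the start.

  The prime is arbitrary, 2 and 3 included, so every auxiliary function needs an integral expansion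
  with leading coefficient 1 or -1. Delta, its inverse and the substitute for j have this property.
  Weight 2 enters only to prove that Delta is modular.

  That 4 divides k gives det(M)^k = 1, as det(M) is a unit of Z[i], and a(m,r,s,n) = a(n,r,s,m)
  without a sign.\<close>

lemma not_Ints_sin:
  fixes w :: complex
  assumes "w \<notin> \<int>"
  shows "w \<notin> \<int>\<^sub>\<le>\<^sub>0" "1 - w \<notin> \<int>\<^sub>\<le>\<^sub>0" "sin (of_real pi * w) \<noteq> 0"
proof -
  show "w \<notin> \<int>\<^sub>\<le>\<^sub>0" using assms nonpos_Ints_Int by blast
  show "1 - w \<notin> \<int>\<^sub>\<le>\<^sub>0"
  proof
    assume "1 - w \<in> \<int>\<^sub>\<le>\<^sub>0"
    hence "1 - w \<in> \<int>" by (rule nonpos_Ints_Int)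
    hence "1 - (1 - w) \<in> \<int>" by (rule Ints_diff[OF Ints_1])
    hence "w \<in> \<int>" by (simp only: diff_diff_eq2 add_diff_cancel_left')
    with assms show False by simp
  qed
  show "sin (of_real pi * w) \<noteq> 0"
  proof
    assume "sin (of_real pi * w) = 0"
    then obtain n :: int where "of_real pi * w = of_real (of_int n * pi)" by (auto simp: sin_eq_0)
    hence "w = of_int n" by simp
    with assms show False by simp
  qed
qed

text \<open>Logarithmic derivative of the reflection formula: Gamma(w) Gamma(1 - w) sin(pi w) is
  constant near every non-integer.\<close>

lemma Digamma_reflection:
  fixes z :: complex
  assumes "z \<notin> \<int>"
  shows "Digamma (1 - z) - Digamma z = of_real pi * cot (of_real pi * z)"
proof -
  note nz = not_Ints_sin[OF assms]
  have eq: "Gamma w * Gamma (1 - w) * sin (of_real pi * w) = of_real pi" if "w \<notin> \<int>" for w :: complex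
    using Gamma_reflection_complex[of w] not_Ints_sin(3)[OF that] by (simp add: field_simps)
  have op: "open (- (\<int> :: complex set))" using closed_Ints by (simp add: open_Compl)
  have ev: "\<forall>\<^sub>F w in nhds z. Gamma w * Gamma (1 - w) * sin (of_real pi * w) = of_real pi"
    using eventually_nhds_in_open[OF op, of z] assms by (auto elim!: eventually_mono simp: eq)
  have "((\<lambda>w. Gamma w * Gamma (1 - w) * sin (of_real pi * w)) has_field_derivative
     (Gamma z * Gamma (1 - z) * sin (of_real pi * z)) * (Digamma z - Digamma (1 - z))
        + Gamma z * Gamma (1 - z) * (of_real pi * cos (of_real pi * z))) (at z)"
    by (rule derivative_eq_intros refl nz | simp add: algebra_simps)+
  moreover have "((\<lambda>w. Gamma w * Gamma (1 - w) * sin (of_real pi * w)) has_field_derivative 0) (at z)"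
    using ev by (subst DERIV_cong_ev[OF refl ev refl]) simp
  ultimately have "(Gamma z * Gamma (1 - z) * sin (of_real pi * z)) * (Digamma z - Digamma (1 - z))
        + Gamma z * Gamma (1 - z) * (of_real pi * cos (of_real pi * z)) = 0"
    by (rule DERIV_unique)
  moreover have "Gamma z * Gamma (1 - z) * (of_real pi * cos (of_real pi * z))
      = (Gamma z * Gamma (1 - z) * sin (of_real pi * z)) * (of_real pi * cot (of_real pi * z))"
    using nz(3) by (simp add: cot_def)
  ultimately have "of_real pi * (Digamma z - Digamma (1 - z) + of_real pi * cot (of_real pi * z)) = 0"
    using eq[OF assms] by (simp add: ring_distribs)
  hence "Digamma z - Digamma (1 - z) + of_real pi * cot (of_real pi * z) = 0"
    by (subst (asm) mult_eq_0_iff) auto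
  thus ?thesis by (simp add: algebra_simps)
qed

text \<open>Derivative of \<open>Digamma_reflection\<close>, valid near z because the non-integers
  form an open set.\<close>

lemma Polygamma_1_reflection:
  fixes z :: complex
  assumes "z \<notin> \<int>"
  shows "Polygamma 1 (1 - z) + Polygamma 1 z = of_real pi ^ 2 / sin (of_real pi * z) ^ 2"
proof -
  have op: "open (- (\<int> :: complex set))" using closed_Ints by (simp add: open_Compl)
  have ev: "\<forall>\<^sub>F w in nhds z. Digamma (1 - w) - Digamma w = of_real pi * cot (of_real pi * w)"
    using eventually_nhds_in_open[OF op, of z] assms by (auto elim!: eventually_mono simp: Digamma_reflection)
  note nz = not_Ints_sin[OF assms]
  have "((\<lambda>w. Digamma (1 - w) - Digamma w) has_field_derivative (- Polygamma 1 (1 - z) - Polygamma 1 z)) (at z)"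
    by (rule derivative_eq_intros refl nz | simp)+
  moreover have "((\<lambda>w. of_real pi * cot (of_real pi * w)) has_field_derivative
        (- (of_real pi)\<^sup>2 / sin (of_real pi * z) ^ 2)) (at z)"
  proof -
    have D: "((\<lambda>w. of_real pi * (cos (of_real pi * w) / sin (of_real pi * w))) has_field_derivative
       of_real pi * ((- sin (of_real pi * z) * of_real pi * sin (of_real pi * z)
          - cos (of_real pi * z) * (cos (of_real pi * z) * of_real pi)) / (sin (of_real pi * z) * sin (of_real pi * z)))) (at z)"
      by (rule derivative_eq_intros refl nz | simp)+
    have "of_real pi * ((- S * of_real pi * S - C * (C * of_real pi)) / (S * S)) = - (of_real pi)\<^sup>2 / S ^ 2"
      if "S ^ 2 + C ^ 2 = 1" for S C :: complex
    proof -
      have "- S * of_real pi * S - C * (C * of_real pi) = - of_real pi * (S ^ 2 + C ^ 2)"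
        unfolding power2_eq_square by algebra
      thus ?thesis unfolding that by (simp add: power2_eq_square)
    qed
    from DERIV_cong[OF D this[OF sin_cos_squared_add]] show ?thesis unfolding cot_def .
  qed
  ultimately have "- Polygamma 1 (1 - z) - Polygamma 1 z = - (of_real pi)\<^sup>2 / sin (of_real pi * z) ^ 2"
    by (intro DERIV_unique[OF DERIV_cong_ev[OF refl ev refl, THEN iffD1]])
  thus ?thesis by (simp add: field_simps)
qed


section \<open>Unordered, symmetric and telescoping sums over the integers\<close>

lemma int_UNIV_split: "(UNIV :: int set) = range int \<union> range (\<lambda>k. - 1 - int k)" (is "_ = ?A")
proof -
  have "n \<in> ?A" for n :: int
  proof (cases "n \<ge> 0")
    case True
    hence "n = int (nat n)" by simp
    thus ?thesis by blast
  next
    case False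
    hence "n = - 1 - int (nat (- 1 - n))" by simp
    thus ?thesis by blast
  qed
  thus ?thesis by blast
qed

lemma has_sum_int_split:
  fixes f :: "int \<Rightarrow> 'a :: {topological_comm_monoid_add, t2_space}"
  assumes "((\<lambda>k. f (int k)) has_sum a) UNIV" "((\<lambda>k. f (- 1 - int k)) has_sum b) UNIV"
  shows "(f has_sum (a + b)) UNIV"
proof -
  have "(f has_sum a) (range int)"
    using assms(1) by (subst has_sum_reindex) (auto simp: o_def inj_on_def)
  moreover have "(f has_sum b) (range (\<lambda>k. - 1 - int k))"
    using assms(2) by (subst has_sum_reindex) (auto simp: o_def inj_on_def)
  moreover have "range int \<inter> range (\<lambda>k. - 1 - int k) = {}" by auto
  ultimately show ?thesis
    unfolding int_UNIV_split by (rule has_sum_Un_disjoint)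
qed

lemma summable_on_int_split:
  fixes f :: "int \<Rightarrow> 'a :: {topological_comm_monoid_add, t2_space}"
  assumes "(\<lambda>k. f (int k)) summable_on UNIV" "(\<lambda>k. f (- 1 - int k)) summable_on UNIV"
  shows "f summable_on UNIV"
  using has_sum_int_split[of f, OF has_sum_infsum[OF assms(1)] has_sum_infsum[OF assms(2)]]
    has_sum_imp_summable by blast

text \<open>The exponent 3/2 is made for \<open>eisenstein_difference_summable\<close>, where decay
  of order 3 in |m| + |n| is shared equally between the two variables.\<close>

lemma summable_powr_int: "(\<lambda>n::int. (1 + \<bar>of_int n\<bar>) powr (- (3/2)) :: real) summable_on UNIV"
proof (rule summable_on_int_split)
  have *: "summable (\<lambda>n. real n powr (- (3/2)))" by (simp add: summable_real_powr_iff)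
  have "(\<lambda>n. real (Suc n) powr (- (3/2))) summable_on UNIV"
    using * by (intro norm_summable_imp_summable_on) (simp add: summable_Suc_iff[of "\<lambda>n. real n powr (- (3/2))"] del: of_nat_Suc)
  thus "(\<lambda>k. (1 + \<bar>of_int (int k)\<bar>) powr (- (3/2)) :: real) summable_on UNIV" by simp
  have "(\<lambda>n. real (Suc (Suc n)) powr (- (3/2))) summable_on UNIV"
    using * by (intro norm_summable_imp_summable_on)
      (simp add: summable_Suc_iff[of "\<lambda>n. real n powr (- (3/2))"] summable_Suc_iff[of "\<lambda>n. real (Suc n) powr (- (3/2))"] del: of_nat_Suc)
  thus "(\<lambda>k. (1 + \<bar>of_int (- 1 - int k)\<bar>) powr (- (3/2)) :: real) summable_on UNIV"
    by (simp add: add.commute)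
qed

text \<open>Lets an unordered sum be evaluated along symmetric intervals, where telescoping and the
  cotangent expansion are available.\<close>

lemma has_sum_int_sym_limit:
  fixes f :: "int \<Rightarrow> 'a :: {topological_comm_monoid_add, t2_space}"
  assumes "(f has_sum s) UNIV"
  shows "(\<lambda>N. \<Sum>n\<in>{- int N..int N}. f n) \<longlonglongrightarrow> s"
proof -
  have "filterlim (\<lambda>N. {- int N..int N}) (finite_subsets_at_top UNIV) sequentially"
  proof (unfold filterlim_finite_subsets_at_top, intro allI impI)
    fix X :: "int set" assume X: "finite X \<and> X \<subseteq> UNIV"
    define M where "M = nat (Max (insert 0 (abs ` X)))"
    have "\<bar>x\<bar> \<le> int M" if "x \<in> X" for x
    proof -
      have "\<bar>x\<bar> \<le> Max (insert 0 (abs ` X))" using X that by (intro Max_ge) auto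
      moreover from this have "0 \<le> Max (insert 0 (abs ` X))" by linarith
      ultimately show ?thesis by (simp add: M_def)
    qed
    hence "X \<subseteq> {- int N..int N}" if "N \<ge> M" for N using that by force
    hence "\<forall>N\<ge>M. finite {- int N..int N} \<and> X \<subseteq> {- int N..int N} \<and> {- int N..int N} \<subseteq> UNIV"
      by blast
    thus "\<forall>\<^sub>F N in sequentially. finite {- int N..int N} \<and> X \<subseteq> {- int N..int N} \<and> {- int N..int N} \<subseteq> UNIV"
      unfolding eventually_sequentially by blast
  qed
  thus ?thesis using assms unfolding has_sum_def by (rule filterlim_compose[rotated])
qed

lemma sum_int_sym_telescope:
  fixes f :: "int \<Rightarrow> 'a :: ab_group_add"
  shows "(\<Sum>n\<in>{- int N..int N}. f (n - 1) - f n) = f (- int N - 1) - f (int N)"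
proof (induction N)
  case (Suc N)
  have "{- int (Suc N)..int (Suc N)} = insert (- int N - 1) (insert (1 + int N) {- int N..int N})"
    by auto
  hence "(\<Sum>n\<in>{- int (Suc N)..int (Suc N)}. f (n - 1) - f n) = (f (- int N - 1 - 1) - f (- int N - 1))
      + ((f (1 + int N - 1) - f (1 + int N)) + (\<Sum>n\<in>{- int N..int N}. f (n - 1) - f n))"
    by (simp only:) simp
  moreover have "- int N - 1 - 1 = - int (Suc N) - 1" "1 + int N - 1 = int N" "int (Suc N) = 1 + int N"
    by simp_all
  moreover have "(a - b) + ((c - d) + (b - c)) = a - d" for a b c d :: 'a by (simp add: algebra_simps)
  ultimately show ?case by (simp only: Suc)
qed simp

text \<open>The terms with n >= 0 add up to the trigamma function at z, those with n < 0 to its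
  value at 1 - z.\<close>

lemma sum_inverse_square_Polygamma:
  fixes z :: complex
  assumes "z \<notin> \<int>"
  shows "((\<lambda>n::int. inverse ((z + of_int n) ^ 2)) has_sum (of_real pi ^ 2 / sin (of_real pi * z) ^ 2)) UNIV"
proof -
  have z: "z \<noteq> 0" "1 - z \<noteq> 0" using assms by (force, metis Ints_1 right_minus_eq)
  have *: "((\<lambda>k. inverse ((w + of_nat k) ^ 2)) has_sum Polygamma 1 w) UNIV" if "w \<noteq> 0" for w :: complex
  proof (rule norm_summable_imp_has_sum)
    show "(\<lambda>k. inverse ((w + of_nat k) ^ 2)) sums Polygamma 1 w"
      using Polygamma_LIMSEQ[of w 1] that by (simp add: numeral_2_eq_2)
    have "summable (\<lambda>n. inverse (real n ^ 2))" by (rule inverse_power_summable) simp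
    hence s: "summable (\<lambda>n. 4 * inverse (real n ^ 2))" by (rule summable_mult)
    show "summable (\<lambda>k. norm (inverse ((w + of_nat k) ^ 2)))"
    proof (rule summable_comparison_test_ev[OF _ s])
      show "\<forall>\<^sub>F n in sequentially. norm (norm (inverse ((w + of_nat n) ^ 2))) \<le> 4 * inverse (real n ^ 2)"
        using eventually_gt_at_top[of "nat \<lceil>2 * norm w\<rceil>"]
      proof eventually_elim
        case (elim n)
        hence n: "real n > 2 * norm w" by linarith
        have "norm (of_nat n :: complex) \<le> norm (w + of_nat n) + norm w"
          using norm_triangle_ineq4[of "w + of_nat n" w] by simp
        hence "real n / 2 \<le> norm (w + of_nat n)" using n by simp
        hence "(real n / 2)^2 \<le> norm (w + of_nat n)^2" by (intro power_mono) auto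
        moreover have "real n > 0" using n norm_ge_zero[of w] by linarith
        ultimately have "inverse (norm (w + of_nat n)^2) \<le> inverse ((real n / 2)^2)"
          by (intro le_imp_inverse_le) auto
        moreover have "inverse ((real n / 2)^2) = 4 * inverse (real n ^ 2)" by (simp add: power_divide inverse_eq_divide)
        moreover have "norm (norm (inverse ((w + of_nat n) ^ 2))) = inverse (norm (w + of_nat n)^2)"
          unfolding real_norm_def abs_norm_cancel by (simp add: norm_inverse norm_power)
        ultimately show ?case by (simp only:)
      qed
    qed
  qed
  have "((\<lambda>k. inverse ((z + of_int (- 1 - int k)) ^ 2)) has_sum Polygamma 1 (1 - z)) UNIV"
  proof -
    have "inverse ((1 - z + of_nat k) ^ 2) = inverse ((z + of_int (- 1 - int k)) ^ 2)" for k
    proof -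
      have "1 - z + of_nat k = - (z + of_int (- 1 - int k))" by simp
      thus ?thesis by (simp only: power2_minus)
    qed
    thus ?thesis using *[OF z(2)] by simp
  qed
  moreover have "((\<lambda>k. inverse ((z + of_int (int k)) ^ 2)) has_sum Polygamma 1 z) UNIV"
    using *[OF z(1)] by simp
  ultimately have "((\<lambda>n::int. inverse ((z + of_int n) ^ 2)) has_sum (Polygamma 1 z + Polygamma 1 (1 - z))) UNIV"
    by (rule has_sum_int_split[rotated])
  thus ?thesis using Polygamma_1_reflection[OF assms] by (simp add: add.commute)
qed

text \<open>The two halves of the sum are the limit formulas for Digamma at z and at 1 - z, and the
  logarithms in them cancel. One more term, tending to 0, makes the range symmetric.\<close>

lemma cot_partial_fractions:
  fixes z :: complex
  assumes "z \<notin> \<int>"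
  shows "(\<lambda>N. \<Sum>n\<in>{- int N..int N}. inverse (z + of_int n)) \<longlonglongrightarrow> of_real pi * cot (of_real pi * z)"
proof -
  have z: "z \<noteq> 0" "1 - z \<noteq> 0" using assms by (force, metis Ints_1 right_minus_eq)
  have "(\<lambda>m. (of_real (ln (real m)) - (\<Sum>n<m. inverse (1 - z + of_nat n)))
          - (of_real (ln (real m)) - (\<Sum>n<m. inverse (z + of_nat n)))) \<longlonglongrightarrow> Digamma (1 - z) - Digamma z"
    by (intro tendsto_diff Digamma_LIMSEQ z)
  hence "(\<lambda>m. (\<Sum>n<m. inverse (z + of_nat n)) - (\<Sum>n<m. inverse (1 - z + of_nat n))) \<longlonglongrightarrow> of_real pi * cot (of_real pi * z)"
    using Digamma_reflection[OF assms] by simp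
  moreover have "(\<lambda>m. inverse (z + of_nat m)) \<longlonglongrightarrow> 0"
    by (rule tendsto_inverse_0[THEN filterlim_compose])
       (rule tendsto_add_filterlim_at_infinity[OF tendsto_const tendsto_of_nat])
  ultimately have "(\<lambda>m. (\<Sum>n<m. inverse (z + of_nat n)) - (\<Sum>n<m. inverse (1 - z + of_nat n)) + inverse (z + of_nat m))
      \<longlonglongrightarrow> of_real pi * cot (of_real pi * z) + 0" by (rule tendsto_add)
  moreover have "(\<Sum>n<N. inverse (z + of_nat n)) - (\<Sum>n<N. inverse (1 - z + of_nat n)) + inverse (z + of_nat N)
      = (\<Sum>n\<in>{- int N..int N}. inverse (z + of_int n))" for N
  proof (induction N)
    case (Suc N)
    have "{- int (Suc N)..int (Suc N)} = insert (- int N - 1) (insert (int (Suc N)) {- int N..int N})"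
      by auto
    hence "(\<Sum>n\<in>{- int (Suc N)..int (Suc N)}. inverse (z + of_int n)) =
       inverse (z + of_int (- int N - 1)) + (inverse (z + of_int (int (Suc N))) + (\<Sum>n\<in>{- int N..int N}. inverse (z + of_int n)))"
      by (simp del: of_int_diff of_int_minus of_nat_Suc)
    moreover have "inverse (z + of_int (- int N - 1)) = - inverse (1 - z + of_nat N)"
      by (subst inverse_minus_eq[symmetric]) simp
    moreover have "inverse (z + of_int (int (Suc N))) = inverse (z + of_nat (Suc N))" by simp
    ultimately have "(\<Sum>n\<in>{- int (Suc N)..int (Suc N)}. inverse (z + of_int n)) =
       - inverse (1 - z + of_nat N) + (inverse (z + of_nat (Suc N)) + ((\<Sum>n<N. inverse (z + of_nat n))
        - (\<Sum>n<N. inverse (1 - z + of_nat n)) + inverse (z + of_nat N)))"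
      using Suc by (simp only:)
    moreover have "- x + (y + ((a - b) + c)) = (a + c) - (b + x) + y" for x y a b c :: complex
      by (simp add: algebra_simps)
    ultimately show ?case by (simp only: sum.lessThan_Suc)
  qed simp
  ultimately show ?thesis by simp
qed

section \<open>The Eisenstein series of weight 2\<close>

definition ee :: "complex \<Rightarrow> complex" where "ee z = exp (2 * of_real pi * \<i> * z)"

lemma ee_add: "ee (x + y) = ee x * ee y" by (simp add: ee_def exp_add ring_distribs)
lemma ee_0 [simp]: "ee 0 = 1" by (simp add: ee_def)
lemma ee_nz [simp]: "ee z \<noteq> 0" by (simp add: ee_def)
lemma ee_minus: "ee (- x) = inverse (ee x)" by (simp add: ee_def exp_minus)
lemma ee_diff: "ee (x - y) = ee x / ee y" by (simp add: ee_def exp_diff ring_distribs)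
lemma ee_of_int [simp]: "ee (of_int n) = 1"
  using exp_integer_2pi[of "of_int n"] by (simp add: ee_def mult_ac)
lemma ee_of_nat [simp]: "ee (of_nat n) = 1" using ee_of_int[of "int n"] by simp
lemma ee_1 [simp]: "ee 1 = 1" using ee_of_int[of 1] by simp
lemma norm_ee: "norm (ee z) = exp (- 2 * pi * Im z)" by (simp add: ee_def)
lemma ee_power: "ee z ^ n = ee (of_nat n * z)"
  unfolding ee_def exp_of_nat_mult[symmetric] by (simp add: mult_ac)
lemma ee_eq_1_iff: "ee z = 1 \<longleftrightarrow> z \<in> \<int>"
proof
  assume "ee z = 1"
  then obtain n :: int where "Im (2 * of_real pi * \<i> * z) = of_int (2 * n) * pi" "Re (2 * of_real pi * \<i> * z) = 0"
    unfolding ee_def exp_eq_1 by auto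
  hence "z = of_int n" by (simp add: complex_eq_iff)
  thus "z \<in> \<int>" by simp
next
  assume "z \<in> \<int>"
  then obtain n where "z = of_int n" by (rule Ints_cases)
  thus "ee z = 1" by simp
qed
lemma norm_ee_less_1: "Im z > 0 \<Longrightarrow> norm (ee z) < 1" by (simp add: norm_ee)
lemma has_field_derivative_ee [derivative_intros]:
  "(f has_field_derivative f') (at z within A) \<Longrightarrow> ((\<lambda>z. ee (f z)) has_field_derivative (2 * of_real pi * \<i> * f' * ee (f z))) (at z within A)"
  unfolding ee_def by (auto intro!: derivative_eq_intros)
lemma holomorphic_on_ee [holomorphic_intros]: "f holomorphic_on A \<Longrightarrow> (\<lambda>z. ee (f z)) holomorphic_on A"
  unfolding ee_def by (intro holomorphic_intros)
lemma continuous_on_ee [continuous_intros]: "continuous_on A f \<Longrightarrow> continuous_on A (\<lambda>z. ee (f z))"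
  unfolding ee_def by (intro continuous_intros)

abbreviation upper_half :: "complex set" where "upper_half \<equiv> {z. Im z > 0}"

lemma open_upper_half: "open upper_half" by (rule open_halfspace_Im_gt)
lemma convex_upper_half: "convex upper_half" by (rule convex_halfspace_Im_gt)

lemma not_Ints_Im: "Im z \<noteq> 0 \<Longrightarrow> z \<notin> \<int>"
  by (metis Ints_cases complex_Im_of_int)

lemma Im_neg_inverse: "Im (- 1 / z) = Im z / (norm z)\<^sup>2"
  by (simp add: Im_divide cmod_power2)

lemma sin_ee: "sin (of_real pi * z) ^ 2 = - ((1 - ee z) ^ 2 / (4 * ee z))"
proof -
  define w where "w = exp (\<i> * (of_real pi * z))"
  have w: "w \<noteq> 0" "exp (- (\<i> * (of_real pi * z))) = inverse w" "ee z = w ^ 2"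
    unfolding w_def ee_def exp_of_nat_mult[symmetric] exp_minus by (simp_all add: mult_ac)
  have "sin (of_real pi * z) = (w - inverse w) / (2 * \<i>)"
    unfolding sin_exp_eq w_def[symmetric] w(2) ..
  moreover have "((v - inverse v) / (2 * \<i>)) ^ 2 = - ((1 - v ^ 2) ^ 2 / (4 * v ^ 2))" if "v \<noteq> 0" for v
    using that by (simp add: power_divide power_mult_distrib divide_simps) (simp add: power2_eq_square algebra_simps)
  ultimately show ?thesis using w by metis
qed

text \<open>\<open>sin_ee\<close> turns pi^2 / sin^2 into a rational function of q =
  \<open>ee z\<close>. The factor q / (1 - q)^2 is the sum of d q^d, so this is the Lipschitz
  formula of exponent 2.\<close>

lemma Lipschitz_2:
  assumes "Im z > 0"
  shows "((\<lambda>n::int. inverse ((z + of_int n) ^ 2)) has_sum (- 4 * of_real pi ^ 2 * (ee z / (1 - ee z)\<^sup>2))) UNIV"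
proof -
  have "ee z \<noteq> 1" using norm_ee_less_1[OF assms] by auto
  hence "(1 - ee z)\<^sup>2 \<noteq> 0" by simp
  moreover have "P / (- (A / (4 * e))) = - 4 * P * (e / A)" if "A \<noteq> 0" "e \<noteq> 0" for P A e :: complex
    using that by (simp add: field_simps)
  ultimately have "of_real pi ^ 2 / sin (of_real pi * z) ^ 2 = - 4 * of_real pi ^ 2 * (ee z / (1 - ee z)\<^sup>2)"
    unfolding sin_ee using ee_nz by blast
  thus ?thesis using sum_inverse_square_Polygamma[OF not_Ints_Im, of z] assms by simp
qed

lemma lattice_lower_bound:
  fixes t :: complex
  assumes "Im t > 0"
  obtains c where "c > 0" "\<And>m n :: int. c * of_int (\<bar>m\<bar> + \<bar>n\<bar>) \<le> norm (of_int m * t + of_int n)"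
proof
  define D where "D = 1 / Im t + 1 + norm t / Im t"
  have D: "D > 0" using assms by (simp add: D_def add_pos_nonneg)
  show "1 / D > 0" using D by simp
  fix m n :: int
  have "\<bar>of_int m\<bar> * Im t \<le> norm (of_int m * t + of_int n)"
    using abs_Im_le_cmod[of "of_int m * t + of_int n"] assms by (simp add: abs_mult)
  hence 1: "\<bar>of_int m\<bar> \<le> norm (of_int m * t + of_int n) / Im t" using assms by (simp add: field_simps)
  have "norm (of_int n :: complex) \<le> norm (of_int m * t + of_int n) + norm (of_int m * t)"
    by (metis add_diff_cancel_left' norm_triangle_ineq4)
  hence "\<bar>of_int n\<bar> \<le> norm (of_int m * t + of_int n) + \<bar>of_int m\<bar> * norm t"
    by (simp add: norm_mult)
  also have "\<dots> \<le> norm (of_int m * t + of_int n) + norm (of_int m * t + of_int n) / Im t * norm t"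
    using 1 by (intro add_mono mult_right_mono) auto
  finally have "of_int (\<bar>m\<bar> + \<bar>n\<bar>) \<le> norm (of_int m * t + of_int n) * D"
    using 1 by (simp add: D_def algebra_simps)
  thus "1 / D * of_int (\<bar>m\<bar> + \<bar>n\<bar>) \<le> norm (of_int m * t + of_int n)" using D by (simp add: field_simps)
qed

lemma summable_on_mult_times:
  fixes g :: "'a \<Rightarrow> real" and h :: "'b \<Rightarrow> real"
  assumes "g summable_on A" "h summable_on B" "\<And>x. g x \<ge> 0" "\<And>x. h x \<ge> 0"
  shows "(\<lambda>x. g (fst x) * h (snd x)) summable_on (A \<times> B)"
proof (rule summable_on_SigmaI)
  fix x
  show "((\<lambda>y. g (fst (x, y)) * h (snd (x, y))) has_sum (g x * infsum h B)) B"
    using assms by (simp add: has_sum_cmult_right)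
qed (use assms in \<open>auto intro: summable_on_cmult_left\<close>)

text \<open>With u = mt + n the difference equals -1 / (u^2 (u - 1)). It decays cubically and is
  summable over the lattice, whereas 1 / u^2 is not. The subtracted term telescopes in n, so it does
  not change the inner sums over n.\<close>

lemma eisenstein_difference_summable:
  fixes t :: complex
  assumes t: "Im t > 0"
  shows "(\<lambda>x. norm ((\<lambda>(m::int, n::int). inverse ((of_int m * t + of_int n) ^ 2)
      - (inverse (of_int m * t + of_int (n - 1)) - inverse (of_int m * t + of_int n))) x)) summable_on UNIV"
proof -
  obtain c where c: "c > 0" "\<And>m n :: int. c * of_int (\<bar>m\<bar> + \<bar>n\<bar>) \<le> norm (of_int m * t + of_int n)"
    using lattice_lower_bound[OF t] by blast
  define g :: "int \<Rightarrow> real" where "g n = (1 + \<bar>of_int n\<bar>) powr (- (3/2))" for n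
  define d where "d = (\<lambda>(m::int, n::int). inverse ((of_int m * t + of_int n) ^ 2)
      - (inverse (of_int m * t + of_int (n - 1)) - inverse (of_int m * t + of_int n)))"
  have "(\<lambda>x. g (fst x) * g (snd x)) summable_on (UNIV \<times> UNIV)"
    using summable_powr_int by (intro summable_on_mult_times) (auto simp: g_def)
  hence "(\<lambda>x. 16 / c ^ 3 * (g (fst x) * g (snd x))) summable_on UNIV"
    by (intro summable_on_cmult_right) simp
  \<comment> \<open>At the two removed points one of the denominators vanishes and
    \<open>inverse\<close> takes its default value; the identity for the difference fails
    there.\<close>
  hence gg: "(\<lambda>x. 16 / c ^ 3 * (g (fst x) * g (snd x))) summable_on (UNIV - {(0,0), (0,1)})"
    by (rule summable_on_subset_banach) auto
  have "(\<lambda>x. norm (d x)) summable_on (UNIV - {(0,0), (0,1)})"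
  proof (rule Infinite_Sum.abs_summable_on_comparison_test')
    show "(\<lambda>x. 16 / c ^ 3 * (g (fst x) * g (snd x))) summable_on (UNIV - {(0,0), (0,1)})" by (rule gg)
    fix x :: "int \<times> int" assume x: "x \<in> UNIV - {(0,0), (0,1)}"
    obtain m n where mn: "x = (m, n)" by force
    define s where "s = real_of_int (\<bar>m\<bar> + \<bar>n\<bar>)"
    have s1: "s \<ge> 1" and s2: "2 * (\<bar>m\<bar> + \<bar>n - 1\<bar>) \<ge> \<bar>m\<bar> + \<bar>n\<bar>"
    proof -
      have "m \<noteq> 0 \<or> (n \<noteq> 0 \<and> n \<noteq> 1)" using x mn by auto
      thus "s \<ge> 1" "2 * (\<bar>m\<bar> + \<bar>n - 1\<bar>) \<ge> \<bar>m\<bar> + \<bar>n\<bar>" unfolding s_def by (linarith, smt (verit))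
    qed
    define u where "u = of_int m * t + of_int n"
    define v where "v = of_int m * t + of_int (n - 1)"
    have u: "c * s \<le> norm u" unfolding u_def s_def by (rule c)
    have "s \<le> of_int (2 * (\<bar>m\<bar> + \<bar>n - 1\<bar>))" unfolding s_def using s2 by (simp only: of_int_le_iff)
    hence "s / 2 \<le> of_int (\<bar>m\<bar> + \<bar>n - 1\<bar>)" by (simp only: of_int_mult) simp
    hence "c * (s / 2) \<le> c * of_int (\<bar>m\<bar> + \<bar>n - 1\<bar>)" using c(1) by (intro mult_left_mono) auto
    also have "\<dots> \<le> norm v" unfolding v_def by (rule c)
    finally have v: "c * (s / 2) \<le> norm v" .
    have pos: "c * s > 0" "c * (s / 2) > 0" using c(1) s1 by auto
    have nz: "u \<noteq> 0" "v \<noteq> 0" using u v pos by auto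
    have uv: "u = v + 1" by (simp add: u_def v_def)
    have "d x = - inverse (u ^ 2 * v)"
      unfolding mn d_def u_def[symmetric] v_def[symmetric] case_prod_conv using nz
      by (simp add: field_simps power2_eq_square) (simp add: uv algebra_simps)
    hence "norm (d x) = inverse (norm u ^ 2 * norm v)" by (simp add: norm_inverse norm_mult norm_power)
    also have "\<dots> \<le> inverse ((c * s) ^ 2 * (c * (s / 2)))"
    proof (rule le_imp_inverse_le)
      show "(c * s) ^ 2 * (c * (s / 2)) \<le> norm u ^ 2 * norm v"
        using u v pos by (intro mult_mono power_mono) (auto simp del: zero_less_mult_iff)
      show "0 < (c * s) ^ 2 * (c * (s / 2))" by (intro mult_pos_pos[OF _ pos(2)] zero_less_power pos(1))
    qed
    also have "\<dots> = 2 / (c ^ 3 * s ^ 3)" by (simp add: field_simps power2_eq_square power3_eq_cube)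
    finally have 1: "norm (d x) \<le> 2 / (c ^ 3 * s ^ 3)" .
    have "(1 + \<bar>real_of_int m\<bar>) powr (3/2) * (1 + \<bar>real_of_int n\<bar>) powr (3/2) \<le> (2 * s) powr (3/2) * (2 * s) powr (3/2)"
      using s1 by (intro mult_mono powr_mono2) (auto simp: s_def)
    also have "\<dots> = (2 * s) powr 3" by (simp add: powr_add[symmetric])
    also have "\<dots> = 8 * s ^ 3" using s1 by (simp add: powr_numeral power_mult_distrib)
    finally have "(1 + \<bar>real_of_int m\<bar>) powr (3/2) * (1 + \<bar>real_of_int n\<bar>) powr (3/2) \<le> 8 * s ^ 3" .
    hence "inverse (8 * s ^ 3) \<le> inverse ((1 + \<bar>real_of_int m\<bar>) powr (3/2) * (1 + \<bar>real_of_int n\<bar>) powr (3/2))"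
      by (intro le_imp_inverse_le) (auto intro!: mult_pos_pos)
    also have "\<dots> = g m * g n" unfolding g_def by (subst (1 2) powr_minus) simp
    finally have "16 / c ^ 3 * inverse (8 * s ^ 3) \<le> 16 / c ^ 3 * (g m * g n)" using c(1) by (intro mult_left_mono) auto
    moreover have "16 / c ^ 3 * inverse (8 * s ^ 3) = 2 / (c ^ 3 * s ^ 3)" by (simp add: field_simps)
    ultimately show "norm (d x) \<le> 16 / c ^ 3 * (g (fst x) * g (snd x))" using 1 mn by simp
  qed
  moreover have "(\<lambda>x. norm (d x)) summable_on {(0,0), (0,1)}" by simp
  ultimately have "(\<lambda>x. norm (d x)) summable_on ((UNIV - {(0,0), (0,1)}) \<union> {(0,0), (0,1)})"
    by (rule summable_on_union)
  moreover have "(UNIV - {(0,0), (0,1)}) \<union> {(0,0), (0,1)} = (UNIV :: (int \<times> int) set)" by blast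
  ultimately show ?thesis unfolding d_def by (simp only:)
qed

text \<open>The order of summation matters: n first, then m. The term at (0, 0) is
  \<open>inverse 0\<close>, that is 0, so this is 2 zeta(2) E_2.\<close>

definition Eis2 :: "complex \<Rightarrow> complex" where
  "Eis2 t = (\<Sum>\<^sub>\<infinity>m::int. \<Sum>\<^sub>\<infinity>n::int. inverse ((of_int m * t + of_int n) ^ 2))"

lemma inverse_of_int_tendsto:
  "(\<lambda>N. inverse (w + of_int (- int N - 1)) :: complex) \<longlonglongrightarrow> 0"
  "(\<lambda>N. inverse (w + of_int (int N)) :: complex) \<longlonglongrightarrow> 0"
proof -
  have *: "(\<lambda>N. inverse (w' + of_nat N) :: complex) \<longlonglongrightarrow> 0" for w'
    by (rule tendsto_inverse_0[THEN filterlim_compose])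
       (rule tendsto_add_filterlim_at_infinity[OF tendsto_const tendsto_of_nat])
  have "(\<lambda>N. - inverse (- w + 1 + of_nat N) :: complex) \<longlonglongrightarrow> - 0" by (intro tendsto_minus *)
  moreover have "- inverse (- w + 1 + of_nat N) = inverse (w + of_int (- int N - 1))" for N
    by (subst inverse_minus_eq[symmetric]) simp
  ultimately show "(\<lambda>N. inverse (w + of_int (- int N - 1)) :: complex) \<longlonglongrightarrow> 0" by simp
  show "(\<lambda>N. inverse (w + of_int (int N)) :: complex) \<longlonglongrightarrow> 0" using *[of w] by simp
qed

lemma inverse_square_int_summable:
  "Im z > 0 \<Longrightarrow> (\<lambda>n::int. inverse ((z + of_int n) ^ 2)) summable_on UNIV"
  using Lipschitz_2 has_sum_imp_summable by blast

lemma row_summable: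
  assumes t: "Im t > 0"
  shows "(\<lambda>n::int. inverse ((of_int m * t + of_int n) ^ 2)) summable_on UNIV"
proof (cases m "0::int" rule: linorder_cases)
  case greater
  thus ?thesis using t by (intro inverse_square_int_summable) auto
next
  case less
  hence "(\<lambda>n::int. inverse ((of_int (- m) * t + of_int n) ^ 2)) summable_on UNIV"
    using t by (intro inverse_square_int_summable) (auto simp: mult_neg_pos)
  hence "(\<lambda>n::int. inverse ((of_int (- m) * t + of_int (- n)) ^ 2)) summable_on UNIV"
    by (subst summable_on_reindex_bij_betw[of uminus UNIV UNIV, symmetric]) (auto intro!: bij_betwI[of _ _ _ uminus])
  moreover have "(of_int (- m) * t + of_int (- n)) ^ 2 = (of_int m * t + of_int n) ^ 2" for n
    by (simp add: power2_eq_square algebra_simps)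
  ultimately show ?thesis by simp
next
  case equal
  have "summable (\<lambda>n. inverse (of_nat n ^ 2) :: real)" by (rule inverse_power_summable) simp
  hence *: "(\<lambda>n. inverse (of_nat n ^ 2) :: complex) summable_on UNIV"
    by (intro norm_summable_imp_summable_on) (simp add: norm_inverse norm_power)
  have **: "(\<lambda>n. inverse ((1 + of_nat n) ^ 2) :: complex) summable_on UNIV"
    using summable_on_reindex[THEN iffD1, OF inj_Suc summable_on_subset_banach[OF * subset_UNIV]] by (simp add: o_def)
  have "(- 1 - of_nat n :: complex) ^ 2 = (1 + of_nat n) ^ 2" for n by (simp add: power2_eq_square algebra_simps)
  thus ?thesis using equal * ** by (intro summable_on_int_split) simp_all
qed

text \<open>In terms of q = \<open>ee (- s)\<close> the cotangent is i (1 + q^N) / (1 - q^N), and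
  |q| < 1.\<close>

lemma cot_tendsto_i:
  fixes s :: complex
  assumes "Im s < 0"
  shows "(\<lambda>N. cot (of_real pi * (of_nat N * s))) \<longlonglongrightarrow> \<i>"
proof -
  define q where "q = ee (- s)"
  have q: "norm q < 1" using assms by (intro norm_ee_less_1[of "- s", folded q_def]) simp
  have "(\<lambda>N. \<i> * ((1 + q ^ N) / (1 - q ^ N))) \<longlonglongrightarrow> \<i> * ((1 + 0) / (1 - 0))"
    by (intro tendsto_intros LIMSEQ_power_zero q) auto
  moreover have "\<i> * ((1 + q ^ N) / (1 - q ^ N)) = cot (of_real pi * (of_nat N * s))" for N
  proof -
    define w where "w = exp (\<i> * (of_real pi * (of_nat N * s)))"
    have w: "w \<noteq> 0" "exp (- (\<i> * (of_real pi * (of_nat N * s)))) = inverse w" "q ^ N = inverse w ^ 2"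
      unfolding w_def ee_def q_def exp_minus[symmetric] exp_of_nat_mult[symmetric] by (simp_all add: mult_ac)
    have "cot (of_real pi * (of_nat N * s)) = ((w + inverse w) / 2) / ((w - inverse w) / (2 * \<i>))"
      unfolding cot_def cos_exp_eq sin_exp_eq w_def[symmetric] w(2) ..
    also have "\<dots> = \<i> * ((w + inverse w) / (w - inverse w))"
    proof -
      have "(a / 2) / (b / (2 * \<i>)) = \<i> * (a / b)" for a b :: complex
        by (cases "b = 0") (simp_all add: field_simps)
      thus ?thesis .
    qed
    also have "(w + inverse w) / (w - inverse w) = (w * (1 + inverse w ^ 2)) / (w * (1 - inverse w ^ 2))"
      using w(1) by (intro arg_cong2[of _ _ _ _ "(/)"]) (simp_all add: field_simps power2_eq_square)
    also have "\<dots> = (1 + inverse w ^ 2) / (1 - inverse w ^ 2)" using w(1) by (rule mult_divide_mult_cancel_left)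
    finally show ?thesis using w(3) by simp
  qed
  ultimately show ?thesis by simp
qed

text \<open>Weight 2: exchanging the order of summation in the conditionally convergent
  double series changes its value by \<open>2\<pi>i/t\<close>.\<close>

theorem Eis2_S:
  assumes t: "Im t > 0"
  shows "Eis2 (- 1 / t) = t ^ 2 * Eis2 t - 2 * of_real pi * \<i> * t"
    and "(\<lambda>m::int. \<Sum>\<^sub>\<infinity>n::int. inverse ((of_int m * t + of_int n) ^ 2)) summable_on UNIV"
proof -
  have summ: "(\<lambda>m::int. \<Sum>\<^sub>\<infinity>n::int. inverse ((of_int m * t + of_int n) ^ 2)) summable_on UNIV \<and>
    (\<lambda>(m::int, n::int). inverse ((of_int m * t + of_int n) ^ 2)
      - (inverse (of_int m * t + of_int (n - 1)) - inverse (of_int m * t + of_int n))) summable_on UNIV \<and>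
    Eis2 t = (\<Sum>\<^sub>\<infinity>(m::int, n::int). inverse ((of_int m * t + of_int n) ^ 2)
      - (inverse (of_int m * t + of_int (n - 1)) - inverse (of_int m * t + of_int n)))" if t: "Im t > 0" for t
  proof -
    define a where "a m n = inverse ((of_int m * t + of_int n) ^ 2)" for m n :: int
    define b where "b m n = inverse (of_int m * t + of_int (n - 1)) - inverse (of_int m * t + of_int n)" for m n :: int
    have d: "(\<lambda>(m, n). a m n - b m n) summable_on UNIV"
      using eisenstein_difference_summable[OF t] unfolding a_def b_def by (rule abs_summable_summable)
    have arow: "a m summable_on UNIV" for m unfolding a_def by (rule row_summable[OF t])
    have drow: "(\<lambda>n. a m n - b m n) summable_on UNIV" for m
      using summable_on_SigmaD1[of "\<lambda>m n. a m n - b m n" UNIV "\<lambda>_. UNIV" m] d by (simp add: )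
    \<comment> \<open>Along a row the telescoping term contributes nothing, so \<open>Eis2\<close>
      is the sum of the absolutely summable difference.\<close>
    have brow: "(b m has_sum 0) UNIV" for m
    proof -
      have "(\<lambda>n. a m n - (a m n - b m n)) summable_on UNIV"
        using summable_on_add[OF arow[of m] summable_on_uminus[THEN iffD2, OF drow[of m]]]
        by (simp only: diff_conv_add_uminus)
      hence *: "(b m has_sum infsum (b m) UNIV) UNIV" by simp
      have "(\<lambda>N. inverse (of_int m * t + of_int (- int N - 1)) - inverse (of_int m * t + of_int (int N))) \<longlonglongrightarrow> 0 - 0"
        by (intro tendsto_diff inverse_of_int_tendsto)
      moreover have "(\<Sum>n\<in>{- int N..int N}. b m n) = inverse (of_int m * t + of_int (- int N - 1)) - inverse (of_int m * t + of_int (int N))" for N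
        unfolding b_def by (rule sum_int_sym_telescope[of "\<lambda>n. inverse (of_int m * t + of_int n)"])
      ultimately have "infsum (b m) UNIV = 0" using has_sum_int_sym_limit[OF *] LIMSEQ_unique by fastforce
      with * show ?thesis by simp
    qed
    have eq: "(\<Sum>\<^sub>\<infinity>n. a m n - b m n) = (\<Sum>\<^sub>\<infinity>n. a m n)" for m
    proof -
      have "((\<lambda>n. a m n - b m n) has_sum (infsum (a m) UNIV - 0)) UNIV"
        using has_sum_add[OF has_sum_infsum[OF arow] has_sum_uminusI[OF brow]] by simp
      thus ?thesis by (simp add: infsumI)
    qed
    have "(\<lambda>m. \<Sum>\<^sub>\<infinity>n. a m n - b m n) summable_on UNIV"
      using summable_on_Sigma_banach[of "\<lambda>m n. a m n - b m n" UNIV "\<lambda>_. UNIV"] d by simp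
    moreover have "(\<Sum>\<^sub>\<infinity>m. \<Sum>\<^sub>\<infinity>n. a m n - b m n) = (\<Sum>\<^sub>\<infinity>(m, n). a m n - b m n)"
      using infsum_Sigma'_banach[of "\<lambda>m n. a m n - b m n" UNIV "\<lambda>_. UNIV"] d by simp
    moreover note d
    ultimately show ?thesis unfolding eq unfolding Eis2_def a_def b_def by (intro conjI)
  qed
  show "(\<lambda>m::int. \<Sum>\<^sub>\<infinity>n::int. inverse ((of_int m * t + of_int n) ^ 2)) summable_on UNIV"
    using summ[OF t] by blast

  have t0: "t \<noteq> 0" using t by auto
  have t': "Im (- 1 / t) > 0" using t t0 by (simp only: Im_neg_inverse) simp
  define a where "a m n = inverse ((of_int m * t + of_int n) ^ 2)" for m n :: int
  define b where "b m n = inverse (of_int m * t + of_int (n - 1)) - inverse (of_int m * t + of_int n)" for m n :: int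
  define B where "B n = (\<Sum>\<^sub>\<infinity>m::int. inverse ((of_int n * (- 1 / t) + of_int m) ^ 2))" for n :: int
  have dsum: "(\<lambda>(m, n). a m n - b m n) summable_on UNIV"
    and E: "Eis2 t = (\<Sum>\<^sub>\<infinity>(m, n). a m n - b m n)"
    using summ[OF t] unfolding a_def b_def by auto
  \<comment> \<open>Absolute summability permits summing the difference over m first.\<close>
  have dswap: "((\<lambda>(n, m). a m n - b m n) has_sum Eis2 t) UNIV"
  proof -
    have "((\<lambda>(m, n). a m n - b m n) has_sum Eis2 t) (UNIV \<times> UNIV)" using dsum E by (simp add: has_sum_iff)
    hence "((\<lambda>(n, m). (\<lambda>(m, n). a m n - b m n) (m, n)) has_sum Eis2 t) (UNIV \<times> UNIV)"
      by (rule has_sum_swap[THEN iffD1])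
    thus ?thesis by simp
  qed
  have acol: "((\<lambda>m. a m n) has_sum (inverse (t ^ 2) * B n)) UNIV" for n
  proof -
    have "((\<lambda>m. inverse ((of_int n * (- 1 / t) + of_int m) ^ 2)) has_sum B n) UNIV"
      unfolding B_def by (rule has_sum_infsum[OF row_summable[OF t']])
    hence "((\<lambda>m. inverse ((of_int n * (- 1 / t) + of_int (- m)) ^ 2)) has_sum B n) UNIV"
      by (subst has_sum_reindex_bij_betw[of uminus UNIV UNIV, symmetric]) (auto intro!: bij_betwI[of _ _ _ uminus])
    hence "((\<lambda>m. inverse (t ^ 2) * inverse ((of_int n * (- 1 / t) + of_int (- m)) ^ 2)) has_sum (inverse (t ^ 2) * B n)) UNIV"
      by (rule has_sum_cmult_right)
    moreover have "inverse (t ^ 2) * inverse ((of_int n * (- 1 / t) + of_int (- m)) ^ 2) = a m n" for m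
    proof -
      have "t * (of_int n * (- 1 / t) + of_int (- m)) = - (of_int m * t + of_int n)" using t0 by (simp add: field_simps)
      hence "t ^ 2 * (of_int n * (- 1 / t) + of_int (- m)) ^ 2 = (of_int m * t + of_int n) ^ 2"
        by (metis power_mult_distrib power2_minus)
      thus ?thesis unfolding a_def by (metis inverse_mult_distrib)
    qed
    ultimately show ?thesis by simp
  qed
  have dcol: "((\<lambda>m. a m n - b m n) has_sum (\<Sum>\<^sub>\<infinity>m. a m n - b m n)) UNIV" for n
    using summable_on_SigmaD1[of "\<lambda>n m. a m n - b m n" UNIV "\<lambda>_. UNIV" n] dswap
    by (simp add: has_sum_iff)
  \<comment> \<open>\<open>K n\<close> is the symmetric limit over m of 1 / (mt + n). A column of
    \<open>b\<close> therefore adds up to K (n - 1) - K n. These telescope to -2 pi i / t, while the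
    rows of \<open>b\<close> give 0; this is the whole defect.\<close>
  define K where "K n = (if n = 0 then 0 else of_real pi / t * cot (of_real pi * (of_int n / t)))" for n :: int
  have Klim: "(\<lambda>N. \<Sum>m\<in>{- int N..int N}. inverse (of_int m * t + of_int n)) \<longlonglongrightarrow> K n" for n
  proof (cases "n = 0")
    case True
    have "(\<Sum>m\<in>{- int N..int N}. inverse (of_int m * t + of_int n)) = 0" for N
    proof -
      have "(\<Sum>m\<in>{- int N..int N}. inverse (of_int m * t)) = (\<Sum>m\<in>{- int N..int N}. - inverse (of_int m * t))"
        by (rule sum.reindex_bij_witness[of _ uminus uminus]) auto
      thus ?thesis using True by (simp add: sum_negf)
    qed
    thus ?thesis by (simp add: K_def True)
  next
    case False
    have "of_int n / t \<notin> \<int>" using False t t0 by (intro not_Ints_Im) (auto simp: Im_divide)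
    from tendsto_mult_left[OF cot_partial_fractions[OF this], of "1 / t"]
    have "(\<lambda>N. \<Sum>m\<in>{- int N..int N}. 1 / t * inverse (of_int n / t + of_int m)) \<longlonglongrightarrow> K n"
      using False by (simp add: K_def sum_distrib_left)
    moreover have "1 / t * inverse (of_int n / t + of_int m) = inverse (of_int m * t + of_int n)" for m
      using t0 by (simp add: divide_inverse inverse_mult_distrib[symmetric] ring_distribs del: inverse_mult_distrib)
    ultimately show ?thesis by simp
  qed
  have bcol: "((\<lambda>m. b m n) has_sum (K (n - 1) - K n)) UNIV" for n
  proof -
    have *: "((\<lambda>m. b m n) has_sum (inverse (t ^ 2) * B n - (\<Sum>\<^sub>\<infinity>m. a m n - b m n))) UNIV"
      using has_sum_add[OF acol has_sum_uminusI[OF dcol], of n n] by simp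
    have "(\<lambda>N. \<Sum>m\<in>{- int N..int N}. b m n) \<longlonglongrightarrow> K (n - 1) - K n"
      unfolding b_def sum_subtractf by (intro tendsto_diff Klim)
    with has_sum_int_sym_limit[OF *] have "inverse (t ^ 2) * B n - (\<Sum>\<^sub>\<infinity>m. a m n - b m n) = K (n - 1) - K n"
      by (rule LIMSEQ_unique)
    with * show ?thesis by simp
  qed
  have dcol': "((\<lambda>m. a m n - b m n) has_sum (inverse (t ^ 2) * B n - (K (n - 1) - K n))) UNIV" for n
    using has_sum_add[OF acol has_sum_uminusI[OF bcol], of n n] by (simp only: diff_conv_add_uminus)
  have "((\<lambda>n. inverse (t ^ 2) * B n - (K (n - 1) - K n)) has_sum Eis2 t) UNIV"
  proof (rule has_sum_SigmaD)
    show "((\<lambda>(n, m). a m n - b m n) has_sum Eis2 t) (UNIV \<times> UNIV)" using dswap by simp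
    show "((\<lambda>m. (\<lambda>(n, m). a m n - b m n) (n, m)) has_sum (inverse (t ^ 2) * B n - (K (n - 1) - K n))) UNIV" for n
      using dcol'[of n] by simp
  qed
  moreover have Bsum: "((\<lambda>n. inverse (t ^ 2) * B n) has_sum (inverse (t ^ 2) * Eis2 (- 1 / t))) UNIV"
    using summ[OF t'] unfolding B_def Eis2_def by (intro has_sum_cmult_right has_sum_infsum) blast
  ultimately have "((\<lambda>n. inverse (t ^ 2) * B n + - (inverse (t ^ 2) * B n - (K (n - 1) - K n))) has_sum (inverse (t ^ 2) * Eis2 (- 1 / t) + - Eis2 t)) UNIV"
    by (intro has_sum_add has_sum_uminusI)
  hence "((\<lambda>n. K (n - 1) - K n) has_sum (inverse (t ^ 2) * Eis2 (- 1 / t) - Eis2 t)) UNIV" by simp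
  from has_sum_int_sym_limit[OF this]
  have 1: "(\<lambda>N. K (- int N - 1) - K (int N)) \<longlonglongrightarrow> inverse (t ^ 2) * Eis2 (- 1 / t) - Eis2 t"
    by (simp add: sum_int_sym_telescope)
  have "Im (- (1 / t)) > 0" using t' by (simp only: minus_divide_left)
  hence Im: "Im (1 / t) < 0" by (simp only: uminus_complex.sel neg_0_less_iff_less)
  have Kodd: "K (- n) = - K n" for n by (simp add: K_def cot_def)
  have c: "(\<lambda>N. cot (of_real pi * (of_nat N * (1 / t)))) \<longlonglongrightarrow> \<i>" by (rule cot_tendsto_i[OF Im])
  have "(\<lambda>N. of_real pi / t * cot (of_real pi * (of_nat N * (1 / t)))) \<longlonglongrightarrow> of_real pi / t * \<i>"
    by (intro tendsto_intros c)
  moreover have "\<forall>\<^sub>F N in sequentially. of_real pi / t * cot (of_real pi * (of_nat N * (1 / t))) = K (int N)"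
    using eventually_gt_at_top[of 0] by eventually_elim (simp add: K_def)
  ultimately have KN: "(\<lambda>N. K (int N)) \<longlonglongrightarrow> of_real pi / t * \<i>"
    by (rule Lim_transform_eventually)
  have "(\<lambda>N. K (- int (Suc N))) \<longlonglongrightarrow> - (of_real pi / t * \<i>)"
    unfolding Kodd by (intro tendsto_minus LIMSEQ_Suc KN)
  moreover have "- int (Suc N) = - int N - 1" for N by simp
  ultimately have "(\<lambda>N. K (- int N - 1)) \<longlonglongrightarrow> - (of_real pi / t * \<i>)" by (simp only:)
  from tendsto_diff[OF this KN] 1
  have "inverse (t ^ 2) * Eis2 (- 1 / t) - Eis2 t = - (of_real pi / t * \<i>) - of_real pi / t * \<i>"
    using LIMSEQ_unique by blast
  hence 2: "inverse (t ^ 2) * Eis2 (- 1 / t) = Eis2 t - 2 * of_real pi * \<i> / t" by (simp add: algebra_simps)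
  have "Eis2 (- 1 / t) = t ^ 2 * (inverse (t ^ 2) * Eis2 (- 1 / t))" using t0 by simp
  also have "\<dots> = t ^ 2 * Eis2 t - 2 * of_real pi * \<i> * t"
    unfolding 2 using t0 by (simp add: field_simps power2_eq_square)
  finally show "Eis2 (- 1 / t) = t ^ 2 * Eis2 t - 2 * of_real pi * \<i> * t" .
qed

section \<open>The discriminant\<close>

definition euler_prod :: "complex \<Rightarrow> complex" where
  "euler_prod q = lim (\<lambda>N. \<Prod>k<N. 1 - q ^ Suc k)"

lemma euler_prod_uniform_limit:
  assumes "r < 1"
  shows "uniform_limit (cball 0 r) (\<lambda>N q. \<Prod>k<N. 1 - q ^ Suc k) euler_prod sequentially"
proof -
  have "uniformly_convergent_on (cball 0 r) (\<lambda>N q::complex. \<Prod>k<N. 1 - q ^ Suc k)"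
  proof (rule uniformly_convergent_on_prod')
    show "uniformly_convergent_on (cball 0 r) (\<lambda>N q::complex. \<Sum>k<N. norm (1 - q ^ Suc k - 1))"
    proof (cases "r \<ge> 0")
      case True
      show ?thesis
      proof (rule Weierstrass_m_test')
        show "norm (norm (1 - q ^ Suc k - 1)) \<le> r ^ Suc k" if "q \<in> cball 0 r" for k and q :: complex
        proof -
          have "norm (1 - q ^ Suc k - 1) = norm q ^ Suc k" by (simp add: norm_power norm_mult)
          thus ?thesis using that by (simp add: mult_mono power_mono del: power_Suc)
        qed
        show "summable (\<lambda>k. r ^ Suc k)" using True assms by (simp add: summable_geometric)
      qed
    next
      case False
      hence "cball (0::complex) r = {}" by simp
      thus ?thesis by (simp add: uniformly_convergent_on_def)
    qed
  qed (auto intro!: continuous_intros)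
  thus ?thesis unfolding euler_prod_def by (rule uniformly_convergent_uniform_limit_iff[THEN iffD1])
qed

lemma euler_prod_holomorphic: "euler_prod holomorphic_on ball 0 1"
proof (rule holomorphic_uniform_sequence)
  show "(\<lambda>q. \<Prod>k<N. 1 - q ^ Suc k) holomorphic_on ball 0 1" for N by (intro holomorphic_intros)
  fix q :: complex assume q: "q \<in> ball 0 1"
  define d where "d = (1 - norm q) / 2"
  have sub: "cball q d \<subseteq> cball 0 (1 - d)" by (subst cball_subset_cball_iff) (use q in \<open>auto simp: d_def dist_norm field_simps\<close>)
  have "d > 0" using q by (simp add: d_def)
  hence s2: "cball 0 (1 - d) \<subseteq> (ball 0 1 :: complex set)" by auto
  have "uniform_limit (cball q d) (\<lambda>N q. \<Prod>k<N. 1 - q ^ Suc k) euler_prod sequentially"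
    using euler_prod_uniform_limit[of "1 - d"] q sub by (intro uniform_limit_on_subset[OF _ sub]) (auto simp: d_def)
  thus "\<exists>d>0. cball q d \<subseteq> ball 0 1 \<and> uniform_limit (cball q d) (\<lambda>N q. \<Prod>k<N. 1 - q ^ Suc k) euler_prod sequentially"
    using sub s2 \<open>d > 0\<close> by blast
qed auto

lemma one_minus_power_nz:
  assumes "norm (q::complex) < 1"
  shows "1 - q ^ Suc k \<noteq> 0"
proof
  assume "1 - q ^ Suc k = 0"
  hence "norm q ^ Suc k = 1" by (metis norm_one norm_power right_minus_eq)
  moreover have "norm q ^ Suc k < 1" using assms by (intro power_less_one_iff[THEN iffD2]) auto
  ultimately show False by simp
qed

lemma euler_prod_nz:
  assumes "norm q < 1"
  shows "euler_prod q \<noteq> 0"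
proof -
  have "summable (\<lambda>k. norm q ^ Suc k)" using assms by (simp add: summable_geometric)
  hence "summable (\<lambda>k. norm (1 - q ^ Suc k - 1))" by (simp add: norm_power norm_mult)
  hence "abs_convergent_prod (\<lambda>k. 1 - q ^ Suc k)" by (rule summable_imp_abs_convergent_prod)
  hence cp: "convergent_prod (\<lambda>k. 1 - q ^ Suc k)" by (rule abs_convergent_prod_imp_convergent_prod)
  have "euler_prod q = prodinf (\<lambda>k. 1 - q ^ Suc k)"
  proof -
    have "(\<lambda>N. \<Prod>k<N. 1 - q ^ Suc k) \<longlonglongrightarrow> prodinf (\<lambda>k. 1 - q ^ Suc k)"
      using convergent_prod_LIMSEQ[OF cp] LIMSEQ_lessThan_iff_atMost by blast
    thus ?thesis unfolding euler_prod_def by (rule limI)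
  qed
  thus ?thesis using prodinf_nonzero[OF cp one_minus_power_nz[OF assms]] by simp
qed

lemma euler_prod_logderiv:
  assumes "norm q < 1"
  shows "(\<lambda>k. - (of_nat (Suc k) * q ^ k) / (1 - q ^ Suc k)) sums (deriv euler_prod q / euler_prod q)"
proof -
  define r where "r = (1 + norm q) / 2"
  have r: "r < 1" "norm q < r" using assms by (auto simp: r_def)
  have "uniform_limit (ball 0 r) (\<lambda>N q. \<Prod>k<N. 1 - q ^ Suc k) euler_prod sequentially"
    using euler_prod_uniform_limit[OF r(1)] by (rule uniform_limit_on_subset) auto
  hence "(\<lambda>k. deriv (\<lambda>q. 1 - q ^ Suc k) q / (1 - q ^ Suc k)) sums (deriv euler_prod q / euler_prod q)"
    by (rule logderiv_prodinf_complex_uniform_limit) (use r assms in \<open>auto intro!: holomorphic_intros euler_prod_nz\<close>)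
  moreover have "deriv (\<lambda>q::complex. 1 - q ^ Suc k) q = - (of_nat (Suc k) * q ^ k)" for k
    by (rule DERIV_imp_deriv) (auto intro!: derivative_eq_intros simp del: power_Suc)
  ultimately show ?thesis by simp
qed

definition euler_fps :: "complex fps" where "euler_fps = fps_expansion euler_prod 0"

text \<open>Integrality survives the limit: the Taylor coefficients of the partial products are
  integers, they converge because the products converge uniformly near 0, and the integers are
  closed.\<close>

lemma euler_fps:
  shows "fps_conv_radius euler_fps \<ge> 1"
    and "norm q < 1 \<Longrightarrow> eval_fps euler_fps q = euler_prod q"
    and "fps_nth euler_fps n \<in> \<int>"
    and "fps_nth euler_fps 0 = 1"
proof -
  show "fps_conv_radius euler_fps \<ge> 1" unfolding euler_fps_def
    using conv_radius_fps_expansion[of euler_prod 0 1] euler_prod_holomorphic by (simp add: eball_ereal[of 0 1, simplified one_ereal_def[symmetric]])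
  show "eval_fps euler_fps q = euler_prod q" if "norm q < 1" for q
    unfolding euler_fps_def
    using eval_fps_expansion'[of euler_prod 0 1 q] euler_prod_holomorphic that
    by (simp add: eball_ereal[of 0 1, simplified one_ereal_def[symmetric]])
  have ul: "uniform_limit (ball 0 (1/2)) (\<lambda>N q. \<Prod>k<N. 1 - q ^ Suc k) euler_prod sequentially"
    using euler_prod_uniform_limit[of "1/2"] by (rule uniform_limit_on_subset) auto
  define P :: "nat \<Rightarrow> complex fps" where "P N = (\<Prod>k<N. 1 - fps_X ^ Suc k)" for N
  have P: "fps_nth (P N) n = (deriv ^^ n) (\<lambda>q. \<Prod>k<N. 1 - q ^ Suc k) 0 / fact n" for N n
  proof -
    have "(\<lambda>q. \<Prod>k<N. 1 - q ^ Suc k) has_fps_expansion P N"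
      unfolding P_def by (intro fps_expansion_intros)
    thus ?thesis by (simp add: fps_nth_fps_expansion)
  qed
  have lim: "(\<lambda>N. fps_nth (P N) n) \<longlonglongrightarrow> fps_nth euler_fps n" for n
    unfolding P euler_fps_def fps_expansion_def fps_nth_Abs_fps
    by (intro tendsto_divide tendsto_const higher_deriv_complex_uniform_limit[OF ul] always_eventually allI holomorphic_intros) auto
  have PI: "fps_nth (P N) n \<in> \<int>" for N n
  proof (induction N arbitrary: n)
    case (Suc N)
    have "P (Suc N) = P N - P N * fps_X ^ Suc N" by (simp add: P_def algebra_simps)
    thus ?case using Suc by (simp add: fps_X_power_mult_right_nth del: power_Suc)
  qed (simp add: P_def)
  show "fps_nth euler_fps n \<in> \<int>"
    by (rule closed_sequentially[OF closed_Ints _ lim]) (rule PI)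
  have "fps_nth (P N) 0 = 1" for N by (induction N) (simp_all add: P_def)
  thus "fps_nth euler_fps 0 = 1" using lim[of 0] by (simp add: LIMSEQ_const_iff)
qed

text \<open>Ramanujan's Delta, the 24th power of the eta function.\<close>

definition Discr :: "complex \<Rightarrow> complex" where "Discr t = ee t * euler_prod (ee t) ^ 24"

lemma Discr_nz: "Im t > 0 \<Longrightarrow> Discr t \<noteq> 0"
  by (simp add: Discr_def euler_prod_nz norm_ee_less_1)

lemma Discr_plus_1: "Discr (t + 1) = Discr t"
  by (simp add: Discr_def ee_add)

text \<open>Rows other than m = 0 are evaluated by \<open>Lipschitz_2\<close>, and row 0 is 2
  zeta(2) = pi^2 / 3. The result is then brought to the Lambert series that
  \<open>euler_prod_logderiv\<close> produces.\<close>

lemma Eis2_q_expansion: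
  assumes t: "Im t > 0"
  shows "(\<lambda>k. of_nat (Suc k) * ee t ^ Suc k / (1 - ee t ^ Suc k)) sums
    ((1 - 3 / of_real pi ^ 2 * Eis2 t) / 24)"
proof -
  define q where "q = ee t"
  have q: "norm q < 1" using t by (simp add: q_def norm_ee_less_1)
  define R where "R m = (\<Sum>\<^sub>\<infinity>n::int. inverse ((of_int m * t + of_int n) ^ 2))" for m :: int
  have Rpos: "R m = - 4 * of_real pi ^ 2 * (q ^ nat m / (1 - q ^ nat m)\<^sup>2)" if "m > 0" for m
  proof -
    have "ee (of_int m * t) = q ^ nat m" using that by (simp add: q_def ee_power)
    thus ?thesis using Lipschitz_2[of "of_int m * t"] that t unfolding R_def by (simp add: infsumI)
  qed
  have Rneg: "R (- m) = R m" for m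
  proof -
    have "R (- m) = (\<Sum>\<^sub>\<infinity>n::int. inverse ((of_int (- m) * t + of_int (- n)) ^ 2))"
      unfolding R_def by (rule infsum_reindex_bij_witness[of _ uminus uminus]) auto
    also have "\<dots> = R m" unfolding R_def
      by (intro infsum_cong) (metis (no_types, lifting) minus_add_distrib mult_minus_left of_int_minus power2_minus)
    finally show ?thesis .
  qed
  have R0: "R 0 = of_real (pi ^ 2 / 3)"
  proof -
    have "(\<lambda>n. 1 / real (n + 1) ^ 2) sums (pi ^ 2 / 6)" using inverse_squares_sums by simp
    hence "((\<lambda>n. 1 / real (n + 1) ^ 2) has_sum (pi ^ 2 / 6)) UNIV" by (intro sums_nonneg_imp_has_sum) auto
    hence "((\<lambda>n. complex_of_real (1 / real (n + 1) ^ 2)) has_sum of_real (pi ^ 2 / 6)) UNIV" by (rule has_sum_of_real)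
    hence b: "((\<lambda>n. inverse ((of_nat n + 1) ^ 2)) has_sum complex_of_real (pi ^ 2 / 6)) UNIV"
      by (simp add: inverse_eq_divide add.commute)
    define f :: "int \<Rightarrow> complex" where "f n = inverse (of_int n ^ 2)" for n
    have neg: "((\<lambda>k. f (- 1 - int k)) has_sum complex_of_real (pi ^ 2 / 6)) UNIV"
    proof -
      have "(- 1 - of_nat k :: complex) ^ 2 = (of_nat k + 1) ^ 2" for k by (simp add: power2_eq_square algebra_simps)
      thus ?thesis using b by (simp add: f_def)
    qed
    have "((\<lambda>k. f (int k)) has_sum complex_of_real (pi ^ 2 / 6)) (range Suc)"
      using b by (subst has_sum_reindex) (auto simp: o_def f_def add.commute)
    hence "((\<lambda>k. f (int k)) has_sum complex_of_real (pi ^ 2 / 6)) UNIV"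
      by (rule has_sum_cong_neutral[THEN iffD1, rotated -1]) (auto simp: f_def image_iff dest: not0_implies_Suc)
    from has_sum_int_split[OF this neg]
    have "(f has_sum complex_of_real (pi ^ 2 / 3)) UNIV" by (simp flip: of_real_add)
    thus ?thesis unfolding R_def f_def by (simp add: infsumI)
  qed
  have Rsum: "(R has_sum Eis2 t) UNIV" unfolding R_def Eis2_def by (intro has_sum_infsum Eis2_S(2) t)
  have "(\<lambda>N. \<Sum>m\<in>{- int N..int N}. R m) \<longlonglongrightarrow> Eis2 t" by (rule has_sum_int_sym_limit[OF Rsum])
  moreover have "(\<Sum>m\<in>{- int N..int N}. R m) = R 0 + 2 * (\<Sum>k<N. R (int (Suc k)))" for N
  proof (induction N)
    case (Suc N)
    have "{- int (Suc N)..int (Suc N)} = insert (- int (Suc N)) (insert (int (Suc N)) {- int N..int N})"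
      by auto
    hence "(\<Sum>m\<in>{- int (Suc N)..int (Suc N)}. R m) = R (- int (Suc N)) + (R (int (Suc N)) + (\<Sum>m\<in>{- int N..int N}. R m))"
      by (simp only:) simp
    thus ?case unfolding Suc Rneg by (simp del: of_nat_Suc)
  qed simp
  ultimately have "(\<lambda>N. R 0 + 2 * (\<Sum>k<N. R (int (Suc k)))) \<longlonglongrightarrow> Eis2 t" by simp
  hence "(\<lambda>N. ((R 0 + 2 * (\<Sum>k<N. R (int (Suc k)))) - R 0) / (- 8 * of_real pi ^ 2)) \<longlonglongrightarrow> (Eis2 t - R 0) / (- 8 * of_real pi ^ 2)"
    by (intro tendsto_intros) auto
  moreover have "((R 0 + 2 * (\<Sum>k<N. R (int (Suc k)))) - R 0) / (- 8 * of_real pi ^ 2) = (\<Sum>k<N. q ^ Suc k / (1 - q ^ Suc k)\<^sup>2)" for N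
  proof -
    have "R (int (Suc k)) = - 4 * of_real pi ^ 2 * (q ^ Suc k / (1 - q ^ Suc k)\<^sup>2)" for k
      using Rpos[of "int (Suc k)"] by (simp only: nat_int of_nat_0_less_iff zero_less_Suc simp_thms)
    hence "(\<Sum>k<N. R (int (Suc k))) = - 4 * of_real pi ^ 2 * (\<Sum>k<N. q ^ Suc k / (1 - q ^ Suc k)\<^sup>2)"
      by (simp only: sum_distrib_left)
    moreover have "((c + 2 * (- 4 * P * S)) - c) / (- 8 * P) = S" if "P \<noteq> 0" for c P S :: complex
      using that by simp
    moreover have "complex_of_real pi ^ 2 \<noteq> 0" by simp
    ultimately show ?thesis by (simp only:) blast
  qed
  ultimately have s1: "(\<lambda>k. q ^ Suc k / (1 - q ^ Suc k)\<^sup>2) sums ((Eis2 t - R 0) / (- 8 * of_real pi ^ 2))"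
    by (simp only: sums_def)
  text \<open>Both Lambert series are rearrangements of \<open>\<Sum>m q\<^sup>m\<^sup>d\<close>.\<close>
  define h where "h = (\<lambda>(k::nat, l::nat). of_nat (Suc l) * q ^ (Suc k * Suc l))"
  have geo1: "((\<lambda>l. of_nat (Suc l) * x ^ Suc l) has_sum (x / (1 - x)\<^sup>2)) UNIV \<and> (\<lambda>l. norm (of_nat (Suc l) * x ^ Suc l)) summable_on UNIV"
    if "norm x < 1" for x :: complex
  proof -
    have "(\<lambda>l. of_nat (Suc l) * y ^ l) sums (1 / (1 - y)\<^sup>2)" if "norm y < 1" for y :: "'a :: {real_normed_field, banach}"
      using geometric_deriv_sums[OF that] .
    from sums_mult[OF this[OF that], of x] have 1: "(\<lambda>l. of_nat (Suc l) * x ^ Suc l) sums (x / (1 - x)\<^sup>2)"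
      by (simp add: mult_ac)
    have "(\<lambda>l. of_nat (Suc l) * norm x ^ l) sums (1 / (1 - norm x)\<^sup>2)"
      using geometric_deriv_sums[of "norm x"] that by simp
    from sums_mult[OF this, of "norm x"] have "summable (\<lambda>l. norm (of_nat (Suc l) * x ^ Suc l))"
      by (simp add: sums_iff norm_mult norm_power mult_ac del: of_nat_Suc)
    note 2 = this
    show ?thesis
    proof
      show "((\<lambda>l. of_nat (Suc l) * x ^ Suc l) has_sum (x / (1 - x)\<^sup>2)) UNIV"
        by (rule norm_summable_imp_has_sum[OF 2 1])
      show "(\<lambda>l. norm (of_nat (Suc l) * x ^ Suc l)) summable_on UNIV"
        using 2 by (intro norm_summable_imp_summable_on) simp
    qed
  qed
  have qk: "norm (q ^ Suc k) < 1" for k using q by (auto simp: norm_power power_less_one_iff simp del: power_Suc)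
  have rows: "((\<lambda>l. h (k, l)) has_sum (q ^ Suc k / (1 - q ^ Suc k)\<^sup>2)) UNIV" for k
    using geo1[OF qk[of k]] by (simp add: h_def power_mult del: power_Suc of_nat_Suc mult_Suc mult_Suc_right)
  have cols: "((\<lambda>k. h (k, l)) has_sum (of_nat (Suc l) * q ^ Suc l / (1 - q ^ Suc l))) UNIV" for l
  proof -
    have "((\<lambda>k. (q ^ Suc l) ^ Suc k) has_sum (q ^ Suc l / (1 - q ^ Suc l))) UNIV"
    proof (rule norm_summable_imp_has_sum)
      have "(\<lambda>k. (q ^ Suc l) * (q ^ Suc l) ^ k) sums (q ^ Suc l * (1 / (1 - q ^ Suc l)))"
        by (intro sums_mult geometric_sums qk)
      thus "(\<lambda>k. (q ^ Suc l) ^ Suc k) sums (q ^ Suc l / (1 - q ^ Suc l))" by simp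
      have "summable (\<lambda>k. norm (q ^ Suc l) * norm (q ^ Suc l) ^ k)"
        by (intro summable_mult summable_geometric) (use qk in auto)
      thus "summable (\<lambda>k. norm ((q ^ Suc l) ^ Suc k))" by (simp add: norm_mult norm_power)
    qed
    from has_sum_cmult_right[OF this, of "of_nat (Suc l)"]
    have "((\<lambda>k. of_nat (Suc l) * (q ^ Suc l) ^ Suc k) has_sum (of_nat (Suc l) * q ^ Suc l / (1 - q ^ Suc l))) UNIV"
      by (simp only: times_divide_eq_right)
    moreover have "of_nat (Suc l) * (q ^ Suc l) ^ Suc k = h (k, l)" for k
      unfolding h_def case_prod_conv power_mult[symmetric] by (simp only: mult.commute)
    ultimately show ?thesis by simp
  qed
  have "h summable_on (UNIV \<times> UNIV)"
  proof (rule abs_summable_summable, rule summable_on_SigmaI)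
    show "((\<lambda>l. norm (h (k, l))) has_sum (norm q ^ Suc k / (1 - norm q ^ Suc k)\<^sup>2)) UNIV" for k
    proof -
      have "norm (h (k, l)) = norm (of_nat (Suc l) * (of_real (norm q) ^ Suc k :: complex) ^ Suc l)" for l
        unfolding h_def case_prod_conv power_mult norm_mult norm_power by simp
      moreover have "((\<lambda>l. of_nat (Suc l) * (of_real (norm q) ^ Suc k :: complex) ^ Suc l) has_sum
          (of_real (norm q) ^ Suc k / (1 - of_real (norm q) ^ Suc k)\<^sup>2)) UNIV"
        using geo1[of "of_real (norm q) ^ Suc k"] qk[of k] by (simp add: norm_power norm_mult)
      hence "((\<lambda>l. complex_of_real (norm (of_nat (Suc l) * (of_real (norm q) ^ Suc k :: complex) ^ Suc l))) has_sum
          complex_of_real (norm q ^ Suc k / (1 - norm q ^ Suc k)\<^sup>2)) UNIV"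
        by (simp add: norm_mult norm_power del: of_nat_Suc power_Suc)
      ultimately show ?thesis by (simp only: has_sum_of_real_iff)
    qed
    have "summable (\<lambda>k. norm q ^ Suc k * (1 / (1 - norm q)\<^sup>2))"
      using q by (intro summable_mult2) (simp add: summable_geometric)
    hence s: "(\<lambda>k. norm q ^ Suc k * (1 / (1 - norm q)\<^sup>2)) summable_on UNIV"
      by (intro summable_nonneg_imp_summable_on) auto
    show "(\<lambda>k. norm q ^ Suc k / (1 - norm q ^ Suc k)\<^sup>2) summable_on UNIV"
    proof (rule summable_on_comparison_test[OF s])
      fix k
      have "norm q ^ Suc k \<le> norm q" using q by (intro power_le_one_iff[THEN iffD2] | simp add: mult_left_le power_le_one)+
      hence "(1 - norm q)\<^sup>2 \<le> (1 - norm q ^ Suc k)\<^sup>2" using q by (intro power_mono) auto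
      hence "norm q ^ Suc k / (1 - norm q ^ Suc k)\<^sup>2 \<le> norm q ^ Suc k / (1 - norm q)\<^sup>2"
        using q by (intro divide_left_mono) (auto intro!: mult_pos_pos simp del: power_Suc)
      thus "norm q ^ Suc k / (1 - norm q ^ Suc k)\<^sup>2 \<le> norm q ^ Suc k * (1 / (1 - norm q)\<^sup>2)" by simp
    qed auto
  qed auto
  then obtain S where S: "(h has_sum S) (UNIV \<times> UNIV)" by (auto simp: summable_on_def)
  have "((\<lambda>k. q ^ Suc k / (1 - q ^ Suc k)\<^sup>2) has_sum S) UNIV"
    by (rule has_sum_SigmaD[OF S rows])
  hence "S = (Eis2 t - R 0) / (- 8 * of_real pi ^ 2)"
    using s1 has_sum_imp_sums sums_unique2 by blast
  moreover have "((\<lambda>l. of_nat (Suc l) * q ^ Suc l / (1 - q ^ Suc l)) has_sum S) UNIV"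
  proof (rule has_sum_SigmaD)
    show "((\<lambda>(l, k). h (k, l)) has_sum S) (UNIV \<times> UNIV)" using S by (rule has_sum_swap[THEN iffD1])
    show "((\<lambda>k. (\<lambda>(l, k). h (k, l)) (l, k)) has_sum (of_nat (Suc l) * q ^ Suc l / (1 - q ^ Suc l))) UNIV" for l
      using cols[of l] by simp
  qed
  moreover have "(Eis2 t - R 0) / (- 8 * of_real pi ^ 2) = (1 - 3 / of_real pi ^ 2 * Eis2 t) / 24"
    unfolding R0 by (simp add: field_simps)
  ultimately show ?thesis unfolding q_def by (simp only: has_sum_imp_sums)
qed

text \<open>The logarithmic derivative of Delta is 2 pi i E_2, which in terms of \<open>Eis2\<close>
  is 6 i / pi times it.\<close>

lemma Discr_deriv:
  assumes t: "Im t > 0"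
  shows "(Discr has_field_derivative (6 * \<i> / of_real pi * Eis2 t * Discr t)) (at t)"
proof -
  define q where "q = ee t"
  have q: "norm q < 1" using t by (simp add: q_def norm_ee_less_1)
  have d: "(euler_prod has_field_derivative deriv euler_prod q) (at q)"
    using euler_prod_holomorphic q by (intro holomorphic_derivI[of _ "ball 0 1"]) auto
  have "(\<lambda>k. - q * (- (of_nat (Suc k) * q ^ k) / (1 - q ^ Suc k))) sums (- q * (deriv euler_prod q / euler_prod q))"
    by (intro sums_mult euler_prod_logderiv q)
  moreover have "- a * (- (n * x) / y) = n * (a * x) / y" for a n x y :: complex
    by (simp add: divide_inverse)
  ultimately have "(\<lambda>k. of_nat (Suc k) * q ^ Suc k / (1 - q ^ Suc k)) sums (- q * (deriv euler_prod q / euler_prod q))"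
    by (simp only: power_Suc)
  hence "- q * (deriv euler_prod q / euler_prod q) = (1 - 3 / of_real pi ^ 2 * Eis2 t) / 24"
    using Eis2_q_expansion[OF t, folded q_def] by (rule sums_unique2)
  moreover have "q * deriv euler_prod q = - (- q * (deriv euler_prod q / euler_prod q)) * euler_prod q"
    using euler_prod_nz[OF q] by simp
  ultimately have ld: "q * deriv euler_prod q = - ((1 - 3 / of_real pi ^ 2 * Eis2 t) / 24) * euler_prod q"
    by (simp only:)
  have "(Discr has_field_derivative (2 * of_real pi * \<i> * q * euler_prod q ^ 24
     + q * (24 * euler_prod q ^ 23 * (deriv euler_prod q * (2 * of_real pi * \<i> * q))))) (at t)"
  proof -
    have e: "(ee has_field_derivative (2 * of_real pi * \<i> * q)) (at t)"
      using has_field_derivative_ee[OF DERIV_ident, of t UNIV] by (simp add: q_def)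
    have "((\<lambda>t. euler_prod (ee t)) has_field_derivative (deriv euler_prod q * (2 * of_real pi * \<i> * q))) (at t)"
      using DERIV_chain2[where f = euler_prod and g = ee, OF d[unfolded q_def] e] by (simp add: q_def)
    from DERIV_mult[OF e DERIV_power[OF this, of 24]]
    show ?thesis by (simp add: Discr_def[abs_def] q_def mult_ac)
  qed
  moreover have "2 * of_real pi * \<i> * q * euler_prod q ^ 24
     + q * (24 * euler_prod q ^ 23 * (deriv euler_prod q * (2 * of_real pi * \<i> * q)))
     = 6 * \<i> / of_real pi * Eis2 t * Discr t"
  proof -
    have p: "euler_prod q ^ 24 = euler_prod q * euler_prod q ^ 23" by (simp flip: power_Suc)
    have "2 * P * \<i> * a * (e * f) + a * (24 * f * (d * (2 * P * \<i> * a)))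
        = 2 * P * \<i> * a * f * (e + 24 * (a * d))" for P a e f d :: complex
      by (simp add: algebra_simps)
    hence 1: "2 * of_real pi * \<i> * q * (euler_prod q * euler_prod q ^ 23) + q * (24 * euler_prod q ^ 23 * (deriv euler_prod q * (2 * of_real pi * \<i> * q)))
        = 2 * of_real pi * \<i> * q * euler_prod q ^ 23 * (euler_prod q + 24 * (q * deriv euler_prod q))"
      by blast
    have "2 * P * \<i> * a * f * (e + 24 * (- ((1 - 3 / P ^ 2 * G) / 24) * e))
       = 6 * \<i> / P * G * (a * (e * f))" if "P \<noteq> 0" for P a e f G :: complex
      using that by (simp add: field_simps power2_eq_square)
    hence "2 * of_real pi * \<i> * q * euler_prod q ^ 23 * (euler_prod q + 24 * (q * deriv euler_prod q))
       = 6 * \<i> / of_real pi * Eis2 t * (q * (euler_prod q * euler_prod q ^ 23))"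
      unfolding ld by simp
    with 1 show ?thesis unfolding Discr_def q_def[symmetric] p by (simp only:)
  qed
  ultimately show ?thesis by (simp only:)
qed

text \<open>The defect -2 pi i t in \<open>Eis2_S\<close> becomes 12 / t in the logarithmic
  derivative of Delta(-1/t), which is what t^12 contributes. So the quotient of the two sides is
  constant, and the fixed point i shows that the constant is 1.\<close>

lemma Discr_S:
  assumes t: "Im t > 0"
  shows "Discr (- 1 / t) = t ^ 12 * Discr t"
proof -
  define f where "f t = Discr (- 1 / t) / (t ^ 12 * Discr t)" for t
  have "\<exists>c. \<forall>x\<in>upper_half. f x = c"
  proof (rule DERIV_zero_connected_constant_on[of _ "{}", OF _ open_upper_half, unfolded constant_on_def])
    show "connected upper_half" by (intro convex_connected convex_upper_half)
    have der: "(f has_field_derivative 0) (at t)" if "t \<in> upper_half" for t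
    proof -
      have t: "Im t > 0" "t \<noteq> 0" using that by auto
      have t': "Im (- 1 / t) > 0" using t by (simp only: Im_neg_inverse) simp
      define E where "E = 6 * \<i> / of_real pi * Eis2 t"
      have "6 * \<i> / of_real pi * Eis2 (- 1 / t) * (1 / t ^ 2) = E + 12 / t"
        unfolding Eis2_S(1)[OF t(1)] E_def using t(2) by (simp add: field_simps power2_eq_square)
      moreover have "((\<lambda>t. Discr (- 1 / t)) has_field_derivative
         (6 * \<i> / of_real pi * Eis2 (- 1 / t) * Discr (- 1 / t)) * (1 / t ^ 2)) (at t)"
        by (rule DERIV_chain2[where f = Discr and g = "\<lambda>t. - 1 / t", OF Discr_deriv[OF t']]) (rule derivative_eq_intros refl t | simp add: power2_eq_square t)+
      moreover have "(6 * \<i> / of_real pi * Eis2 (- 1 / t) * Discr (- 1 / t)) * (1 / t ^ 2)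
          = (6 * \<i> / of_real pi * Eis2 (- 1 / t) * (1 / t ^ 2)) * Discr (- 1 / t)" by (simp only: mult_ac)
      ultimately have 1: "((\<lambda>t. Discr (- 1 / t)) has_field_derivative (E + 12 / t) * Discr (- 1 / t)) (at t)"
        by (simp only:)
      have 2: "((\<lambda>t. t ^ 12 * Discr t) has_field_derivative (E + 12 / t) * (t ^ 12 * Discr t)) (at t)"
      proof -
        have "((\<lambda>t. t ^ 12 * Discr t) has_field_derivative (12 * t ^ 11 * Discr t + t ^ 12 * (E * Discr t))) (at t)"
          unfolding E_def by (rule derivative_eq_intros Discr_deriv t refl | simp)+
        moreover have "12 * t ^ 11 * Discr t + t ^ 12 * (E * Discr t) = (E + 12 / t) * (t ^ 12 * Discr t)"
          using t(2) by (simp add: field_simps eval_nat_numeral)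
        ultimately show ?thesis by simp
      qed
      have nz: "t ^ 12 * Discr t \<noteq> 0" using t Discr_nz by simp
      from DERIV_divide[OF 1 2 nz] show ?thesis by (simp add: f_def[abs_def] mult_ac)
    qed
    show "continuous_on upper_half f"
      using der by (intro continuous_at_imp_continuous_on ballI DERIV_isCont) blast
    show "\<forall>x\<in>upper_half - {}. (f has_field_derivative 0) (at x)" using der by simp
  qed auto
  then obtain c where c: "\<And>x. Im x > 0 \<Longrightarrow> f x = c" by auto
  have "- 1 / \<i> = \<i>" by (simp add: field_simps)
  moreover have "\<i> ^ 12 = 1" using power_mult[of \<i> 2 6] by simp
  ultimately have "f \<i> = 1" using Discr_nz[of \<i>] unfolding f_def by simp
  hence "f t = 1" using c[of \<i>] c[OF t] by simp
  moreover have "t ^ 12 * Discr t \<noteq> 0" using t Discr_nz[OF t] by auto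
  ultimately show ?thesis unfolding f_def by (simp only: divide_eq_1_iff simp_thms)
qed

section \<open>Functions with a q-expansion\<close>

text \<open>With q = \<open>ee t\<close>: \<open>G\<close> is the expansion of q^n h in powers of
  q^(1/L). So h has a pole of order at most n in q, and the coefficient of \<open>G\<close> at n * L
  is the constant term of h.\<close>

definition qexp :: "nat \<Rightarrow> nat \<Rightarrow> (complex \<Rightarrow> complex) \<Rightarrow> complex fps \<Rightarrow> bool" where
  "qexp L n h G \<longleftrightarrow> fps_conv_radius G \<ge> 1 \<and>
     (\<forall>t. Im t > 0 \<longrightarrow> h t * ee (of_nat n * t) = eval_fps G (ee (t / of_nat L)))"

lemma fps_conv_radius_ge_1I:
  assumes "\<And>z. 0 < norm z \<Longrightarrow> norm z < 1 \<Longrightarrow> summable (\<lambda>n. fps_nth G n * z ^ n)"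
  shows "fps_conv_radius (G :: complex fps) \<ge> 1"
  unfolding fps_conv_radius_def
proof (rule conv_radius_geI_ex')
  fix r :: real assume "0 < r" "ereal r < 1"
  thus "summable (\<lambda>n. fps_nth G n * of_real r ^ n)"
    by (intro assms) auto
qed

lemma eball_1: "eball (0::complex) 1 = ball 0 1"
  using eball_ereal[of 0 1] by (simp add: one_ereal_def)

lemma summable_fps_1:
  assumes "fps_conv_radius G \<ge> 1" "norm z < 1"
  shows "summable (\<lambda>n. norm (fps_nth G n * z ^ n))" "(\<lambda>n. fps_nth G n * z ^ n) sums eval_fps G z"
proof -
  have "ereal (norm z) < 1" using assms(2) by simp
  hence *: "ereal (norm z) < fps_conv_radius G" using assms(1) by (rule less_le_trans)
  show "summable (\<lambda>n. norm (fps_nth G n * z ^ n))" by (rule norm_summable_fps[OF *])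
  show "(\<lambda>n. fps_nth G n * z ^ n) sums eval_fps G z" by (rule sums_eval_fps[OF *])
qed

lemma holomorphic_eval_fps_1:
  assumes "fps_conv_radius G \<ge> 1"
  shows "eval_fps G holomorphic_on ball 0 1"
proof (rule holomorphic_on_eval_fps)
  show "(ball 0 1 :: complex set) \<subseteq> eball 0 (fps_conv_radius G)" unfolding eball_1[symmetric] by (rule eball_mono[OF assms])
qed

lemma ee_surj:
  assumes "0 < norm z" "norm z < 1" "L > 0"
  obtains t where "Im t > 0" "ee (t / of_nat L) = z"
proof
  define t where "t = of_nat L * (Ln z / (2 * of_real pi * \<i>))"
  have "Im (Ln z / (2 * of_real pi * \<i>)) = - ln (norm z) / (2 * pi)"
    using assms by (simp add: Im_divide power2_eq_square field_simps)
  moreover have "ln (norm z) < 0" using assms by (simp add: ln_less_zero)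
  ultimately have "Im (Ln z / (2 * of_real pi * \<i>)) > 0" by (simp add: divide_neg_pos)
  moreover have "Im t = real L * Im (Ln z / (2 * of_real pi * \<i>))" unfolding t_def times_complex.sel by simp
  ultimately show "Im t > 0" using assms(3) by simp
  have "t / of_nat L = Ln z / (2 * of_real pi * \<i>)" using assms(3) by (simp add: t_def)
  thus "ee (t / of_nat L) = z" using assms(1) by (simp add: ee_def)
qed

lemma norm_ee_L: "Im t > 0 \<Longrightarrow> L > 0 \<Longrightarrow> norm (ee (t / of_nat L)) < 1"
  by (rule norm_ee_less_1) simp

text \<open>The values of \<open>ee\<close> on the upper half plane fill only the punctured disc;
  continuity supplies the value at 0.\<close>

lemma fps_eqI_punctured:
  fixes F G :: "complex fps"
  assumes "fps_conv_radius F \<ge> 1" "fps_conv_radius G \<ge> 1"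
    and "\<And>z. 0 < norm z \<Longrightarrow> norm z < 1 \<Longrightarrow> eval_fps F z = eval_fps G z"
  shows "F = G"
proof (rule eval_fps_eqD)
  show "fps_conv_radius F > 0" "fps_conv_radius G > 0" using assms(1,2) by (auto intro: less_le_trans[of 0 1])
  have c: "continuous_on (ball 0 1) (\<lambda>z. eval_fps F z - eval_fps G z)"
    by (intro continuous_intros holomorphic_on_imp_continuous_on holomorphic_eval_fps_1 assms)
  have 1: "((\<lambda>z. eval_fps F z - eval_fps G z) \<longlongrightarrow> eval_fps F 0 - eval_fps G 0) (at 0)"
    using c by (simp add: continuous_on_eq_continuous_at isCont_def)
  have "\<forall>\<^sub>F z in at 0. eval_fps F z - eval_fps G z = 0"
    unfolding eventually_at by (rule exI[of _ 1]) (use assms(3) in \<open>auto simp: dist_norm\<close>)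
  hence "((\<lambda>z. eval_fps F z - eval_fps G z) \<longlongrightarrow> 0) (at 0)" by (rule tendsto_eventually)
  with 1 have "eval_fps F 0 - eval_fps G 0 = 0" by (rule tendsto_unique[OF at_neq_bot])
  hence "eval_fps F z = eval_fps G z" if "norm z < 1" for z
    using assms(3)[of z] that by (cases "z = 0") auto
  thus "\<forall>\<^sub>F z in nhds 0. eval_fps F z = eval_fps G z"
    unfolding eventually_nhds_metric by (intro exI[of _ 1]) (auto simp: dist_norm)
qed

lemma qexp_unique:
  assumes "qexp L n h F" "qexp L n h G" "L > 0"
  shows "F = G"
proof (rule fps_eqI_punctured)
  fix z :: complex assume "0 < norm z" "norm z < 1"
  then obtain t where "Im t > 0" "ee (t / of_nat L) = z" using assms(3) ee_surj by metis
  thus "eval_fps F z = eval_fps G z" using assms(1,2) unfolding qexp_def by metis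
qed (use assms in \<open>auto simp: qexp_def\<close>)

lemma conv_radius_mult_1:
  "fps_conv_radius F \<ge> 1 \<Longrightarrow> fps_conv_radius G \<ge> 1 \<Longrightarrow> fps_conv_radius (F * G :: complex fps) \<ge> 1"
  by (rule order_trans[OF _ fps_conv_radius_mult]) simp

lemma eval_mult_1:
  assumes "fps_conv_radius F \<ge> 1" "fps_conv_radius G \<ge> 1" "norm (z::complex) < 1"
  shows "eval_fps (F * G) z = eval_fps F z * eval_fps G z"
  by (rule eval_fps_mult) (use assms in \<open>auto intro: less_le_trans[of _ 1]\<close>)

lemma qexp_mult:
  assumes "qexp L n h F" "qexp L m k G" "L > 0"
  shows "qexp L (n + m) (\<lambda>t. h t * k t) (F * G)"
  unfolding qexp_def
proof (intro conjI allI impI)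
  show "fps_conv_radius (F * G) \<ge> 1" using assms by (simp add: qexp_def conv_radius_mult_1)
  fix t :: complex assume t: "Im t > 0"
  have "h t * k t * ee (of_nat (n + m) * t) = (h t * ee (of_nat n * t)) * (k t * ee (of_nat m * t))"
    by (simp add: ee_add distrib_right)
  also have "\<dots> = eval_fps F (ee (t / of_nat L)) * eval_fps G (ee (t / of_nat L))"
    using assms(1,2) t by (simp add: qexp_def)
  also have "\<dots> = eval_fps (F * G) (ee (t / of_nat L))"
    using assms t by (intro eval_mult_1[symmetric] norm_ee_L) (auto simp: qexp_def)
  finally show "h t * k t * ee (of_nat (n + m) * t) = eval_fps (F * G) (ee (t / of_nat L))" .
qed

lemma qexp_add:
  assumes "qexp L n h F" "qexp L n k G" "L > 0"
  shows "qexp L n (\<lambda>t. h t + k t) (F + G)"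
  unfolding qexp_def
proof (intro conjI allI impI)
  show "fps_conv_radius (F + G) \<ge> 1" using assms by (intro order_trans[OF _ fps_conv_radius_add]) (simp add: qexp_def)
  fix t :: complex assume t: "Im t > 0"
  have 1: "eval_fps (F + G) (ee (t / of_nat L)) = eval_fps F (ee (t / of_nat L)) + eval_fps G (ee (t / of_nat L))"
    using assms norm_ee_L[OF t assms(3)]
    by (intro eval_fps_add) (auto simp: qexp_def intro: less_le_trans[of _ 1])
  have "(h t + k t) * ee (of_nat n * t) = h t * ee (of_nat n * t) + k t * ee (of_nat n * t)" by (rule ring_distribs)
  thus "(h t + k t) * ee (of_nat n * t) = eval_fps (F + G) (ee (t / of_nat L))"
    using assms(1,2) t unfolding 1 qexp_def by metis
qed

lemma qexp_const: "L > 0 \<Longrightarrow> qexp L 0 (\<lambda>t. c) (fps_const c)"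
  by (simp add: qexp_def)

lemma qexp_cmult:
  assumes "qexp L n h F" "L > 0"
  shows "qexp L n (\<lambda>t. c * h t) (fps_const c * F)"
  using qexp_mult[OF qexp_const[OF assms(2), of c] assms(1,2)] by simp

lemma qexp_power:
  assumes "qexp L n h F" "L > 0"
  shows "qexp L (n * r) (\<lambda>t. h t ^ r) (F ^ r)"
proof (induction r)
  case 0 thus ?case using qexp_const[OF assms(2), of 1] by simp
next
  case (Suc r)
  from qexp_mult[OF assms(1) Suc assms(2)] show ?case by (simp add: algebra_simps)
qed

lemma qexp_sum:
  assumes "finite I" "\<And>i. i \<in> I \<Longrightarrow> qexp L n (h i) (F i)" "L > 0"
  shows "qexp L n (\<lambda>t. \<Sum>i\<in>I. h i t) (\<Sum>i\<in>I. F i)"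
  using assms(1,2)
proof (induction I rule: finite_induct)
  case empty
  show ?case by (simp add: qexp_def)
next
  case (insert i I)
  have "qexp L n (\<lambda>t. h i t + (\<Sum>i\<in>I. h i t)) (F i + (\<Sum>i\<in>I. F i))"
    using insert assms(3) by (intro qexp_add) auto
  thus ?case using insert by simp
qed

lemma qexp_prod:
  assumes "finite I" "\<And>i. i \<in> I \<Longrightarrow> qexp L n (h i) (F i)" "L > 0"
  shows "qexp L (card I * n) (\<lambda>t. \<Prod>i\<in>I. h i t) (\<Prod>i\<in>I. F i)"
  using assms(1,2)
proof (induction I rule: finite_induct)
  case empty
  show ?case using qexp_const[OF assms(3), of 1] by simp
next
  case (insert i I)
  have "qexp L (n + card I * n) (\<lambda>t. h i t * (\<Prod>i\<in>I. h i t)) (F i * (\<Prod>i\<in>I. F i))"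
    using insert assms(3) by (intro qexp_mult) auto
  thus ?case using insert by simp
qed

text \<open>This is G(X^L). It rewrites an expansion in terms of a finer root of q.\<close>

definition fps_spread :: "nat \<Rightarrow> complex fps \<Rightarrow> complex fps" where
  "fps_spread L G = Abs_fps (\<lambda>i. if L dvd i then fps_nth G (i div L) else 0)"

lemma fps_spread:
  assumes G: "fps_conv_radius G \<ge> 1" and L: "L > 0"
  shows "fps_conv_radius (fps_spread L G) \<ge> 1"
    and "norm z < 1 \<Longrightarrow> eval_fps (fps_spread L G) z = eval_fps G (z ^ L)"
proof -
  have *: "(\<lambda>i. fps_nth (fps_spread L G) i * z ^ i) sums eval_fps G (z ^ L)" if z: "norm z < 1" for z
  proof -
    have "norm (z ^ L) < 1" using z L by (simp add: norm_power power_less_one_iff)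
    hence "((\<lambda>n. fps_nth G n * (z ^ L) ^ n) has_sum eval_fps G (z ^ L)) UNIV"
      using summable_fps_1[OF G] by (intro norm_summable_imp_has_sum) auto
    hence "((\<lambda>i. fps_nth (fps_spread L G) i * z ^ i) has_sum eval_fps G (z ^ L)) (range (\<lambda>n. L * n))"
      using L by (subst has_sum_reindex) (auto simp: inj_on_def o_def fps_spread_def power_mult)
    hence "((\<lambda>i. fps_nth (fps_spread L G) i * z ^ i) has_sum eval_fps G (z ^ L)) UNIV"
      by (rule has_sum_cong_neutral[THEN iffD1, rotated -1]) (auto simp: fps_spread_def dvd_def)
    thus ?thesis by (rule has_sum_imp_sums)
  qed
  show "fps_conv_radius (fps_spread L G) \<ge> 1"
    using * by (intro fps_conv_radius_ge_1I) (auto simp: sums_iff)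
  show "eval_fps (fps_spread L G) z = eval_fps G (z ^ L)" if "norm z < 1"
    using *[OF that] by (simp add: eval_fps_def sums_iff)
qed

lemma fps_spread_0 [simp]: "fps_nth (fps_spread L G) 0 = fps_nth G 0"
  by (simp add: fps_spread_def)

lemma qexp_spread:
  assumes "qexp L n h G" "K > 0" "L > 0"
  shows "qexp (L * K) n h (fps_spread K G)"
  unfolding qexp_def
proof (intro conjI allI impI)
  show "fps_conv_radius (fps_spread K G) \<ge> 1" using assms by (intro fps_spread) (auto simp: qexp_def)
  fix t :: complex assume t: "Im t > 0"
  have "ee (t / of_nat (L * K)) ^ K = ee (t / of_nat L)" using assms by (simp add: ee_power)
  moreover have "norm (ee (t / of_nat (L * K))) < 1" by (rule norm_ee_L[OF t]) (use assms in auto)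
  ultimately show "h t * ee (of_nat n * t) = eval_fps (fps_spread K G) (ee (t / of_nat (L * K)))"
    using assms t by (simp add: qexp_def fps_spread)
qed

lemma qexp_holomorphic:
  assumes "qexp L n h G" "L > 0"
  shows "h holomorphic_on upper_half"
proof -
  have "(\<lambda>t. eval_fps G (ee (t / of_nat L)) / ee (of_nat n * t)) holomorphic_on upper_half"
  proof (intro holomorphic_on_divide)
    have "(eval_fps G \<circ> (\<lambda>t. ee (t / of_nat L))) holomorphic_on upper_half"
      using assms norm_ee_L by (intro holomorphic_on_compose_gen[OF _ holomorphic_eval_fps_1[of G]] holomorphic_intros)
        (auto simp: qexp_def)
    thus "(\<lambda>t. eval_fps G (ee (t / of_nat L))) holomorphic_on upper_half" by (simp add: o_def)
  qed (auto intro!: holomorphic_intros)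
  moreover have "eval_fps G (ee (t / of_nat L)) / ee (of_nat n * t) = h t" if "t \<in> upper_half" for t
    using assms(1) that by (auto simp: qexp_def field_simps)
  ultimately show ?thesis by (rule holomorphic_transform)
qed

section \<open>Functions invariant under the modular group\<close>

lemma upper_half_reduction:
  fixes h :: "complex \<Rightarrow> 'a"
  assumes T: "\<And>t. Im t > 0 \<Longrightarrow> h (t + 1) = h t" and S: "\<And>t. Im t > 0 \<Longrightarrow> h (- 1 / t) = h t"
    and t: "Im t > 0"
  shows "\<exists>t'. \<bar>Re t'\<bar> \<le> 1 / 2 \<and> Im t' \<ge> 1 / 2 \<and> h t' = h t"
proof -
  have Tn: "h (t + of_nat n) = h t" if "Im t > 0" for n t
  proof (induction n)
    case (Suc n)
    have "h (t + of_nat (Suc n)) = h ((t + of_nat n) + 1)" by (simp add: add_ac)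
    also have "\<dots> = h (t + of_nat n)" using that by (intro T) simp
    finally show ?case using Suc by simp
  qed simp
  have Ti: "h (t + of_int n) = h t" if "Im t > 0" for n t
  proof (cases "n \<ge> 0")
    case True
    thus ?thesis using Tn[OF that, of "nat n"] by simp
  next
    case False
    have "h ((t + of_int n) + of_nat (nat (- n))) = h (t + of_int n)" using that by (intro Tn) simp
    thus ?thesis using False by simp
  qed
  have shift: "\<exists>t'. \<bar>Re t'\<bar> \<le> 1 / 2 \<and> Im t' = Im t \<and> h t' = h t" if "Im t > 0" for t
  proof (intro exI conjI)
    show "\<bar>Re (t + of_int (- round (Re t)))\<bar> \<le> 1 / 2" using of_int_round_abs_le[of "Re t"] by (simp add: abs_minus_commute)
    show "h (t + of_int (- round (Re t))) = h t" by (rule Ti[OF that])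
  qed simp
  have main: "\<exists>t'. \<bar>Re t'\<bar> \<le> 1 / 2 \<and> Im t' \<ge> 1 / 2 \<and> h t' = h t" if "Im t * 2 ^ k \<ge> 1 / 2" "Im t > 0" for t k
    using that
  proof (induction k arbitrary: t)
    case 0
    thus ?case using shift[of t] by auto
  next
    case (Suc k)
    obtain t' where t': "\<bar>Re t'\<bar> \<le> 1 / 2" "Im t' = Im t" "h t' = h t" using shift[OF Suc.prems(2)] by blast
    show ?case
    proof (cases "Im t' \<ge> 1 / 2")
      case True thus ?thesis using t' by blast
    next
      case False
      \<comment> \<open>Below height 1/2 in the strip |t'|^2 is at most 1/2, so the inversion at
        least doubles the imaginary part. The induction counts the doublings needed to reach height
        1/2.\<close>
      have "(Re t')\<^sup>2 \<le> (1/2)\<^sup>2" using t'(1) by (subst abs_le_square_iff[symmetric]) simp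
      moreover have "(Im t')\<^sup>2 \<le> (1/2)\<^sup>2" using False Suc.prems t' by (intro power_mono) auto
      ultimately have n: "(norm t')\<^sup>2 \<le> 1 / 2" unfolding cmod_power2 by (simp add: power2_eq_square)
      have pos: "Im t' > 0" using Suc.prems t' by simp
      hence npos: "(norm t')\<^sup>2 > 0" by auto
      have "2 * Im t' \<le> Im t' / (norm t')\<^sup>2" using n pos npos by (simp add: field_simps)
      hence I: "Im (- 1 / t') \<ge> 2 * Im t'" by (simp only: Im_neg_inverse)
      have "2 * Im t' * 2 ^ k \<le> Im (- 1 / t') * 2 ^ k" using I by (intro mult_right_mono) auto
      hence "Im (- 1 / t') * 2 ^ k \<ge> 1 / 2" using Suc.prems(1) t'(2) by simp
      moreover have "Im (- 1 / t') > 0" using I pos by linarith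
      ultimately have "\<exists>t''. \<bar>Re t''\<bar> \<le> 1 / 2 \<and> Im t'' \<ge> 1 / 2 \<and> h t'' = h (- 1 / t')" by (rule Suc.IH)
      thus ?thesis using S[OF pos] t'(3) by simp
    qed
  qed
  obtain k where "1 / (2 * Im t) < 2 ^ k" using real_arch_pow[of 2 "1 / (2 * Im t)"] by auto
  hence "Im t * 2 ^ k \<ge> 1 / 2" using t by (simp add: field_simps)
  thus ?thesis using main t by blast
qed

text \<open>Reduction to the strip and decay at the cusp put a global maximum of |h| into a compact
  rectangle. By the maximum modulus principle h is constant, and decay makes the constant 0.\<close>

lemma level_one_vanish:
  assumes T: "\<And>t. Im t > 0 \<Longrightarrow> h (t + 1) = h t" and S: "\<And>t. Im t > 0 \<Longrightarrow> h (- 1 / t) = h t"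
    and hol: "h holomorphic_on upper_half"
    and cusp: "\<And>e::real. e > 0 \<Longrightarrow> \<exists>Y. \<forall>t. Im t > Y \<longrightarrow> norm (h t) < e"
    and t: "Im t > 0"
  shows "h t = 0"
proof (rule ccontr)
  assume nz: "h t \<noteq> 0"
  obtain Y where Y: "\<And>s. Im s > Y \<Longrightarrow> norm (h s) < norm (h t)" using cusp[of "norm (h t)"] nz by auto
  define Z where "Z = max Y 1"
  define K where "K = cbox (Complex (-1/2) (1/2)) (Complex (1/2) Z)"
  have memK: "s \<in> K \<longleftrightarrow> \<bar>Re s\<bar> \<le> 1 / 2 \<and> Im s \<ge> 1 / 2 \<and> Im s \<le> Z" for s
    by (auto simp: K_def in_cbox_complex_iff)
  obtain t0 where t0: "\<bar>Re t0\<bar> \<le> 1 / 2" "Im t0 \<ge> 1 / 2" "h t0 = h t"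
    using upper_half_reduction[of h, OF T S t] by blast
  have "Im t0 \<le> Y" using Y[of t0] t0(3) by fastforce
  hence t0K: "t0 \<in> K" using t0 by (simp add: memK Z_def)
  have Ksub: "K \<subseteq> upper_half" by (auto simp: memK)
  have "continuous_on K (\<lambda>s. norm (h s))"
    by (intro continuous_intros holomorphic_on_imp_continuous_on holomorphic_on_subset[OF hol Ksub])
  then obtain x where x: "x \<in> K" "\<And>s. s \<in> K \<Longrightarrow> norm (h s) \<le> norm (h x)"
    using continuous_attains_sup[of K "\<lambda>s. norm (h s)"] t0K by (auto simp: K_def)
  have big: "norm (h t) \<le> norm (h x)" using x(2)[OF t0K] t0(3) by simp
  have max: "norm (h s) \<le> norm (h x)" if "s \<in> upper_half" for s
  proof -
    have "Im s > 0" using that by simp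
    then obtain s' where s': "\<bar>Re s'\<bar> \<le> 1 / 2" "Im s' \<ge> 1 / 2" "h s' = h s"
      using upper_half_reduction[of h, OF T S] by blast
    show ?thesis
    proof (cases "Im s' \<le> Z")
      case True
      thus ?thesis using x(2)[of s'] s' by (simp add: memK)
    next
      case False
      hence "Im s' > Y" by (simp add: Z_def)
      hence "norm (h s) < norm (h t)" using Y[of s'] unfolding s'(3) by blast
      thus ?thesis using big by linarith
    qed
  qed
  have "h constant_on upper_half"
    by (rule maximum_modulus_principle[OF hol open_upper_half _ open_upper_half, of x])
       (use x Ksub max in \<open>auto intro: convex_connected convex_upper_half\<close>)
  then obtain c where c: "\<And>s. Im s > 0 \<Longrightarrow> h s = c" by (auto simp: constant_on_def)
  define s where "s = Complex 0 (\<bar>Y\<bar> + 1)"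
  have "norm (h s) < norm (h t)" by (rule Y) (simp add: s_def)
  moreover have "h s = h t" using c[of s] c[OF t] by (simp add: s_def)
  ultimately show False by simp
qed

section \<open>Level one congruences\<close>

locale csubring =
  fixes A :: "complex set"
  assumes one_mem: "1 \<in> A"
    and diff_mem: "x \<in> A \<Longrightarrow> y \<in> A \<Longrightarrow> x - y \<in> A"
    and mult_mem: "x \<in> A \<Longrightarrow> y \<in> A \<Longrightarrow> x * y \<in> A"
begin

lemma zero_mem: "0 \<in> A" using diff_mem[OF one_mem one_mem] by simp
lemma uminus_mem: "x \<in> A \<Longrightarrow> - x \<in> A" using diff_mem[OF zero_mem, of x] by simp
lemma add_mem: "x \<in> A \<Longrightarrow> y \<in> A \<Longrightarrow> x + y \<in> A" using diff_mem[of x "- y"] uminus_mem by simp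
lemma sum_mem: "(\<And>i. i \<in> I \<Longrightarrow> f i \<in> A) \<Longrightarrow> sum f I \<in> A"
  by (induction I rule: infinite_finite_induct) (auto intro: zero_mem add_mem)
lemma power_mem: "x \<in> A \<Longrightarrow> x ^ n \<in> A"
  by (induction n) (auto intro: one_mem mult_mem)
lemma of_nat_mem: "of_nat n \<in> A" by (induction n) (auto intro: zero_mem one_mem add_mem)
lemma Ints_subset: "\<int> \<subseteq> A"
proof
  fix x :: complex assume "x \<in> \<int>"
  then obtain n where "x = of_int n" by (rule Ints_cases)
  thus "x \<in> A" using of_nat_mem[of "nat n"] uminus_mem[OF of_nat_mem[of "nat (- n)"]] by (cases "n \<ge> 0") auto
qed

definition fin :: "complex fps \<Rightarrow> bool" where "fin F \<longleftrightarrow> (\<forall>n. fps_nth F n \<in> A)"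

lemma fin_mult: "fin F \<Longrightarrow> fin G \<Longrightarrow> fin (F * G)"
  by (auto simp: fin_def fps_mult_nth intro!: sum_mem mult_mem)
lemma fin_add: "fin F \<Longrightarrow> fin G \<Longrightarrow> fin (F + G)" by (auto simp: fin_def intro: add_mem)
lemma fin_diff: "fin F \<Longrightarrow> fin G \<Longrightarrow> fin (F - G)" by (auto simp: fin_def intro: diff_mem)
lemma fin_const: "c \<in> A \<Longrightarrow> fin (fps_const c)" by (auto simp: fin_def zero_mem)
lemma fin_0: "fin 0" by (auto simp: fin_def zero_mem)
lemma fin_1: "fin 1" by (auto simp: fin_def zero_mem one_mem)
lemma fin_X: "fin fps_X" by (auto simp: fin_def fps_X_def zero_mem one_mem)
lemma fin_power: "fin F \<Longrightarrow> fin (F ^ n)" by (induction n) (auto intro: fin_1 fin_mult)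
lemma fin_sum: "(\<And>i. i \<in> I \<Longrightarrow> fin (F i)) \<Longrightarrow> fin (sum F I)"
  by (induction I rule: infinite_finite_induct) (auto intro: fin_0 fin_add)
lemma fin_prod: "(\<And>i. i \<in> I \<Longrightarrow> fin (F i)) \<Longrightarrow> fin (prod F I)"
  by (induction I rule: infinite_finite_induct) (auto intro: fin_1 fin_mult)
lemma fin_spread: "fin F \<Longrightarrow> fin (fps_spread L F)" by (auto simp: fin_def fps_spread_def zero_mem)
text \<open>Dividing by a series with constant term 1 creates no denominators: G is solved for one
  coefficient at a time.\<close>

lemma fin_inverse:
  assumes "fin F" "fin H" "fps_nth F 0 = 1" "G * F = H"
  shows "fin G"
proof -
  have "fps_nth G n \<in> A" for n
  proof (induction n rule: less_induct)
    case (less n)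
    have "fps_nth H n = (\<Sum>i=0..n. fps_nth G i * fps_nth F (n - i))" using assms(4) by (auto simp: fps_mult_nth)
    also have "{0..n} = insert n {0..<n}" by auto
    finally have "fps_nth G n = fps_nth H n - (\<Sum>i\<in>{0..<n}. fps_nth G i * fps_nth F (n - i))"
      using assms(3) by simp
    thus ?case using less assms(1,2) by (auto simp: fin_def intro!: diff_mem sum_mem mult_mem)
  qed
  thus ?thesis by (simp add: fin_def)
qed

end

interpretation Ints: csubring "\<int> :: complex set"
  by unfold_locales auto

lemma (in csubring) fin_Ints: "Ints.fin F \<Longrightarrow> fin F"
  using Ints_subset by (auto simp: fin_def Ints.fin_def)

section \<open>Integral expansions of Delta, of its inverse and of a substitute for j\<close>

lemma conv_radius_closed_1:
  "fps_conv_radius F \<ge> 1 \<Longrightarrow> fps_conv_radius G \<ge> 1 \<Longrightarrow> fps_conv_radius (F - G :: complex fps) \<ge> 1"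
  "fps_conv_radius F \<ge> 1 \<Longrightarrow> fps_conv_radius (F ^ n :: complex fps) \<ge> 1"
  "fps_conv_radius (fps_const c :: complex fps) \<ge> 1"
  "fps_conv_radius (fps_X ^ n :: complex fps) \<ge> 1"
  by (rule order_trans[OF _ fps_conv_radius_diff], simp, rule order_trans[OF _ fps_conv_radius_power]) simp_all

lemma eval_closed_1:
  assumes "norm (z::complex) < 1"
  shows "fps_conv_radius F \<ge> 1 \<Longrightarrow> fps_conv_radius G \<ge> 1 \<Longrightarrow> eval_fps (F - G) z = eval_fps F z - eval_fps G z"
    "fps_conv_radius F \<ge> 1 \<Longrightarrow> eval_fps (F ^ n) z = eval_fps F z ^ n"
  using assms by (auto intro!: eval_fps_diff eval_fps_power intro: less_le_trans[of _ 1])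

definition Phi_fps :: "complex fps" where "Phi_fps = euler_fps ^ 24"

lemma Phi_fps:
  "fps_conv_radius Phi_fps \<ge> 1" "norm q < 1 \<Longrightarrow> eval_fps Phi_fps q = euler_prod q ^ 24"
  "Ints.fin Phi_fps" "fps_nth Phi_fps 0 = 1"
proof -
  show "fps_conv_radius Phi_fps \<ge> 1" by (simp add: Phi_fps_def conv_radius_closed_1 euler_fps)
  show "norm q < 1 \<Longrightarrow> eval_fps Phi_fps q = euler_prod q ^ 24"
    by (simp add: Phi_fps_def eval_closed_1 euler_fps)
  show "Ints.fin Phi_fps" unfolding Phi_fps_def by (intro Ints.fin_power) (simp add: Ints.fin_def euler_fps)
  show "fps_nth Phi_fps 0 = 1" by (simp add: Phi_fps_def fps_power_zeroth euler_fps)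
qed

lemma Discr_ee: "Discr t = ee t * eval_fps Phi_fps (ee t)" if "Im t > 0"
  using that by (simp add: Discr_def Phi_fps norm_ee_less_1)

lemma qexp_Discr: "qexp 1 0 Discr (fps_X * Phi_fps)"
  unfolding qexp_def
  by (auto simp: Discr_ee eval_mult_1 conv_radius_mult_1 Phi_fps norm_ee_less_1)

lemma inverse_Phi:
  obtains Psi where "fps_conv_radius Psi \<ge> 1" "Ints.fin Psi" "fps_nth Psi 0 = 1"
    "\<And>q. norm q < 1 \<Longrightarrow> eval_fps Psi q = 1 / eval_fps Phi_fps q"
proof
  define f where "f q = 1 / eval_fps Phi_fps q" for q
  define Psi where "Psi = fps_expansion f 0"
  have nz: "eval_fps Phi_fps q \<noteq> 0" if "norm q < 1" for q using that by (simp add: Phi_fps euler_prod_nz)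
  have hol: "f holomorphic_on ball 0 1" unfolding f_def
    using nz by (intro holomorphic_intros holomorphic_eval_fps_1 Phi_fps) auto
  show c: "fps_conv_radius Psi \<ge> 1" unfolding Psi_def
    using conv_radius_fps_expansion[of f 0 1] hol by (simp add: eball_1)
  show ev: "eval_fps Psi q = 1 / eval_fps Phi_fps q" if "norm q < 1" for q
    unfolding Psi_def using eval_fps_expansion'[of f 0 1 q] hol that by (simp add: eball_1 f_def)
  have "Psi * Phi_fps = 1"
    by (rule fps_eqI_punctured) (simp_all add: conv_radius_mult_1 c Phi_fps(1) eval_mult_1 ev nz)
  thus "Ints.fin Psi" by (rule Ints.fin_inverse[OF Phi_fps(3) Ints.fin_1 Phi_fps(4)])
  show "fps_nth Psi 0 = 1" using ev[of 0] by (simp add: eval_fps_at_0 Phi_fps(4))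
qed

lemma qexp_inverse_Discr: obtains Psi where "Ints.fin Psi" "fps_nth Psi 0 = 1" "qexp 1 1 (\<lambda>t. 1 / Discr t) Psi"
proof -
  obtain Psi where P: "fps_conv_radius Psi \<ge> 1" "Ints.fin Psi" "fps_nth Psi 0 = 1"
    "\<And>q. norm q < 1 \<Longrightarrow> eval_fps Psi q = 1 / eval_fps Phi_fps q" using inverse_Phi by blast
  have "qexp 1 1 (\<lambda>t. 1 / Discr t) Psi"
    unfolding qexp_def using P by (auto simp: Discr_ee norm_ee_less_1)
  thus ?thesis using that P by blast
qed

text \<open>A replacement for Klein's \<open>j\<close>: the second elementary symmetric function of the three
  conjugates of \<open>2\<^sup>1\<^sup>2 \<Delta>(2t)/\<Delta>(t)\<close> over level two.\<close>

definition jj :: "complex \<Rightarrow> complex" where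
  "jj t = (let u = 4096 * Discr (2 * t) / Discr t; v = Discr (t / 2) / Discr t; w = Discr ((t + 1) / 2) / Discr t
     in u * (v + w) + v * w)"

text \<open>The translation fixes the first conjugate and exchanges the other two.\<close>

lemma jj_T: "jj (t + 1) = jj t"
proof -
  have "Discr (2 * (t + 1)) = Discr (2 * t)" using Discr_plus_1[of "2 * t + 1"] Discr_plus_1[of "2 * t"] by (simp add: add_ac)
  moreover have "Discr ((t + 1 + 1) / 2) = Discr (t / 2)" using Discr_plus_1[of "t / 2"] by (simp add: add_divide_distrib add_ac)
  moreover have "u * (v + w) + v * w = u * (w + v) + w * v" for u v w :: complex by (simp add: algebra_simps)
  ultimately show ?thesis unfolding jj_def Let_def by (simp only: Discr_plus_1)
qed

text \<open>The inversion exchanges the first two conjugates and fixes the third.\<close>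

lemma jj_S:
  assumes t: "Im t > 0"
  shows "jj (- 1 / t) = jj t"
proof -
  have t0: "t \<noteq> 0" using t by auto
  have 1: "Discr (2 * (- 1 / t)) = t ^ 12 / 4096 * Discr (t / 2)"
    using Discr_S[of "t / 2"] t by (simp add: power_divide)
  have 2: "Discr (- 1 / t / 2) = 4096 * t ^ 12 * Discr (2 * t)"
    using Discr_S[of "2 * t"] t by (simp add: power_mult_distrib mult_ac)
  \<comment> \<open>The chain is w = (t + 1)/2, then w - 1, then y = -1/(w - 1), then y - 2, then
    -1/(y - 2) = (1 - 1/t)/2. The two factors of weight 12 combine to t^12 because (y - 2)(w - 1) =
    -t.\<close>
  have 3: "Discr ((- 1 / t + 1) / 2) = t ^ 12 * Discr ((t + 1) / 2)"
  proof -
    define w where "w = (t + 1) / 2"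
    have w: "Im w > 0" "w - 1 \<noteq> 0" using t by (auto simp: w_def complex_eq_iff)
    have w1: "Im (w - 1) > 0" using w by simp
    define y where "y = - 1 / (w - 1)"
    have y: "Im y > 0" unfolding y_def using w1 w(2) by (simp only: Im_neg_inverse) simp
    have y2: "Im (y - 2) > 0" using y by simp
    have y2nz: "y - 2 \<noteq> 0" using y2 by auto
    have t2: "t = 2 * w - 1" by (simp add: w_def field_simps)
    have "y - 2 = - t / (w - 1)" using w(2) unfolding y_def t2 by (simp add: field_simps)
    hence "- 1 / (y - 2) = - 1 / (- t / (w - 1))" by (simp only:)
    also have "\<dots> = (w - 1) / t" using t0 w(2) by (simp add: divide_simps)
    also have "\<dots> = (- 1 / t + 1) / 2" using t0 by (simp add: w_def field_simps)
    finally have "Discr ((- 1 / t + 1) / 2) = Discr (- 1 / (y - 2))" by (simp only:)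
    also have "\<dots> = (y - 2) ^ 12 * Discr (y - 2)" by (rule Discr_S[OF y2])
    also have "Discr (y - 2) = Discr y"
      using Discr_plus_1[of "y - 2"] Discr_plus_1[of "y - 1"] by simp
    also have "Discr y = (w - 1) ^ 12 * Discr (w - 1)" unfolding y_def by (rule Discr_S[OF w1])
    also have "Discr (w - 1) = Discr w" using Discr_plus_1[of "w - 1"] by simp
    finally have "Discr ((- 1 / t + 1) / 2) = ((y - 2) * (w - 1)) ^ 12 * Discr w" by (simp add: power_mult_distrib)
    also have "(y - 2) * (w - 1) = - t" using w(2) unfolding y_def t2 by (simp add: field_simps)
    finally show ?thesis by (simp add: w_def)
  qed
  have D: "Discr (- 1 / t) = t ^ 12 * Discr t" by (rule Discr_S[OF t])
  have nz: "Discr t \<noteq> 0" "t ^ 12 \<noteq> 0" using t0 Discr_nz[OF t] by auto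
  have e: "4096 * Discr (2 * (- 1 / t)) / Discr (- 1 / t) = Discr (t / 2) / Discr t"
    "Discr (- 1 / t / 2) / Discr (- 1 / t) = 4096 * Discr (2 * t) / Discr t"
    "Discr ((- 1 / t + 1) / 2) / Discr (- 1 / t) = Discr ((t + 1) / 2) / Discr t"
    unfolding 1 2 3 D using nz by simp_all
  have "v * (u + w) + u * w = u * (v + w) + v * w" for u v w :: complex by (simp add: algebra_simps)
  thus ?thesis unfolding jj_def Let_def e by blast
qed

text \<open>Put z = q^(1/2) and write F for \<open>Phi_fps\<close>. The product v w is -F(z) F(-z) /
  (z^2 F(z^2)^2), while u (v + w) has no pole. So there is a simple pole in q with leading
  coefficient -1, invertible in every coefficient ring.\<close>

lemma qexp_jj: obtains J where "Ints.fin J" "fps_nth J 0 = - 1" "qexp 2 1 jj J"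
proof -
  obtain Psi where P: "fps_conv_radius Psi \<ge> 1" "Ints.fin Psi" "fps_nth Psi 0 = 1"
    "\<And>q. norm q < 1 \<Longrightarrow> eval_fps Psi q = 1 / eval_fps Phi_fps q" using inverse_Phi by blast
  define F where "F = Phi_fps"
  define Fm where "Fm = Abs_fps (\<lambda>n. (- 1) ^ n * fps_nth F n)"
  define F4 where "F4 = fps_spread 4 F"
  define P2 where "P2 = fps_spread 2 Psi"
  define J where "J = P2 ^ 2 * (fps_const 4096 * fps_X ^ 3 * F4 * (F - Fm) - F * Fm)"
  have F: "fps_conv_radius F \<ge> 1" "Ints.fin F" "fps_nth F 0 = 1" by (simp_all add: F_def Phi_fps)
  have Fm1: "(\<lambda>n. fps_nth Fm n * z ^ n) sums eval_fps F (- z)" if "norm z < 1" for z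
  proof -
    have "(\<lambda>n. fps_nth F n * (- z) ^ n) sums eval_fps F (- z)" using summable_fps_1[OF F(1), of "- z"] that by simp
    moreover have "fps_nth F n * (- z) ^ n = fps_nth Fm n * z ^ n" for n
      using power_minus[of z n] by (simp add: Fm_def)
    ultimately show ?thesis by simp
  qed
  have Fm: "fps_conv_radius Fm \<ge> 1" using Fm1 by (intro fps_conv_radius_ge_1I) (auto simp: sums_iff)
  have evm: "eval_fps Fm z = eval_fps F (- z)" if "norm z < 1" for z
    using Fm1[OF that] by (simp add: eval_fps_def sums_iff)
  have Fm2: "Ints.fin Fm" using F(2) by (auto simp: Ints.fin_def Fm_def)
  have F4: "fps_conv_radius F4 \<ge> 1" "Ints.fin F4" unfolding F4_def by (auto intro!: fps_spread Ints.fin_spread F)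
  have P2: "fps_conv_radius P2 \<ge> 1" "Ints.fin P2" unfolding P2_def by (auto intro!: fps_spread Ints.fin_spread P)
  have fin: "Ints.fin J" unfolding J_def
    by (intro Ints.fin_mult Ints.fin_power Ints.fin_diff Ints.fin_const Ints.fin_X F Fm2 F4 P2) auto
  have J0: "fps_nth J 0 = - 1"
    by (simp add: J_def fps_power_zeroth P2_def P(3) F(3) Fm_def)
  note cv = conv_radius_mult_1 conv_radius_closed_1 F Fm F4 P2
  have cJ: "fps_conv_radius J \<ge> 1" unfolding J_def by (intro cv)
  have evJ: "eval_fps J z = (eval_fps P2 z) ^ 2 * (4096 * z ^ 3 * eval_fps F4 z * (eval_fps F z - eval_fps Fm z) - eval_fps F z * eval_fps Fm z)"
    if "norm z < 1" for z
    unfolding J_def using that by (simp add: cv eval_mult_1 eval_closed_1)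
  have "jj t * ee (of_nat 1 * t) = eval_fps J (ee (t / of_nat 2))" if t: "Im t > 0" for t
  proof -
    define z where "z = ee (t / 2)"
    have z: "norm z < 1" "z \<noteq> 0" unfolding z_def using t by (auto intro: norm_ee_less_1)
    have zz: "ee t = z ^ 2" "ee (2 * t) = z ^ 4" by (simp_all add: z_def ee_power)
    have h: "ee ((t + 1) / 2) = - z"
    proof -
      have "ee (1 / 2) = - 1" unfolding ee_def using exp_pi_i' by (simp add: mult_ac)
      thus ?thesis by (simp add: z_def add_divide_distrib ee_add)
    qed
    define a b c d where "a = eval_fps F z" and "b = eval_fps F (- z)" and "c = eval_fps F (z ^ 4)" and "d = eval_fps F (z ^ 2)"
    have nd: "norm (z ^ 2) < 1" "norm (z ^ 4) < 1" using z(1) by (simp_all add: norm_power power_less_one_iff)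
    have d0: "d \<noteq> 0" using nd(1) by (simp add: d_def F_def Phi_fps euler_prod_nz)
    have D: "Discr t = z ^ 2 * d" "Discr (2 * t) = z ^ 4 * c" "Discr (t / 2) = z * a" "Discr ((t + 1) / 2) = - z * b"
      using t by (simp_all add: Discr_ee zz h z_def[symmetric] F_def[symmetric] a_def b_def c_def d_def)
    have "jj t * z ^ 2 = (1 / d) ^ 2 * (4096 * z ^ 3 * c * (a - b) - a * b)"
      unfolding jj_def Let_def D using z(2) d0 by (simp add: field_simps) (simp add: algebra_simps eval_nat_numeral)
    also have "\<dots> = eval_fps J z"
      using z(1) nd by (simp add: evJ evm P2_def F4_def fps_spread P F a_def b_def c_def d_def F_def[symmetric])
    finally show ?thesis by (simp add: zz z_def)
  qed
  hence "qexp 2 1 jj J" using cJ unfolding qexp_def by blast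
  thus ?thesis using that fin J0 by blast
qed

section \<open>Congruences modulo an ideal\<close>

locale cideal = csubring +
  fixes M :: "complex set"
  assumes M_sub: "M \<subseteq> A"
    and M_0: "0 \<in> M"
    and M_add: "x \<in> M \<Longrightarrow> y \<in> M \<Longrightarrow> x + y \<in> M"
    and M_mult: "x \<in> A \<Longrightarrow> y \<in> M \<Longrightarrow> x * y \<in> M"
begin

lemma M_sum: "(\<And>i. i \<in> I \<Longrightarrow> f i \<in> M) \<Longrightarrow> sum f I \<in> M"
  by (induction I rule: infinite_finite_induct) (auto intro: M_0 M_add)

lemma M_uminus: "x \<in> M \<Longrightarrow> - x \<in> M"
  using M_mult[of "- 1" x] uminus_mem[OF one_mem] by simp

definition fim :: "complex fps \<Rightarrow> bool" where "fim F \<longleftrightarrow> (\<forall>n. fps_nth F n \<in> M)"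

lemma fim_mult: "fin F \<Longrightarrow> fim G \<Longrightarrow> fim (F * G)"
  by (auto simp: fin_def fim_def fps_mult_nth intro!: M_sum M_mult)

text \<open>The level one Sturm argument: a \<open>q\<close>-expansion congruent to zero up to its constant term
  is congruent to zero. The principal part is removed by subtracting powers of \<open>jj\<close>.\<close>

lemma level_one_congruence:
  assumes L: "even L" "L > 0"
    and "\<And>t. Im t > 0 \<Longrightarrow> h (t + 1) = h t" "\<And>t. Im t > 0 \<Longrightarrow> h (- 1 / t) = h t"
    and "qexp L n h G" "fin G" "\<And>i. i \<le> n * L \<Longrightarrow> fps_nth G i \<in> M"
  shows "fim G"
  using assms(3-)
proof (induction n arbitrary: h G)
  case 0
  define c where "c = fps_nth G 0"
  have G: "fps_conv_radius G \<ge> 1" and ev: "\<And>t. Im t > 0 \<Longrightarrow> h t = eval_fps G (ee (t / of_nat L))"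
    using "0.prems"(3) by (auto simp: qexp_def)
  \<comment> \<open>Without a pole, h minus its value at the cusp decays there, so h is constant and
    its expansion is the constant \<open>c\<close>.\<close>
  have "h t - c = 0" if "Im t > 0" for t
  proof (rule level_one_vanish[of "\<lambda>t. h t - c", OF _ _ _ _ that])
    show "h (t + 1) - c = h t - c" if "Im t > 0" for t using "0.prems"(1)[OF that] by simp
    show "h (- 1 / t) - c = h t - c" if "Im t > 0" for t using "0.prems"(2)[OF that] by simp
    show "(\<lambda>t. h t - c) holomorphic_on upper_half"
      by (intro holomorphic_intros qexp_holomorphic[OF "0.prems"(3) L(2)])
    fix e :: real assume e: "e > 0"
    have "continuous_on (ball 0 1) (eval_fps G)"
      by (intro holomorphic_on_imp_continuous_on holomorphic_eval_fps_1 G)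
    hence "isCont (eval_fps G) 0" by (simp add: continuous_on_eq_continuous_at)
    then obtain d where d: "d > 0" "\<And>z. norm z < d \<Longrightarrow> norm (eval_fps G z - c) < e"
      using e unfolding continuous_at_eps_delta by (auto simp: dist_norm c_def eval_fps_at_0)
    show "\<exists>Y. \<forall>t. Im t > Y \<longrightarrow> norm (h t - c) < e"
    proof (intro exI allI impI)
      fix t assume t: "Im t > max 0 (- of_nat L * ln d / (2 * pi))"
      have "norm (ee (t / of_nat L)) < d"
      proof -
        have "- of_nat L * ln d / (2 * pi) < Im t" using t by simp
        hence "- 2 * pi * (Im t / of_nat L) < ln d" using L(2) by (simp add: field_simps)
        hence "exp (- 2 * pi * (Im t / of_nat L)) < exp (ln d)" by (subst exp_less_cancel_iff)
        thus ?thesis using d(1) by (simp add: norm_ee)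
      qed
      thus "norm (h t - c) < e" using d(2) ev[of t] t by simp
    qed
  qed
  hence "qexp L 0 h (fps_const c)" by (simp add: qexp_def)
  hence "G = fps_const c" by (rule qexp_unique[OF "0.prems"(3) _ L(2)])
  hence "fps_nth G i = (if i = 0 then c else 0)" for i by (simp only: fps_const_def fps_nth_Abs_fps)
  moreover have "c \<in> M" using "0.prems"(5)[of 0] by (simp add: c_def)
  ultimately show ?case using M_0 by (simp add: fim_def)
next
  case (Suc n)
  obtain J0 where J0: "Ints.fin J0" "fps_nth J0 0 = - 1" "qexp 2 1 jj J0" using qexp_jj by blast
  obtain K where K: "L = 2 * K" "K > 0" using L by (auto elim: evenE)
  define J where "J = fps_spread K J0"
  have J: "fin J" "fps_nth J 0 = - 1" "qexp L 1 jj J"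
    unfolding J_def K(1) using J0 K(2) by (auto intro: fin_spread fin_Ints qexp_spread)
  have Jn: "qexp L (Suc n) (\<lambda>t. jj t ^ Suc n) (J ^ Suc n)"
    using qexp_power[OF J(3) L(2), of "Suc n"] by (simp only: mult_1)
  \<comment> \<open>\<open>c * jj ^ Suc n\<close> cancels the leading coefficient of
    \<open>G\<close>, as that of \<open>jj\<close> is -1. Since \<open>c\<close> lies in
    \<open>M\<close>, subtracting it preserves all congruences.\<close>
  define c where "c = - fps_nth G 0 * (- 1) ^ Suc n"
  have cM: "c \<in> M" unfolding c_def
  proof -
    have "fps_nth G 0 * (- 1) ^ n \<in> M"
      using M_mult[OF power_mem[OF uminus_mem[OF one_mem]] Suc.prems(5)[of 0], of n] by (simp add: mult.commute)
    thus "- fps_nth G 0 * (- 1) ^ Suc n \<in> M" by simp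
  qed
  define h' where "h' t = h t + c * jj t ^ Suc n" for t
  define G' where "G' = G + fps_const c * J ^ Suc n"
  have q': "qexp L (Suc n) h' G'"
    unfolding h'_def[abs_def] G'_def by (intro qexp_add Suc.prems(3) qexp_cmult Jn L(2))
  have cJM: "fim (fps_const c * J ^ Suc n)"
    by (subst mult.commute, rule fim_mult) (use cM M_0 J in \<open>auto simp: fim_def intro: fin_power simp del: power_Suc\<close>)
  have finG': "fin G'" unfolding G'_def
    using Suc.prems(4) cM M_sub J by (intro fin_add fin_mult fin_const fin_power) auto
  have T': "h' (t + 1) = h' t" if "Im t > 0" for t using Suc.prems(1)[OF that] by (simp add: h'_def jj_T)
  have S': "h' (- 1 / t) = h' t" if "Im t > 0" for t using Suc.prems(2)[OF that] jj_S[OF that] by (simp add: h'_def)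
  have G'0: "fps_nth G' 0 = 0"
  proof -
    have "fps_nth (J ^ Suc n) 0 = (- 1) ^ Suc n" by (simp only: fps_power_zeroth J(2))
    hence "fps_nth G' 0 = fps_nth G 0 - fps_nth G 0 * ((- 1) ^ Suc n * (- 1) ^ Suc n)"
      by (simp add: G'_def c_def del: power_Suc)
    also have "(- 1 :: complex) ^ Suc n * (- 1) ^ Suc n = 1" by (simp flip: power_mult_distrib del: power_Suc)
    finally show ?thesis by simp
  qed
  \<comment> \<open>The translation multiplies q^(1/L) by the root of unity \<open>w\<close>, so
    invariance leaves only exponents divisible by L. Together with the cancelled constant
    coefficient, a full factor q splits off and the pole order drops by one.\<close>
  have vanish: "fps_nth G' i = 0" if "\<not> L dvd i" for i
  proof -
    define w where "w = ee (1 / of_nat L)"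
    have nw: "norm w = 1" by (simp add: w_def norm_ee)
    define H where "H = Abs_fps (\<lambda>i. w ^ i * fps_nth G' i)"
    have cG': "fps_conv_radius G' \<ge> 1" using q' by (simp add: qexp_def)
    have H: "(\<lambda>i. fps_nth H i * z ^ i) sums eval_fps G' (w * z)" if "norm z < 1" for z
    proof -
      have "norm (w * z) < 1" using that nw by (simp add: norm_mult)
      from summable_fps_1(2)[OF cG' this] show ?thesis by (simp add: H_def power_mult_distrib mult_ac)
    qed
    have cH: "fps_conv_radius H \<ge> 1" using H by (intro fps_conv_radius_ge_1I) (auto simp: sums_iff)
    have "H = G'"
    proof (rule fps_eqI_punctured[OF cH cG'])
      fix z :: complex assume z: "0 < norm z" "norm z < 1"
      obtain t where t: "Im t > 0" "ee (t / of_nat L) = z" using ee_surj[OF z L(2)] by blast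
      have e: "ee ((t + 1) / of_nat L) = w * z" using t(2) by (simp add: w_def add_divide_distrib ee_add)
      have "eval_fps G' (w * z) = h' (t + 1) * ee (of_nat (Suc n) * (t + 1))"
        using q' t(1) unfolding e[symmetric] qexp_def by simp
      also have "ee (of_nat (Suc n) * (t + 1)) = ee (of_nat (Suc n) * t)"
        using ee_of_nat[of "Suc n"] by (simp only: distrib_left ee_add mult_1_right)
      also have "h' (t + 1) * ee (of_nat (Suc n) * t) = eval_fps G' z"
        using q' t T'[OF t(1)] unfolding qexp_def by simp
      finally show "eval_fps H z = eval_fps G' z" using H[OF z(2)] by (simp add: eval_fps_def sums_iff)
    qed
    hence "w ^ i * fps_nth G' i = fps_nth G' i" by (metis H_def fps_nth_Abs_fps)
    moreover have "w ^ i \<noteq> 1"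
    proof
      assume "w ^ i = 1"
      hence "of_nat i / of_nat L \<in> (\<int> :: complex set)" by (simp add: w_def ee_power ee_eq_1_iff)
      then obtain m :: int where "of_nat i / of_nat L = (of_int m :: complex)" by (rule Ints_cases)
      hence "complex_of_int (int i) = of_int (m * int L)" using L(2) by (simp add: field_simps)
      hence "int i = m * int L" by (simp only: of_int_eq_iff)
      hence "int L dvd int i" by simp
      thus False using that by simp
    qed
    ultimately show ?thesis by simp
  qed
  have low: "fps_nth G' i = 0" if "i < L" for i
    using vanish[of i] G'0 that nat_dvd_not_less[of i L] by (cases "i = 0") auto
  define G2 where "G2 = fps_shift L G'"
  have q2: "qexp L n h' G2" unfolding qexp_def
  proof (intro conjI allI impI)
    show "fps_conv_radius G2 \<ge> 1" using q' by (simp add: G2_def qexp_def)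
    fix t :: complex assume t: "Im t > 0"
    have "ee (t / of_nat L) ^ L * eval_fps G2 (ee (t / of_nat L)) = eval_fps G' (ee (t / of_nat L))"
    proof -
      have "fps_X ^ L * G2 = G'" by (rule fps_ext) (auto simp: G2_def fps_X_power_mult_nth low)
      hence "eval_fps G' (ee (t / of_nat L)) = eval_fps (fps_X ^ L * G2) (ee (t / of_nat L))" by simp
      also have "\<dots> = eval_fps (fps_X ^ L) (ee (t / of_nat L)) * eval_fps G2 (ee (t / of_nat L))"
        using \<open>fps_conv_radius G2 \<ge> 1\<close> by (intro eval_mult_1 norm_ee_L t L) (auto simp: conv_radius_closed_1)
      finally show ?thesis by simp
    qed
    also have "\<dots> = h' t * ee (of_nat (Suc n) * t)" using q' t by (simp add: qexp_def)
    also have "ee (of_nat (Suc n) * t) = ee t * ee (of_nat n * t)" by (simp add: ee_add[symmetric] algebra_simps)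
    also have "h' t * (ee t * ee (of_nat n * t)) = ee t * (h' t * ee (of_nat n * t))" by (simp only: mult_ac)
    also have "ee (t / of_nat L) ^ L = ee t" using L(2) by (simp add: ee_power)
    finally show "h' t * ee (of_nat n * t) = eval_fps G2 (ee (t / of_nat L))" by simp
  qed
  have "fim G2"
  proof (rule Suc.IH[OF T' S' q2])
    show "fin G2" using finG' by (simp add: fin_def G2_def)
    fix i assume "i \<le> n * L"
    hence "fps_nth G (i + L) \<in> M" by (intro Suc.prems(5)) simp
    thus "fps_nth G2 i \<in> M" using cJM by (auto simp: G2_def G'_def fim_def simp del: power_Suc intro: M_add)
  qed
  have "fps_nth G' i \<in> M" for i
  proof (cases "i < L")
    case True thus ?thesis using low M_0 by simp
  next
    case False
    hence "fps_nth G' i = fps_nth G2 (i - L)" by (simp add: G2_def)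
    thus ?thesis using \<open>fim G2\<close> by (simp add: fim_def)
  qed
  moreover have "fps_nth G i = fps_nth G' i + - fps_nth (fps_const c * J ^ Suc n) i" for i by (simp add: G'_def)
  ultimately show ?case using cJM M_uminus M_add unfolding fim_def by metis
qed

end

section \<open>Prime ideals of cyclotomic rings\<close>

locale cprime = cideal +
  fixes p :: nat
  assumes M_one: "1 \<notin> M"
    and M_prime: "x \<in> A \<Longrightarrow> y \<in> A \<Longrightarrow> x * y \<in> M \<Longrightarrow> x \<in> M \<or> y \<in> M"
    and p_prime: "prime p"
    and p_M: "of_nat p \<in> M"
begin

text \<open>By Bezout, an integer prime to p in \<open>M\<close> would bring 1 into
  \<open>M\<close>.\<close>

lemma of_int_M_iff: "of_int n \<in> M \<longleftrightarrow> int p dvd n"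
proof
  assume n: "of_int n \<in> M"
  show "int p dvd n"
  proof (rule ccontr)
    assume "\<not> int p dvd n"
    hence "coprime (int p) n" using p_prime by (intro prime_imp_coprime) auto
    then obtain u v where "u * int p + v * n = 1" by (metis bezout_int coprime_imp_gcd_eq_1)
    hence "of_int u * of_nat p + of_int v * of_int n = (1 :: complex)"
      by (metis of_int_1 of_int_add of_int_mult of_int_of_nat_eq)
    moreover have "of_int u * of_nat p + of_int v * of_int n \<in> M"
      using Ints_subset by (intro M_add M_mult p_M n) auto
    ultimately show False using M_one by simp
  qed
next
  assume "int p dvd n"
  then obtain k where "n = int p * k" by blast
  hence "of_int n = of_int k * (of_nat p :: complex)" by simp
  moreover have "of_int k \<in> A" using Ints_subset by auto
  ultimately show "of_int n \<in> M" using M_mult[OF _ p_M] by metis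
qed

lemma not_fim_order:
  assumes "fin F" "\<not> fim F"
  obtains d where "fps_nth F d \<notin> M" "\<And>i. i < d \<Longrightarrow> fps_nth F i \<in> M"
proof
  have ex: "\<exists>d. fps_nth F d \<notin> M" using assms by (auto simp: fim_def)
  show "fps_nth F (LEAST d. fps_nth F d \<notin> M) \<notin> M" by (rule LeastI_ex[OF ex])
  show "fps_nth F i \<in> M" if "i < (LEAST d. fps_nth F d \<notin> M)" for i
    using not_less_Least[OF that] by simp
qed

text \<open>Gauss's lemma: the product of the first coefficients outside \<open>M\<close> is, modulo
  \<open>M\<close>, a coefficient of the product series.\<close>

lemma fim_prime:
  assumes "fin F" "fin G" "fim (F * G)"
  shows "fim F \<or> fim G"
proof (rule ccontr)
  assume "\<not> (fim F \<or> fim G)"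
  then obtain d e where d: "fps_nth F d \<notin> M" "\<And>i. i < d \<Longrightarrow> fps_nth F i \<in> M"
    and e: "fps_nth G e \<notin> M" "\<And>i. i < e \<Longrightarrow> fps_nth G i \<in> M"
    using not_fim_order assms(1,2) by metis
  have FA: "fps_nth F i \<in> A" and GA: "fps_nth G i \<in> A" for i using assms by (auto simp: fin_def)
  have "fps_nth (F * G) (d + e) = (\<Sum>i=0..d+e. fps_nth F i * fps_nth G (d + e - i))" by (simp add: fps_mult_nth)
  also have "\<dots> = fps_nth F d * fps_nth G e + (\<Sum>i\<in>{0..d+e} - {d}. fps_nth F i * fps_nth G (d + e - i))"
    by (subst sum.remove[of _ d]) auto
  finally have eq: "fps_nth F d * fps_nth G e = fps_nth (F * G) (d + e) + - (\<Sum>i\<in>{0..d+e} - {d}. fps_nth F i * fps_nth G (d + e - i))"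
    by simp
  have "(\<Sum>i\<in>{0..d+e} - {d}. fps_nth F i * fps_nth G (d + e - i)) \<in> M"
  proof (rule M_sum)
    fix i assume i: "i \<in> {0..d+e} - {d}"
    show "fps_nth F i * fps_nth G (d + e - i) \<in> M"
    proof (cases "i < d")
      case True
      thus ?thesis using M_mult[OF GA d(2)] by (simp add: mult.commute)
    next
      case False
      hence "d + e - i < e" using i by auto
      thus ?thesis using M_mult[OF FA e(2)] by simp
    qed
  qed
  hence "fps_nth F d * fps_nth G e \<in> M" unfolding eq using assms(3) by (intro M_add M_uminus) (auto simp: fim_def)
  thus False using M_prime[OF FA GA] d(1) e(1) by blast
qed

lemma fim_prod:
  assumes "finite I" "\<And>i. i \<in> I \<Longrightarrow> fin (F i)" "fim (\<Prod>i\<in>I. F i)"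
  shows "\<exists>i\<in>I. fim (F i)"
  using assms
proof (induction I rule: finite_induct)
  case empty
  hence "fps_nth (1 :: complex fps) 0 \<in> M" unfolding fim_def by (metis prod.empty)
  thus ?case using M_one by simp
next
  case (insert i I)
  hence "fim (F i * (\<Prod>i\<in>I. F i))" by simp
  hence "fim (F i) \<or> fim (\<Prod>i\<in>I. F i)" using insert by (intro fim_prime fin_prod) auto
  thus ?case using insert by auto
qed

definition low :: "nat \<Rightarrow> complex fps \<Rightarrow> bool" where "low d F \<longleftrightarrow> (\<forall>i<d. fps_nth F i \<in> M)"

lemma low_mult:
  assumes "fin F" "fin G" "low d F" "low e G"
  shows "low (d + e) (F * G)"
  unfolding low_def
proof (intro allI impI)
  fix n assume n: "n < d + e"
  show "fps_nth (F * G) n \<in> M" unfolding fps_mult_nth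
  proof (rule M_sum)
    fix i assume i: "i \<in> {0..n}"
    show "fps_nth F i * fps_nth G (n - i) \<in> M"
    proof (cases "i < d")
      case True
      thus ?thesis using M_mult[of "fps_nth G (n - i)" "fps_nth F i"] assms by (simp add: mult.commute low_def fin_def)
    next
      case False
      hence "n - i < e" using i n by auto
      thus ?thesis using M_mult assms by (simp add: low_def fin_def)
    qed
  qed
qed

lemma low_0: "low 0 F" by (simp add: low_def)

lemma low_power: "fin F \<Longrightarrow> low d F \<Longrightarrow> low (r * d) (F ^ r)"
  by (induction r) (auto simp: low_0 intro!: low_mult fin_power)

lemma low_prod:
  assumes "finite I" "\<And>i. i \<in> I \<Longrightarrow> fin (F i) \<and> low (d i) (F i)"
  shows "low (\<Sum>i\<in>I. d i) (\<Prod>i\<in>I. F i)"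
  using assms by (induction I rule: finite_induct) (auto simp: low_0 intro!: low_mult fin_prod)

end

section \<open>Cyclotomic rings and a prime ideal above p\<close>

lemma rational_functional:
  obtains f :: "complex \<Rightarrow> rat" where "\<And>x y. f (x + y) = f x + f y" "\<And>q x. f (of_rat q * x) = q * f x" "f 1 = 1"
proof -
  interpret V: vector_space_pair "\<lambda>(q::rat) (x::complex). of_rat q * x" "\<lambda>(q::rat) (x::rat). q * x"
    by unfold_locales (simp_all add: of_rat_add of_rat_mult algebra_simps)
  \<comment> \<open>The functional is a coordinate: {1} is extended to a basis of the complex
    numbers over the rationals.\<close>
  have "V.vs1.independent {1}" using V.vs1.dependent_single[of 1] by simp
  from V.linear_independent_extend[OF this, of "\<lambda>_. 1"]
  obtain g where g: "Vector_Spaces.linear (\<lambda>(q::rat) (x::complex). of_rat q * x) (\<lambda>(q::rat) (x::rat). q * x) g" "g 1 = 1"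
    by auto
  show ?thesis using that[of g] V.linear_add[OF g(1)] V.linear_scale[OF g(1)] g(2) by blast
qed

lemma common_denominator:
  fixes q :: "nat \<Rightarrow> rat"
  shows "\<exists>D::nat. D > 0 \<and> (\<forall>i<K. of_nat D * q i \<in> \<int>)"
proof (induction K)
  case 0 show ?case by (intro exI[of _ 1]) auto
next
  case (Suc K)
  then obtain D where D: "D > 0" "\<And>i. i < K \<Longrightarrow> of_nat D * q i \<in> \<int>" by blast
  obtain a b where ab: "q K = of_int a / of_int b" "b > 0"
    by (metis Fract_of_int_quotient quotient_of_denom_pos quotient_of_div surj_pair)
  show ?case
  proof (intro exI[of _ "D * nat b"] conjI allI impI)
    show "D * nat b > 0" using D(1) ab(2) by simp
    fix i assume "i < Suc K"
    show "of_nat (D * nat b) * q i \<in> \<int>"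
    proof (cases "i = K")
      case True
      have "of_nat (D * nat b) * q K = of_nat D * of_int a" using ab by simp
      also have "\<dots> \<in> \<int>" by simp
      finally show ?thesis unfolding True .
    next
      case False
      hence "i < K" using \<open>i < Suc K\<close> by simp
      hence "of_nat (nat b) * (of_nat D * q i) \<in> \<int>" by (intro Ints_mult Ints_of_nat D(2))
      moreover have "of_nat (D * nat b) * q i = of_nat (nat b) * (of_nat D * q i)" by (simp only: of_nat_mult mult_ac)
      ultimately show ?thesis by (simp only:)
    qed
  qed
qed

text \<open>For z^K = 1 this is the ring Z[z]. Writing it as the span of K powers shows that it is a
  finitely generated group, which bounds denominators.\<close>

definition cyclo_ring :: "nat \<Rightarrow> complex \<Rightarrow> complex set" where
  "cyclo_ring K z = {\<Sum>i<K. of_int (c i) * z ^ i |c :: nat \<Rightarrow> int. True}"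

lemma cyclo_ring:
  assumes z: "z ^ K = 1" and K: "K > 0"
  shows "csubring (cyclo_ring K z)" "z \<in> cyclo_ring K z"
proof -
  let ?A = "cyclo_ring K z"
  have memI: "(\<Sum>i<K. of_int (c i) * z ^ i) \<in> ?A" for c by (auto simp: cyclo_ring_def)
  have add: "x + y \<in> ?A" if "x \<in> ?A" "y \<in> ?A" for x y
  proof -
    note xy = that
    obtain c d where "x = (\<Sum>i<K. of_int (c i) * z ^ i)" "y = (\<Sum>i<K. of_int (d i) * z ^ i)"
      using xy unfolding cyclo_ring_def by blast
    hence "x + y = (\<Sum>i<K. of_int (c i + d i) * z ^ i)" by (simp add: sum.distrib distrib_right)
    thus ?thesis using memI by metis
  qed
  have scal: "of_int n * x \<in> ?A" if "x \<in> ?A" for x n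
  proof -
    note xy = that
    obtain c where "x = (\<Sum>i<K. of_int (c i) * z ^ i)" using xy unfolding cyclo_ring_def by blast
    hence "of_int n * x = (\<Sum>i<K. of_int (n * c i) * z ^ i)" by (simp add: sum_distrib_left mult_ac)
    thus ?thesis using memI by metis
  qed
  have zero: "0 \<in> ?A" using memI[of "\<lambda>_. 0"] by simp
  have sum: "(\<And>i. i \<in> I \<Longrightarrow> f i \<in> ?A) \<Longrightarrow> sum f I \<in> ?A" for f :: "'a \<Rightarrow> complex" and I
    by (induction I rule: infinite_finite_induct) (auto intro: zero add)
  have zp: "z ^ n \<in> ?A" for n
  proof -
    have "z ^ n = (z ^ K) ^ (n div K) * z ^ (n mod K)" by (simp add: power_mult[symmetric] power_add[symmetric])
    hence "z ^ n = z ^ (n mod K)" using z by simp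
    also have "\<dots> = (\<Sum>i<K. of_int (if i = n mod K then 1 else 0) * z ^ i)"
      using K by (simp add: if_distrib[of of_int] if_distrib[of "\<lambda>x. x * _"] cong: if_cong)
    finally show ?thesis using memI by metis
  qed
  show "csubring ?A"
  proof
    show "1 \<in> ?A" using zp[of 0] by simp
    fix x y assume xy: "x \<in> ?A" "y \<in> ?A"
    show "x - y \<in> ?A" using add[OF xy(1) scal[OF xy(2), of "-1"]] by simp
    obtain c where "x = (\<Sum>i<K. of_int (c i) * z ^ i)" using xy unfolding cyclo_ring_def by blast
    moreover obtain d where "y = (\<Sum>i<K. of_int (d i) * z ^ i)" using xy unfolding cyclo_ring_def by blast
    ultimately have "x * y = (\<Sum>i<K. \<Sum>j<K. of_int (c i * d j) * z ^ (i + j))"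
      by (simp add: sum_product power_add mult_ac)
    also have "\<dots> \<in> ?A" by (intro sum scal zp)
    finally show "x * y \<in> ?A" .
  qed
  show "z \<in> ?A" using zp[of 1] by simp
qed

text \<open>A rational functional has a common denominator D on the finitely generated group. If 1/p
  belonged to the ring, so would p^(-D), and D / p^D would be an integer, although 0 < D <
  p^D.\<close>

lemma inverse_prime_not_cyclo:
  assumes z: "z ^ K = 1" and K: "K > 0" and p: "p > (1::nat)"
  shows "1 / of_nat p \<notin> cyclo_ring K z"
proof
  assume pA: "1 / of_nat p \<in> cyclo_ring K z"
  interpret csubring "cyclo_ring K z" by (rule cyclo_ring[OF z K])
  obtain f :: "complex \<Rightarrow> rat" where f: "\<And>x y. f (x + y) = f x + f y" "\<And>q x. f (of_rat q * x) = q * f x" "f 1 = 1"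
    using rational_functional by blast
  obtain D :: nat where D: "D > 0" "\<And>i. i < K \<Longrightarrow> of_nat D * f (z ^ i) \<in> \<int>"
    using common_denominator[of K "\<lambda>i. f (z ^ i)"] by blast
  have f0: "f 0 = 0" using f(1)[of 0 0] by simp
  have fsum: "f (sum g I) = (\<Sum>i\<in>I. f (g i))" for g :: "nat \<Rightarrow> complex" and I
    by (induction I rule: infinite_finite_induct) (auto simp: f f0)
  have fint: "f (of_int n * x) = of_int n * f x" for n x using f(2)[of "of_int n" x] by simp
  have DA: "of_nat D * f x \<in> \<int>" if "x \<in> cyclo_ring K z" for x
  proof -
    note xy = that
    obtain c where "x = (\<Sum>i<K. of_int (c i) * z ^ i)" using xy unfolding cyclo_ring_def by blast
    hence "of_nat D * f x = (\<Sum>i<K. of_int (c i) * (of_nat D * f (z ^ i)))"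
      by (simp add: fsum fint sum_distrib_left mult_ac)
    also have "\<dots> \<in> \<int>" by (intro Ints_sum Ints_mult Ints_of_int D(2)) simp
    finally show ?thesis .
  qed
  have "D < 2 ^ D" by simp
  also have "(2::nat) ^ D \<le> p ^ D" using p by (intro power_mono) auto
  finally have lt: "D < p ^ D" .
  have "(1 / of_nat p) ^ D \<in> cyclo_ring K z" by (rule power_mem[OF pA])
  hence "of_nat D * f ((1 / of_nat p) ^ D) \<in> \<int>" by (rule DA)
  moreover have "(1 / of_nat p :: complex) ^ D = of_rat (1 / of_nat (p ^ D)) * 1" by (simp add: of_rat_divide of_rat_power power_divide)
  ultimately have "of_nat D / of_nat (p ^ D) \<in> (\<int> :: rat set)" by (simp only: f(2,3)) simp
  then obtain m :: int where m: "of_nat D / of_nat (p ^ D) = (of_int m :: rat)" by (rule Ints_cases)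
  have "p ^ D > 0" using p by simp
  hence "(of_nat D :: rat) = of_int m * of_nat (p ^ D)" using m by (simp add: field_simps)
  hence "of_int (int D) = (of_int (m * int (p ^ D)) :: rat)" by simp
  hence eq: "int D = m * int (p ^ D)" by (simp only: of_int_eq_iff)
  hence "m > 0" using D(1) \<open>p ^ D > 0\<close> by (metis of_nat_0_less_iff zero_less_mult_pos2)
  hence "1 * int (p ^ D) \<le> m * int (p ^ D)" by (intro mult_right_mono) auto
  thus False using eq lt by linarith
qed

text \<open>By Zorn's lemma: an ideal maximal among those that contain p but not 1 is prime. The
  ideal pA is such an ideal because 1/p is not in A.\<close>

lemma prime_ideal_exists:
  assumes A: "csubring A" and p: "prime p" and pA: "1 / of_nat p \<notin> A"
  obtains M where "cprime A M p"
proof -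
  interpret csubring A by fact
  define ideals where "ideals = {I. cideal A I \<and> of_nat p \<in> I \<and> 1 \<notin> I}"
  have p0: "(of_nat p :: complex) \<noteq> 0" using p by (auto dest: prime_gt_0_nat)
  have "(\<lambda>x. of_nat p * x) ` A \<in> ideals"
  proof -
    have "cideal A ((\<lambda>x. of_nat p * x) ` A)"
    proof
      show "(\<lambda>x. of_nat p * x) ` A \<subseteq> A" using mult_mem of_nat_mem by auto
      show "0 \<in> (\<lambda>x. of_nat p * x) ` A" using zero_mem by force
      show "x + y \<in> (\<lambda>x. of_nat p * x) ` A" if "x \<in> (\<lambda>x. of_nat p * x) ` A" "y \<in> (\<lambda>x. of_nat p * x) ` A" for x y
        using that by (auto simp: distrib_left[symmetric] intro: add_mem)
      show "x * y \<in> (\<lambda>x. of_nat p * x) ` A" if "x \<in> A" "y \<in> (\<lambda>x. of_nat p * x) ` A" for x y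
        using that by (auto simp: mult.left_commute[of x] intro: mult_mem)
    qed
    moreover have "of_nat p \<in> (\<lambda>x. of_nat p * x) ` A" using one_mem by force
    moreover have "1 \<notin> (\<lambda>x. of_nat p * x) ` A"
    proof
      assume "1 \<in> (\<lambda>x. of_nat p * x) ` A"
      then obtain x where x: "x \<in> A" "1 = of_nat p * x" by auto
      hence "x = 1 / of_nat p" using p0 by (simp add: field_simps)
      with x(1) pA show False by simp
    qed
    ultimately show ?thesis by (simp add: ideals_def)
  qed
  hence ne: "ideals \<noteq> {}" by blast
  have chain: "\<Union>C \<in> ideals" if C: "C \<noteq> {}" "subset.chain ideals C" for C
  proof -
    have sub: "C \<subseteq> ideals" and lin: "\<And>X Y. X \<in> C \<Longrightarrow> Y \<in> C \<Longrightarrow> X \<subseteq> Y \<or> Y \<subseteq> X"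
      using C(2) by (auto simp: subset_chain_def)
    have id: "cideal A X" "of_nat p \<in> X" "1 \<notin> X" if "X \<in> C" for X using sub that by (auto simp: ideals_def)
    obtain X0 where X0: "X0 \<in> C" using C(1) by blast
    have "cideal A (\<Union>C)"
    proof
      show "\<Union>C \<subseteq> A" using id(1) cideal.M_sub by blast
      show "0 \<in> \<Union>C" using id(1)[OF X0] cideal.M_0 X0 by blast
      show "x + y \<in> \<Union>C" if xy: "x \<in> \<Union>C" "y \<in> \<Union>C" for x y
      proof -
        obtain X Y where XY: "X \<in> C" "Y \<in> C" "x \<in> X" "y \<in> Y" using xy by blast
        then obtain Z where "Z \<in> C" "x \<in> Z" "y \<in> Z" using lin by blast
        thus ?thesis using cideal.M_add[OF id(1)] by blast
      qed
      show "x * y \<in> \<Union>C" if "x \<in> A" "y \<in> \<Union>C" for x y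
        using that cideal.M_mult[OF id(1)] by blast
    qed
    thus ?thesis using id X0 by (auto simp: ideals_def)
  qed
  obtain M where M: "M \<in> ideals" "\<And>X. X \<in> ideals \<Longrightarrow> M \<subseteq> X \<Longrightarrow> X = M"
    using subset_Zorn_nonempty[OF ne chain] by blast
  interpret M: cideal A M using M(1) by (simp add: ideals_def)
  have "cprime A M p"
  proof
    show "1 \<notin> M" "of_nat p \<in> M" using M(1) by (auto simp: ideals_def)
    show "prime p" by fact
    fix x y assume xy: "x \<in> A" "y \<in> A" "x * y \<in> M"
    show "x \<in> M \<or> y \<in> M"
    proof (rule disjCI)
      assume y: "y \<notin> M"
      define I where "I = {m + a * y |m a. m \<in> M \<and> a \<in> A}"
      have "cideal A I"
      proof
        show "I \<subseteq> A" unfolding I_def using M.M_sub xy(2) by (auto intro!: add_mem mult_mem)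
        show "0 \<in> I" unfolding I_def using M.M_0 zero_mem by force
        show "u + v \<in> I" if uv: "u \<in> I" "v \<in> I" for u v
        proof -
          obtain m a m' a' where "u = m + a * y" "v = m' + a' * y" "m \<in> M" "m' \<in> M" "a \<in> A" "a' \<in> A"
            using uv unfolding I_def by blast
          hence "u + v = (m + m') + (a + a') * y" "m + m' \<in> M" "a + a' \<in> A"
            by (auto simp: algebra_simps intro: M.M_add add_mem)
          thus ?thesis unfolding I_def by blast
        qed
        show "u * v \<in> I" if uv: "u \<in> A" "v \<in> I" for u v
        proof -
          obtain m a where "v = m + a * y" "m \<in> M" "a \<in> A" using uv unfolding I_def by blast
          hence "u * v = u * m + (u * a) * y" "u * m \<in> M" "u * a \<in> A"
            using M.M_mult[OF uv(1), of m] mult_mem[OF uv(1), of a] by (auto simp: distrib_left)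
          thus ?thesis unfolding I_def by blast
        qed
      qed
      moreover have "M \<subseteq> I"
      proof
        fix m assume "m \<in> M"
        moreover have "m = m + 0 * y" by simp
        ultimately show "m \<in> I" unfolding I_def using zero_mem by blast
      qed
      moreover have "y \<in> I"
      proof -
        have "y = 0 + 1 * y" by simp
        thus ?thesis unfolding I_def using M.M_0 one_mem by blast
      qed
      ultimately have "I \<notin> ideals" using M(2) y by blast
      hence "1 \<in> I" using \<open>cideal A I\<close> \<open>M \<subseteq> I\<close> M(1) by (auto simp: ideals_def)
      then obtain m a where ma: "1 = m + a * y" "m \<in> M" "a \<in> A" unfolding I_def by blast
      have "x = x * (m + a * y)" using ma(1) by simp
      also have "\<dots> = x * m + a * (x * y)" by (simp add: algebra_simps)
      finally show "x \<in> M" using M.M_add[OF M.M_mult[OF xy(1) ma(2)] M.M_mult[OF ma(3) xy(3)]] by simp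
    qed
  qed
  thus ?thesis using that by blast
qed

section \<open>Conjugates and elementary symmetric functions\<close>

context cprime
begin

lemma fim_add: "fim F \<Longrightarrow> fim G \<Longrightarrow> fim (F + G)" by (auto simp: fim_def intro: M_add)
lemma fim_uminus: "fim F \<Longrightarrow> fim (- F)" by (auto simp: fim_def intro: M_uminus)
lemma fim_sum: "(\<And>i. i \<in> I \<Longrightarrow> fim (F i)) \<Longrightarrow> fim (sum F I)"
  by (induction I rule: infinite_finite_induct) (auto simp: fim_def M_0 intro: M_add)

text \<open>Among the conjugates \<open>u x\<close>, those whose expansion vanishes modulo \<open>M\<close> are discarded by
  passing to the elementary symmetric function whose degree is the number of the others.\<close>

lemma norm_argument:
  fixes u :: "'i \<Rightarrow> complex \<Rightarrow> complex"
  assumes L: "even L" "L > 0" and I: "finite I"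
    and q: "\<And>x. x \<in> I \<Longrightarrow> qexp L n (u x) (G x)" and fin: "\<And>x. x \<in> I \<Longrightarrow> fin (G x)"
    and low: "\<And>x. x \<in> I \<Longrightarrow> low (d x) (G x)"
    and I': "\<And>x. x \<in> I' \<Longrightarrow> \<not> fim (G x)" "I' \<subseteq> I"
    and T: "bij_betw \<sigma> I I" "\<And>x t. x \<in> I \<Longrightarrow> Im t > 0 \<Longrightarrow> u x (t + 1) = u (\<sigma> x) t"
    and S: "bij_betw \<tau> I I" "\<And>x t. x \<in> I \<Longrightarrow> Im t > 0 \<Longrightarrow> u x (- 1 / t) = u (\<tau> x) t"
    and bound: "\<And>S. I' \<subseteq> S \<Longrightarrow> S \<subseteq> I \<Longrightarrow> card S * n * L < (\<Sum>x\<in>S. d x)"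
  shows False
proof -
  \<comment> \<open>Only I' and I are known to enclose \<open>S0\<close>, which is why
    \<open>bound\<close> is assumed for every set between them.\<close>
  define S0 where "S0 = {x \<in> I. \<not> fim (G x)}"
  define \<S> where "\<S> = {S. S \<subseteq> I \<and> card S = card S0}"
  define h where "h t = (\<Sum>S\<in>\<S>. \<Prod>x\<in>S. u x t)" for t
  define E where "E = (\<Sum>S\<in>\<S>. \<Prod>x\<in>S. G x)"
  have S0: "S0 \<subseteq> I" "I' \<subseteq> S0" "S0 \<in> \<S>" using I' by (auto simp: S0_def \<S>_def)
  have fS: "finite \<S>" unfolding \<S>_def using I by auto
  have sub: "finite S" "S \<subseteq> I" "card S = card S0" if "S \<in> \<S>" for S
    using that I finite_subset by (auto simp: \<S>_def)
  have inv: "(\<Sum>S\<in>\<S>. \<Prod>x\<in>S. u (\<rho> x) t) = h t" if \<rho>: "bij_betw \<rho> I I" for \<rho> t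
  proof -
    have inj: "inj_on \<rho> I" using \<rho> by (simp add: bij_betw_def)
    have bij: "bij_betw (\<lambda>S. \<rho> ` S) \<S> \<S>"
    proof (rule bij_betw_imageI)
      show "inj_on (\<lambda>S. \<rho> ` S) \<S>" using inj_on_image_Pow[OF inj] by (rule inj_on_subset) (auto simp: \<S>_def)
      have "(\<lambda>S. \<rho> ` S) ` \<S> \<subseteq> \<S>"
        using \<rho> inj by (auto simp: \<S>_def bij_betw_def card_image inj_on_subset)
      moreover have "card ((\<lambda>S. \<rho> ` S) ` \<S>) = card \<S>"
        by (rule card_image) fact
      ultimately show "(\<lambda>S. \<rho> ` S) ` \<S> = \<S>" using fS card_subset_eq by blast
    qed
    have "(\<Sum>S\<in>\<S>. \<Prod>x\<in>S. u (\<rho> x) t) = (\<Sum>S\<in>\<S>. \<Prod>x\<in>\<rho> ` S. u x t)"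
    proof (rule sum.cong[OF refl])
      fix S assume "S \<in> \<S>"
      hence "inj_on \<rho> S" using inj sub(2) inj_on_subset by blast
      thus "(\<Prod>x\<in>S. u (\<rho> x) t) = (\<Prod>x\<in>\<rho> ` S. u x t)" by (simp add: prod.reindex o_def)
    qed
    also have "\<dots> = h t" unfolding h_def by (rule sum.reindex_bij_betw[OF bij])
    finally show ?thesis .
  qed
  have hT: "h (t + 1) = h t" if "Im t > 0" for t
  proof -
    have "h (t + 1) = (\<Sum>S\<in>\<S>. \<Prod>x\<in>S. u (\<sigma> x) t)"
      unfolding h_def using T(2)[OF _ that] sub by (intro sum.cong prod.cong refl) blast
    thus ?thesis using inv[OF T(1)] by simp
  qed
  have hS: "h (- 1 / t) = h t" if "Im t > 0" for t
  proof -
    have "h (- 1 / t) = (\<Sum>S\<in>\<S>. \<Prod>x\<in>S. u (\<tau> x) t)"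
      unfolding h_def using S(2)[OF _ that] sub by (intro sum.cong prod.cong refl) blast
    thus ?thesis using inv[OF S(1)] by simp
  qed
  have qE: "qexp L (card S0 * n) h E"
    unfolding h_def[abs_def] E_def
  proof (rule qexp_sum[OF fS _ L(2)])
    fix S assume S: "S \<in> \<S>"
    have "qexp L (card S * n) (\<lambda>t. \<Prod>x\<in>S. u x t) (\<Prod>x\<in>S. G x)"
      using sub[OF S] q by (intro qexp_prod L) auto
    thus "qexp L (card S0 * n) (\<lambda>t. \<Prod>x\<in>S. u x t) (\<Prod>x\<in>S. G x)" using sub[OF S] by simp
  qed
  have finE: "fin E" unfolding E_def using sub fin by (intro fin_sum fin_prod) blast
  define R where "R = (\<Sum>S\<in>\<S> - {S0}. \<Prod>x\<in>S. G x)"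
  have ER: "E = (\<Prod>x\<in>S0. G x) + R" unfolding E_def R_def using fS S0(3) by (simp add: sum.remove)
  have R: "fim R" unfolding R_def
  proof (rule fim_sum)
    fix S assume S: "S \<in> \<S> - {S0}"
    \<comment> \<open>Any other set of the same size contains a discarded index, so modulo
      \<open>M\<close> only the product over \<open>S0\<close> survives.\<close>
    have "\<not> S \<subseteq> S0" using S sub[of S] sub[OF S0(3)] card_subset_eq by blast
    then obtain x where x: "x \<in> S" "x \<notin> S0" by blast
    hence "fim (G x)" using S sub[of S] by (auto simp: S0_def)
    moreover have "fin (\<Prod>x\<in>S - {x}. G x)" using S sub[of S] fin by (intro fin_prod) auto
    ultimately have "fim ((\<Prod>x\<in>S - {x}. G x) * G x)" by (intro fim_mult)
    moreover have "(\<Prod>x\<in>S. G x) = (\<Prod>x\<in>S - {x}. G x) * G x"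
      using S sub[of S] x by (simp add: prod.remove mult.commute)
    ultimately show "fim (\<Prod>x\<in>S. G x)" by simp
  qed
  have finS0: "finite S0" "\<And>x. x \<in> S0 \<Longrightarrow> fin (G x)" "\<And>x. x \<in> S0 \<Longrightarrow> fin (G x) \<and> low (d x) (G x)"
    using sub(1)[OF S0(3)] fin low by (auto simp: S0_def)
  have lowS0: "low (\<Sum>x\<in>S0. d x) (\<Prod>x\<in>S0. G x)" using low_prod[OF finS0(1), of G d] finS0(3) by blast
  have "fim E"
  proof (rule level_one_congruence[OF L hT hS qE finE])
    fix i assume "i \<le> card S0 * n * L"
    hence "i < (\<Sum>x\<in>S0. d x)" using bound[OF S0(2,1)] by linarith
    thus "fps_nth E i \<in> M" using lowS0 R by (auto simp: ER low_def fim_def intro: M_add)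
  qed
  hence "fim (E + - R)" using R by (intro fim_add fim_uminus)
  moreover have "E + - R = (\<Prod>x\<in>S0. G x)" by (simp add: ER)
  ultimately have "fim (\<Prod>x\<in>S0. G x)" by simp
  hence "\<exists>x\<in>S0. fim (G x)" using fim_prod[OF finS0(1), of G] finS0(2) by blast
  thus False by (auto simp: S0_def)
qed

lemma not_fim_1: "fps_nth F i = 1 \<Longrightarrow> \<not> fim F" using M_one unfolding fim_def by metis

lemma not_fim_power: "fin F \<Longrightarrow> \<not> fim F \<Longrightarrow> \<not> fim (F ^ r)"
proof (induction r)
  case 0
  show ?case by (rule not_fim_1[of _ 0]) simp
next
  case (Suc r)
  thus ?case using fim_prime[of F "F ^ r"] fin_power by auto
qed

lemma not_fim_spread:
  assumes "K > 0" "\<not> fim F"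
  shows "\<not> fim (fps_spread K F)"
proof -
  obtain i where "fps_nth F i \<notin> M" using assms(2) by (auto simp: fim_def)
  moreover have "fps_nth (fps_spread K F) (K * i) = fps_nth F i" using assms(1) by (simp add: fps_spread_def)
  ultimately show ?thesis unfolding fim_def by metis
qed

lemma low_spread:
  assumes "K > 0" "low d F"
  shows "low (K * d) (fps_spread K F)"
  unfolding low_def
proof (intro allI impI)
  fix i assume i: "i < K * d"
  show "fps_nth (fps_spread K F) i \<in> M"
  proof (cases "K dvd i")
    case True
    then obtain j where j: "i = K * j" ..
    hence "j < d" using i by simp
    thus ?thesis using assms by (simp add: j fps_spread_def low_def)
  qed (simp add: fps_spread_def M_0)
qed

text \<open>The weight may have either sign: for k >= 0 the power has a pole and d = 0, for k < 0 it
  has a zero and n = 0. The last conclusion treats both cases alike, as pole order minus zero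
  order.\<close>

lemma Discr_power_expansion:
  fixes k :: int
  assumes L: "L > 0"
  obtains n d W where "qexp L n (\<lambda>t. Discr t powi (- k)) W" "fin W" "\<not> fim W" "low d W" "int n * int L - int d = k * int L"
proof (cases "k \<ge> 0")
  case True
  obtain Psi where P: "Ints.fin Psi" "fps_nth Psi 0 = 1" "qexp 1 1 (\<lambda>t. 1 / Discr t) Psi"
    using qexp_inverse_Discr by blast
  define W where "W = fps_spread L Psi ^ nat k"
  have fs: "fin (fps_spread L Psi)" using P by (intro fin_spread fin_Ints)
  show ?thesis
  proof (rule that)
    have "qexp L (1 * nat k) (\<lambda>t. (1 / Discr t) ^ nat k) W"
      unfolding W_def using qexp_spread[OF P(3) L] by (intro qexp_power L) simp
    moreover have "(1 / Discr t) ^ nat k = Discr t powi (- k)" for t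
      using True by (simp add: power_int_def power_divide inverse_eq_divide)
    ultimately show "qexp L (nat k) (\<lambda>t. Discr t powi (- k)) W" by simp
    show "fin W" unfolding W_def by (intro fin_power fs)
    show "\<not> fim W" unfolding W_def by (intro not_fim_power fs not_fim_1[of _ 0]) (simp add: P)
    show "low 0 W" by (rule low_0)
    show "int (nat k) * int L - int 0 = k * int L" using True by simp
  qed
next
  case False
  define D where "D = fps_X * Phi_fps"
  have D: "fin D" unfolding D_def using Phi_fps by (intro fin_mult fin_X fin_Ints)
  define W where "W = fps_spread L D ^ nat (- k)"
  show ?thesis
  proof (rule that)
    have "qexp L (0 * nat (- k)) (\<lambda>t. Discr t ^ nat (- k)) W"
      unfolding W_def using qexp_spread[OF qexp_Discr L] by (intro qexp_power L) (simp add: D_def)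
    moreover have "Discr t ^ nat (- k) = Discr t powi (- k)" for t using False by (simp add: power_int_def)
    ultimately show "qexp L 0 (\<lambda>t. Discr t powi (- k)) W" by simp
    show "fin W" unfolding W_def by (intro fin_power fin_spread D)
    have "fps_nth D 1 = 1" by (simp add: D_def Phi_fps)
    thus "\<not> fim W" unfolding W_def by (intro not_fim_power fin_spread D not_fim_spread L not_fim_1[of _ 1])
    have "low 1 D" by (simp add: low_def D_def M_0)
    hence "low (L * 1) (fps_spread L D)" by (intro low_spread L)
    thus "low (nat (- k) * (L * 1)) W" unfolding W_def by (intro low_power fin_spread D)
    show "int 0 * int L - int (nat (- k) * (L * 1)) = k * int L" using False by simp
  qed
qed

end

section \<open>From absolutely convergent sums to q-expansions\<close>

lemma finite_of_summable:
  fixes f :: "'a \<Rightarrow> complex"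
  assumes "f summable_on X" "e > 0" "\<And>x. x \<in> Y \<Longrightarrow> norm (f x) \<ge> e" "Y \<subseteq> X"
  shows "finite Y"
proof (rule ccontr)
  assume inf: "infinite Y"
  have "(\<lambda>x. norm (f x)) summable_on Y"
    using assms(1,4) summable_on_subset_banach summable_on_iff_abs_summable_on_complex by blast
  hence "(\<lambda>_. e) summable_on Y"
    by (rule summable_on_comparison_test) (use assms in auto)
  thus False using infsum_diverge_constant[OF inf, of e] assms(2) by simp
qed

lemma qexp_of_has_sum:
  fixes Q :: "'a \<Rightarrow> nat" and w :: "'a \<Rightarrow> complex"
  assumes hs: "\<And>t. Im t > 0 \<Longrightarrow> ((\<lambda>x. w x * ee (of_nat (Q x) * (t / of_nat L))) has_sum f t) X"
    and fin: "\<And>l. finite {x \<in> X. Q x = l}" and L: "L > 0"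
  shows "qexp L 0 f (Abs_fps (\<lambda>l. \<Sum>x | x \<in> X \<and> Q x = l. w x))" (is "qexp L 0 f ?G")
proof -
  have sums: "(\<lambda>l. fps_nth ?G l * ee (t / of_nat L) ^ l) sums f t" if t: "Im t > 0" for t
  proof -
    define S where "S = Sigma UNIV (\<lambda>l. {x \<in> X. Q x = l})"
    have im: "snd ` S = X" by (force simp: S_def)
    have inj: "inj_on snd S" by (auto simp: S_def inj_on_def)
    have "((\<lambda>x. w x * ee (of_nat (Q x) * (t / of_nat L))) has_sum f t) (snd ` S)" using hs[OF t] im by simp
    hence "(((\<lambda>x. w x * ee (of_nat (Q x) * (t / of_nat L))) \<circ> snd) has_sum f t) S"
      by (subst (asm) has_sum_reindex[OF inj])
    hence 1: "((\<lambda>y. w (snd y) * ee (t / of_nat L) ^ fst y) has_sum f t) S"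
      by (rule has_sum_cong[THEN iffD1, rotated]) (auto simp: S_def ee_power)
    have "((\<lambda>l. fps_nth ?G l * ee (t / of_nat L) ^ l) has_sum f t) UNIV"
    proof (rule has_sum_SigmaD)
      show "((\<lambda>y. w (snd y) * ee (t / of_nat L) ^ fst y) has_sum f t) (Sigma UNIV (\<lambda>l. {x \<in> X. Q x = l}))"
        using 1 by (simp add: S_def)
      fix l
      show "((\<lambda>x. w (snd (l, x)) * ee (t / of_nat L) ^ fst (l, x)) has_sum (fps_nth ?G l * ee (t / of_nat L) ^ l)) {x \<in> X. Q x = l}"
        using fin[of l] by (intro has_sum_finiteI) (auto simp: sum_distrib_right)
    qed
    thus ?thesis by (rule has_sum_imp_sums)
  qed
  have "fps_conv_radius ?G \<ge> 1"
  proof (rule fps_conv_radius_ge_1I)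
    fix z :: complex assume "0 < norm z" "norm z < 1"
    then obtain t where "Im t > 0" "ee (t / of_nat L) = z" using ee_surj[OF _ _ L] by metis
    thus "summable (\<lambda>n. fps_nth ?G n * z ^ n)" using sums[of t] by (simp only: sums_iff)
  qed
  moreover have "f t = eval_fps ?G (ee (t / of_nat L))" if "Im t > 0" for t
    using sums[OF that] unfolding eval_fps_def by (simp only: sums_iff)
  ultimately show ?thesis by (simp add: qexp_def)
qed

section \<open>Jacobi forms at torsion points\<close>

definition jphi :: "(int \<times> int \<times> int \<Rightarrow> int) \<Rightarrow> complex \<Rightarrow> complex \<Rightarrow> complex \<Rightarrow> complex" where
  "jphi c t x y = (\<Sum>\<^sub>\<infinity>(m, r, s). of_int (c (m, r, s)) * ee (of_int m * t + of_int r * x + of_int s * y))"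

lemma periodic_mod:
  fixes g :: "int \<Rightarrow> 'a"
  assumes "\<And>j. g (j + N) = g j"
  shows "g (j mod N) = g j"
proof -
  have nat: "g (j + int q * N) = g j" for j q
  proof (induction q)
    case (Suc q)
    have "j + int (Suc q) * N = (j + int q * N) + N" by (simp add: algebra_simps)
    thus ?case using assms[of "j + int q * N"] Suc by (simp only:)
  qed simp
  have eq: "j = j mod N + (j div N) * N" by simp
  show ?thesis
  proof (cases "j div N \<ge> 0")
    case True
    thus ?thesis using nat[of "j mod N" "nat (j div N)"] eq by simp
  next
    case False
    have "j + int (nat (- (j div N))) * N = j mod N" using False eq by (simp add: algebra_simps)
    thus ?thesis using nat[of j "nat (- (j div N))"] by simp
  qed
qed

text \<open>What is kept of a Fourier-Jacobi coefficient of index n. The support bound is the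
  Koecher principle, the shifts express the translations of x and of y by t in terms of
  coefficients, and \<open>phi_S\<close> is the inversion.\<close>

locale jacobi_data =
  fixes c :: "int \<times> int \<times> int \<Rightarrow> int" and n k :: int
  assumes n0: "n \<ge> 0"
    and supp: "c (m, r, s) \<noteq> 0 \<Longrightarrow> m \<ge> 0 \<and> r\<^sup>2 + s\<^sup>2 \<le> 4 * n * m"
    and shift1: "c (m + r + n, r + 2 * n, s) = c (m, r, s)"
    and shift2: "c (m + s + n, r, s + 2 * n) = c (m, r, s)"
    and summ: "Im t > 0 \<Longrightarrow> (\<lambda>(m, r, s). of_int (c (m, r, s)) * ee (of_int m * t + of_int r * x + of_int s * y)) summable_on UNIV"
    and phi_S: "Im t > 0 \<Longrightarrow> jphi c (- 1 / t) (x / t) (y / t) = t powi k * ee (of_int n * (x\<^sup>2 + y\<^sup>2) / t) * jphi c t x y"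
begin

lemma phi_T: "jphi c (t + 1) x y = jphi c t x y"
  unfolding jphi_def
proof (intro infsum_cong, clarify)
  fix m r s :: int
  have "of_int m * (t + 1) + of_int r * x + of_int s * y = (of_int m * t + of_int r * x + of_int s * y) + of_int m"
    by (simp add: algebra_simps)
  thus "of_int (c (m, r, s)) * ee (of_int m * (t + 1) + of_int r * x + of_int s * y)
      = of_int (c (m, r, s)) * ee (of_int m * t + of_int r * x + of_int s * y)"
    by (simp only: ee_add[of _ "of_int m"] ee_of_int mult_1_right)
qed

lemma phi_period: "jphi c t (x + 1) (y + of_int K) = jphi c t x y"
  unfolding jphi_def
proof (intro infsum_cong, clarify)
  fix m r s :: int
  have "of_int m * t + of_int r * (x + 1) + of_int s * (y + of_int K) = (of_int m * t + of_int r * x + of_int s * y) + of_int (r + s * K)"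
    by (simp add: algebra_simps)
  thus "of_int (c (m, r, s)) * ee (of_int m * t + of_int r * (x + 1) + of_int s * (y + of_int K))
      = of_int (c (m, r, s)) * ee (of_int m * t + of_int r * x + of_int s * y)"
    by (simp only: ee_add[of _ "of_int (r + s * K)"] ee_of_int mult_1_right)
qed

text \<open>The value at the torsion point \<open>(it + j)/N\<close> of the restriction to the line \<open>y = Kx\<close>, with the
  factor that makes the modular group act by permutations of the pairs \<open>(i, j)\<close>.\<close>

definition tors :: "int \<Rightarrow> int \<Rightarrow> int \<Rightarrow> int \<Rightarrow> complex \<Rightarrow> complex" where
  "tors K N i j t = (let a = of_int i / of_int N; b = of_int j / of_int N in
     ee (of_int (n * (1 + K\<^sup>2)) * (a\<^sup>2 * t + a * b)) * jphi c t (a * t + b) (of_int K * (a * t + b)))"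

lemma tors_T: "tors K N i j (t + 1) = tors K N i (i + j) t"
proof -
  define a b where "a = (of_int i / of_int N :: complex)" and "b = (of_int j / of_int N :: complex)"
  have ab: "of_int (i + j) / of_int N = a + b" by (simp add: a_def b_def add_divide_distrib)
  have 1: "a * (t + 1) + b = a * t + (a + b)" "a\<^sup>2 * (t + 1) + a * b = a\<^sup>2 * t + a * (a + b)"
    by (simp_all add: algebra_simps power2_eq_square)
  show ?thesis unfolding tors_def Let_def ab a_def[symmetric] b_def[symmetric] 1 phi_T ..
qed

text \<open>The exponential in \<open>tors\<close> is designed to absorb the automorphy factor. With
  x = bt - a the two exponents, divided by \<open>\<mu>\<close>, add up as -a^2/t + ab + x^2/t = b^2
  t - ab.\<close>

lemma tors_S:
  assumes t: "Im t > 0"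
  shows "tors K N i j (- 1 / t) = t powi k * tors K N j (- i) t"
proof -
  define a b where "a = (of_int i / of_int N :: complex)" and "b = (of_int j / of_int N :: complex)"
  define x where "x = b * t - a"
  have t0: "t \<noteq> 0" using t by auto
  have nb: "of_int (- i) / of_int N = - a" by (simp add: a_def)
  have 1: "a * (- 1 / t) + b = x / t" "of_int K * (x / t) = (of_int K * x) / t"
    using t0 by (simp_all add: x_def field_simps)
  have 2: "jphi c (- 1 / t) (x / t) (of_int K * x / t) = t powi k * ee (of_int n * (x\<^sup>2 + (of_int K * x)\<^sup>2) / t) * jphi c t x (of_int K * x)"
    by (rule phi_S[OF t])
  define \<mu> where "\<mu> = (of_int (n * (1 + K\<^sup>2)) :: complex)"
  have 3: "of_int n * (x\<^sup>2 + (of_int K * x)\<^sup>2) / t = \<mu> * (x\<^sup>2 / t)"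
    by (simp add: \<mu>_def algebra_simps power_mult_distrib add_divide_distrib)
  have 4: "\<mu> * (a\<^sup>2 * (- 1 / t) + a * b) + \<mu> * (x\<^sup>2 / t) = \<mu> * (b\<^sup>2 * t + b * (- a))"
  proof -
    have "a\<^sup>2 * (- 1 / t) + a * b + x\<^sup>2 / t = b\<^sup>2 * t + b * (- a)"
      using t0 by (simp add: x_def field_simps power2_eq_square)
    thus ?thesis by (metis distrib_left)
  qed
  have "tors K N i j (- 1 / t) = ee (\<mu> * (a\<^sup>2 * (- 1 / t) + a * b)) * (t powi k * ee (\<mu> * (x\<^sup>2 / t)) * jphi c t x (of_int K * x))"
    unfolding tors_def Let_def a_def[symmetric] b_def[symmetric] \<mu>_def[symmetric] 1 2 3 ..
  also have "\<dots> = t powi k * (ee (\<mu> * (a\<^sup>2 * (- 1 / t) + a * b) + \<mu> * (x\<^sup>2 / t)) * jphi c t x (of_int K * x))"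
    by (simp only: ee_add mult_ac)
  finally have 5: "tors K N i j (- 1 / t) = t powi k * (ee (\<mu> * (b\<^sup>2 * t + b * (- a))) * jphi c t x (of_int K * x))"
    unfolding 4 .
  have x': "b * t + - a = x" by (simp add: x_def)
  have "tors K N j (- i) t = ee (\<mu> * (b\<^sup>2 * t + b * (- a))) * jphi c t x (of_int K * x)"
    unfolding tors_def Let_def nb b_def[symmetric] \<mu>_def[symmetric] x' ..
  with 5 show ?thesis by (simp only:)
qed

lemma tors_period_j:
  assumes N: "N > 0"
  shows "tors K N i (j + N) t = ee (of_int (n * (1 + K\<^sup>2) * i) / of_int N) * tors K N i j t"
proof -
  define a b where "a = (of_int i / of_int N :: complex)" and "b = (of_int j / of_int N :: complex)"
  have b1: "of_int (j + N) / of_int N = b + 1" using N by (simp add: b_def add_divide_distrib)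
  define \<mu> where "\<mu> = (of_int (n * (1 + K\<^sup>2)) :: complex)"
  have 1: "a * t + (b + 1) = (a * t + b) + 1" "of_int K * (a * t + b + 1) = of_int K * (a * t + b) + of_int K"
    by (simp_all add: algebra_simps)
  have 2: "\<mu> * (a\<^sup>2 * t + a * (b + 1)) = \<mu> * a + \<mu> * (a\<^sup>2 * t + a * b)" by (simp add: algebra_simps)
  have 3: "of_int (n * (1 + K\<^sup>2) * i) / of_int N = \<mu> * a" by (simp add: \<mu>_def a_def)
  show ?thesis unfolding tors_def Let_def b1 a_def[symmetric] b_def[symmetric] \<mu>_def[symmetric] 1 phi_period 2 3 ee_add
    by (simp only: mult.assoc)
qed

text \<open>The factor in \<open>tors_period_j\<close> is an N-th root of unity, so an exponent
  divisible by N removes it.\<close>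

lemma tors_pow_period_j:
  assumes N: "N > 0" and "nat N dvd l"
  shows "tors K N i (j + N) t ^ l = tors K N i j t ^ l"
proof -
  obtain q where q: "l = nat N * q" using assms(2) ..
  have "ee (of_int (n * (1 + K\<^sup>2) * i) / of_int N) ^ nat N = ee (of_int (n * (1 + K\<^sup>2) * i))"
    using N by (simp add: ee_power)
  also have "\<dots> = 1" by (rule ee_of_int)
  finally show ?thesis unfolding tors_period_j[OF N] q power_mult power_mult_distrib by simp
qed

text \<open>Conjugation by the inversion turns a shift of i into a shift of j.\<close>

lemma tors_pow_period_i:
  assumes N: "N > 0" and "nat N dvd l" and t: "Im t > 0"
  shows "tors K N (i + N) j t ^ l = tors K N i j t ^ l"
proof -
  have t0: "t \<noteq> 0" using t by auto
  define s where "s = - 1 / t"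
  have s: "Im s > 0" unfolding s_def using t t0 by (simp only: Im_neg_inverse) simp
  have ts: "t = - 1 / s" using t0 by (simp add: s_def)
  have "tors K N j (- i - N) s ^ l = tors K N j (- i) s ^ l"
    using tors_pow_period_j[OF assms(1,2), of K j "- i - N" s] by simp
  moreover have "- (i + N) = - i - N" by simp
  ultimately show ?thesis unfolding ts tors_S[OF s] power_mult_distrib by (simp only:)
qed

text \<open>Multiplied by 4n and with squares completed, the exponent becomes N^2 (4nm - r^2 - s^2)
  plus two squares. For n = 0 the support bound forces r = s = 0.\<close>

lemma exponent_nonneg:
  assumes "c (m, r, s) \<noteq> 0"
  shows "N\<^sup>2 * m + N * i * (r + K * s) + n * (1 + K\<^sup>2) * i\<^sup>2 \<ge> 0" (is "?Q \<ge> 0")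
proof (cases "n = 0")
  case True
  hence "r\<^sup>2 + s\<^sup>2 \<le> 0" "m \<ge> 0" using supp[OF assms] by auto
  hence "r = 0" "s = 0" by (simp_all add: sum_power2_le_zero_iff)
  thus ?thesis using True \<open>m \<ge> 0\<close> by simp
next
  case False
  have "4 * n * ?Q = N\<^sup>2 * (4 * n * m - (r\<^sup>2 + s\<^sup>2)) + (2 * n * i + N * r)\<^sup>2 + (2 * n * K * i + N * s)\<^sup>2"
    by (simp add: algebra_simps power2_eq_square)
  also have "\<dots> \<ge> 0" using supp[OF assms] by (intro add_nonneg_nonneg mult_nonneg_nonneg) auto
  finally have "0 \<le> (4 * n) * ?Q" .
  thus ?thesis using False n0 by (simp add: zero_le_mult_iff)
qed

text \<open>In the expansion of \<open>tors K N i j\<close>, the index \<open>(m, r, s)\<close> contributes \<open>wcoef\<close> times the power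
  \<open>Qexp\<close> of \<open>ee (t / N\<^sup>2)\<close>.\<close>

definition Qexp :: "int \<Rightarrow> int \<Rightarrow> int \<Rightarrow> int \<times> int \<times> int \<Rightarrow> nat" where
  "Qexp K N i = (\<lambda>(m, r, s). nat (N\<^sup>2 * m + N * i * (r + K * s) + n * (1 + K\<^sup>2) * i\<^sup>2))"

definition wcoef :: "int \<Rightarrow> int \<Rightarrow> int \<Rightarrow> int \<Rightarrow> int \<times> int \<times> int \<Rightarrow> complex" where
  "wcoef K N i j = (\<lambda>(m, r, s). of_int (c (m, r, s)) * ee (of_int (N * j * (r + K * s) + n * (1 + K\<^sup>2) * i * j) / of_int (N\<^sup>2)))"

lemma tors_has_sum:
  assumes N: "N > 0" and t: "Im t > 0"
  shows "((\<lambda>x. wcoef K N i j x * ee (of_nat (Qexp K N i x) * (t / of_nat (nat (N\<^sup>2))))) has_sum tors K N i j t) {x. c x \<noteq> 0}"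
proof -
  define a b where "a = (of_int i / of_int N :: complex)" and "b = (of_int j / of_int N :: complex)"
  define x where "x = a * t + b"
  define y where "y = of_int K * x"
  define \<mu> where "\<mu> = (of_int (n * (1 + K\<^sup>2)) :: complex)"
  have "((\<lambda>(m, r, s). of_int (c (m, r, s)) * ee (of_int m * t + of_int r * x + of_int s * y)) has_sum jphi c t x y) UNIV"
    unfolding jphi_def by (rule has_sum_infsum[OF summ[OF t]])
  hence "((\<lambda>z. ee (\<mu> * (a\<^sup>2 * t + a * b)) * (case z of (m, r, s) \<Rightarrow> of_int (c (m, r, s)) * ee (of_int m * t + of_int r * x + of_int s * y)))
      has_sum (ee (\<mu> * (a\<^sup>2 * t + a * b)) * jphi c t x y)) UNIV" by (rule has_sum_cmult_right)
  moreover have "ee (\<mu> * (a\<^sup>2 * t + a * b)) * jphi c t x y = tors K N i j t"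
    by (simp add: tors_def Let_def a_def b_def x_def y_def \<mu>_def)
  ultimately have 1: "((\<lambda>z. ee (\<mu> * (a\<^sup>2 * t + a * b)) * (case z of (m, r, s) \<Rightarrow> of_int (c (m, r, s)) * ee (of_int m * t + of_int r * x + of_int s * y)))
      has_sum tors K N i j t) UNIV" by simp
  have N0: "(of_int N :: complex) \<noteq> 0" using N by simp
  show ?thesis
  proof (rule has_sum_cong_neutral[THEN iffD1, OF _ _ _ 1])
    fix z assume "z \<in> UNIV \<inter> {x. c x \<noteq> 0}"
    moreover obtain m r s where z: "z = (m, r, s)" by (cases z)
    ultimately have "N\<^sup>2 * m + N * i * (r + K * s) + n * (1 + K\<^sup>2) * i\<^sup>2 \<ge> 0" by (intro exponent_nonneg) simp
    hence "(of_nat (Qexp K N i z) :: complex) = of_int (N\<^sup>2 * m + N * i * (r + K * s) + n * (1 + K\<^sup>2) * i\<^sup>2)"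
      by (simp add: Qexp_def z)
    moreover have "(of_nat (nat (N\<^sup>2)) :: complex) = of_int N ^ 2" by simp
    moreover have "\<mu> * (a\<^sup>2 * t + a * b) + (of_int m * t + of_int r * x + of_int s * y)
      = of_int (N * j * (r + K * s) + n * (1 + K\<^sup>2) * i * j) / of_int (N\<^sup>2)
       + of_int (N\<^sup>2 * m + N * i * (r + K * s) + n * (1 + K\<^sup>2) * i\<^sup>2) * (t / of_int N ^ 2)"
    proof -
      have "i' / N' * (i' / N') = i' * i' / (N' * N')" for i' N' :: complex by simp
      moreover have "of_int i = a * of_int N" "of_int j = b * of_int N" using N0 by (simp_all add: a_def b_def)
      ultimately show ?thesis using N0
        by (simp add: x_def y_def \<mu>_def field_simps power2_eq_square)
    qed
    ultimately show "ee (\<mu> * (a\<^sup>2 * t + a * b)) * (case z of (m, r, s) \<Rightarrow> of_int (c (m, r, s)) * ee (of_int m * t + of_int r * x + of_int s * y))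
        = wcoef K N i j z * ee (of_nat (Qexp K N i z) * (t / of_nat (nat (N\<^sup>2))))"
      unfolding wcoef_def z case_prod_conv by (simp only: mult.left_commute[of "ee (\<mu> * _)"] mult.assoc ee_add[symmetric])
  qed (auto simp: wcoef_def)
qed

text \<open>Nonzero coefficients are integers, so terms of exponent l stay above a fixed size at t =
  i; summability admits only finitely many.\<close>

lemma Qexp_finite:
  assumes N: "N > 0"
  shows "finite {x \<in> {x. c x \<noteq> 0}. Qexp K N i x = l}"
proof (rule finite_of_summable)
  have "Im \<i> > 0" by simp
  from has_sum_imp_summable[OF tors_has_sum[OF N this, of K i 0]]
  show "(\<lambda>x. wcoef K N i 0 x * ee (of_nat (Qexp K N i x) * (\<i> / of_nat (nat (N\<^sup>2))))) summable_on {x. c x \<noteq> 0}" .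
  define e where "e = norm (ee (of_nat l * (\<i> / of_nat (nat (N\<^sup>2)))))"
  show "e > 0" by (simp add: e_def)
  fix x assume "x \<in> {x \<in> {x. c x \<noteq> 0}. Qexp K N i x = l}"
  hence x: "c x \<noteq> 0" "Qexp K N i x = l" by auto
  have "norm (wcoef K N i 0 x) = \<bar>of_int (c x)\<bar>" by (cases x) (simp add: wcoef_def norm_mult)
  also have "\<dots> \<ge> 1" using x(1) by linarith
  finally have "1 * e \<le> norm (wcoef K N i 0 x) * e" by (intro mult_right_mono) (auto simp: e_def)
  thus "e \<le> norm (wcoef K N i 0 x * ee (of_nat (Qexp K N i x) * (\<i> / of_nat (nat (N\<^sup>2)))))"
    by (simp add: x(2) e_def norm_mult)
qed auto

definition tfps :: "int \<Rightarrow> int \<Rightarrow> int \<Rightarrow> int \<Rightarrow> complex fps" where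
  "tfps K N i j = Abs_fps (\<lambda>l. \<Sum>x | x \<in> {x. c x \<noteq> 0} \<and> Qexp K N i x = l. wcoef K N i j x)"

lemma qexp_tors:
  assumes N: "N > 0"
  shows "qexp (nat (N\<^sup>2)) 0 (tors K N i j) (tfps K N i j)"
  unfolding tfps_def by (rule qexp_of_has_sum) (use tors_has_sum[OF N] Qexp_finite[OF N] N in auto)

lemma shift2_iter: "c (m + s * int l + n * (int l)\<^sup>2, r, s + 2 * n * int l) = c (m, r, s)"
proof (induction l)
  case (Suc l)
  have "c (m + s * int (Suc l) + n * (int (Suc l))\<^sup>2, r, s + 2 * n * int (Suc l))
      = c ((m + s * int l + n * (int l)\<^sup>2) + (s + 2 * n * int l) + n, r, (s + 2 * n * int l) + 2 * n)"
    by (simp add: algebra_simps power2_eq_square)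
  thus ?case using Suc shift2 by simp
qed simp

text \<open>The shifts in s first reduce K i to i' modulo N. Then the exponent plus the two
  corrections is a combination of the first entries of four indices that share the coefficient of
  (m, r, s). The weights (N - i)(N - i'), i (N - i'), (N - i) i', i i' are nonnegative with sum N^2,
  and each first entry is at least B.\<close>

lemma Qexp_lower_bound:
  fixes p B :: int
  assumes van: "\<And>m r s. m < B \<Longrightarrow> p dvd c (m, r, s)" and ndvd: "\<not> p dvd c (m, r, s)"
    and N: "N > 0" and i: "0 \<le> i" "i < N" and K: "K \<ge> 0"
  defines "i' \<equiv> (K * i) mod N"
  shows "N\<^sup>2 * B - n * (i * (N - i)) - n * (i' * (N - i')) \<le> int (Qexp K N i (m, r, s))"
proof -
  define l where "l = nat ((K * i) div N)"
  define m2 where "m2 = m + s * int l + n * (int l)\<^sup>2"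
  define s2 where "s2 = s + 2 * n * int l"
  have Ki: "K * i = i' + int l * N" using K i N by (simp add: i'_def l_def pos_imp_zdiv_nonneg_iff)
  have i': "0 \<le> i'" "i' < N" using N by (simp_all add: i'_def)
  have B: "B \<le> m'" if "c (m', r', s') = c (m, r, s)" for m' r' s'
    using van[of m' r' s'] ndvd that by (metis not_le)
  have c2: "c (m2, r, s2) = c (m, r, s)" unfolding m2_def s2_def by (rule shift2_iter)
  have c3: "c (m2 + r + n, r + 2 * n, s2) = c (m, r, s)" using c2 shift1 by simp
  have c4: "c (m2 + s2 + n, r, s2 + 2 * n) = c (m, r, s)" using c2 shift2 by simp
  have c5: "c ((m2 + r + n) + s2 + n, r + 2 * n, s2 + 2 * n) = c (m, r, s)" using c3 by (simp only: shift2)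
  have "c (m, r, s) \<noteq> 0" using ndvd by auto
  hence "int (Qexp K N i (m, r, s)) = N\<^sup>2 * m + N * i * (r + K * s) + n * (1 + K\<^sup>2) * i\<^sup>2"
    unfolding Qexp_def using exponent_nonneg by simp
  also have "\<dots> = N\<^sup>2 * m + N * i * r + N * s * (K * i) + n * i\<^sup>2 + n * (K * i)\<^sup>2"
    by (simp add: algebra_simps power2_eq_square)
  also have "\<dots> = N\<^sup>2 * m2 + N * i * r + N * i' * s2 + n * i\<^sup>2 + n * i'\<^sup>2"
    unfolding Ki by (simp add: m2_def s2_def algebra_simps power2_eq_square)
  also have "\<dots> = ((N - i) * (N - i')) * m2 + (i * (N - i')) * (m2 + r + n) + ((N - i) * i') * (m2 + s2 + n)
      + (i * i') * ((m2 + r + n) + s2 + n) - n * (i * (N - i)) - n * (i' * (N - i'))"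
    by (simp add: algebra_simps power2_eq_square)
  finally have eq: "int (Qexp K N i (m, r, s)) = ((N - i) * (N - i')) * m2 + (i * (N - i')) * (m2 + r + n) + ((N - i) * i') * (m2 + s2 + n)
      + (i * i') * ((m2 + r + n) + s2 + n) - n * (i * (N - i)) - n * (i' * (N - i'))" .
  have "((N - i) * (N - i')) * B + (i * (N - i')) * B + ((N - i) * i') * B + (i * i') * B
     \<le> ((N - i) * (N - i')) * m2 + (i * (N - i')) * (m2 + r + n) + ((N - i) * i') * (m2 + s2 + n)
      + (i * i') * ((m2 + r + n) + s2 + n)"
    using i i' B[OF c2] B[OF c3] B[OF c4] B[OF c5] by (intro add_mono mult_left_mono mult_nonneg_nonneg) auto
  moreover have "((N - i) * (N - i')) * B + (i * (N - i')) * B + ((N - i) * i') * B + (i * i') * B = N\<^sup>2 * B"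
    by (simp add: algebra_simps power2_eq_square)
  ultimately show ?thesis unfolding eq by linarith
qed

end

section \<open>Averages of the losses over the torsion points\<close>

lemma sum_i_times_N_minus_i:
  fixes N :: nat
  shows "6 * (\<Sum>i\<in>{1..<int N}. i * (int N - i)) = (int N - 1) * int N * (int N + 1)"
proof -
  \<comment> \<open>The end q of the range and the modulus M are separated so that induction on q
    works.\<close>
  have "6 * (\<Sum>i\<in>{1..<int q}. i * (M - i)) = 3 * M * int q * (int q - 1) - (int q - 1) * int q * (2 * int q - 1)" for q M
  proof (induction q)
    case (Suc q)
    show ?case
    proof (cases q)
      case (Suc q')
      have "{1..<int (Suc q)} = insert (int q) {1..<int q}" using Suc by auto
      thus ?thesis using Suc.IH by (simp add: algebra_simps)
    qed simp
  qed simp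
  from this[where q = N and M = "int N"] show ?thesis by (simp add: algebra_simps)
qed

text \<open>Multiplication by K permutes the nonzero residues, so the second loss has the same total
  as the first.\<close>

lemma sum_mult_mod_prime:
  fixes g :: "int \<Rightarrow> int"
  assumes N: "prime N" and K: "\<not> int N dvd K"
  shows "(\<Sum>i\<in>{1..<int N}. g ((K * i) mod int N)) = (\<Sum>i\<in>{1..<int N}. g i)"
proof (rule sum.reindex_bij_betw)
  have N0: "int N > 0" using N prime_gt_0_nat by simp
  have pN: "prime (int N)" using N by simp
  have inj: "inj_on (\<lambda>i. (K * i) mod int N) {1..<int N}"
  proof (rule inj_onI)
    fix x y assume x: "x \<in> {1..<int N}" and y: "y \<in> {1..<int N}" and eq: "(K * x) mod int N = (K * y) mod int N"
    have "int N dvd K * (x - y)" using eq by (simp add: mod_eq_dvd_iff right_diff_distrib)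
    hence "int N dvd x - y" using pN K prime_dvd_mult_iff by blast
    moreover have "\<bar>x - y\<bar> < int N" using x y by auto
    ultimately show "x = y" using zdvd_not_zless[of "\<bar>x - y\<bar>" "int N"] by fastforce
  qed
  have sub: "(\<lambda>i. (K * i) mod int N) ` {1..<int N} \<subseteq> {1..<int N}"
  proof clarify
    fix i assume i: "i \<in> {1..<int N}"
    have "\<not> int N dvd i" using i by (auto dest: zdvd_imp_le)
    hence "\<not> int N dvd K * i" using pN K prime_dvd_mult_iff by blast
    hence "(K * i) mod int N \<noteq> 0" by (simp add: dvd_eq_mod_eq_0)
    moreover have "0 \<le> (K * i) mod int N" "(K * i) mod int N < int N" using N0 by auto
    ultimately show "(K * i) mod int N \<in> {1..<int N}" by auto
  qed
  have "(\<lambda>i. (K * i) mod int N) ` {1..<int N} = {1..<int N}"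
    by (rule card_subset_eq) (use sub in \<open>auto simp: card_image[OF inj]\<close>)
  thus "bij_betw (\<lambda>i. (K * i) mod int N) {1..<int N} {1..<int N}" using inj by (simp add: bij_betw_def)
qed

section \<open>The congruence for a single Jacobi form\<close>

context jacobi_data
begin

theorem jacobi_congruence:
  fixes p :: nat and B :: int
  assumes p: "prime p" and van: "\<And>m r s. m < B \<Longrightarrow> int p dvd c (m, r, s)"
    and kB: "k < 8 * B" and nB: "n \<le> B"
  shows "int p dvd c (m1, r1, s1)"
proof (rule ccontr)
  assume nd: "\<not> int p dvd c (m1, r1, s1)"
  hence c0: "c (m1, r1, s1) \<noteq> 0" by auto
  have B0: "B \<ge> 0" using nB n0 by simp
  have m1: "m1 \<ge> 0" "r1\<^sup>2 + s1\<^sup>2 \<le> 4 * n * m1" using supp[OF c0] by auto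
  \<comment> \<open>Indices with first entry m1 satisfy |r| <= 4 n m1, so two values of r differ by
    less than K, and r + K s determines both r and s.\<close>
  define K where "K = 8 * n * m1 + 1"
  have K: "K > 0" using n0 m1 by (simp add: K_def add_nonneg_pos)
  define \<rho>1 where "\<rho>1 = r1 + K * s1"
  define \<mu> where "\<mu> = n * (1 + K\<^sup>2)"
  have \<mu>: "\<mu> \<ge> 0" using n0 by (simp add: \<mu>_def)
  \<comment> \<open>\<open>P\<close> will bound |r + K s| for every index with the same exponent as
    (m1, r1, s1). Then N > P + |rho1| lets a congruence modulo N decide equality; N > K keeps K
    prime to N, and N > 4n serves the final estimate.\<close>
  define P where "P = 4 * \<mu> * (m1 + \<bar>\<rho>1\<bar> + 1)"
  obtain N' :: nat where N': "prime N'" "N' > nat (P + \<bar>\<rho>1\<bar> + K + 4 * n)" using bigger_prime by blast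
  define N where "N = int N'"
  have P0: "P \<ge> 0" using \<mu> m1 by (simp add: P_def)
  have N: "N > 0" "N > P + \<bar>\<rho>1\<bar>" "N > K" "N > 4 * n"
    using N' prime_gt_0_nat P0 K n0 by (auto simp: N_def)
  have pN: "prime N" using N' by (simp add: N_def)
  have nN: "nat N = N'" by (simp add: N_def)

  define L0 where "L0 = nat (N\<^sup>2)"
  have L0: "L0 > 0" "int L0 = N\<^sup>2" using N(1) by (simp_all add: L0_def)
  \<comment> \<open>The twists in \<open>wcoef\<close> are roots of unity of order dividing
    N^2.\<close>
  define z where "z = ee (1 / of_nat L0)"
  have z: "z ^ L0 = 1" using L0(1) by (simp add: z_def ee_power)
  define A where "A = cyclo_ring L0 z"
  have A: "csubring A" "z \<in> A" "1 / of_nat p \<notin> A"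
    unfolding A_def using cyclo_ring[OF z L0(1)] inverse_prime_not_cyclo[OF z L0(1)] prime_gt_1_nat[OF p] by auto
  obtain M where M: "cprime A M p" using prime_ideal_exists[OF A(1) p A(3)] by blast
  interpret cprime A M p by (rule M)
  have ee_mem: "ee (of_int E / of_int (N\<^sup>2)) \<in> A" for E
  proof -
    define q where "q = nat (E mod N\<^sup>2)"
    have "E = int q + N\<^sup>2 * (E div N\<^sup>2)" using N(1) by (simp add: q_def)
    hence "(of_int E :: complex) = of_nat q + of_int (N\<^sup>2) * of_int (E div N\<^sup>2)"
      by (metis of_int_add of_int_mult of_int_of_nat_eq)
    moreover have "(of_int (N\<^sup>2) :: complex) \<noteq> 0" using N(1) by simp
    ultimately have "(of_int E / of_int (N\<^sup>2) :: complex) = of_nat q / of_int (N\<^sup>2) + of_int (E div N\<^sup>2)"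
      by (simp add: add_divide_distrib)
    hence "ee (of_int E / of_int (N\<^sup>2)) = ee (of_nat q / of_int (N\<^sup>2))" by (simp only: ee_add ee_of_int mult_1_right)
    also have "of_nat q / of_int (N\<^sup>2) = of_nat q * (1 / (of_nat L0 :: complex))"
      using L0(2) by (metis of_int_of_nat_eq times_divide_eq_right mult_1_right)
    also have "ee \<dots> = z ^ q" by (simp add: z_def ee_power)
    also have "\<dots> \<in> A" by (rule power_mem[OF A(2)])
    finally show ?thesis .
  qed
  have of_int_mem: "of_int E \<in> A" for E using Ints_subset by auto
  have w_mem: "wcoef K N i j x \<in> A" for i j x
    unfolding wcoef_def case_prod_unfold by (intro mult_mem of_int_mem ee_mem)
  have fin_t: "fin (tfps K N i j)" for i j
    unfolding fin_def tfps_def by (auto intro!: sum_mem w_mem)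
  \<comment> \<open>N^2 times the expected order, since exponents here count powers of
    q^(1/N^2).\<close>
  define bd where "bd i = N\<^sup>2 * B - n * (i * (N - i)) - n * (((K * i) mod N) * (N - (K * i) mod N))" for i
  have low_t: "low (nat (bd i)) (tfps K N i j)" if i: "0 \<le> i" "i < N" for i j
    unfolding low_def
  proof (intro allI impI)
    fix l assume l: "l < nat (bd i)"
    have "wcoef K N i j x \<in> M" if x: "Qexp K N i x = l" for x
    proof -
      obtain m r s where mrs: "x = (m, r, s)" by (cases x)
      have "int p dvd c (m, r, s)"
      proof (rule ccontr)
        assume "\<not> int p dvd c (m, r, s)"
        have "K \<ge> 0" using K by simp
        from Qexp_lower_bound[where B = B and K = K, OF van \<open>\<not> int p dvd c (m, r, s)\<close> N(1) i this]
        have "bd i \<le> int (Qexp K N i (m, r, s))" by (simp add: bd_def)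
        thus False using x l by (simp add: mrs)
      qed
      hence "of_int (c x) \<in> M" by (simp add: of_int_M_iff mrs)
      thus ?thesis using M_mult[OF ee_mem] by (simp only: wcoef_def mrs case_prod_conv mult.commute)
    qed
    thus "fps_nth (tfps K N i j) l \<in> M" unfolding tfps_def by (auto intro!: M_sum)
  qed
  \<comment> \<open>For 0 < i < N no other index has the exponent of (m1, r1, s1), so the
    coefficient there is c (m1, r1, s1) times a root of unity. At i = 0 the exponent sees only m,
    and this can fail.\<close>
  have nf_t: "\<not> fim (tfps K N i j)" if i: "1 \<le> i" "i < N" for i j
  proof
    assume fim: "fim (tfps K N i j)"
    define l where "l = Qexp K N i (m1, r1, s1)"
    have "{x \<in> {x. c x \<noteq> 0}. Qexp K N i x = l} = {(m1, r1, s1)}"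
    proof (intro equalityI subsetI)
      fix x assume "x \<in> {x \<in> {x. c x \<noteq> 0}. Qexp K N i x = l}"
      moreover obtain m r s where x: "x = (m, r, s)" by (cases x)
      ultimately have cx: "c (m, r, s) \<noteq> 0" and "Qexp K N i (m, r, s) = Qexp K N i (m1, r1, s1)" by (auto simp: l_def)
      hence "N\<^sup>2 * m + N * i * (r + K * s) + n * (1 + K\<^sup>2) * i\<^sup>2 = N\<^sup>2 * m1 + N * i * (r1 + K * s1) + n * (1 + K\<^sup>2) * i\<^sup>2"
        unfolding Qexp_def using exponent_nonneg[OF cx, of N i K] exponent_nonneg[OF c0, of N i K]
        by (simp only: case_prod_conv eq_nat_nat_iff)
      define \<rho> where "\<rho> = r + K * s"
      have "N * (N * m + i * \<rho>) = N * (N * m1 + i * \<rho>1)"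
        using \<open>N\<^sup>2 * m + _ + _ = _\<close> by (simp add: \<rho>_def \<rho>1_def algebra_simps power2_eq_square)
      hence e: "N * m + i * \<rho> = N * m1 + i * \<rho>1" using N(1) by simp
      have m: "m \<ge> 0" "r\<^sup>2 + s\<^sup>2 \<le> 4 * n * m" using supp[OF cx] by auto
      \<comment> \<open>Cauchy-Schwarz for (r, s) against (1, K), followed by the support
        bound.\<close>
      have "\<rho>\<^sup>2 \<le> (1 + K\<^sup>2) * (r\<^sup>2 + s\<^sup>2)"
      proof -
        have "(1 + K\<^sup>2) * (r\<^sup>2 + s\<^sup>2) - \<rho>\<^sup>2 = (K * r - s)\<^sup>2" by (simp add: \<rho>_def algebra_simps power2_eq_square)
        thus ?thesis by (smt (verit) zero_le_power2)
      qed
      also have "\<dots> \<le> (1 + K\<^sup>2) * (4 * n * m)" using m by (intro mult_left_mono) auto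
      also have "\<dots> = 4 * \<mu> * m" by (simp add: \<mu>_def)
      finally have q: "\<rho>\<^sup>2 \<le> 4 * \<mu> * m" .
      have "N * m \<le> N * (m1 + \<bar>\<rho>1\<bar> + \<bar>\<rho>\<bar>)"
      proof -
        have iv: "i * v \<le> N * \<bar>v\<bar>" for v
        proof -
          have "i * v \<le> i * \<bar>v\<bar>" using i by (intro mult_left_mono) auto
          also have "\<dots> \<le> N * \<bar>v\<bar>" using i by (intro mult_right_mono) auto
          finally show ?thesis .
        qed
        have "i * \<rho>1 \<le> N * \<bar>\<rho>1\<bar>" by (rule iv)
        moreover have "- (i * \<rho>) \<le> N * \<bar>\<rho>\<bar>" using iv[of "- \<rho>"] by simp
        ultimately show ?thesis using e by (simp add: algebra_simps)
      qed
      hence mle: "m \<le> m1 + \<bar>\<rho>1\<bar> + \<bar>\<rho>\<bar>" using N(1) by simp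
      \<comment> \<open>The square of |rho| is at most a linear function of |rho|, and |rho| >= 1
        lets the constant term be absorbed.\<close>
      have "\<bar>\<rho>\<bar> \<le> P"
      proof (cases "\<rho> = 0")
        case True thus ?thesis using P0 by simp
      next
        case False
        have "\<bar>\<rho>\<bar> * \<bar>\<rho>\<bar> = \<rho>\<^sup>2" by (simp add: power2_eq_square)
        also have "\<dots> \<le> 4 * \<mu> * (m1 + \<bar>\<rho>1\<bar> + \<bar>\<rho>\<bar>)" using q mle \<mu> by (intro order_trans[OF q] mult_left_mono) auto
        also have "\<dots> \<le> 4 * \<mu> * ((m1 + \<bar>\<rho>1\<bar> + 1) * \<bar>\<rho>\<bar>)"
        proof (intro mult_left_mono)
          have "1 * (m1 + \<bar>\<rho>1\<bar>) \<le> \<bar>\<rho>\<bar> * (m1 + \<bar>\<rho>1\<bar>)" using False m1 by (intro mult_right_mono) auto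
          thus "m1 + \<bar>\<rho>1\<bar> + \<bar>\<rho>\<bar> \<le> (m1 + \<bar>\<rho>1\<bar> + 1) * \<bar>\<rho>\<bar>" by (simp add: algebra_simps)
        qed (use \<mu> in auto)
        finally have "\<bar>\<rho>\<bar> * \<bar>\<rho>\<bar> \<le> P * \<bar>\<rho>\<bar>" by (simp only: P_def mult_ac)
        thus ?thesis by (rule mult_right_le_imp_le) (use False in simp)
      qed
      hence small: "\<bar>\<rho> - \<rho>1\<bar> < N" using N(2) by linarith
      have "i * (\<rho> - \<rho>1) = N * (m1 - m)" using e by (simp add: algebra_simps)
      hence "N dvd i * (\<rho> - \<rho>1)" by simp
      moreover have "\<not> N dvd i" using i by (auto dest: zdvd_imp_le)
      ultimately have "N dvd \<rho> - \<rho>1" using pN prime_dvd_mult_iff by blast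
      hence \<rho>: "\<rho> = \<rho>1" using small zdvd_not_zless[of "\<bar>\<rho> - \<rho>1\<bar>" N] by fastforce
      hence mm: "m = m1" using e N(1) by simp
      have sq: "\<bar>v\<bar> \<le> v\<^sup>2" for v :: int
      proof (cases "v = 0")
        case False
        hence "\<bar>v\<bar> * 1 \<le> \<bar>v\<bar> * \<bar>v\<bar>" by (intro mult_left_mono) auto
        thus ?thesis by (simp add: power2_eq_square)
      qed simp
      have "\<bar>r\<bar> \<le> 4 * n * m1" "\<bar>r1\<bar> \<le> 4 * n * m1"
        using m(2) m1(2) sq[of r] sq[of r1] zero_le_power2[of s] zero_le_power2[of s1] unfolding mm by linarith+
      hence "\<bar>r - r1\<bar> < K" by (simp add: K_def)
      moreover have eq2: "r - r1 = K * (s1 - s)" using \<rho> by (simp add: \<rho>_def \<rho>1_def algebra_simps)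
      ultimately have "K * \<bar>s1 - s\<bar> < K * 1" using K by (simp add: abs_mult)
      hence "s1 - s = 0" using K by simp
      thus "x \<in> {(m1, r1, s1)}" using eq2 mm by (simp add: x)
    qed (use c0 in \<open>auto simp: l_def\<close>)
    hence "fps_nth (tfps K N i j) l = wcoef K N i j (m1, r1, s1)" by (simp add: tfps_def)
    hence wM: "wcoef K N i j (m1, r1, s1) \<in> M" using fim unfolding fim_def by metis
    define E where "E = N * j * (r1 + K * s1) + n * (1 + K\<^sup>2) * i * j"
    have "ee (of_int (- E) / of_int (N\<^sup>2)) * wcoef K N i j (m1, r1, s1) \<in> M" by (rule M_mult[OF ee_mem wM])
    moreover have "ee (of_int (- E) / of_int (N\<^sup>2)) * wcoef K N i j (m1, r1, s1)
        = of_int (c (m1, r1, s1)) * ee (of_int (- E) / of_int (N\<^sup>2) + of_int E / of_int (N\<^sup>2))"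
      unfolding wcoef_def case_prod_conv E_def[symmetric] by (simp only: ee_add mult_ac)
    ultimately have "of_int (c (m1, r1, s1)) \<in> M" by simp
    thus False using nd of_int_M_iff by blast
  qed

  \<comment> \<open>The factor 2 makes L even, as the expansion of \<open>jj\<close> in q^(1/2)
    requires.\<close>
  define L where "L = L0 * 2"
  have L: "even L" "L > 0" using L0 by (simp_all add: L_def)
  obtain \<kappa> dW W where W: "qexp L \<kappa> (\<lambda>t. Discr t powi (- (k * N))) W" "fin W" "\<not> fim W" "low dW W"
    "int \<kappa> * int L - int dW = k * N * int L"
    using Discr_power_expansion[OF L(2), of "k * N"] by blast
  \<comment> \<open>The factor N' in the exponent removes the roots of unity, so i and j matter only
    modulo N. The factor 12 matches the weight of Delta: 12 N k - 12 k N = 0.\<close>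
  define u where "u = (\<lambda>(i, j) t. tors K N i j t ^ (12 * N') * Discr t powi (- (k * N)))"
  define G where "G = (\<lambda>(i, j). fps_spread 2 (tfps K N i j) ^ (12 * N') * W)"
  define d where "d = (\<lambda>(i::int, j::int). 12 * N' * (2 * nat (bd i)) + dW)"
  define I where "I = {0..<N} \<times> {0..<N}"
  define I' where "I' = {1..<N} \<times> {0..<N}"
  have per_i: "tors K N (i mod N) j t ^ (12 * N') = tors K N i j t ^ (12 * N')" if "Im t > 0" for i j t
    by (rule periodic_mod[of "\<lambda>i. tors K N i j t ^ (12 * N')"]) (rule tors_pow_period_i[OF N(1) _ that], simp add: nN)
  have per_j: "tors K N i (j mod N) t ^ (12 * N') = tors K N i j t ^ (12 * N')" for i j t
    by (rule periodic_mod[of "\<lambda>j. tors K N i j t ^ (12 * N')"]) (rule tors_pow_period_j[OF N(1)], simp add: nN)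
  show False
  proof (rule norm_argument[where u = u and G = G and d = d and I = I and I' = I' and n = \<kappa> and L = L
      and \<sigma> = "\<lambda>(i, j). (i, (i + j) mod N)" and \<tau> = "\<lambda>(i, j). (j, (- i) mod N)"])
    show "even L" "L > 0" "finite I" "I' \<subseteq> I" using L by (auto simp: I_def I'_def)
    show "qexp L \<kappa> (u x) (G x)" for x
    proof -
      obtain i j where x: "x = (i, j)" by (cases x)
      have "qexp L 0 (tors K N i j) (fps_spread 2 (tfps K N i j))"
        unfolding L_def using qexp_tors[OF N(1), of K i j] L0 by (intro qexp_spread) (simp_all add: L0_def)
      from qexp_mult[OF qexp_power[OF this L(2), of "12 * N'"] W(1) L(2)] show ?thesis by (simp add: u_def G_def x)
    qed
    show "fin (G x)" for x by (cases x) (auto simp: G_def intro!: fin_mult fin_power fin_spread fin_t W)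
    show "low (d x) (G x)" if "x \<in> I" for x
    proof -
      note xI = that
      obtain i j where x: "x = (i, j)" "0 \<le> i" "i < N" using xI by (auto simp: I_def)
      show ?thesis unfolding d_def G_def x case_prod_conv
        using x by (intro low_mult fin_power fin_spread fin_t W low_power low_spread low_t) auto
    qed
    show "\<not> fim (G x)" if "x \<in> I'" for x
    proof -
      note xI = that
      obtain i j where x: "x = (i, j)" "1 \<le> i" "i < N" using xI by (auto simp: I'_def)
      have "\<not> fim (fps_spread 2 (tfps K N i j) ^ (12 * N'))"
        using x by (intro not_fim_power fin_spread fin_t not_fim_spread nf_t) auto
      thus ?thesis unfolding G_def x case_prod_conv
        using fim_prime[OF fin_power[OF fin_spread[OF fin_t]] W(2)] W(3) by blast
    qed
    show "bij_betw (\<lambda>(i, j). (i, (i + j) mod N)) I I"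
      by (rule bij_betw_byWitness[where f' = "\<lambda>(i, j). (i, (j - i) mod N)"])
         (use N(1) in \<open>auto simp: I_def mod_simps\<close>)
    show "bij_betw (\<lambda>(i, j). (j, (- i) mod N)) I I"
      by (rule bij_betw_byWitness[where f' = "\<lambda>(i, j). ((- j) mod N, i)"])
         (use N(1) in \<open>auto simp: I_def mod_simps\<close>)
    show "u x (t + 1) = u (case x of (i, j) \<Rightarrow> (i, (i + j) mod N)) t" if "Im t > 0" for x t
      by (cases x) (simp add: u_def tors_T Discr_plus_1 per_j)
    show "u x (- 1 / t) = u (case x of (i, j) \<Rightarrow> (j, (- i) mod N)) t" if t: "Im t > 0" for x t
    proof -
      obtain i j where x: "x = (i, j)" by (cases x)
      have t0: "t \<noteq> 0" using t by auto
      have "(t powi k * T) ^ (12 * N') * (t ^ 12 * D) powi (- (k * N)) = T ^ (12 * N') * D powi (- (k * N))" for T D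
      proof -
        have "(t powi k) ^ (12 * N') = t powi (k * (12 * N))"
          by (simp add: N_def power_int_mult power_int_power power_mult)
        moreover have "(t ^ 12) powi (- (k * N)) = t powi (12 * (- (k * N)))"
          by (simp only: power_int_mult power_int_numeral)
        moreover have "t powi (k * (12 * N)) * t powi (12 * (- (k * N))) = 1"
          using t0 by (simp flip: power_int_add)
        ultimately show ?thesis by (simp add: power_mult_distrib power_int_mult_distrib mult_ac)
      qed
      thus ?thesis unfolding u_def x case_prod_conv tors_S[OF t] Discr_S[OF t] per_j by blast
    qed
    fix S assume S: "I' \<subseteq> S" "S \<subseteq> I"
    have finI: "finite I" by (simp add: I_def)
    have finS: "finite S" using S(2) finI finite_subset by blast
    \<comment> \<open>The surplus of the order of G (i, j) over the pole order charged to it. It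
      does not depend on j.\<close>
    define \<delta> where "\<delta> i = 24 * N * bd i - 2 * k * N ^ 3" for i
    \<comment> \<open>Needed because \<open>d\<close> uses \<open>nat (bd i)\<close>. It follows
      from 2 v (N - v) <= N^2 and n <= B.\<close>
    have bd0: "bd i \<ge> 0" if i: "0 \<le> i" "i < N" for i
    proof -
      have amgm: "2 * (v * (N - v)) \<le> N\<^sup>2" for v
      proof -
        have "N\<^sup>2 - 2 * (v * (N - v)) = v\<^sup>2 + (N - v)\<^sup>2" by (simp add: algebra_simps power2_eq_square)
        thus ?thesis by (smt (verit) zero_le_power2)
      qed
      have "n * (2 * (i * (N - i))) \<le> n * N\<^sup>2" "n * (2 * (((K * i) mod N) * (N - (K * i) mod N))) \<le> n * N\<^sup>2"
        using n0 amgm by (auto intro!: mult_left_mono)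
      moreover have "N\<^sup>2 * n \<le> N\<^sup>2 * B" using nB by (intro mult_left_mono) auto
      ultimately have "2 * bd i \<ge> 0" unfolding bd_def by (simp add: mult.commute)
      thus ?thesis by simp
    qed
    have \<delta>: "int (d (i, j)) - int \<kappa> * int L = \<delta> i" if "(i, j) \<in> I" for i j
    proof -
      have "int (d (i, j)) - int \<kappa> * int L = 24 * N * bd i - (int \<kappa> * int L - int dW)"
        using bd0[of i] that by (simp add: d_def N_def I_def)
      also have "\<dots> = 24 * N * bd i - k * N * (N\<^sup>2 * 2)" unfolding W(5) by (simp add: L_def L0)
      finally show ?thesis by (simp add: \<delta>_def power2_eq_square power3_eq_cube)
    qed
    \<comment> \<open>Points with i = 0 may or may not belong to S; a nonnegative surplus makes
      either case harmless.\<close>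
    have \<delta>0: "\<delta> 0 \<ge> 0"
    proof -
      have "\<delta> 0 = 2 * N ^ 3 * (12 * B - k)" by (simp add: \<delta>_def bd_def algebra_simps power2_eq_square power3_eq_cube)
      thus ?thesis using N(1) kB B0 by simp
    qed
    have sum_\<delta>: "(\<Sum>i\<in>{1..<N}. \<delta> i) > 0"
    proof -
      define \<Sigma> where "\<Sigma> = (\<Sum>i\<in>{1..<N}. i * (N - i))"
      have s6: "6 * \<Sigma> = (N - 1) * N * (N + 1)" unfolding \<Sigma>_def N_def by (rule sum_i_times_N_minus_i)
      have "\<not> N dvd K" using K N(3) by (auto dest: zdvd_imp_le)
      hence perm: "(\<Sum>i\<in>{1..<N}. ((K * i) mod N) * (N - (K * i) mod N)) = \<Sigma>"
        unfolding \<Sigma>_def N_def by (intro sum_mult_mod_prime[of N' K "\<lambda>v. v * (int N' - v)"] N'(1))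
      have card: "int (card {1..<N}) = N - 1" using N(1) by simp
      have "(\<Sum>i\<in>{1..<N}. bd i) = (N - 1) * (N\<^sup>2 * B) - n * \<Sigma> - n * \<Sigma>"
        unfolding bd_def sum_subtractf sum_distrib_left[symmetric] perm \<Sigma>_def[symmetric] using card by simp
      hence "(\<Sum>i\<in>{1..<N}. \<delta> i) = 24 * N * ((N - 1) * (N\<^sup>2 * B) - n * \<Sigma> - n * \<Sigma>) - (N - 1) * (2 * k * N ^ 3)"
        unfolding \<delta>_def sum_subtractf sum_distrib_left[symmetric] using card by simp
      also have "\<dots> = 24 * N * (N - 1) * (N\<^sup>2 * B) - 8 * N * n * (6 * \<Sigma>) - (N - 1) * (2 * k * N ^ 3)"
        by (simp add: algebra_simps)
      also have "\<dots> = 2 * N\<^sup>2 * (N - 1) * (N * (12 * B - 4 * n - k) - 4 * n)"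
        unfolding s6 by (simp add: algebra_simps power2_eq_square power3_eq_cube)
      also have "\<dots> > 0"
      proof -
        \<comment> \<open>This is where 8 enters: n <= B and k < 8 B give 12 B - 4 n - k >= 1. The
          term 4n is the price of leaving out i = 0, and N > 4n pays for it.\<close>
        have "N * 1 \<le> N * (12 * B - 4 * n - k)" using kB nB N(1) by (intro mult_left_mono) auto
        hence "N * (12 * B - 4 * n - k) - 4 * n > 0" using N(4) by linarith
        moreover have "N > 1" using pN by (simp add: prime_gt_1_int)
        ultimately show ?thesis by (intro mult_pos_pos) auto
      qed
      finally show ?thesis .
    qed
    have "0 < N * (\<Sum>i\<in>{1..<N}. \<delta> i)" using N(1) sum_\<delta> by simp
    also have "\<dots> = (\<Sum>x\<in>I'. \<delta> (fst x))"
    proof -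
      have "(\<Sum>i\<in>{1..<N}. \<Sum>j\<in>{0..<N}. \<delta> i) = (\<Sum>(i, j)\<in>{1..<N} \<times> {0..<N}. \<delta> i)" by (rule sum.cartesian_product)
      thus ?thesis using N(1) by (simp add: I'_def case_prod_unfold sum_distrib_left)
    qed
    also have "\<dots> \<le> (\<Sum>x\<in>S. \<delta> (fst x))"
    proof (rule sum_mono2[OF finS S(1)])
      fix x assume "x \<in> S - I'"
      hence "fst x = 0" using S(2) by (auto simp: I_def I'_def)
      thus "0 \<le> \<delta> (fst x)" using \<delta>0 by simp
    qed
    also have "\<dots> = (\<Sum>x\<in>S. int (d x) - int \<kappa> * int L)"
      using S(2) \<delta> by (intro sum.cong refl) (auto split: prod.splits)
    also have "\<dots> = int (\<Sum>x\<in>S. d x) - int (card S) * (int \<kappa> * int L)" by (simp add: sum_subtractf)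
    finally have "int (card S * \<kappa> * L) < int (\<Sum>x\<in>S. d x)" by (simp add: mult.assoc)
    thus "card S * \<kappa> * L < (\<Sum>x\<in>S. d x)" by linarith
  qed
qed

end

section \<open>Fourier series of periodic holomorphic functions\<close>

text \<open>With a primitive P of F on \<open>D\<close>, the integral is P (w + 1) - P w, whose
  derivative F (w + 1) - F w vanishes. \<open>D'\<close> is kept apart from \<open>D\<close> for
  \<open>fourier_has_sum\<close>, where the integrand is used only near one period.\<close>

lemma period_integral_const:
  fixes F :: "complex \<Rightarrow> complex"
  assumes D: "open D" "convex D" "F holomorphic_on D"
    and D': "open D'" "convex D'" "\<And>w x. w \<in> D' \<Longrightarrow> 0 \<le> x \<Longrightarrow> x \<le> 1 \<Longrightarrow> w + of_real x \<in> D"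
    and per: "\<And>w. w \<in> D' \<Longrightarrow> F (w + 1) = F w"
  shows "\<exists>c. \<forall>w\<in>D'. ((\<lambda>x::real. F (w + of_real x)) has_integral c) {0..1}"
proof -
  obtain P where P0: "\<And>x. x \<in> D \<Longrightarrow> (P has_field_derivative F x) (at x within D)"
  proof (rule holomorphic_convex_primitive'[OF D(2,1,3)])
    fix g assume "\<And>x. x \<in> D \<Longrightarrow> (g has_field_derivative F x) (at x within D)"
    thus thesis by (rule that)
  qed
  have P: "(P has_field_derivative F x) (at x)" if "x \<in> D" for x
    using P0[OF that] unfolding at_within_open[OF that D(1)] .
  have in_D: "w \<in> D" "w + 1 \<in> D" if "w \<in> D'" for w
  proof -
    have "w + of_real 0 \<in> D" "w + of_real 1 \<in> D" by (rule D'(3)[OF that]; simp)+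
    thus "w \<in> D" "w + 1 \<in> D" by simp_all
  qed
  have "\<exists>c. \<forall>w\<in>D'. P (w + 1) - P w = c"
  proof (rule has_field_derivative_zero_constant[OF D'(2)])
    fix w assume w: "w \<in> D'"
    have "((\<lambda>w. P (w + 1)) has_field_derivative F (w + 1)) (at w)"
      by (rule DERIV_shift[THEN iffD1, OF P[OF in_D(2)[OF w]]])
    hence "((\<lambda>w. P (w + 1) - P w) has_field_derivative (F (w + 1) - F w)) (at w)"
      by (intro DERIV_diff P in_D w)
    thus "((\<lambda>w. P (w + 1) - P w) has_field_derivative 0) (at w within D')"
      using per[OF w] by (simp add: has_field_derivative_at_within)
  qed
  then obtain c where c: "\<And>w. w \<in> D' \<Longrightarrow> P (w + 1) - P w = c" by blast
  have "((\<lambda>x::real. F (w + of_real x)) has_integral c) {0..1}" if w: "w \<in> D'" for w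
  proof -
    have "((\<lambda>x::real. F (w + of_real x)) has_integral (P (w + of_real 1) - P (w + of_real 0))) {0..1}"
    proof (rule fundamental_theorem_of_calculus)
      fix x :: real assume x: "x \<in> {0..1}"
      have "((\<lambda>x. w + of_real x) has_vector_derivative 1) (at x within {0..1})"
        by (auto intro!: derivative_eq_intros)
      from field_vector_diff_chain_within[OF this, of P "F (w + of_real x)"]
      show "((\<lambda>x. P (w + of_real x)) has_vector_derivative F (w + of_real x)) (at x within {0..1})"
        using P[OF D'(3)[OF w]] x by (simp add: o_def has_field_derivative_at_within)
    qed simp
    thus ?thesis using c[OF w] by simp
  qed
  thus ?thesis by blast
qed

text \<open>If f is the sum of c_n \<open>ee\<close> (n z), this is the whole term c_n
  \<open>ee\<close> (n z) and not c_n, so the Fourier series of f at z is simply the sum over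
  n.\<close>

definition fcoef :: "(complex \<Rightarrow> complex) \<Rightarrow> int \<Rightarrow> complex \<Rightarrow> complex" where
  "fcoef f n z = integral {0..1} (\<lambda>x::real. f (z + of_real x) * ee (- (of_int n * of_real x)))"

lemma ee_int_periodic: "ee (- (of_int n * (w + 1))) = ee (- (of_int n * w))"
proof -
  have "- (of_int n * (w + 1)) = - (of_int n * w) + of_int (- n)" by (simp add: distrib_left)
  thus ?thesis by (simp only: ee_add ee_of_int mult_1_right)
qed

lemma norm_integral_le:
  fixes f :: "real \<Rightarrow> complex"
  assumes "f integrable_on {0..1}" "\<And>x. 0 \<le> x \<Longrightarrow> x \<le> 1 \<Longrightarrow> norm (f x) \<le> B" "B \<ge> 0"
  shows "norm (integral {0..1} f) \<le> B"
  using has_integral_bound_real[of B "{}" f "integral {0..1} f" 0 1] assms by (auto simp: integrable_integral)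

lemma continuous_compact_bound:
  assumes "continuous_on K g" "compact K"
  obtains B where "B \<ge> 0" "\<And>x. x \<in> K \<Longrightarrow> norm (g x) \<le> B"
proof -
  have "bounded (g ` K)" by (intro compact_imp_bounded compact_continuous_image assms)
  then obtain B where "B > 0" "\<forall>y\<in>g ` K. norm y \<le> B" unfolding bounded_pos by blast
  hence "B \<ge> 0" "\<And>x. x \<in> K \<Longrightarrow> norm (g x) \<le> B" by auto
  thus ?thesis by (rule that)
qed

lemma summable_exp_int:
  assumes "c > 0"
  shows "(\<lambda>n::int. exp (- c * \<bar>of_int n\<bar>) :: real) summable_on UNIV"
proof (rule summable_on_int_split)
  have g: "(\<lambda>k. exp (- c) ^ k) summable_on (UNIV :: nat set)"
    using assms by (intro norm_summable_imp_summable_on) (simp add: summable_geometric norm_power)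
  have 1: "exp (- c * \<bar>of_int (int k)\<bar>) = exp (- c) ^ k" for k by (simp add: exp_of_nat_mult[symmetric] mult.commute)
  thus "(\<lambda>k. exp (- c * \<bar>of_int (int k)\<bar>)) summable_on UNIV" using g by simp
  have 2: "exp (- c * \<bar>of_int (- 1 - int k)\<bar>) = exp (- c) * exp (- c) ^ k" for k
  proof -
    have "\<bar>of_int (- 1 - int k)\<bar> = (1 + real k)" by simp
    thus ?thesis by (simp add: exp_of_nat_mult[symmetric] exp_add[symmetric] algebra_simps)
  qed
  show "(\<lambda>k. exp (- c * \<bar>of_int (- 1 - int k)\<bar>)) summable_on UNIV"
    unfolding 2 by (intro summable_on_cmult_right g)
qed

locale strip =
  fixes S :: "complex set" and f :: "complex \<Rightarrow> complex"
  assumes S: "open S" "convex S" and S_real: "w \<in> S \<Longrightarrow> w + of_real x \<in> S"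
    and hol: "f holomorphic_on S" and per: "w \<in> S \<Longrightarrow> f (w + 1) = f w"
begin

text \<open>The integral of f(v) \<open>ee\<close> (-n v) over a period is independent of its
  starting point.\<close>

lemma fcoef_shift:
  assumes "z \<in> S" "w \<in> S"
  shows "fcoef f n w = ee (of_int n * (w - z)) * fcoef f n z"
proof -
  define F where "F v = f v * ee (- (of_int n * v))" for v
  have "\<exists>c. \<forall>w\<in>S. ((\<lambda>x::real. F (w + of_real x)) has_integral c) {0..1}"
    by (rule period_integral_const[where D = S and D' = S])
       (auto simp: F_def ee_int_periodic per intro!: S S_real holomorphic_intros hol)
  then obtain c where c: "\<And>w. w \<in> S \<Longrightarrow> ((\<lambda>x::real. F (w + of_real x)) has_integral c) {0..1}" by blast
  have "fcoef f n v = ee (of_int n * v) * c" if "v \<in> S" for v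
  proof -
    have "((\<lambda>x::real. ee (of_int n * v) * F (v + of_real x)) has_integral (ee (of_int n * v) * c)) {0..1}"
      by (intro has_integral_mult_right c that)
    moreover have "ee (of_int n * v) * F (v + of_real x) = f (v + of_real x) * ee (- (of_int n * of_real x))" for x :: real
    proof -
      have "ee (of_int n * v) * ee (- (of_int n * (v + of_real x))) = ee (- (of_int n * of_real x))"
        unfolding ee_add[symmetric] by (simp add: algebra_simps)
      thus ?thesis by (simp add: F_def mult.left_commute)
    qed
    ultimately show ?thesis unfolding fcoef_def by (simp add: integral_unique)
  qed
  hence "fcoef f n w = ee (of_int n * w) * c" "fcoef f n z = ee (of_int n * z) * c" using assms by auto
  moreover have "ee (of_int n * w) = ee (of_int n * (w - z)) * ee (of_int n * z)"
    unfolding ee_add[symmetric] by (simp add: algebra_simps)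
  ultimately show ?thesis by simp
qed

lemma integrable_fcoef:
  assumes "z \<in> S"
  shows "(\<lambda>x::real. f (z + of_real x) * ee (- (of_int n * of_real x))) integrable_on {0..1}"
proof -
  have "continuous_on {0..1} (\<lambda>x::real. f (z + of_real x))"
    by (rule continuous_on_compose2[OF holomorphic_on_imp_continuous_on[OF hol]])
       (auto intro!: continuous_intros S_real assms)
  thus ?thesis by (intro integrable_continuous_real continuous_intros)
qed

lemma norm_fcoef_le:
  assumes "z \<in> S" "B \<ge> 0" "\<And>x. 0 \<le> x \<Longrightarrow> x \<le> 1 \<Longrightarrow> norm (f (z + of_real x)) \<le> B"
  shows "norm (fcoef f n z) \<le> B"
  unfolding fcoef_def
  using assms by (intro norm_integral_le integrable_fcoef) (auto simp: norm_mult norm_ee)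

lemma segment_bound:
  assumes "z \<in> S"
  obtains B where "B \<ge> 0" "\<And>x. 0 \<le> x \<Longrightarrow> x \<le> 1 \<Longrightarrow> norm (f (z + of_real x)) \<le> B"
proof -
  have "continuous_on {0..1} (\<lambda>x::real. f (z + of_real x))"
    by (rule continuous_on_compose2[OF holomorphic_on_imp_continuous_on[OF hol]])
       (auto intro!: continuous_intros S_real assms)
  then obtain B where B: "B \<ge> 0" "\<And>x. x \<in> {0..1} \<Longrightarrow> norm (f (z + of_real x)) \<le> B"
    using continuous_compact_bound[OF _ compact_Icc] by metis
  show ?thesis by (rule that[of B]) (use B in auto)
qed

lemma vertical_nbhd:
  assumes "z \<in> S"
  obtains e where "e > 0" "z + \<i> * of_real e \<in> S" "z - \<i> * of_real e \<in> S"
proof -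
  obtain r where r: "r > 0" "ball z r \<subseteq> S" using S(1) assms openE by blast
  have "z + \<i> * of_real (r / 2) \<in> ball z r" "z - \<i> * of_real (r / 2) \<in> ball z r"
    using r(1) by (auto simp: dist_norm norm_mult)
  hence "z + \<i> * of_real (r / 2) \<in> S" "z - \<i> * of_real (r / 2) \<in> S" using r(2) by blast+
  moreover have "r / 2 > 0" using r(1) by simp
  ultimately show ?thesis using that by blast
qed

text \<open>The line of integration is moved by e, downwards for n >= 0 and upwards for n < 0;
  \<open>fcoef_shift\<close> then yields the factor exp(-2 pi e |n|).\<close>

lemma fcoef_decay:
  assumes "z \<in> S"
  obtains B e where "e > 0" "B \<ge> 0" "\<And>n. norm (fcoef f n z) \<le> B * exp (- (2 * pi * e) * \<bar>of_int n\<bar>)"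
proof -
  obtain e where e: "e > 0" "z + \<i> * of_real e \<in> S" "z - \<i> * of_real e \<in> S" using vertical_nbhd[OF assms] by blast
  obtain B1 where B1: "B1 \<ge> 0" "\<And>x. 0 \<le> x \<Longrightarrow> x \<le> 1 \<Longrightarrow> norm (f (z + \<i> * of_real e + of_real x)) \<le> B1"
    using segment_bound[OF e(2)] by blast
  obtain B2 where B2: "B2 \<ge> 0" "\<And>x. 0 \<le> x \<Longrightarrow> x \<le> 1 \<Longrightarrow> norm (f (z - \<i> * of_real e + of_real x)) \<le> B2"
    using segment_bound[OF e(3)] by blast
  have "norm (fcoef f n z) \<le> max B1 B2 * exp (- (2 * pi * e) * \<bar>of_int n\<bar>)" for n
  proof (cases "n \<ge> 0")
    case False
    have "norm (fcoef f n z) = norm (ee (of_int n * (z - (z + \<i> * of_real e)))) * norm (fcoef f n (z + \<i> * of_real e))"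
      by (subst fcoef_shift[OF e(2) assms]) (simp add: norm_mult)
    also have "\<dots> \<le> exp (- (2 * pi * e) * \<bar>of_int n\<bar>) * B1"
      using norm_fcoef_le[OF e(2) B1] False by (intro mult_mono) (auto simp: norm_ee mult_ac)
    also have "\<dots> \<le> exp (- (2 * pi * e) * \<bar>of_int n\<bar>) * max B1 B2" by (intro mult_left_mono) auto
    finally show ?thesis by (simp add: mult.commute)
  next
    case True
    have "norm (fcoef f n z) = norm (ee (of_int n * (z - (z - \<i> * of_real e)))) * norm (fcoef f n (z - \<i> * of_real e))"
      by (subst fcoef_shift[OF e(3) assms]) (simp add: norm_mult)
    also have "\<dots> \<le> exp (- (2 * pi * e) * \<bar>of_int n\<bar>) * B2"
      using norm_fcoef_le[OF e(3) B2] True by (intro mult_mono) (auto simp: norm_ee mult_ac)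
    also have "\<dots> \<le> exp (- (2 * pi * e) * \<bar>of_int n\<bar>) * max B1 B2" by (intro mult_left_mono) auto
    finally show ?thesis by (simp add: mult.commute)
  qed
  thus ?thesis using that[of e "max B1 B2"] e(1) B1(1) by (simp add: le_max_iff_disj)
qed

lemma fcoef_summable:
  assumes "z \<in> S"
  shows "(\<lambda>n. fcoef f n z) summable_on UNIV"
proof -
  obtain B e where B: "e > 0" "B \<ge> 0" "\<And>n. norm (fcoef f n z) \<le> B * exp (- (2 * pi * e) * \<bar>of_int n\<bar>)"
    using fcoef_decay[OF assms] by blast
  have "(\<lambda>n::int. B * exp (- (2 * pi * e) * \<bar>of_int n\<bar>)) summable_on UNIV"
    using B(1) by (intro summable_on_cmult_right summable_exp_int) auto
  from Infinite_Sum.abs_summable_on_comparison_test'[OF this B(3)]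
  show ?thesis by (rule abs_summable_summable)
qed

text \<open>Chernoff's telescoping proof of the pointwise convergence of Fourier series: dividing
  \<open>f - f z\<close> by \<open>ee (w - z) - 1\<close> writes the coefficients as differences of coefficients
  that tend to zero.\<close>

theorem fourier_has_sum:
  assumes z: "z \<in> S"
  shows "((\<lambda>n. fcoef f n z) has_sum f z) UNIV"
proof -
  \<comment> \<open>On \<open>D\<close> the function \<open>ee (w - z)\<close> takes the value 1
    only at z. A unit segment starting in \<open>D'\<close>, to the left of z, stays within
    \<open>D\<close>.\<close>
  define D where "D = S \<inter> {w. \<bar>Re (w - z)\<bar> < 1}"
  define D' where "D' = S \<inter> {w. - 1 < Re (w - z) \<and> Re (w - z) < 0}"
  have strip_eq: "{w. a < Re (w - z) \<and> Re (w - z) < b} = {w. Re w > a + Re z} \<inter> {w. Re w < b + Re z}" for a b by auto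
  have "{w. \<bar>Re (w - z)\<bar> < 1} = {w. - 1 < Re (w - z) \<and> Re (w - z) < 1}" by auto
  hence D: "open D" "convex D" and D': "open D'" "convex D'" unfolding D_def D'_def strip_eq
    by (auto simp: strip_eq intro!: open_Int convex_Int S open_halfspace_Re_gt open_halfspace_Re_lt convex_halfspace_Re_gt convex_halfspace_Re_lt)
  have zD: "z \<in> D" using z by (simp add: D_def)
  \<comment> \<open>The quotient of f - f z by k - 1 is written as a quotient of two difference
    quotients, each of which extends holomorphically over z.\<close>
  define h1 where "h1 w = (if w = z then deriv f z else (f w - f z) / (w - z))" for w
  define k where "k w = ee (w - z)" for w
  define h2 where "h2 w = (if w = z then deriv k z else (k w - k z) / (w - z))" for w
  have "f holomorphic_on D" using hol by (rule holomorphic_on_subset) (simp add: D_def)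
  hence h1: "h1 holomorphic_on D" unfolding h1_def[abs_def] by (rule pole_lemma_open[OF _ D(1)])
  have "k holomorphic_on D" unfolding k_def[abs_def] by (intro holomorphic_intros)
  hence h2: "h2 holomorphic_on D" unfolding h2_def[abs_def] by (rule pole_lemma_open[OF _ D(1)])
  have kz: "k z = 1" by (simp add: k_def)
  have "(k has_field_derivative 2 * of_real pi * \<i>) (at z)"
    unfolding k_def[abs_def] by (auto intro!: derivative_eq_intros)
  hence dk: "deriv k z = 2 * of_real pi * \<i>" by (rule DERIV_imp_deriv)
  have k1: "k w \<noteq> 1" if "w \<noteq> z" "\<bar>Re (w - z)\<bar> < 1" for w
  proof
    assume "k w = 1"
    then obtain m :: int where m: "w - z = of_int m" unfolding k_def ee_eq_1_iff by (auto elim: Ints_cases)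
    hence "m = 0" using that(2) by simp
    thus False using m that(1) by simp
  qed
  have h2nz: "h2 w \<noteq> 0" if "w \<in> D" for w
    using k1[of w] that by (cases "w = z") (auto simp: h2_def dk kz D_def)
  define g where "g w = h1 w / h2 w" for w
  have g: "g holomorphic_on D" unfolding g_def[abs_def] by (intro holomorphic_on_divide h1 h2) (use h2nz in auto)
  have fg: "f w - f z = (k w - 1) * g w" if "w \<in> D" for w
    using k1[of w] that by (cases "w = z") (auto simp: g_def h1_def h2_def kz D_def)
  have DD: "w + of_real x \<in> D" if "w \<in> D'" "0 \<le> x" "x \<le> 1" for w x
    using that S_real by (auto simp: D_def D'_def)
  have gper: "g (w + 1) = g w" if w: "w \<in> D'" for w
  proof -
    have "w \<in> D" "w + 1 \<in> D" using DD[OF w, of 0] DD[OF w, of 1] by auto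
    hence "(k w - 1) * g w = (k (w + 1) - 1) * g (w + 1)"
      using fg[of w] fg[of "w + 1"] per[of w] w by (simp add: D'_def)
    moreover have "k (w + 1) = k w" by (simp add: k_def ee_diff ee_add)
    moreover have "k w \<noteq> 1" using w by (intro k1) (auto simp: D'_def)
    ultimately show ?thesis by simp
  qed
  define Fn where "Fn n w = g w * ee (- (of_int n * (w - z)))" for n :: int and w
  have Fper: "Fn n (w + 1) = Fn n w" if "w \<in> D'" for n w
    using gper[OF that] ee_int_periodic[of n "w - z"] by (simp add: Fn_def algebra_simps)
  have "\<exists>c. \<forall>w\<in>D'. ((\<lambda>x::real. Fn n (w + of_real x)) has_integral c) {0..1}" for n
    by (rule period_integral_const[where F = "Fn n" and D = D and D' = D', OF D _ D' DD Fper])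
       (auto simp: Fn_def[abs_def] intro!: holomorphic_intros g)
  then obtain G where G: "\<And>n w. w \<in> D' \<Longrightarrow> ((\<lambda>x::real. Fn n (w + of_real x)) has_integral G n) {0..1}" by metis
  define z' where "z' = z - 1 / 2"
  have z'S: "z' \<in> S" using S_real[OF z, of "- 1 / 2"] by (simp add: z'_def)
  have z'D: "z' \<in> D'" using z'S by (simp add: D'_def z'_def)
  \<comment> \<open>Since f - f z = (k - 1) g and multiplication by k shifts the frequency by one,
    the coefficients are differences of those of g. The base point lies half a period to the left of
    z, inside \<open>D'\<close>.\<close>
  have key: "fcoef f n z - (if n = 0 then f z else 0) = G (n - 1) - G n" for n
  proof -
    define I where "I x = f (z' + of_real x) * ee (- (of_int n * of_real x))" for x :: real
    have I: "(I has_integral fcoef f n z') {0..1}"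
      unfolding I_def[abs_def] fcoef_def by (intro integrable_integral integrable_fcoef z'S)
    have "((\<lambda>x. ee (- (of_int n * (z' - z))) * I x) has_integral (ee (- (of_int n * (z' - z))) * fcoef f n z')) {0..1}"
      by (intro has_integral_mult_right I)
    moreover have "ee (- (of_int n * (z' - z))) * fcoef f n z' = fcoef f n z"
      by (subst fcoef_shift[OF z z'S]) (simp add: ee_minus)
    moreover have "ee (- (of_int n * (z' - z))) * I x = f (z' + of_real x) * ee (- (of_int n * (z' + of_real x - z)))" for x
    proof -
      have "ee (- (of_int n * (z' - z))) * ee (- (of_int n * of_real x)) = ee (- (of_int n * (z' + of_real x - z)))"
        unfolding ee_add[symmetric] by (simp add: algebra_simps)
      thus ?thesis by (simp add: I_def mult.left_commute)
    qed
    ultimately have 1: "((\<lambda>x. f (z' + of_real x) * ee (- (of_int n * (z' + of_real x - z)))) has_integral fcoef f n z) {0..1}"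
      by simp
    have 2: "((\<lambda>x::real. f z * ee (- (of_int n * (z' + of_real x - z)))) has_integral (if n = 0 then f z else 0)) {0..1}"
    proof (cases "n = 0")
      case True
      thus ?thesis using has_integral_const_real[of "f z" 0 1] by simp
    next
      case False
      define c where "c = f z / (- 2 * of_real pi * \<i> * of_int n)"
      have "((\<lambda>x::real. f z * ee (- (of_int n * (z' + of_real x - z)))) has_integral
          (c * ee (- (of_int n * (z' + of_real 1 - z))) - c * ee (- (of_int n * (z' + of_real 0 - z))))) {0..1}"
      proof (rule fundamental_theorem_of_calculus)
        fix x :: real assume "x \<in> {0..1}"
        have DV: "((\<lambda>v. c * ee (- (of_int n * (z' + v - z)))) has_field_derivative
            c * (2 * of_real pi * \<i> * (- of_int n) * ee (- (of_int n * (z' + of_real x - z))))) (at (of_real x))"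
          by (auto intro!: derivative_eq_intros)
        have eq: "c * (2 * of_real pi * \<i> * (- of_int n) * ee (- (of_int n * (z' + of_real x - z))))
            = f z * ee (- (of_int n * (z' + of_real x - z)))" using False by (simp add: c_def)
        show "((\<lambda>x. c * ee (- (of_int n * (z' + of_real x - z)))) has_vector_derivative
            f z * ee (- (of_int n * (z' + of_real x - z)))) (at x within {0..1})"
          using has_vector_derivative_real_field[OF DV, of "{0..1}"] unfolding eq .
      qed simp
      moreover have "ee (- (of_int n * (z' + of_real 1 - z))) = ee (- (of_int n * (z' + of_real 0 - z)))"
        using ee_int_periodic[of n "z' - z"] by (simp add: algebra_simps)
      ultimately show ?thesis using False by simp
    qed
    have "((\<lambda>x. Fn (n - 1) (z' + of_real x) - Fn n (z' + of_real x)) has_integral (G (n - 1) - G n)) {0..1}"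
      by (intro has_integral_diff G z'D)
    moreover have "Fn (n - 1) (z' + of_real x) - Fn n (z' + of_real x)
        = f (z' + of_real x) * ee (- (of_int n * (z' + of_real x - z))) - f z * ee (- (of_int n * (z' + of_real x - z)))"
      if x: "x \<in> {0..1}" for x
    proof -
      define w where "w = z' + of_real x"
      have "w \<in> D" unfolding w_def using DD[OF z'D] x by simp
      have "ee (- (of_int (n - 1) * (w - z))) = k w * ee (- (of_int n * (w - z)))"
        unfolding k_def ee_add[symmetric] by (simp add: algebra_simps)
      hence "Fn (n - 1) w - Fn n w = ((k w - 1) * g w) * ee (- (of_int n * (w - z)))"
        by (simp add: Fn_def algebra_simps)
      also have "\<dots> = (f w - f z) * ee (- (of_int n * (w - z)))" using fg[OF \<open>w \<in> D\<close>] by simp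
      finally show ?thesis by (simp add: w_def left_diff_distrib)
    qed
    ultimately have 3: "((\<lambda>x. f (z' + of_real x) * ee (- (of_int n * (z' + of_real x - z))) - f z * ee (- (of_int n * (z' + of_real x - z))))
        has_integral (G (n - 1) - G n)) {0..1}" by (rule has_integral_eq[rotated])
    show ?thesis using has_integral_diff[OF 1 2] 3 by (rule has_integral_unique)
  qed
  obtain e where e: "e > 0" "z' + \<i> * of_real e \<in> S" "z' - \<i> * of_real e \<in> S" using vertical_nbhd[OF z'S] by blast
  have bound: "\<exists>B\<ge>0. \<forall>x. 0 \<le> x \<longrightarrow> x \<le> 1 \<longrightarrow> norm (g (w + of_real x)) \<le> B" if w: "w \<in> D'" for w
  proof -
    have "continuous_on {0..1} (\<lambda>x::real. g (w + of_real x))"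
      by (rule continuous_on_compose2[OF holomorphic_on_imp_continuous_on[OF g]])
         (auto intro!: continuous_intros DD w)
    then obtain B where "B \<ge> 0" "\<And>x. x \<in> {0..1} \<Longrightarrow> norm (g (w + of_real x)) \<le> B"
      using continuous_compact_bound[OF _ compact_Icc] by metis
    thus ?thesis by (intro exI[of _ B]) auto
  qed
  \<comment> \<open>The segment may start at any point of \<open>D'\<close>. Starting it below and
    above the height of z shows that \<open>G n\<close> tends to 0 in both directions.\<close>
  have Gle: "\<exists>B. \<forall>n. norm (G n) \<le> B * exp (2 * pi * Im (w - z) * of_int n)" if w: "w \<in> D'" for w
  proof -
    obtain B where B: "B \<ge> 0" "\<And>x. 0 \<le> x \<Longrightarrow> x \<le> 1 \<Longrightarrow> norm (g (w + of_real x)) \<le> B" using bound[OF w] by blast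
    have "norm (G n) \<le> B * exp (2 * pi * Im (w - z) * of_int n)" for n
    proof -
      have "norm (integral {0..1} (\<lambda>x::real. Fn n (w + of_real x))) \<le> B * exp (2 * pi * Im (w - z) * of_int n)"
      proof (rule norm_integral_le)
        show "(\<lambda>x::real. Fn n (w + of_real x)) integrable_on {0..1}" using G[OF w] by blast
        fix x :: real assume x: "0 \<le> x" "x \<le> 1"
        have "norm (ee (- (of_int n * (w + of_real x - z)))) = exp (2 * pi * Im (w - z) * of_int n)"
          by (simp add: norm_ee algebra_simps)
        thus "norm (Fn n (w + of_real x)) \<le> B * exp (2 * pi * Im (w - z) * of_int n)"
          using B(2)[OF x] by (simp add: Fn_def norm_mult)
      qed (use B(1) in auto)
      thus ?thesis by (simp only: integral_unique[OF G[OF w]])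
    qed
    thus ?thesis by blast
  qed
  have tend: "(\<lambda>N. B * exp (- c * real N)) \<longlonglongrightarrow> 0" if "c > 0" for B c :: real
  proof -
    have "(\<lambda>N. B * exp (- c) ^ N) \<longlonglongrightarrow> B * 0" using that by (intro tendsto_mult LIMSEQ_power_zero tendsto_const) auto
    thus ?thesis by (simp add: exp_of_nat_mult[symmetric] mult.commute)
  qed
  have lim1: "(\<lambda>N. G (int N)) \<longlonglongrightarrow> 0"
  proof -
    have "z' - \<i> * of_real e \<in> D'" using e by (simp add: D'_def z'_def)
    then obtain B where B: "\<And>n. norm (G n) \<le> B * exp (2 * pi * Im (z' - \<i> * of_real e - z) * of_int n)" using Gle by blast
    have 1: "norm (G (int N)) \<le> B * exp (- (2 * pi * e) * real N)" for N
      using B[of "int N"] by (simp add: z'_def)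
    have 2: "(\<lambda>N. B * exp (- (2 * pi * e) * real N)) \<longlonglongrightarrow> 0" using e(1) by (intro tend) simp
    show ?thesis by (rule Lim_null_comparison[OF always_eventually[OF allI[OF 1]] 2])
  qed
  have lim2: "(\<lambda>N. G (- int N - 1)) \<longlonglongrightarrow> 0"
  proof -
    have "z' + \<i> * of_real e \<in> D'" using e by (simp add: D'_def z'_def)
    then obtain B where B: "\<And>n. norm (G n) \<le> B * exp (2 * pi * Im (z' + \<i> * of_real e - z) * of_int n)" using Gle by blast
    have 1: "norm (G (- int N - 1)) \<le> B * exp (- (2 * pi * e) * real (Suc N))" for N
    proof -
      have "2 * pi * Im (z' + \<i> * of_real e - z) * of_int (- int N - 1) = - (2 * pi * e) * real (Suc N)"
        by (simp add: z'_def algebra_simps)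
      thus ?thesis using B[of "- int N - 1"] by (simp only:)
    qed
    have 2: "(\<lambda>N. B * exp (- (2 * pi * e) * real (Suc N))) \<longlonglongrightarrow> 0" using e(1) by (intro LIMSEQ_Suc[OF tend]) simp
    show ?thesis by (rule Lim_null_comparison[OF always_eventually[OF allI[OF 1]] 2])
  qed
  have part: "(\<Sum>n\<in>{- int N..int N}. fcoef f n z) = f z + (G (- int N - 1) - G (int N))" for N
  proof -
    have "fcoef f n z = (if n = 0 then f z else 0) + (G (n - 1) - G n)" for n using key[of n] by (simp add: algebra_simps)
    hence "(\<Sum>n\<in>{- int N..int N}. fcoef f n z) = (\<Sum>n\<in>{- int N..int N}. if n = 0 then f z else 0) + (\<Sum>n\<in>{- int N..int N}. G (n - 1) - G n)"
      by (simp only: sum.distrib)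
    thus ?thesis by (simp only: sum_int_sym_telescope) simp
  qed
  have "(\<lambda>N. f z + (G (- int N - 1) - G (int N))) \<longlonglongrightarrow> f z + (0 - 0)"
    by (intro tendsto_add tendsto_diff tendsto_const lim1 lim2)
  hence "(\<lambda>N. \<Sum>n\<in>{- int N..int N}. fcoef f n z) \<longlonglongrightarrow> f z" by (simp add: part)
  moreover have hs: "((\<lambda>n. fcoef f n z) has_sum (\<Sum>\<^sub>\<infinity>n. fcoef f n z)) UNIV" by (rule has_sum_infsum[OF fcoef_summable[OF z]])
  ultimately have "(\<Sum>\<^sub>\<infinity>n. fcoef f n z) = f z" using has_sum_int_sym_limit[OF hs] LIMSEQ_unique by blast
  thus ?thesis using hs by simp
qed

end

section \<open>Fourier series in several variables on tubes\<close>

text \<open>Morera's theorem: by Fubini the triangle integrals are integrals over the parameter of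
  triangle integrals of g, and these vanish by Cauchy.\<close>

lemma holomorphic_integral_param:
  fixes g :: "complex \<Rightarrow> real \<Rightarrow> complex"
  assumes U: "open U" and cont: "continuous_on (U \<times> cbox 0 1) (\<lambda>(t, x). g t x)"
    and hol: "\<And>x. x \<in> cbox 0 1 \<Longrightarrow> (\<lambda>t. g t x) holomorphic_on U"
  shows "(\<lambda>t. integral (cbox 0 1) (g t)) holomorphic_on U"
proof (rule analytic_imp_holomorphic, rule Morera_triangle[OF _ U], goal_cases)
  case 1
  show ?case by (rule integral_continuous_on_param[OF cont])
next
  case (2 a b c)
  show ?case
  proof
    assume sub: "convex hull {a, b, c} \<subseteq> U"
    define J where "J a b x = contour_integral (linepath a b) (\<lambda>t. g t x)" for a b x
    have swap: "contour_integral (linepath u v) (\<lambda>t. integral (cbox 0 1) (g t)) = integral (cbox 0 1) (J u v) \<and> J u v integrable_on cbox 0 1"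
      if uv: "closed_segment u v \<subseteq> U" for u v
    proof -
      have lp: "linepath u v s \<in> U" if "s \<in> cbox 0 1" for s
        using uv that linepath_in_path[of s u v] by auto
      have c1: "continuous_on (cbox (0, 0) (1, 1)) (\<lambda>y :: real \<times> real. (linepath u v (fst y), snd y))"
        by (intro continuous_intros continuous_on_compose2[OF continuous_on_linepath[of UNIV]]) auto
      have "(\<lambda>y :: real \<times> real. (linepath u v (fst y), snd y)) ` cbox (0, 0) (1, 1) \<subseteq> U \<times> cbox 0 1"
        using lp by auto
      from continuous_on_compose2[OF cont c1 this]
      have c: "continuous_on (cbox (0, 0) (1, 1)) (\<lambda>y :: real \<times> real. g (linepath u v (fst y)) (snd y) * (v - u))"
        by (intro continuous_on_mult_right) simp
      have "contour_integral (linepath u v) (\<lambda>t. integral (cbox 0 1) (g t))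
          = integral (cbox 0 1) (\<lambda>s. integral (cbox 0 1) (g (linepath u v s)) * (v - u))"
        by (simp add: contour_integral_integral)
      also have "\<dots> = integral (cbox 0 1) (\<lambda>s. integral (cbox 0 1) (\<lambda>x. g (linepath u v s) x * (v - u)))" by simp
      also have "\<dots> = integral (cbox 0 1) (\<lambda>x. integral (cbox 0 1) (\<lambda>s. g (linepath u v s) x * (v - u)))"
        using c by (intro integral_swap_continuous) (simp add: case_prod_unfold)
      also have "(\<lambda>x. integral (cbox 0 1) (\<lambda>s. g (linepath u v s) x * (v - u))) = J u v"
        by (rule ext) (simp add: J_def contour_integral_integral)
      finally have 1: "contour_integral (linepath u v) (\<lambda>t. integral (cbox 0 1) (g t)) = integral (cbox 0 1) (J u v)" .
      have c2: "continuous_on (cbox 0 1 \<times> cbox 0 1) (\<lambda>(x, s). g (linepath u v s) x * (v - u))"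
      proof -
        have "continuous_on (cbox 0 1 \<times> cbox 0 1) (\<lambda>z :: real \<times> real. (snd z, fst z))" by (intro continuous_intros)
        moreover have "(\<lambda>z :: real \<times> real. (snd z, fst z)) ` (cbox 0 1 \<times> cbox 0 1) \<subseteq> cbox (0, 0) (1, 1)" by auto
        ultimately show ?thesis using continuous_on_compose2[OF c, of "cbox 0 1 \<times> cbox 0 1" "\<lambda>z. (snd z, fst z)"]
          by (simp add: case_prod_unfold)
      qed
      have "continuous_on (cbox 0 1) (\<lambda>x. integral (cbox 0 1) (\<lambda>s. g (linepath u v s) x * (v - u)))"
        by (rule integral_continuous_on_param[OF c2])
      also have "(\<lambda>x. integral (cbox 0 1) (\<lambda>s. g (linepath u v s) x * (v - u))) = J u v"
        by (rule ext) (simp add: J_def contour_integral_integral)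
      finally show ?thesis using 1 integrable_continuous by blast
    qed
    have seg: "closed_segment a b \<subseteq> U" "closed_segment b c \<subseteq> U" "closed_segment c a \<subseteq> U"
      using sub hull_mono[of "{a, b}" "{a, b, c}" convex] hull_mono[of "{b, c}" "{a, b, c}" convex]
        hull_mono[of "{c, a}" "{a, b, c}" convex] unfolding segment_convex_hull by auto
    have zero: "J a b x + J b c x + J c a x = 0" if x: "x \<in> cbox 0 1" for x
    proof -
      have "((\<lambda>t. g t x) has_contour_integral 0) (linepath a b +++ linepath b c +++ linepath c a)"
        using hol[OF x] sub by (intro Cauchy_theorem_triangle) (rule holomorphic_on_subset)
      moreover have "(\<lambda>t. g t x) contour_integrable_on linepath u v" if "closed_segment u v \<subseteq> U" for u v
        using hol[OF x] that by (intro contour_integrable_continuous_linepath holomorphic_on_imp_continuous_on) (rule holomorphic_on_subset)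
      ultimately show ?thesis using seg
        by (simp add: J_def contour_integral_unique contour_integrable_joinI has_chain_integral_chain_integral3)
    qed
    have "integral (cbox 0 1) (J a b) + integral (cbox 0 1) (J b c) + integral (cbox 0 1) (J c a)
        = integral (cbox 0 1) (\<lambda>x. J a b x + J b c x + J c a x)"
      using swap[OF seg(1)] swap[OF seg(2)] swap[OF seg(3)] by (simp add: integral_add integrable_add)
    also have "\<dots> = integral (cbox 0 1) (\<lambda>x::real. 0)" using zero by (rule Henstock_Kurzweil_Integration.integral_cong)
    finally show "contour_integral (linepath a b) (\<lambda>t. integral (cbox 0 1) (g t)) +
       contour_integral (linepath b c) (\<lambda>t. integral (cbox 0 1) (g t)) +
       contour_integral (linepath c a) (\<lambda>t. integral (cbox 0 1) (g t)) = 0"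
      using swap[OF seg(1)] swap[OF seg(2)] swap[OF seg(3)] by simp
  qed
qed

text \<open>The modulus of a term does not depend on x, so absolute convergence at x = 0 makes the
  convergence uniform, and integration selects the frequency n.\<close>

lemma integral_termwise:
  fixes \<rho> :: "'h \<Rightarrow> int"
  assumes hs: "\<And>x::real. 0 \<le> x \<Longrightarrow> x \<le> 1 \<Longrightarrow> ((\<lambda>k. c k * ee (of_int (\<rho> k) * of_real x)) has_sum f x) I"
  shows "((\<lambda>k. if \<rho> k = n then c k else 0) has_sum integral {0..1} (\<lambda>x. f x * ee (- (of_int n * of_real x)))) I"
proof -
  define g where "g k x = c k * ee (of_int (\<rho> k - n) * of_real x)" for k and x :: real
  have g_eq: "c k * ee (of_int (\<rho> k) * of_real x) * ee (- (of_int n * of_real x)) = g k x" for k x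
  proof -
    have "ee (of_int (\<rho> k) * of_real x) * ee (- (of_int n * of_real x)) = ee (of_int (\<rho> k - n) * of_real x)"
      unfolding ee_add[symmetric] by (simp add: algebra_simps)
    thus ?thesis by (simp add: g_def)
  qed
  have ng: "norm (g k x) = norm (c k)" for k x by (simp add: g_def norm_mult norm_ee)
  have hs': "((\<lambda>k. g k x) has_sum (f x * ee (- (of_int n * of_real x)))) I" if "x \<in> {0..1}" for x
    using has_sum_cmult_left[OF hs[of x], of "ee (- (of_int n * of_real x))"] that by (simp add: g_eq)
  have "(\<lambda>k. c k) summable_on I" using hs[of 0] by (simp add: has_sum_imp_summable)
  hence summ: "(\<lambda>k. norm (c k)) summable_on I" by (simp only: summable_on_iff_abs_summable_on_complex)
  have ul: "uniform_limit {0..1} (\<lambda>X x. \<Sum>k\<in>X. g k x) (\<lambda>x. f x * ee (- (of_int n * of_real x))) (finite_subsets_at_top I)"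
    by (rule Weierstrass_m_test_general'[OF _ hs' summ]) (simp_all add: ng)
  have hi: "(g k has_integral (if \<rho> k = n then c k else 0)) {0..1}" for k
  proof (cases "\<rho> k = n")
    case True
    thus ?thesis using has_integral_const_real[of "c k" 0 1] by (simp add: g_def[abs_def])
  next
    case False
    define d where "d = c k / (2 * of_real pi * \<i> * of_int (\<rho> k - n))"
    have "(g k has_integral (d * ee (of_int (\<rho> k - n) * of_real 1) - d * ee (of_int (\<rho> k - n) * of_real 0))) {0..1}"
    proof (rule fundamental_theorem_of_calculus)
      fix x :: real assume "x \<in> {0..1}"
      have DV: "((\<lambda>v. d * ee (of_int (\<rho> k - n) * v)) has_field_derivative
          d * (2 * of_real pi * \<i> * of_int (\<rho> k - n) * ee (of_int (\<rho> k - n) * of_real x))) (at (of_real x))"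
        by (auto intro!: derivative_eq_intros)
      have eq: "d * (2 * of_real pi * \<i> * of_int (\<rho> k - n) * ee (of_int (\<rho> k - n) * of_real x)) = g k x"
        using False by (simp add: d_def g_def)
      show "((\<lambda>x. d * ee (of_int (\<rho> k - n) * of_real x)) has_vector_derivative g k x) (at x within {0..1})"
        using has_vector_derivative_real_field[OF DV, of "{0..1}"] unfolding eq .
    qed simp
    moreover have "ee (of_int (\<rho> k - n) * of_real 1) = 1" using ee_of_int[of "\<rho> k - n"] by simp
    ultimately show ?thesis using False by simp
  qed
  have cont: "continuous_on {0..1} (\<lambda>x. \<Sum>k\<in>X. g k x)" for X
    unfolding g_def by (intro continuous_intros)
  obtain IX J where IX: "\<And>X. ((\<lambda>x. \<Sum>k\<in>X. g k x) has_integral IX X) {0..1}"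
      and J: "((\<lambda>x. f x * ee (- (of_int n * of_real x))) has_integral J) {0..1}"
      and lim: "(IX \<longlongrightarrow> J) (finite_subsets_at_top I)"
  proof (rule uniform_limit_integral[OF ul cont finite_subsets_at_top_neq_bot])
    fix I' J' assume "\<And>X. ((\<lambda>x. \<Sum>k\<in>X. g k x) has_integral I' X) {0..1}"
      "((\<lambda>x. f x * ee (- (of_int n * of_real x))) has_integral J') {0..1}" "(I' \<longlongrightarrow> J') (finite_subsets_at_top I)"
    thus thesis by (rule that)
  qed
  have "IX X = (\<Sum>k\<in>X. if \<rho> k = n then c k else 0)" if "finite X" for X
    by (rule has_integral_unique[OF IX has_integral_sum[OF that hi]])
  hence "\<forall>\<^sub>F X in finite_subsets_at_top I. IX X = (\<Sum>k\<in>X. if \<rho> k = n then c k else 0)"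
    by (intro eventually_finite_subsets_at_top_weakI) auto
  hence "((\<lambda>X. \<Sum>k\<in>X. if \<rho> k = n then c k else 0) \<longlongrightarrow> J) (finite_subsets_at_top I)"
    by (rule Lim_transform_eventually[OF lim])
  thus ?thesis using J by (simp add: has_sum_def integral_unique)
qed

text \<open>Keeps of the tube over the positive cone what is needed to expand in one direction
  \<open>un i\<close> at a time: every slice in such a direction is a \<open>strip\<close>.\<close>

locale tube =
  fixes T :: "'a :: real_normed_vector set" and un :: "nat \<Rightarrow> complex \<Rightarrow> 'a"
  assumes bl: "bounded_linear (un i)"
    and T: "open T" "convex T" and T_real: "Z \<in> T \<Longrightarrow> Z + un i (of_real x) \<in> T"
begin

lemma un_add: "un i (s + t) = un i s + un i t" using bl by (simp add: bounded_linear.linear linear_add)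
lemma un_0 [simp]: "un i 0 = 0" using bl by (simp add: bounded_linear.linear linear_0)
lemma un_scaleR: "un i (r *\<^sub>R t) = r *\<^sub>R un i t" using bl by (simp add: bounded_linear.linear linear_scale)
lemma continuous_on_un [continuous_intros]: "continuous_on A g \<Longrightarrow> continuous_on A (\<lambda>x. un i (g x))"
  using bl by (rule bounded_linear.continuous_on)

lemma T_real_iff: "Z + un i (of_real x) \<in> T \<longleftrightarrow> Z \<in> T"
proof
  assume "Z + un i (of_real x) \<in> T"
  hence "(Z + un i (of_real x)) + un i (of_real (- x)) \<in> T" by (rule T_real)
  thus "Z \<in> T" by (simp add: add.assoc flip: un_add)
qed (rule T_real)

definition slice :: "nat \<Rightarrow> 'a \<Rightarrow> complex set" where "slice i Z = {t. Z + un i t \<in> T}"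

lemma slice: "open (slice i Z)" "convex (slice i Z)"
proof -
  have "open ((\<lambda>t. Z + un i t) -` T)" by (rule open_vimage[OF T(1)]) (intro continuous_intros)
  thus "open (slice i Z)" by (simp add: slice_def vimage_def)
  show "convex (slice i Z)"
  proof (rule convexI)
    fix s t :: complex and u v :: real assume a: "s \<in> slice i Z" "t \<in> slice i Z" "0 \<le> u" "0 \<le> v" "u + v = 1"
    have "u *\<^sub>R (Z + un i s) + v *\<^sub>R (Z + un i t) \<in> T"
      using a by (intro convexD[OF T(2)]) (auto simp: slice_def)
    also have "u *\<^sub>R (Z + un i s) + v *\<^sub>R (Z + un i t) = (u + v) *\<^sub>R Z + un i (u *\<^sub>R s + v *\<^sub>R t)"
      by (simp add: un_add un_scaleR algebra_simps)
    finally show "u *\<^sub>R s + v *\<^sub>R t \<in> slice i Z" using a(5) by (simp add: slice_def)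
  qed
qed

definition nice :: "('a \<Rightarrow> complex) \<Rightarrow> bool" where
  "nice F \<longleftrightarrow> continuous_on T F \<and> (\<forall>i. \<forall>Z\<in>T. (\<lambda>t. F (Z + un i t)) holomorphic_on slice i Z)
     \<and> (\<forall>i. \<forall>Z\<in>T. F (Z + un i 1) = F Z)"

text \<open>The projection to frequency n in direction i, that is, \<open>fcoef\<close> along the
  slice through Z.\<close>

definition Cop :: "nat \<Rightarrow> int \<Rightarrow> ('a \<Rightarrow> complex) \<Rightarrow> 'a \<Rightarrow> complex" where
  "Cop i n F Z = integral {0..1} (\<lambda>x::real. F (Z + un i (of_real x)) * ee (- (of_int n * of_real x)))"

lemma strip:
  assumes "nice F" "Z \<in> T"
  shows "strip (slice i Z) (\<lambda>t. F (Z + un i t))"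
proof
  show "open (slice i Z)" "convex (slice i Z)" by (rule slice)+
  show "(\<lambda>t. F (Z + un i t)) holomorphic_on slice i Z" using assms by (simp add: nice_def)
  fix w assume w: "w \<in> slice i Z"
  show "w + of_real x \<in> slice i Z" for x using w T_real[of "Z + un i w"] by (simp add: slice_def un_add add.assoc)
  show "F (Z + un i (w + 1)) = F (Z + un i w)" using w assms by (simp add: slice_def nice_def un_add flip: add.assoc)
qed

lemma Cop_fcoef: "fcoef (\<lambda>t. F (Z + un i t)) n t = Cop i n F (Z + un i t)"
  by (simp add: fcoef_def Cop_def un_add add.assoc)

lemma zero_slice: "Z \<in> T \<Longrightarrow> 0 \<in> slice i Z" by (simp add: slice_def)

lemma Cop_has_sum:
  assumes "nice F" "Z \<in> T"
  shows "((\<lambda>n. Cop i n F Z) has_sum F Z) UNIV"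
  using strip.fourier_has_sum[OF strip[OF assms] zero_slice[OF assms(2)], of i] by (simp add: Cop_fcoef)

definition equi :: "nat \<Rightarrow> int \<Rightarrow> ('a \<Rightarrow> complex) \<Rightarrow> bool" where
  "equi i n F \<longleftrightarrow> (\<forall>Z t. Z \<in> T \<longrightarrow> Z + un i t \<in> T \<longrightarrow> F (Z + un i t) = ee (of_int n * t) * F Z)"

lemma equiD: "equi i n F \<Longrightarrow> Z \<in> T \<Longrightarrow> Z + un i t \<in> T \<Longrightarrow> F (Z + un i t) = ee (of_int n * t) * F Z"
  by (simp add: equi_def)

lemma equi_Cop_same: "nice F \<Longrightarrow> equi i n (Cop i n F)"
  unfolding equi_def
  using strip.fcoef_shift[OF strip zero_slice, of F] by (auto simp: Cop_fcoef slice_def)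

lemma equi_Cop: "equi j m F \<Longrightarrow> equi j m (Cop i n F)"
  unfolding equi_def
proof (intro allI impI)
  fix Z t assume F: "\<forall>Z t. Z \<in> T \<longrightarrow> Z + un j t \<in> T \<longrightarrow> F (Z + un j t) = ee (of_int m * t) * F Z"
    and Z: "Z \<in> T" "Z + un j t \<in> T"
  have "F (Z + un j t + un i (of_real x)) = ee (of_int m * t) * F (Z + un i (of_real x))" for x :: real
    using F[rule_format, OF T_real[OF Z(1), of i x], of t] T_real[OF Z(2), of i x] by (simp add: add_ac)
  thus "Cop i n F (Z + un j t) = ee (of_int m * t) * Cop i n F Z"
    by (simp add: Cop_def mult.assoc)
qed

text \<open>Holomorphy in the remaining directions passes under the integral, so the projections can
  be iterated.\<close>

lemma nice_Cop:
  assumes F: "nice F"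
  shows "nice (Cop i n F)"
proof -
  have cF: "continuous_on T F" using F by (simp add: nice_def)
  have cont: "continuous_on (U \<times> cbox 0 1) (\<lambda>(t, x). F (\<gamma> t + un i (of_real x)) * ee (- (of_int n * of_real x)))"
    if "continuous_on U \<gamma>" "\<gamma> ` U \<subseteq> T" for \<gamma> :: "'b::topological_space \<Rightarrow> 'a" and U
  proof -
    have "continuous_on (U \<times> cbox 0 1) (\<lambda>z :: 'b \<times> real. \<gamma> (fst z) + un i (of_real (snd z)))"
      by (intro continuous_intros continuous_on_compose2[OF that(1)]) auto
    hence "continuous_on (U \<times> cbox 0 1) (\<lambda>z :: 'b \<times> real. F (\<gamma> (fst z) + un i (of_real (snd z))))"
      using that(2) T_real by (intro continuous_on_compose2[OF cF]) auto
    thus ?thesis unfolding case_prod_unfold by (intro continuous_intros)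
  qed
  have 1: "continuous_on T (Cop i n F)"
    using integral_continuous_on_param[OF cont[of T "\<lambda>Z. Z"]] by (simp add: Cop_def[abs_def])
  have 2: "(\<lambda>t. Cop i n F (Z + un j t)) holomorphic_on slice j Z" if Z: "Z \<in> T" for j Z
  proof -
    have "(\<lambda>t. integral (cbox 0 1) (\<lambda>x::real. F (Z + un j t + un i (of_real x)) * ee (- (of_int n * of_real x)))) holomorphic_on slice j Z"
    proof (rule holomorphic_integral_param[OF slice(1)])
      show "continuous_on (slice j Z \<times> cbox 0 1) (\<lambda>(t, x). F (Z + un j t + un i (of_real x)) * ee (- (of_int n * of_real x)))"
        by (rule cont[of _ "\<lambda>t. Z + un j t"]) (auto simp: slice_def intro!: continuous_intros)
      fix x :: real
      have "(\<lambda>t. F ((Z + un i (of_real x)) + un j t)) holomorphic_on slice j (Z + un i (of_real x))"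
        using F T_real[OF Z] by (simp add: nice_def)
      moreover have "slice j (Z + un i (of_real x)) = slice j Z"
        using T_real_iff[of "Z + un j _" i x] by (auto simp: slice_def add_ac)
      ultimately show "(\<lambda>t. F (Z + un j t + un i (of_real x)) * ee (- (of_int n * of_real x))) holomorphic_on slice j Z"
        by (intro holomorphic_intros) (simp add: add_ac)
    qed
    thus ?thesis by (simp add: Cop_def)
  qed
  have 3: "Cop i n F (Z + un j 1) = Cop i n F Z" if Z: "Z \<in> T" for j Z
  proof -
    have "F (Z + un j 1 + un i (of_real x)) = F (Z + un i (of_real x))" for x :: real
    proof -
      have "F ((Z + un i (of_real x)) + un j 1) = F (Z + un i (of_real x))"
        using F T_real[OF Z] unfolding nice_def by blast
      thus ?thesis by (simp add: add_ac)
    qed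
    thus ?thesis by (simp add: Cop_def)
  qed
  show ?thesis using 1 2 3 by (simp add: nice_def)
qed

lemma norm_Cop_le:
  assumes "nice F" "Z \<in> T" "B \<ge> 0" "\<And>x. 0 \<le> x \<Longrightarrow> x \<le> 1 \<Longrightarrow> norm (F (Z + un i (of_real x))) \<le> B"
  shows "norm (Cop i n F Z) \<le> B"
  using strip.norm_fcoef_le[OF strip[OF assms(1,2)] zero_slice[OF assms(2)] assms(3), of i n] assms(4)
  by (simp add: Cop_fcoef)

definition Cop4 :: "('a \<Rightarrow> complex) \<Rightarrow> int \<times> int \<times> int \<times> int \<Rightarrow> 'a \<Rightarrow> complex" where
  "Cop4 F = (\<lambda>(h0, h1, h2, h3). Cop 3 h3 (Cop 2 h2 (Cop 1 h1 (Cop 0 h0 F))))"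

lemma equi_Cop4:
  assumes "nice F"
  shows "equi 0 h0 (Cop4 F (h0, h1, h2, h3))" "equi 1 h1 (Cop4 F (h0, h1, h2, h3))"
    "equi 2 h2 (Cop4 F (h0, h1, h2, h3))" "equi 3 h3 (Cop4 F (h0, h1, h2, h3))"
  unfolding Cop4_def case_prod_conv
  by (intro equi_Cop equi_Cop_same nice_Cop assms)+

lemma norm_Cop4_le:
  assumes F: "nice F" and Z: "Z \<in> T" and B: "B \<ge> 0"
    "\<And>x0 x1 x2 x3. x0 \<in> {0..1} \<Longrightarrow> x1 \<in> {0..1} \<Longrightarrow> x2 \<in> {0..1} \<Longrightarrow> x3 \<in> {0..1} \<Longrightarrow>
       norm (F (Z + un 3 (of_real x3) + un 2 (of_real x2) + un 1 (of_real x1) + un 0 (of_real x0))) \<le> B"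
  shows "norm (Cop4 F h Z) \<le> B"
proof -
  obtain h0 h1 h2 h3 where h: "h = (h0, h1, h2, h3)" by (cases h)
  show ?thesis unfolding h Cop4_def case_prod_conv
    by (intro norm_Cop_le nice_Cop F B T_real Z) auto
qed

text \<open>The argument of \<open>fcoef_decay\<close> in all four directions at once: shifting each
  coordinate by e according to the sign of its frequency gains a factor exp(-2 pi e |h|) for each,
  while F is bounded on a compact part of the tube.\<close>

lemma Cop4_summable:
  assumes F: "nice F" and Z: "Z \<in> T"
  shows "(\<lambda>h. norm (Cop4 F h Z)) summable_on UNIV"
proof -
  define \<Phi> where "\<Phi> = (\<lambda>(s0, s1, s2, s3). Z + un 3 s3 + un 2 s2 + un 1 s1 + un 0 s0)"
  have c\<Phi>: "continuous_on UNIV \<Phi>" unfolding \<Phi>_def case_prod_unfold by (intro continuous_intros)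
  have "open (\<Phi> -` T)" by (rule open_vimage[OF T(1) c\<Phi>])
  moreover have "0 \<in> \<Phi> -` T" using Z by (simp add: \<Phi>_def zero_prod_def)
  ultimately obtain r where r: "r > 0" "ball 0 r \<subseteq> \<Phi> -` T" using openE by blast
  \<comment> \<open>Four coordinates of size r / 5 still have total norm below r.\<close>
  define e where "e = r / 5"
  have e: "e > 0" using r by (simp add: e_def)
  have cube: "Z + un 3 s3 + un 2 s2 + un 1 s1 + un 0 s0 \<in> T" if "norm s0 \<le> e" "norm s1 \<le> e" "norm s2 \<le> e" "norm s3 \<le> e" for s0 s1 s2 s3
  proof -
    have "norm (s0, s1, s2, s3) \<le> norm s0 + norm (s1, s2, s3)" by (rule norm_Pair_le)
    also have "norm (s1, s2, s3) \<le> norm s1 + norm (s2, s3)" by (rule norm_Pair_le)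
    also have "norm (s2, s3) \<le> norm s2 + norm s3" by (rule norm_Pair_le)
    finally have "norm (s0, s1, s2, s3) < r" using that e by (simp add: e_def)
    hence "(s0, s1, s2, s3) \<in> ball 0 r" by simp
    thus ?thesis using r(2) by (auto simp: \<Phi>_def)
  qed
  define K where "K = (cbox (Complex 0 (- e)) (Complex 1 e))"
  have memK: "s \<in> K \<longleftrightarrow> 0 \<le> Re s \<and> Re s \<le> 1 \<and> - e \<le> Im s \<and> Im s \<le> e" for s
    by (auto simp: K_def in_cbox_complex_iff)
  have K4: "\<Phi> ` (K \<times> K \<times> K \<times> K) \<subseteq> T"
  proof clarify
    fix s0 s1 s2 s3 assume s: "s0 \<in> K" "s1 \<in> K" "s2 \<in> K" "s3 \<in> K"
    have dec: "un i s = un i (\<i> * of_real (Im s)) + un i (of_real (Re s))" for i s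
    proof -
      have "s = \<i> * of_real (Im s) + of_real (Re s)" by (simp add: complex_eq_iff)
      from arg_cong[OF this, of "un i"] show ?thesis unfolding un_add .
    qed
    have "Z + un 3 (\<i> * of_real (Im s3)) + un 2 (\<i> * of_real (Im s2)) + un 1 (\<i> * of_real (Im s1)) + un 0 (\<i> * of_real (Im s0)) \<in> T"
      by (rule cube) (use s in \<open>auto simp: memK norm_mult\<close>)
    hence "Z + un 3 (\<i> * of_real (Im s3)) + un 2 (\<i> * of_real (Im s2)) + un 1 (\<i> * of_real (Im s1)) + un 0 (\<i> * of_real (Im s0))
      + un 3 (of_real (Re s3)) + un 2 (of_real (Re s2)) + un 1 (of_real (Re s1)) + un 0 (of_real (Re s0)) \<in> T"
      by (intro T_real)
    thus "\<Phi> (s0, s1, s2, s3) \<in> T" unfolding \<Phi>_def case_prod_conv dec[of 0 s0] dec[of 1 s1] dec[of 2 s2] dec[of 3 s3]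
      by (simp add: add_ac)
  qed
  have "continuous_on (K \<times> K \<times> K \<times> K) (\<lambda>s. F (\<Phi> s))"
    using F K4 by (intro continuous_on_compose2[of T F _ \<Phi>] continuous_on_subset[OF c\<Phi>]) (auto simp: nice_def)
  moreover have "compact (K \<times> K \<times> K \<times> K)" by (intro compact_Times) (auto simp: K_def)
  ultimately obtain B where B: "B \<ge> 0" "\<And>s. s \<in> K \<times> K \<times> K \<times> K \<Longrightarrow> norm (F (\<Phi> s)) \<le> B"
    using continuous_compact_bound by blast
  \<comment> \<open>The imaginary part has the sign opposite to the frequency, so
    \<open>ee (of_int n * \<sigma> n)\<close> is large.\<close>
  define \<sigma> where "\<sigma> n = - \<i> * of_real (e * (if n \<ge> 0 then 1 else - 1))" for n :: int
  have n\<sigma>: "norm (\<sigma> n) \<le> e" "Re (\<sigma> n) = 0" "\<bar>Im (\<sigma> n)\<bar> \<le> e" for n using e by (auto simp: \<sigma>_def norm_mult)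
  have ee\<sigma>: "norm (ee (of_int n * \<sigma> n)) = exp (2 * pi * e * \<bar>of_int n\<bar>)" for n
    by (auto simp: norm_ee \<sigma>_def)
  define E where "E n = exp (- (2 * pi * e) * \<bar>of_int n\<bar>)" for n :: int
  have EE: "E n * norm (ee (of_int n * \<sigma> n)) = 1" for n unfolding ee\<sigma> E_def by (simp flip: exp_add)
  have main: "norm (Cop4 F (h0, h1, h2, h3) Z) \<le> B * (E h0 * (E h1 * (E h2 * E h3)))" for h0 h1 h2 h3
  proof -
    let ?G = "Cop4 F (h0, h1, h2, h3)"
    define Z3 where "Z3 = Z + un 3 (\<sigma> h3)"
    define Z2 where "Z2 = Z3 + un 2 (\<sigma> h2)"
    define Z1 where "Z1 = Z2 + un 1 (\<sigma> h1)"
    define Z0 where "Z0 = Z1 + un 0 (\<sigma> h0)"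
    have inT: "Z3 \<in> T" "Z2 \<in> T" "Z1 \<in> T" "Z0 \<in> T"
      using cube[of 0 0 0 "\<sigma> h3"] cube[of 0 0 "\<sigma> h2" "\<sigma> h3"] cube[of 0 "\<sigma> h1" "\<sigma> h2" "\<sigma> h3"] cube[of "\<sigma> h0" "\<sigma> h1" "\<sigma> h2" "\<sigma> h3"] n\<sigma> e
      by (auto simp: Z3_def Z2_def Z1_def Z0_def)
    have eq: "?G Z3 = ee (of_int h3 * \<sigma> h3) * ?G Z" "?G Z2 = ee (of_int h2 * \<sigma> h2) * ?G Z3"
      "?G Z1 = ee (of_int h1 * \<sigma> h1) * ?G Z2" "?G Z0 = ee (of_int h0 * \<sigma> h0) * ?G Z1"
      unfolding Z3_def Z2_def Z1_def Z0_def
      by (rule equiD[OF equi_Cop4(4)[OF F]], (use Z inT in \<open>simp_all add: Z3_def Z2_def Z1_def Z0_def\<close>)[2])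
         (rule equiD[OF equi_Cop4(3)[OF F]], (use Z inT in \<open>simp_all add: Z3_def Z2_def Z1_def Z0_def\<close>)[2],
          rule equiD[OF equi_Cop4(2)[OF F]], (use Z inT in \<open>simp_all add: Z3_def Z2_def Z1_def Z0_def\<close>)[2],
          rule equiD[OF equi_Cop4(1)[OF F]], (use Z inT in \<open>simp_all add: Z3_def Z2_def Z1_def Z0_def\<close>)[2])
    have le: "norm (?G Z0) \<le> B"
    proof (rule norm_Cop4_le[OF F inT(4) B(1)])
      fix x0 x1 x2 x3 :: real assume x: "x0 \<in> {0..1}" "x1 \<in> {0..1}" "x2 \<in> {0..1}" "x3 \<in> {0..1}"
      have "Z0 + un 3 (of_real x3) + un 2 (of_real x2) + un 1 (of_real x1) + un 0 (of_real x0)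
          = \<Phi> (\<sigma> h0 + of_real x0, \<sigma> h1 + of_real x1, \<sigma> h2 + of_real x2, \<sigma> h3 + of_real x3)"
        by (simp add: \<Phi>_def Z0_def Z1_def Z2_def Z3_def un_add add_ac)
      moreover have "\<sigma> n + of_real y \<in> K" if "y \<in> {0..1}" for n y
        using that n\<sigma>(2,3)[of n] by (auto simp: memK)
      ultimately show "norm (F (Z0 + un 3 (of_real x3) + un 2 (of_real x2) + un 1 (of_real x1) + un 0 (of_real x0))) \<le> B"
        using B(2) x by simp
    qed
    have E0: "E n \<ge> 0" for n by (simp add: E_def)
    have "norm (?G Z) = (E h0 * (E h1 * (E h2 * E h3))) * norm (?G Z0)"
    proof -
      have "norm (?G Z0) = norm (ee (of_int h0 * \<sigma> h0)) * (norm (ee (of_int h1 * \<sigma> h1)) * (norm (ee (of_int h2 * \<sigma> h2)) * (norm (ee (of_int h3 * \<sigma> h3)) * norm (?G Z))))"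
        unfolding eq norm_mult ..
      hence "(E h0 * (E h1 * (E h2 * E h3))) * norm (?G Z0) = (E h0 * norm (ee (of_int h0 * \<sigma> h0))) * ((E h1 * norm (ee (of_int h1 * \<sigma> h1)))
         * ((E h2 * norm (ee (of_int h2 * \<sigma> h2))) * ((E h3 * norm (ee (of_int h3 * \<sigma> h3))) * norm (?G Z))))"
        by (simp only: mult_ac)
      thus ?thesis unfolding EE by simp
    qed
    also have "\<dots> \<le> (E h0 * (E h1 * (E h2 * E h3))) * B" using le E0 by (intro mult_left_mono) auto
    finally show ?thesis by (simp add: mult.commute)
  qed
  have sE: "E summable_on UNIV" unfolding E_def[abs_def] using e by (intro summable_exp_int) simp
  have E0: "E n \<ge> 0" for n by (simp add: E_def)
  have "(\<lambda>h. E (fst h) * E (snd h)) summable_on (UNIV \<times> UNIV)" by (intro summable_on_mult_times sE E0)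
  hence s2: "(\<lambda>h. E (fst h) * E (snd h)) summable_on UNIV" by simp
  have "(\<lambda>h. E (fst h) * (E (fst (snd h)) * E (snd (snd h)))) summable_on (UNIV \<times> UNIV)"
    using summable_on_mult_times[OF sE s2 E0] E0 by simp
  hence s3: "(\<lambda>h. E (fst h) * (E (fst (snd h)) * E (snd (snd h)))) summable_on UNIV" by simp
  have "(\<lambda>h. E (fst h) * (E (fst (snd h)) * (E (fst (snd (snd h))) * E (snd (snd (snd h)))))) summable_on (UNIV \<times> UNIV)"
    using summable_on_mult_times[OF sE s3 E0] E0 by simp
  hence "(\<lambda>h. E (fst h) * (E (fst (snd h)) * (E (fst (snd (snd h))) * E (snd (snd (snd h)))))) summable_on UNIV" by simp
  hence "(\<lambda>h. B * (E (fst h) * (E (fst (snd h)) * (E (fst (snd (snd h))) * E (snd (snd (snd h))))))) summable_on UNIV"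
    by (rule summable_on_cmult_right)
  thus ?thesis
  proof (rule Infinite_Sum.abs_summable_on_comparison_test')
    fix h
    show "norm (Cop4 F h Z) \<le> B * (E (fst h) * (E (fst (snd h)) * (E (fst (snd (snd h))) * E (snd (snd (snd h))))))"
      using main[of "fst h" "fst (snd h)" "fst (snd (snd h))" "snd (snd (snd h))"] by simp
  qed
qed

text \<open>The one-variable expansions are nested, and \<open>Cop4_summable\<close> turns the
  iterated sum into an unordered one.\<close>

theorem Cop4_has_sum:
  assumes F: "nice F" and Z: "Z \<in> T"
  shows "((\<lambda>h. Cop4 F h Z) has_sum F Z) UNIV"
proof -
  have s4: "(\<lambda>h. Cop4 F h Z) summable_on UNIV \<times> UNIV"
    using abs_summable_summable[OF Cop4_summable[OF F Z]] by simp
  have s3: "(\<lambda>y. Cop4 F (h0, y) Z) summable_on UNIV \<times> UNIV" for h0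
    using summable_on_SigmaD1[of "\<lambda>x y. Cop4 F (x, y) Z" UNIV "\<lambda>_. UNIV" h0] s4 by (simp add: case_prod_unfold)
  have s2: "(\<lambda>y. Cop4 F (h0, h1, y) Z) summable_on UNIV \<times> UNIV" for h0 h1
    using summable_on_SigmaD1[of "\<lambda>x y. Cop4 F (h0, x, y) Z" UNIV "\<lambda>_. UNIV" h1] s3[of h0] by (simp add: case_prod_unfold)
  have a2: "((\<lambda>y. Cop4 F (h0, h1, y) Z) has_sum Cop 1 h1 (Cop 0 h0 F) Z) (UNIV \<times> UNIV)" for h0 h1
  proof (rule has_sum_SigmaI[OF _ _ s2])
    show "((\<lambda>h2. Cop 2 h2 (Cop 1 h1 (Cop 0 h0 F)) Z) has_sum Cop 1 h1 (Cop 0 h0 F) Z) UNIV"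
      by (intro Cop_has_sum nice_Cop F Z)
    show "((\<lambda>h3. Cop4 F (h0, h1, h2, h3) Z) has_sum Cop 2 h2 (Cop 1 h1 (Cop 0 h0 F)) Z) UNIV" for h2
      unfolding Cop4_def case_prod_conv by (intro Cop_has_sum nice_Cop F Z)
  qed
  have a3: "((\<lambda>y. Cop4 F (h0, y) Z) has_sum Cop 0 h0 F Z) (UNIV \<times> UNIV)" for h0
  proof (rule has_sum_SigmaI[OF _ _ s3])
    show "((\<lambda>h1. Cop 1 h1 (Cop 0 h0 F) Z) has_sum Cop 0 h0 F Z) UNIV"
      by (intro Cop_has_sum nice_Cop F Z)
    show "((\<lambda>y. Cop4 F (h0, h1, y) Z) has_sum Cop 1 h1 (Cop 0 h0 F) Z) UNIV" for h1
      using a2[of h0 h1] by simp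
  qed
  have "((\<lambda>h. Cop4 F h Z) has_sum F Z) (UNIV \<times> UNIV)"
  proof (rule has_sum_SigmaI[OF _ _ s4])
    show "((\<lambda>h0. Cop 0 h0 F Z) has_sum F Z) UNIV" by (intro Cop_has_sum F Z)
    show "((\<lambda>y. Cop4 F (h0, y) Z) has_sum Cop 0 h0 F Z) UNIV" for h0 using a3[of h0] by simp
  qed
  thus ?thesis by simp
qed

text \<open>Real translations suffice to describe the frequencies, since the integrals in
  \<open>Cop\<close> run along them.\<close>

definition expansion :: "(nat \<Rightarrow> 'h \<Rightarrow> int) \<Rightarrow> ('h \<Rightarrow> 'a \<Rightarrow> complex) \<Rightarrow> ('a \<Rightarrow> complex) \<Rightarrow> bool" where
  "expansion \<rho> b F \<longleftrightarrow> (\<forall>h i x. \<forall>Z\<in>T. b h (Z + un i (of_real x)) = ee (of_int (\<rho> i h) * of_real x) * b h Z)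
     \<and> (\<forall>Z\<in>T. ((\<lambda>h. b h Z) has_sum F Z) UNIV)"

lemma expansion_Cop:
  assumes b: "expansion \<rho> b F"
  shows "expansion \<rho> (\<lambda>h Z. if \<rho> i h = n then b h Z else 0) (Cop i n F)"
proof -
  have "((\<lambda>h. if \<rho> i h = n then b h Z else 0) has_sum Cop i n F Z) UNIV" if Z: "Z \<in> T" for Z
  proof -
    have "((\<lambda>h. b h (Z + un i (of_real x))) has_sum F (Z + un i (of_real x))) UNIV" for x :: real
      using b T_real[OF Z, of i x] unfolding expansion_def by blast
    hence "((\<lambda>h. b h Z * ee (of_int (\<rho> i h) * of_real x)) has_sum F (Z + un i (of_real x))) UNIV" for x :: real
      using b Z by (simp add: expansion_def mult.commute)
    from integral_termwise[OF this] show ?thesis by (simp add: Cop_def)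
  qed
  thus ?thesis using b by (simp add: expansion_def)
qed

text \<open>Each projection keeps only the terms of one frequency, so four of them isolate a single
  term of any given expansion.\<close>

lemma Cop4_unique:
  assumes b: "expansion (\<lambda>i (h0, h1, h2, h3). if i = 0 then h0 else if i = 1 then h1 else if i = 2 then h2 else h3) b F"
    and Z: "Z \<in> T"
  shows "Cop4 F h Z = b h Z"
proof -
  obtain h0 h1 h2 h3 where h: "h = (h0, h1, h2, h3)" by (cases h)
  note 4 = expansion_Cop[where i = 3 and n = h3, OF expansion_Cop[where i = 2 and n = h2, OF
     expansion_Cop[where i = 1 and n = h1, OF expansion_Cop[where i = 0 and n = h0, OF b]]]]
  have "((\<lambda>k. if k = h then b h Z else 0) has_sum Cop4 F h Z) UNIV"
    using 4[unfolded expansion_def, THEN conjunct2, rule_format, OF Z] unfolding Cop4_def h case_prod_conv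
    by (rule has_sum_cong[THEN iffD1, rotated]) auto
  moreover have "((\<lambda>k. if k = h then b h Z else 0) has_sum b h Z) UNIV"
    by (rule has_sum_finite_neutralI[of "{h}"]) auto
  ultimately show ?thesis by (rule has_sum_unique)
qed

end

section \<open>The Koecher principle\<close>

text \<open>The quadruple \<open>(a, b, x, y)\<close> stands for the matrix with diagonal \<open>a, b\<close> and off-diagonal
  entries \<open>x + iy\<close>, \<open>x - iy\<close>. Fourier indices are ordered accordingly: \<open>(m, n, r, s)\<close> here is
  \<open>(m, r, s, n)\<close> in the notation of the theorem.\<close>

type_synonym quad = "complex \<times> complex \<times> complex \<times> complex"

definition T4 :: "quad set" where
  "T4 = {(a, b, x, y). 0 < Im a \<and> (Im x)\<^sup>2 + (Im y)\<^sup>2 < Im a * Im b}"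

definition un4 :: "nat \<Rightarrow> complex \<Rightarrow> quad" where
  "un4 i t = (if i = 0 then (t, 0, 0, 0) else if i = 1 then (0, t, 0, 0) else if i = 2 then (0, 0, t, 0) else (0, 0, 0, t))"

lemma T4_iff [simp]: "(a, b, x, y) \<in> T4 \<longleftrightarrow> 0 < Im a \<and> (Im x)\<^sup>2 + (Im y)\<^sup>2 < Im a * Im b"
  by (simp add: T4_def)

text \<open>Positivity is tested on the vectors (1, p - iq) and (0, 1). These conditions are linear
  in A, B, X, Y, so convexity of the tube becomes immediate.\<close>

lemma posdef2_iff:
  fixes A B X Y :: real
  shows "0 < A \<and> X\<^sup>2 + Y\<^sup>2 < A * B \<longleftrightarrow> 0 < B \<and> (\<forall>p q. 0 < A + 2 * (p * X + q * Y) + (p\<^sup>2 + q\<^sup>2) * B)"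
    (is "?L \<longleftrightarrow> ?R")
proof
  assume L: ?L
  have "0 < A * B" using L sum_power2_ge_zero[of X Y] by linarith
  hence B: "0 < B" using L zero_less_mult_pos by blast
  have "0 < A + 2 * (p * X + q * Y) + (p\<^sup>2 + q\<^sup>2) * B" for p q
  proof -
    have "B * (A + 2 * (p * X + q * Y) + (p\<^sup>2 + q\<^sup>2) * B) = (A * B - (X\<^sup>2 + Y\<^sup>2)) + ((X + p * B)\<^sup>2 + (Y + q * B)\<^sup>2)"
      by (simp add: power2_eq_square algebra_simps)
    hence "0 < B * (A + 2 * (p * X + q * Y) + (p\<^sup>2 + q\<^sup>2) * B)"
      using L sum_power2_ge_zero[of "X + p * B" "Y + q * B"] by linarith
    thus ?thesis using B zero_less_mult_pos by blast
  qed
  thus ?R using B by blast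
next
  assume R: ?R
  have A: "0 < A" using R[THEN conjunct2, rule_format, of 0 0] by simp
  have B: "0 < B" using R by simp
  have "0 < A + 2 * (- X / B * X + - Y / B * Y) + ((- X / B)\<^sup>2 + (- Y / B)\<^sup>2) * B"
    using R by blast
  also have "\<dots> = A - (X\<^sup>2 + Y\<^sup>2) / B" using B by (simp add: power2_eq_square field_simps)
  finally have "X\<^sup>2 + Y\<^sup>2 < A * B" using B by (simp add: field_simps)
  thus ?L using A by simp
qed

lemma open_T4: "open T4"
proof -
  have "T4 = {z. 0 < Im (fst z)} \<inter> {z. (Im (fst (snd (snd z))))\<^sup>2 + (Im (snd (snd (snd z))))\<^sup>2 < Im (fst z) * Im (fst (snd z))}"
    by (auto simp: T4_def)
  also have "open \<dots>" by (intro open_Int open_Collect_less continuous_intros)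
  finally show ?thesis .
qed

lemma convex_T4: "convex T4"
proof (rule convexI)
  fix Z W :: quad and u v :: real
  assume ZW: "Z \<in> T4" "W \<in> T4" and uv: "0 \<le> u" "0 \<le> v" "u + v = 1"
  have pos: "0 < u * A + v * B" if "0 < A" "0 < B" for A B :: real
    using that uv by (cases "u = 0") (auto intro!: add_pos_nonneg)
  obtain a b x y a' b' x' y' where Z: "Z = (a, b, x, y)" "W = (a', b', x', y')" by (cases Z, cases W)
  have 1: "0 < Im b" "0 < Im a + 2 * (p * Im x + q * Im y) + (p\<^sup>2 + q\<^sup>2) * Im b" for p q
    using ZW(1) unfolding Z T4_iff posdef2_iff by auto
  have 2: "0 < Im b'" "0 < Im a' + 2 * (p * Im x' + q * Im y') + (p\<^sup>2 + q\<^sup>2) * Im b'" for p q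
    using ZW(2) unfolding Z T4_iff posdef2_iff by auto
  have "0 < (u * Im a + v * Im a') + 2 * (p * (u * Im x + v * Im x') + q * (u * Im y + v * Im y')) + (p\<^sup>2 + q\<^sup>2) * (u * Im b + v * Im b')" for p q
    using pos[OF 1(2)[of p q] 2(2)[of p q]] by (simp add: algebra_simps)
  moreover have "0 < u * Im b + v * Im b'" by (intro pos 1 2)
  ultimately show "u *\<^sub>R Z + v *\<^sub>R W \<in> T4" unfolding Z
    using posdef2_iff[of "u * Im a + v * Im a'" "u * Im x + v * Im x'" "u * Im y + v * Im y'" "u * Im b + v * Im b'"] by simp
qed

interpretation q4: tube T4 un4
proof (rule tube.intro)
  show "bounded_linear (un4 i)" for i
    unfolding un4_def by (cases "i = 0"; cases "i = 1"; cases "i = 2")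
      (simp_all add: bounded_linear_Pair bounded_linear_ident bounded_linear_zero)
  show "Z + un4 i (of_real x) \<in> T4" if "Z \<in> T4" for Z i x
    using that by (cases Z) (simp add: un4_def)
qed (rule open_T4 convex_T4)+

definition lin4 :: "int \<times> int \<times> int \<times> int \<Rightarrow> quad \<Rightarrow> complex" where
  "lin4 = (\<lambda>(m, n, r, s) (a, b, x, y). of_int m * a + of_int n * b + of_int r * x + of_int s * y)"

lemma lin4_simp [simp]: "lin4 (m, n, r, s) (a, b, x, y) = of_int m * a + of_int n * b + of_int r * x + of_int s * y"
  by (simp add: lin4_def)

definition coef4 :: "(quad \<Rightarrow> complex) \<Rightarrow> int \<times> int \<times> int \<times> int \<Rightarrow> complex" where
  "coef4 F h = q4.Cop4 F h (\<i>, \<i>, 0, 0) * ee (- lin4 h (\<i>, \<i>, 0, 0))"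

text \<open>By equivariance the projection divided by the exponential is constant along coordinate
  directions. The path to (i, i, 0, 0) removes x and y first, which keeps it inside
  \<open>T4\<close>.\<close>

lemma Cop4_coef4:
  assumes F: "q4.nice F" and Z: "Z \<in> T4"
  shows "q4.Cop4 F h Z = coef4 F h * ee (lin4 h Z)"
proof -
  obtain m n r s where h: "h = (m, n, r, s)" by (cases h)
  obtain a b x y where Zq: "Z = (a, b, x, y)" by (cases Z)
  define G where "G Z = q4.Cop4 F h Z * ee (- lin4 h Z)" for Z
  have move: "G (Z + un4 i t) = G Z" if "Z \<in> T4" "Z + un4 i t \<in> T4" "q4.equi i l (q4.Cop4 F h)"
      "lin4 h (Z + un4 i t) = lin4 h Z + of_int l * t" for Z i t l
  proof -
    have "ee (of_int l * t) * ee (- lin4 h (Z + un4 i t)) = ee (- lin4 h Z)"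
      unfolding that(4) ee_add[symmetric] by simp
    thus ?thesis using q4.equiD[OF that(3) that(1,2)] by (simp add: G_def mult_ac)
  qed
  note eq = q4.equi_Cop4[OF F, where ?h0.0 = m and ?h1.0 = n and ?h2.0 = r and ?h3.0 = s, folded h]
  have P: "0 < Im a" "0 < Im b" "(Im x)\<^sup>2 + (Im y)\<^sup>2 < Im a * Im b"
    using Z posdef2_iff[of "Im a" "Im x" "Im y" "Im b"] by (auto simp: Zq)
  have P': "(Im y)\<^sup>2 < Im a * Im b" "0 < Im a * Im b" using P zero_le_power2[of "Im x"] by (linarith, simp)
  have "G (a, b, x, y) = G (a, b, 0, y)"
    using move[of "(a, b, x, y)" 2 "- x" r] P P' eq(3) by (simp add: un4_def h algebra_simps)
  also have "\<dots> = G (a, b, 0, 0)"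
    using move[of "(a, b, 0, y)" 3 "- y" s] P P' eq(4) by (simp add: un4_def h algebra_simps)
  also have "\<dots> = G (\<i>, b, 0, 0)"
    using move[of "(a, b, 0, 0)" 0 "\<i> - a" m] P P' eq(1) by (simp add: un4_def h algebra_simps)
  also have "\<dots> = G (\<i>, \<i>, 0, 0)"
    using move[of "(\<i>, b, 0, 0)" 1 "\<i> - b" n] P P' eq(2) by (simp add: un4_def h algebra_simps)
  also have "\<dots> = coef4 F h" by (simp add: G_def coef4_def)
  finally show ?thesis unfolding Zq[symmetric] by (simp add: G_def ee_minus field_simps ee_nz)
qed

lemma coef4_has_sum:
  assumes F: "q4.nice F" and Z: "Z \<in> T4"
  shows "((\<lambda>h. coef4 F h * ee (lin4 h Z)) has_sum F Z) UNIV"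
  using q4.Cop4_has_sum[OF assms] by (simp add: Cop4_coef4[OF assms])

lemma coef4_summable:
  assumes "q4.nice F" "Z \<in> T4"
  shows "(\<lambda>h. norm (coef4 F h * ee (lin4 h Z))) summable_on UNIV"
  using q4.Cop4_summable[OF assms] by (simp add: Cop4_coef4[OF assms])

lemma expansion_lin4:
  assumes "\<And>Z. Z \<in> T4 \<Longrightarrow> ((\<lambda>h. b h * ee (lin4 h Z)) has_sum F Z) UNIV"
  shows "q4.expansion (\<lambda>i (h0, h1, h2, h3). if i = 0 then h0 else if i = 1 then h1 else if i = 2 then h2 else h3)
    (\<lambda>h Z. b h * ee (lin4 h Z)) F"
  unfolding q4.expansion_def
proof safe
  fix h0 h1 h2 h3 :: int and i :: nat and x :: real and Z assume "Z \<in> T4"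
  have "lin4 (h0, h1, h2, h3) (Z + un4 i (of_real x)) = lin4 (h0, h1, h2, h3) Z
     + of_int (if i = 0 then h0 else if i = 1 then h1 else if i = 2 then h2 else h3) * of_real x"
    by (cases Z) (simp add: un4_def algebra_simps)
  thus "b (h0, h1, h2, h3) * ee (lin4 (h0, h1, h2, h3) (Z + un4 i (of_real x))) =
     ee (of_int (if i = 0 then h0 else if i = 1 then h1 else if i = 2 then h2 else h3) * of_real x)
      * (b (h0, h1, h2, h3) * ee (lin4 (h0, h1, h2, h3) Z))"
    by (simp only: ee_add mult_ac)
qed (rule assms)

lemma coef4_unique:
  assumes F: "q4.nice F" and b: "\<And>Z. Z \<in> T4 \<Longrightarrow> ((\<lambda>h. b h * ee (lin4 h Z)) has_sum F Z) UNIV"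
  shows "b = coef4 F"
proof
  fix h
  have Z: "(\<i>, \<i>, 0, 0) \<in> T4" by simp
  show "b h = coef4 F h"
    using q4.Cop4_unique[OF expansion_lin4[OF b] Z, of h] unfolding Cop4_coef4[OF F Z] by (simp add: ee_nz)
qed

text \<open>Invariance of \<open>F\<close> under a substitution transfers to its coefficients by uniqueness.\<close>

lemma coef4_transform:
  assumes F: "q4.nice F" and g: "bij g" and T4: "\<And>a b x y. (a, b, x, y) \<in> T4 \<Longrightarrow> \<gamma> (a, b, x, y) \<in> T4"
    and inv: "\<And>a b x y. (a, b, x, y) \<in> T4 \<Longrightarrow> F (\<gamma> (a, b, x, y)) = F (a, b, x, y)"
    and lin4: "\<And>m n r s a b x y. lin4 (m, n, r, s) (\<gamma> (a, b, x, y)) = lin4 (g (m, n, r, s)) (a, b, x, y)"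
  shows "coef4 F (g h) = coef4 F h"
proof -
  have T: "\<gamma> Z \<in> T4" "F (\<gamma> Z) = F Z" if "Z \<in> T4" for Z
    using T4 inv that by (cases Z; blast)+
  have lin: "lin4 h (\<gamma> Z) = lin4 (g h) Z" for h Z by (cases h; cases Z) (simp only: lin4)
  have "((\<lambda>h. coef4 F (inv g h) * ee (lin4 h Z)) has_sum F Z) UNIV" if Z: "Z \<in> T4" for Z
  proof -
    have "((\<lambda>h. coef4 F h * ee (lin4 (g h) Z)) has_sum F Z) UNIV"
      using coef4_has_sum[OF F T(1)[OF Z]] by (simp add: T(2)[OF Z] lin)
    hence "((\<lambda>h. coef4 F (inv g h) * ee (lin4 (g (inv g h)) Z)) has_sum F Z) UNIV"
      using has_sum_reindex_bij_betw[OF bij_imp_bij_inv[OF g], of "\<lambda>h. coef4 F h * ee (lin4 (g h) Z)" "F Z"] by simp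
    thus ?thesis using g by (simp add: bij_is_surj surj_f_inv_f)
  qed
  from coef4_unique[OF F this] have "coef4 F (inv g (g h)) = coef4 F (g h)" by metis
  thus ?thesis using g by (simp add: bij_is_inj)
qed

text \<open>The modularity that the argument uses: two shears, the exchange of the diagonal entries,
  and the inversion in the first of them.\<close>

locale hermitian_quad =
  fixes F :: "quad \<Rightarrow> complex" and k :: int
  assumes F: "q4.nice F"
    and F_shift1: "(a, b, x, y) \<in> T4 \<Longrightarrow> F (a, b + 2 * x + a, x + a, y) = F (a, b, x, y)"
    and F_shift2: "(a, b, x, y) \<in> T4 \<Longrightarrow> F (a, b + 2 * y + a, x, y + a) = F (a, b, x, y)"
    and F_swap: "(a, b, x, y) \<in> T4 \<Longrightarrow> F (b, a, x, y) = F (a, b, x, y)"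
    and F_S: "(a, b, x, y) \<in> T4 \<Longrightarrow> F (- 1 / a, b - (x\<^sup>2 + y\<^sup>2) / a, x / a, y / a) = a powi k * F (a, b, x, y)"
begin

lemma coef_shift1: "coef4 F (m + r + n, n, r + 2 * n, s) = coef4 F (m, n, r, s)"
proof -
  have bij: "bij (\<lambda>(m, n, r, s). (m + r + n, n, r + 2 * n, s) :: int \<times> int \<times> int \<times> int)"
    by (rule o_bij[of "\<lambda>(m, n, r, s). (m - r + n, n, r - 2 * n, s)"]) (auto simp: fun_eq_iff)
  have T: "(a, b + 2 * x + a, x + a, y) \<in> T4" if "(a, b, x, y) \<in> T4" for a b x y
    using that by (simp add: power2_eq_square algebra_simps)
  have lin: "lin4 (m, n, r, s) ((\<lambda>(a, b, x, y). (a, b + 2 * x + a, x + a, y)) (a, b, x, y)) = lin4 ((\<lambda>(m, n, r, s). (m + r + n, n, r + 2 * n, s)) (m, n, r, s)) (a, b, x, y)" for m n r s a b x y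
    by (simp add: algebra_simps)
  have "coef4 F ((\<lambda>(m, n, r, s). (m + r + n, n, r + 2 * n, s)) (m, n, r, s)) = coef4 F (m, n, r, s)"
    by (rule coef4_transform[OF F bij _ _ lin]) (use T F_shift1 in \<open>simp_all del: T4_iff\<close>)
  thus ?thesis by simp
qed

lemma coef_shift2: "coef4 F (m + s + n, n, r, s + 2 * n) = coef4 F (m, n, r, s)"
proof -
  have bij: "bij (\<lambda>(m, n, r, s). (m + s + n, n, r, s + 2 * n) :: int \<times> int \<times> int \<times> int)"
    by (rule o_bij[of "\<lambda>(m, n, r, s). (m - s + n, n, r, s - 2 * n)"]) (auto simp: fun_eq_iff)
  have T: "(a, b + 2 * y + a, x, y + a) \<in> T4" if "(a, b, x, y) \<in> T4" for a b x y
    using that by (simp add: power2_eq_square algebra_simps)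
  have lin: "lin4 (m, n, r, s) ((\<lambda>(a, b, x, y). (a, b + 2 * y + a, x, y + a)) (a, b, x, y)) = lin4 ((\<lambda>(m, n, r, s). (m + s + n, n, r, s + 2 * n)) (m, n, r, s)) (a, b, x, y)" for m n r s a b x y
    by (simp add: algebra_simps)
  have "coef4 F ((\<lambda>(m, n, r, s). (m + s + n, n, r, s + 2 * n)) (m, n, r, s)) = coef4 F (m, n, r, s)"
    by (rule coef4_transform[OF F bij _ _ lin]) (use T F_shift2 in \<open>simp_all del: T4_iff\<close>)
  thus ?thesis by simp
qed

lemma coef_swap: "coef4 F (n, m, r, s) = coef4 F (m, n, r, s)"
proof -
  have bij: "bij (\<lambda>(m, n, r, s). (n, m, r, s) :: int \<times> int \<times> int \<times> int)"
    by (rule o_bij[of "\<lambda>(m, n, r, s). (n, m, r, s)"]) (auto simp: fun_eq_iff)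
  have T: "(b, a, x, y) \<in> T4" if "(a, b, x, y) \<in> T4" for a b x y
    using that posdef2_iff[of "Im a" "Im x" "Im y" "Im b"] by (simp add: mult.commute)
  have lin: "lin4 (m, n, r, s) ((\<lambda>(a, b, x, y). (b, a, x, y)) (a, b, x, y)) = lin4 ((\<lambda>(m, n, r, s). (n, m, r, s)) (m, n, r, s)) (a, b, x, y)" for m n r s a b x y
    by (simp add: algebra_simps)
  have "coef4 F ((\<lambda>(m, n, r, s). (n, m, r, s)) (m, n, r, s)) = coef4 F (m, n, r, s)"
    by (rule coef4_transform[OF F bij _ _ lin]) (use T F_swap in \<open>simp_all del: T4_iff\<close>)
  thus ?thesis by simp
qed

lemma coef_shift1_iter: "coef4 F (m + j * r + j\<^sup>2 * n, n, r + 2 * n * j, s) = coef4 F (m, n, r, s)"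
proof (induction j rule: int_induct[of _ 0])
  case (step1 j)
  have "coef4 F (m + (j + 1) * r + (j + 1)\<^sup>2 * n, n, r + 2 * n * (j + 1), s)
      = coef4 F ((m + j * r + j\<^sup>2 * n) + (r + 2 * n * j) + n, n, (r + 2 * n * j) + 2 * n, s)"
    by (simp add: power2_eq_square algebra_simps)
  thus ?case unfolding coef_shift1 using step1 by simp
next
  case (step2 j)
  have "coef4 F (m + j * r + j\<^sup>2 * n, n, r + 2 * n * j, s) = coef4 F ((m + (j - 1) * r + (j - 1)\<^sup>2 * n) + (r + 2 * n * (j - 1)) + n, n, (r + 2 * n * (j - 1)) + 2 * n, s)"
    by (simp add: power2_eq_square algebra_simps)
  thus ?case unfolding coef_shift1 using step2 by simp
qed simp

lemma coef_shift2_iter: "coef4 F (m + j * s + j\<^sup>2 * n, n, r, s + 2 * n * j) = coef4 F (m, n, r, s)"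
proof (induction j rule: int_induct[of _ 0])
  case (step1 j)
  have "coef4 F (m + (j + 1) * s + (j + 1)\<^sup>2 * n, n, r, s + 2 * n * (j + 1))
      = coef4 F ((m + j * s + j\<^sup>2 * n) + (s + 2 * n * j) + n, n, r, (s + 2 * n * j) + 2 * n)"
    by (simp add: power2_eq_square algebra_simps)
  thus ?case unfolding coef_shift2 using step1 by simp
next
  case (step2 j)
  have "coef4 F (m + j * s + j\<^sup>2 * n, n, r, s + 2 * n * j) = coef4 F ((m + (j - 1) * s + (j - 1)\<^sup>2 * n) + (s + 2 * n * (j - 1)) + n, n, r, (s + 2 * n * (j - 1)) + 2 * n)"
    by (simp add: power2_eq_square algebra_simps)
  thus ?case unfolding coef_shift2 using step2 by simp
qed simp

text \<open>Absolute convergence at \<open>(\<i>, \<i>, 0, 0)\<close> forbids infinitely many equal nonzero coefficients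
  with bounded trace.\<close>

lemma coef_orbit_zero:
  assumes A: "infinite A" and g: "inj_on g A" "\<And>j. j \<in> A \<Longrightarrow> coef4 F (g j) = c"
    and b: "\<And>j. j \<in> A \<Longrightarrow> fst (g j) + fst (snd (g j)) \<le> M"
  shows "c = 0"
proof (rule ccontr)
  assume c: "c \<noteq> 0"
  define e where "e = norm c * exp (- (2 * pi * of_int M))"
  have e: "e > 0" using c by (simp add: e_def)
  have "(\<lambda>h. norm (coef4 F h * ee (lin4 h (\<i>, \<i>, 0, 0)))) summable_on (g ` A)"
    by (rule summable_on_subset_banach[OF coef4_summable[OF F]]) auto
  hence s: "(\<lambda>j. norm (coef4 F (g j) * ee (lin4 (g j) (\<i>, \<i>, 0, 0)))) summable_on A"
    using summable_on_reindex[OF g(1), of "\<lambda>h. norm (coef4 F h * ee (lin4 h (\<i>, \<i>, 0, 0)))"] by (simp add: o_def)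
  have ge: "e \<le> norm (coef4 F (g j) * ee (lin4 (g j) (\<i>, \<i>, 0, 0)))" if j: "j \<in> A" for j
  proof -
    obtain m n r s where h: "g j = (m, n, r, s)" by (cases "g j")
    have "m + n \<le> M" using b[OF j] h by simp
    hence "real_of_int m + of_int n \<le> of_int M" by linarith
    hence "exp (- (2 * pi * of_int M)) \<le> exp (- (2 * pi * (of_int m + of_int n)))" by simp
    also have "\<dots> = norm (ee (lin4 (g j) (\<i>, \<i>, 0, 0)))" by (simp add: h norm_ee algebra_simps)
    finally show ?thesis by (simp add: e_def norm_mult g(2)[OF j] mult_left_mono)
  qed
  have "finite A" by (rule finite_of_summable[OF abs_summable_summable[OF s] e ge]) auto
  thus False using A by simp
qed

text \<open>For n < 0 the orbit under the shifts is infinite, and m + j r + j^2 n stays bounded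
  above along it.\<close>

lemma coef_neg:
  assumes "n < 0" shows "coef4 F (m, n, r, s) = 0"
proof (rule coef_orbit_zero)
  show "infinite (UNIV :: int set)" by (rule infinite_UNIV_int)
  show "coef4 F (m + j * r + j\<^sup>2 * n, n, r + 2 * n * j, s) = coef4 F (m, n, r, s)" for j by (rule coef_shift1_iter)
  show "inj (\<lambda>j. (m + j * r + j\<^sup>2 * n, n, r + 2 * n * j, s))" using assms by (auto simp: inj_on_def)
  fix j :: int
  have "j * r + j\<^sup>2 * n \<le> r\<^sup>2"
  proof -
    have "j * r + j\<^sup>2 * n \<le> j * r - j\<^sup>2" using mult_left_mono[of n "-1" "j\<^sup>2"] assms by simp
    also have "\<dots> \<le> r\<^sup>2"
    proof -
      have "0 \<le> (2 * j - r)\<^sup>2" by simp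
      hence "4 * (j * r - j\<^sup>2) \<le> r\<^sup>2" by (simp add: power2_eq_square algebra_simps)
      moreover have "u - w \<le> v" if "4 * (u - w) \<le> v" "0 \<le> v" for u v w :: int using that by presburger
      ultimately show ?thesis using zero_le_power2[of r] by blast
    qed
    finally show ?thesis .
  qed
  thus "fst (m + j * r + j\<^sup>2 * n, n, r + 2 * n * j, s) + fst (snd (m + j * r + j\<^sup>2 * n, n, r + 2 * n * j, s)) \<le> m + r\<^sup>2 + n"
    by simp
qed

lemma infinite_multiples: "infinite {j :: int. j * r \<le> 0}"
proof -
  have "\<not> finite ((\<lambda>i. - (sgn r) * int i) ` UNIV)" if "r \<noteq> 0"
    using that by (subst finite_image_iff) (auto simp: inj_on_def sgn_if split: if_splits)
  moreover have "(\<lambda>i. - (sgn r) * int i) ` UNIV \<subseteq> {j. j * r \<le> 0}"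
    by (auto simp: sgn_if mult_nonneg_nonpos mult_nonpos_nonneg)
  ultimately show ?thesis
    by (cases "r = 0") (auto dest: finite_subset simp: infinite_UNIV_int)
qed

text \<open>For n = 0 the shifts fix r and s and move m by multiples of r or of s; half of a
  nontrivial orbit has bounded m.\<close>

lemma coef_n0:
  assumes "coef4 F (m, 0, r, s) \<noteq> 0" shows "r = 0 \<and> s = 0"
proof (rule ccontr)
  assume ne: "\<not> (r = 0 \<and> s = 0)"
  have "coef4 F (m, 0, r, s) = 0"
  proof (cases "r = 0")
    case False
    show ?thesis
    proof (rule coef_orbit_zero[OF infinite_multiples[of r]])
      show "coef4 F (m + j * r, 0, r, s) = coef4 F (m, 0, r, s)" for j using coef_shift1_iter[of m j r 0 s] by simp
      show "inj_on (\<lambda>j. (m + j * r, 0, r, s)) {j. j * r \<le> 0}" using False by (auto simp: inj_on_def)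
      show "fst (m + j * r, 0, r, s) + fst (snd (m + j * r, 0, r, s)) \<le> m" if "j \<in> {j. j * r \<le> 0}" for j using that by simp
    qed
  next
    case True
    show ?thesis
    proof (rule coef_orbit_zero[OF infinite_multiples[of s]])
      show "coef4 F (m + j * s, 0, r, s) = coef4 F (m, 0, r, s)" for j using coef_shift2_iter[of m j s 0 r] by simp
      show "inj_on (\<lambda>j. (m + j * s, 0, r, s)) {j. j * s \<le> 0}" using True ne by (auto simp: inj_on_def)
      show "fst (m + j * s, 0, r, s) + fst (snd (m + j * s, 0, r, s)) \<le> m" if "j \<in> {j. j * s \<le> 0}" for j using that by simp
    qed
  qed
  thus False using assms by simp
qed

lemma reduce_residue: "\<exists>j. \<bar>r + 2 * n * j\<bar> \<le> n" if "0 < n" for r n :: int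
proof -
  have "r + n = (r + n) div (2 * n) * (2 * n) + (r + n) mod (2 * n)"
    by (rule div_mult_mod_eq[symmetric])
  moreover have "0 \<le> (r + n) mod (2 * n)" "(r + n) mod (2 * n) < 2 * n" using that by simp_all
  ultimately have "\<bar>r + 2 * n * (- ((r + n) div (2 * n)))\<bar> \<le> n" by (simp add: algebra_simps abs_le_iff)
  thus ?thesis by blast
qed

text \<open>The Koecher principle, by descent: reducing \<open>r\<close> and \<open>s\<close> modulo \<open>2n\<close> brings \<open>m\<close> below \<open>n\<close> when
  the discriminant is negative.\<close>

lemma coef_disc: "4 * m * n < r\<^sup>2 + s\<^sup>2 \<Longrightarrow> coef4 F (m, n, r, s) = 0"
proof (induction "nat n" arbitrary: m n r s rule: less_induct)
  case less
  consider "n < 0" | "n = 0" | "n > 0" by linarith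
  thus ?case
  proof cases
    case 1 thus ?thesis by (rule coef_neg)
  next
    case 2 thus ?thesis using less.prems coef_n0[of m r s] by (cases "coef4 F (m, n, r, s) = 0") auto
  next
    case 3
    obtain j where j: "\<bar>r + 2 * n * j\<bar> \<le> n" using reduce_residue[OF 3] by blast
    obtain l where l: "\<bar>s + 2 * n * l\<bar> \<le> n" using reduce_residue[OF 3] by blast
    define r' where "r' = r + 2 * n * j"
    define s' where "s' = s + 2 * n * l"
    define m' where "m' = m + j * r + j\<^sup>2 * n + l * s + l\<^sup>2 * n"
    have eq: "coef4 F (m', n, r', s') = coef4 F (m, n, r, s)"
      using coef_shift2_iter[of "m + j * r + j\<^sup>2 * n" l s n r'] coef_shift1_iter[of m j r n s]
      by (simp add: m'_def r'_def s'_def)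
    have disc: "4 * m' * n - (r'\<^sup>2 + s'\<^sup>2) = 4 * m * n - (r\<^sup>2 + s\<^sup>2)"
      by (simp add: m'_def r'_def s'_def power2_eq_square algebra_simps)
    have "r'\<^sup>2 \<le> n\<^sup>2" "s'\<^sup>2 \<le> n\<^sup>2" using j l 3 by (simp_all add: r'_def s'_def abs_le_square_iff[symmetric])
    hence "4 * m' * n < 2 * n\<^sup>2" using disc less.prems by linarith
    hence "(2 * m') * (2 * n) < n * (2 * n)" by (simp add: power2_eq_square algebra_simps)
    hence m': "2 * m' < n" using 3 by (simp add: mult_less_cancel_right)
    have "coef4 F (n, m', r', s') = 0"
    proof (cases "m' < 0")
      case True thus ?thesis by (rule coef_neg)
    next
      case False
      have "4 * n * m' < r'\<^sup>2 + s'\<^sup>2" using disc less.prems by (simp add: algebra_simps)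
      thus ?thesis using False m' 3 by (intro less.hyps) auto
    qed
    thus ?thesis using eq coef_swap[of n m' r' s'] by simp
  qed
qed

theorem koecher:
  assumes "coef4 F (m, n, r, s) \<noteq> 0"
  shows "0 \<le> m" "0 \<le> n" "r\<^sup>2 + s\<^sup>2 \<le> 4 * n * m"
proof -
  show "0 \<le> n" using assms coef_neg[of n m r s] by (cases "n < 0") auto
  show "0 \<le> m" using assms coef_neg[of m n r s] coef_swap[of n m r s] by (cases "m < 0") auto
  show "r\<^sup>2 + s\<^sup>2 \<le> 4 * n * m" using assms coef_disc[of m n r s] by (cases "4 * m * n < r\<^sup>2 + s\<^sup>2") (auto simp: mult_ac)
qed

end

section \<open>Fourier--Jacobi coefficients\<close>

context hermitian_quad
begin

lemma fourier_jacobi_has_sum: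
  assumes Z: "(a, b, x, y) \<in> T4"
  shows "((\<lambda>(m, r, s). coef4 F (m, n, r, s) * ee (of_int m * a + of_int r * x + of_int s * y))
    has_sum q4.Cop 1 n F (a, b, x, y) * ee (- (of_int n * b))) UNIV"
proof -
  define \<iota> where "\<iota> = (\<lambda>(m :: int, r :: int, s :: int). (m, n, r, s))"
  have rng: "h \<in> range \<iota> \<longleftrightarrow> fst (snd h) = n" for h
    by (cases h) (force simp: \<iota>_def image_iff)
  have inj: "inj \<iota>" by (auto simp: \<iota>_def inj_on_def)
  have "((\<lambda>h. if fst (snd h) = n then coef4 F h * ee (lin4 h (a, b, x, y)) else 0) has_sum q4.Cop 1 n F (a, b, x, y)) UNIV"
    using q4.expansion_Cop[OF expansion_lin4[OF coef4_has_sum[OF F]], of 1 n] Z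
    unfolding q4.expansion_def by (simp add: case_prod_unfold)
  hence "((\<lambda>h. coef4 F h * ee (lin4 h (a, b, x, y))) has_sum q4.Cop 1 n F (a, b, x, y)) (range \<iota>)"
    by (rule has_sum_cong_neutral[THEN iffD1, rotated -1]) (auto simp: rng)
  hence "((\<lambda>h. coef4 F (\<iota> h) * ee (lin4 (\<iota> h) (a, b, x, y))) has_sum q4.Cop 1 n F (a, b, x, y)) UNIV"
    by (simp add: has_sum_reindex[OF inj] o_def)
  from has_sum_cmult_left[OF this, of "ee (- (of_int n * b))"]
  have "((\<lambda>h. coef4 F (\<iota> h) * (ee (lin4 (\<iota> h) (a, b, x, y)) * ee (- (of_int n * b)))) has_sum q4.Cop 1 n F (a, b, x, y) * ee (- (of_int n * b))) UNIV"
    by (simp only: mult.assoc)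
  moreover have "ee (lin4 (\<iota> h) (a, b, x, y)) * ee (- (of_int n * b)) = (case h of (m, r, s) \<Rightarrow> ee (of_int m * a + of_int r * x + of_int s * y))" for h
    unfolding ee_add[symmetric] by (cases h) (simp add: \<iota>_def algebra_simps)
  ultimately show ?thesis by (simp add: \<iota>_def case_prod_unfold)
qed

text \<open>The inversion acts on b by a translation, so it commutes with integration over a period
  of b.\<close>

lemma Cop_S:
  assumes Z: "(a, b, x, y) \<in> T4"
  shows "q4.Cop 1 n F (- 1 / a, b - (x\<^sup>2 + y\<^sup>2) / a, x / a, y / a) = a powi k * q4.Cop 1 n F (a, b, x, y)"
proof -
  have "F ((- 1 / a, b - (x\<^sup>2 + y\<^sup>2) / a, x / a, y / a) + un4 1 (of_real u)) = a powi k * F ((a, b, x, y) + un4 1 (of_real u))" for u :: real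
    using F_S[of a "b + of_real u" x y] Z by (simp add: un4_def diff_add_eq)
  thus ?thesis unfolding q4.Cop_def by (simp add: mult.assoc)
qed

text \<open>A Jacobi form lives on all (t, x, y), the tube only on part of (t, b, x, y). Taking Im b
  large puts both a given point and its image under the inversion into \<open>T4\<close>.\<close>

lemma jacobi_coef:
  assumes cz: "\<And>h. of_int (cz h) = coef4 F h" and n: "0 \<le> n"
  shows "jacobi_data (\<lambda>(m, r, s). cz (m, n, r, s)) n k"
proof
  let ?c = "\<lambda>(m, r, s). cz (m, n, r, s)"
  have hs: "((\<lambda>(m, r, s). of_int (?c (m, r, s)) * ee (of_int m * a + of_int r * x + of_int s * y))
    has_sum q4.Cop 1 n F (a, b, x, y) * ee (- (of_int n * b))) UNIV" if "(a, b, x, y) \<in> T4" for a b x y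
    using fourier_jacobi_has_sum[OF that, of n] by (simp add: cz)
  have big: "\<exists>Y. B < A * Y \<and> B' < A' * (Y - e)" if "0 < A" "0 < A'" for A A' B B' e :: real
  proof -
    define Y where "Y = max (B / A) (B' / A' + e) + 1"
    have "B / A < Y" "B' / A' < Y - e" by (auto simp: Y_def)
    hence "B < A * Y \<and> B' < A' * (Y - e)" using that by (simp add: field_simps)
    thus ?thesis by blast
  qed
  show "0 \<le> n" by (rule n)
  show "0 \<le> m \<and> r\<^sup>2 + s\<^sup>2 \<le> 4 * n * m" if "?c (m, r, s) \<noteq> 0" for m r s
  proof -
    have "coef4 F (m, n, r, s) \<noteq> 0" using that cz[of "(m, n, r, s)"] by auto
    from koecher[OF this] show ?thesis by simp
  qed
  have inj: "cz h = cz h'" if "coef4 F h = coef4 F h'" for h h'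
    using that cz[of h] cz[of h'] by (metis of_int_eq_iff)
  show "?c (m + r + n, r + 2 * n, s) = ?c (m, r, s)" for m r s using inj[OF coef_shift1] by simp
  show "?c (m + s + n, r, s + 2 * n) = ?c (m, r, s)" for m r s using inj[OF coef_shift2] by simp
  fix t x y :: complex assume t: "0 < Im t"
  obtain Y where Y: "(Im x)\<^sup>2 + (Im y)\<^sup>2 < Im t * Y"
      "(Im (x / t))\<^sup>2 + (Im (y / t))\<^sup>2 < Im (- 1 / t) * (Y - Im ((x\<^sup>2 + y\<^sup>2) / t))"
    using big[OF t, of "Im (- 1 / t)"] Im_neg_inverse[of t] t by (metis divide_pos_pos less_numeral_extra(3) norm_eq_zero zero_complex.simps(2) zero_less_power2)
  define b where "b = \<i> * of_real Y"
  have Z: "(t, b, x, y) \<in> T4" using Y(1) t by (simp add: b_def)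
  have t0: "t \<noteq> 0" using t by auto
  have "0 < Im (- 1 / t)" using t t0 by (simp only: Im_neg_inverse) simp
  hence Z': "(- 1 / t, b - (x\<^sup>2 + y\<^sup>2) / t, x / t, y / t) \<in> T4"
    using Y(2) unfolding T4_iff by (simp only: b_def minus_complex.simps) simp
  show "(\<lambda>(m, r, s). of_int (?c (m, r, s)) * ee (of_int m * t + of_int r * x + of_int s * y)) summable_on UNIV"
    using hs[OF Z] by (rule has_sum_imp_summable)
  have j: "jphi ?c t' x' y' = q4.Cop 1 n F (t', b', x', y') * ee (- (of_int n * b'))" if "(t', b', x', y') \<in> T4" for t' b' x' y'
    using infsumI[OF hs[OF that]] unfolding jphi_def .
  have e: "ee (- (of_int n * (b - (x\<^sup>2 + y\<^sup>2) / t))) = ee (of_int n * (x\<^sup>2 + y\<^sup>2) / t) * ee (- (of_int n * b))"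
    unfolding ee_add[symmetric] by (simp add: right_diff_distrib)
  show "jphi ?c (- 1 / t) (x / t) (y / t) = t powi k * ee (of_int n * (x\<^sup>2 + y\<^sup>2) / t) * jphi ?c t x y"
    unfolding j[OF Z] j[OF Z'] Cop_S[OF Z] e by (simp only: mult_ac)
qed

theorem coef_congruence:
  assumes p: "prime p" and cz: "\<And>h. of_int (cz h) = coef4 F h"
    and hyp: "\<And>m n r s. 0 \<le> m \<Longrightarrow> m \<le> k div 8 \<Longrightarrow> 0 \<le> n \<Longrightarrow> n \<le> k div 8 \<Longrightarrow> int p dvd cz (m, n, r, s)"
  shows "int p dvd cz (m, n, r, s)"
proof (induction "nat n" arbitrary: m n r s rule: less_induct)
  case less
  have neg: "cz (m, n, r, s) = 0" if "m < 0 \<or> n < 0" for m n r s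
  proof (rule ccontr)
    assume "cz (m, n, r, s) \<noteq> 0"
    hence "coef4 F (m, n, r, s) \<noteq> 0" using cz[of "(m, n, r, s)"] by auto
    from koecher[OF this] show False using that by simp
  qed
  show ?case
  proof (cases "n < 0")
    case True
    thus ?thesis by (simp add: neg)
  next
    case False
    hence n: "0 \<le> n" by simp
    \<comment> \<open>In the first case the hypothesis covers m <= k div 8. In the second, the
      induction hypothesis covers m < n after exchanging m and n.\<close>
    define B where "B = (if n \<le> k div 8 then k div 8 + 1 else n)"
    interpret jacobi_data "\<lambda>(m, r, s). cz (m, n, r, s)" n k by (rule jacobi_coef[OF cz n])
    have "int p dvd (case (m, r, s) of (m, r, s) \<Rightarrow> cz (m, n, r, s))"
    proof (rule jacobi_congruence[OF p, where B = B])
      have k: "k < 8 * (k div 8 + 1)" by presburger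
      show "k < 8 * B"
      proof (cases "n \<le> k div 8")
        case False
        hence "8 * (k div 8 + 1) \<le> 8 * n" by simp
        thus ?thesis using k False by (simp add: B_def)
      qed (use k in \<open>simp add: B_def\<close>)
      show "n \<le> B" by (simp add: B_def)
      fix m r s assume m: "m < B"
      have "int p dvd cz (m, n, r, s)"
      proof (cases "0 \<le> m")
        case True
        show ?thesis
        proof (cases "n \<le> k div 8")
          case True
          thus ?thesis using m n \<open>0 \<le> m\<close> by (intro hyp) (simp_all add: B_def)
        next
          case False
          hence "int p dvd cz (n, m, r, s)" using m True by (intro less.hyps) (simp add: B_def)
          moreover have "of_int (cz (n, m, r, s)) = (of_int (cz (m, n, r, s)) :: complex)"
            unfolding cz by (rule coef_swap)
          ultimately show ?thesis by simp
        qed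
      qed (simp add: neg)
      thus "int p dvd (case (m, r, s) of (m, r, s) \<Rightarrow> cz (m, n, r, s))" by simp
    qed
    thus ?thesis by simp
  qed
qed

end

section \<open>Hermitian modular forms of degree two\<close>

no_notation fps_nth (infixl "$" 75)

definition m2 :: "complex \<Rightarrow> complex \<Rightarrow> complex \<Rightarrow> complex \<Rightarrow> complex^2^2" where
  "m2 a b c d = vector [vector [a, b], vector [c, d]]"

lemma m2_nth [simp]: "m2 a b c d $ 1 $ 1 = a" "m2 a b c d $ 1 $ 2 = b" "m2 a b c d $ 2 $ 1 = c" "m2 a b c d $ 2 $ 2 = d"
  by (simp_all add: m2_def)

lemma m2_eta: "Z = m2 (Z $ 1 $ 1) (Z $ 1 $ 2) (Z $ 2 $ 1) (Z $ 2 $ 2)"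
  by (simp add: vec_eq_iff forall_2)

lemma m2_eq_iff: "m2 a b c d = m2 a' b' c' d' \<longleftrightarrow> a = a' \<and> b = b' \<and> c = c' \<and> d = d'"
  by (auto simp: vec_eq_iff forall_2)

lemma m2_arith: "m2 a b c d ** m2 a' b' c' d' = m2 (a * a' + b * c') (a * b' + b * d') (c * a' + d * c') (c * b' + d * d')"
  "m2 a b c d + m2 a' b' c' d' = m2 (a + a') (b + b') (c + c') (d + d')"
  "mat 1 = m2 1 0 0 1" "transpose (m2 a b c d) = m2 a c b d" "det (m2 a b c d) = a * d - b * c"
  by (simp_all add: vec_eq_iff forall_2 matrix_matrix_mult_def sum_2 mat_def transpose_def det_2)

definition mk4 :: "quad \<Rightarrow> complex^2^2" where
  "mk4 = (\<lambda>(a, b, x, y). m2 a (x + \<i> * y) (x - \<i> * y) b)"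

lemma mk4_simp [simp]: "mk4 (a, b, x, y) = m2 a (x + \<i> * y) (x - \<i> * y) b"
  by (simp add: mk4_def)

lemma mk4_surj: "\<exists>q. Z = mk4 q"
proof
  show "Z = mk4 (Z $ 1 $ 1, Z $ 2 $ 2, (Z $ 1 $ 2 + Z $ 2 $ 1) / 2, \<i> * (Z $ 2 $ 1 - Z $ 1 $ 2) / 2)"
    by (simp add: vec_eq_iff forall_2 field_simps)
qed

lemma herm_form_m2:
  fixes A B X Y :: real
  shows "Re (herm_form (m2 (of_real A) (Complex X Y) (Complex X (- Y)) (of_real B)) v)
    = A * (norm (v $ 1))\<^sup>2 + B * (norm (v $ 2))\<^sup>2 + 2 * Re (cnj (v $ 1) * Complex X Y * v $ 2)"
  unfolding cmod_power2 by (simp add: herm_form_def sum_2 power2_eq_square algebra_simps)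

text \<open>Completing the square gives both the definite and the semidefinite criterion.\<close>

lemma herm_form_square:
  fixes A B X Y :: real
  shows "A * (A * (norm v)\<^sup>2 + B * (norm w)\<^sup>2 + 2 * Re (cnj v * Complex X Y * w))
    = (norm (of_real A * v + Complex X Y * w))\<^sup>2 + (A * B - (X\<^sup>2 + Y\<^sup>2)) * (norm w)\<^sup>2"
  unfolding cmod_power2 by (simp add: power2_eq_square algebra_simps)

lemma half_space_iff: "mk4 q \<in> hermitian_half_space \<longleftrightarrow> q \<in> T4"
proof -
  obtain a b x y where q: "q = (a, b, x, y)" by (cases q)
  define N where "N = m2 (of_real (Im a)) (Complex (Im x) (Im y)) (Complex (Im x) (- Im y)) (of_real (Im b))"
  have N: "(\<chi> i j. (mk4 q - conj_transpose (mk4 q)) $ i $ j / (2 * \<i>)) = N"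
    by (simp add: q N_def vec_eq_iff forall_2 conj_transpose_def complex_eq_iff)
  have herm: "hermitian N" by (simp add: N_def hermitian_def conj_transpose_def vec_eq_iff forall_2 complex_eq_iff)
  have form: "Re (herm_form N v) = Im a * (norm (v $ 1))\<^sup>2 + Im b * (norm (v $ 2))\<^sup>2 + 2 * Re (cnj (v $ 1) * Complex (Im x) (Im y) * v $ 2)" for v
    unfolding N_def by (rule herm_form_m2)
  have "(\<forall>v. v \<noteq> 0 \<longrightarrow> 0 < Re (herm_form N v)) \<longleftrightarrow> q \<in> T4"
  proof safe
    assume P: "\<forall>v. v \<noteq> 0 \<longrightarrow> 0 < Re (herm_form N v)"
    \<comment> \<open>The vectors (0, 1) and (1, p - is) give exactly the conditions of
      \<open>posdef2_iff\<close>.\<close>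
    have "0 < Im b" using P[rule_format, of "vector [0, 1]"] by (simp add: form vec_eq_iff forall_2)
    moreover have "0 < Im a + 2 * (p * Im x + s * Im y) + (p\<^sup>2 + s\<^sup>2) * Im b" for p s
      using P[rule_format, of "vector [1, Complex p (- s)]"]
      by (simp add: form vec_eq_iff forall_2 cmod_power2 algebra_simps)
    ultimately show "q \<in> T4" unfolding q T4_iff posdef2_iff by blast
  next
    fix v :: "complex^2" assume T: "q \<in> T4" and v: "v \<noteq> 0"
    have A: "0 < Im a" "0 < Im a * Im b - ((Im x)\<^sup>2 + (Im y)\<^sup>2)" using T by (auto simp: q)
    have "0 < Im a * Re (herm_form N v)"
    proof (cases "v $ 2 = 0")
      case True
      hence "v $ 1 \<noteq> 0" using v by (simp add: vec_eq_iff forall_2)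
      thus ?thesis unfolding form herm_form_square using A True by simp
    next
      case False
      thus ?thesis unfolding form herm_form_square using A by (intro add_nonneg_pos mult_pos_pos) auto
    qed
    thus "0 < Re (herm_form N v)" using A zero_less_mult_pos by blast
  qed
  thus ?thesis using herm unfolding hermitian_half_space_def mem_Collect_eq N pos_def_def by simp
qed

definition ixm :: "int \<times> int \<times> int \<times> int \<Rightarrow> complex^2^2" where
  "ixm = (\<lambda>(m, n, r, s). index_mat m r s n)"

lemma ixm_m2: "ixm (m, n, r, s) = m2 (of_int m) (Complex (of_int r / 2) (of_int s / 2)) (Complex (of_int r / 2) (- of_int s / 2)) (of_int n)"
  by (simp add: ixm_def index_mat_def m2_def[symmetric] m2_eq_iff complex_eq_iff)

lemma trace_ixm: "trace (ixm h ** mk4 q) = lin4 h q"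
  by (cases h; cases q) (simp add: ixm_m2 m2_arith trace_def sum_2 Complex_eq field_simps)

lemma inj_ixm: "inj ixm"
  by (auto simp: inj_on_def ixm_m2 m2_eq_iff)

lemma Lambda2_range: "H \<in> Lambda2 \<Longrightarrow> H \<in> range ixm"
proof -
  assume H: "H \<in> Lambda2"
  from H obtain m n where mn: "H $ 1 $ 1 = of_int m" "H $ 2 $ 2 = of_int n"
    unfolding Lambda2_def Ints_def by blast
  from H obtain r s where rs: "Re (2 * H $ 1 $ 2) = of_int r" "Im (2 * H $ 1 $ 2) = of_int s"
    unfolding Lambda2_def gaussian_ints_def Ints_def by blast
  have "H $ 2 $ 1 = cnj (H $ 1 $ 2)"
    using H by (simp add: Lambda2_def hermitian_def conj_transpose_def vec_eq_iff forall_2)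
  hence "H = ixm (m, n, r, s)" using mn rs by (simp add: ixm_m2 vec_eq_iff forall_2 complex_eq_iff)
  thus ?thesis by blast
qed

lemma ixm_fourier_index:
  assumes "0 \<le> m" "0 \<le> n" "r\<^sup>2 + s\<^sup>2 \<le> 4 * n * m"
  shows "ixm (m, n, r, s) \<in> fourier_index"
proof -
  define A B X Y :: real where "A = of_int m" and "B = of_int n" and "X = of_int r / 2" and "Y = of_int s / 2"
  have ixm: "ixm (m, n, r, s) = m2 (of_real A) (Complex X Y) (Complex X (- Y)) (of_real B)"
    by (simp add: ixm_m2 A_def B_def X_def Y_def)
  have AB: "0 \<le> A" "0 \<le> B" using assms by (auto simp: A_def B_def)
  have "real_of_int (r\<^sup>2 + s\<^sup>2) \<le> real_of_int (4 * n * m)" using assms(3) by (simp only: of_int_le_iff)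
  hence D: "X\<^sup>2 + Y\<^sup>2 \<le> A * B" by (simp add: A_def B_def X_def Y_def power2_eq_square field_simps)
  have "0 \<le> A * (norm v)\<^sup>2 + B * (norm w)\<^sup>2 + 2 * Re (cnj v * Complex X Y * w)" for v w
  proof (cases "A = 0")
    case True
    hence "X\<^sup>2 + Y\<^sup>2 = 0" using D sum_power2_ge_zero[of X Y] by simp
    thus ?thesis using True AB by (simp add: sum_power2_eq_zero_iff Complex_eq)
  next
    case False
    have "0 \<le> A * (A * (norm v)\<^sup>2 + B * (norm w)\<^sup>2 + 2 * Re (cnj v * Complex X Y * w))"
      unfolding herm_form_square using D by simp
    thus ?thesis using False AB by (simp add: zero_le_mult_iff)
  qed
  hence "pos_semidef (ixm (m, n, r, s))"
    unfolding pos_semidef_def ixm herm_form_m2 hermitian_def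
    by (simp add: conj_transpose_def vec_eq_iff forall_2 complex_eq_iff)
  moreover have "ixm (m, n, r, s) \<in> Lambda2"
    by (simp add: Lambda2_def ixm_m2 hermitian_def conj_transpose_def gaussian_ints_def vec_eq_iff forall_2 complex_eq_iff)
  ultimately show ?thesis by (simp add: fourier_index_def)
qed

section \<open>Block matrices and the elements of U_2(O) that are used\<close>

lemma sum_22: "(\<Sum>a\<in>UNIV. f (a :: 2 + 2)) = f (Inl 1) + f (Inl 2) + (f (Inr 1) + f (Inr 2))"
proof -
  have "sum f UNIV = sum f (Inl ` UNIV) + sum f (Inr ` UNIV)"
    unfolding UNIV_sum by (rule sum.union_disjoint) auto
  thus ?thesis by (simp add: sum.reindex sum_2)
qed

lemma forall_22: "(\<forall>a :: 2 + 2. P a) \<longleftrightarrow> P (Inl 1) \<and> P (Inl 2) \<and> P (Inr 1) \<and> P (Inr 2)"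
  by (simp only: split_sum_all forall_2 conj_assoc)

definition blk :: "complex^2^2 \<Rightarrow> complex^2^2 \<Rightarrow> complex^2^2 \<Rightarrow> complex^2^2 \<Rightarrow> mat4" where
  "blk A B C D = (\<chi> a b. case a of
      Inl i \<Rightarrow> (case b of Inl j \<Rightarrow> A $ i $ j | Inr j \<Rightarrow> B $ i $ j)
    | Inr i \<Rightarrow> (case b of Inl j \<Rightarrow> C $ i $ j | Inr j \<Rightarrow> D $ i $ j))"

lemma blk_nth [simp]: "blk A B C D $ Inl i $ Inl j = A $ i $ j" "blk A B C D $ Inl i $ Inr j = B $ i $ j"
  "blk A B C D $ Inr i $ Inl j = C $ i $ j" "blk A B C D $ Inr i $ Inr j = D $ i $ j"
  by (simp_all add: blk_def)

lemma block_blk [simp]: "blockA (blk A B C D) = A" "blockB (blk A B C D) = B" "blockC (blk A B C D) = C" "blockD (blk A B C D) = D"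
  by (simp_all add: blockA_def blockB_def blockC_def blockD_def vec_eq_iff)

lemma gaussian_ints_add: "x \<in> gaussian_ints \<Longrightarrow> y \<in> gaussian_ints \<Longrightarrow> x + y \<in> gaussian_ints"
  and gaussian_ints_mult: "x \<in> gaussian_ints \<Longrightarrow> y \<in> gaussian_ints \<Longrightarrow> x * y \<in> gaussian_ints"
  and gaussian_ints_Ints: "of_int n \<in> gaussian_ints"
  by (auto simp: gaussian_ints_def)

lemma det_gaussian:
  assumes "\<forall>a b. M $ a $ b \<in> gaussian_ints"
  shows "det M \<in> gaussian_ints"
proof -
  have s: "sum f A \<in> gaussian_ints" if "\<And>x. x \<in> A \<Longrightarrow> f x \<in> gaussian_ints" for f and A :: "'b set"
    using that by (induction A rule: infinite_finite_induct) (auto intro: gaussian_ints_add simp: gaussian_ints_def)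
  have p: "prod f A \<in> gaussian_ints" if "\<And>x. x \<in> A \<Longrightarrow> f x \<in> gaussian_ints" for f and A :: "'b set"
    using that by (induction A rule: infinite_finite_induct) (auto intro: gaussian_ints_mult simp: gaussian_ints_def)
  show ?thesis unfolding det_def
    by (intro s gaussian_ints_mult gaussian_ints_Ints p) (use assms in auto)
qed

lemma det_conj_transpose: "det (conj_transpose M) = cnj (det M)"
proof -
  have "conj_transpose M = transpose (\<chi> i j. cnj (M $ i $ j))"
    by (simp add: conj_transpose_def transpose_def vec_eq_iff)
  thus ?thesis by (simp add: det_transpose) (simp add: det_def)
qed

text \<open>The determinant is a Gaussian integer of modulus 1, hence a fourth root of
  unity.\<close>

lemma U2_det_powi:
  assumes M: "M \<in> U2" and k: "4 dvd k"
  shows "det M powi k = 1"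
proof -
  have "Jmat ** (- 1 *\<^sub>R Jmat) = mat 1"
    by (simp add: vec_eq_iff forall_22 matrix_matrix_mult_def sum_22 Jmat_def mat_def)
  hence "det Jmat * det (- 1 *\<^sub>R Jmat) = 1" using det_mul[of Jmat "- 1 *\<^sub>R Jmat"] by simp
  hence J: "det Jmat \<noteq> 0" by auto
  have "det (conj_transpose M ** Jmat ** M) = det Jmat" using M by (simp add: U2_def)
  hence "cnj (det M) * det M = 1" using J by (simp add: det_mul det_conj_transpose)
  hence "complex_of_real ((cmod (det M))\<^sup>2) = 1" by (simp only: complex_norm_square mult.commute)
  hence "(cmod (det M))\<^sup>2 = 1" by (simp only: of_real_eq_1_iff)
  moreover have "det M \<in> gaussian_ints" using M by (intro det_gaussian) (simp add: U2_def)
  then obtain u v where uv: "Re (det M) = of_int u" "Im (det M) = of_int v"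
    unfolding gaussian_ints_def Ints_def by blast
  ultimately have "real_of_int (u\<^sup>2 + v\<^sup>2) = real_of_int 1" by (simp add: cmod_power2)
  hence "u\<^sup>2 + v\<^sup>2 = 1" by (simp only: of_int_eq_iff)
  moreover have "u * v = 0"
  proof (rule ccontr)
    assume "u * v \<noteq> 0"
    hence "1 \<le> u\<^sup>2" "1 \<le> v\<^sup>2" by (auto simp: int_one_le_iff_zero_less)
    thus False using calculation by simp
  qed
  ultimately have "(u = 0 \<and> v\<^sup>2 = 1) \<or> (v = 0 \<and> u\<^sup>2 = 1)" by auto
  hence "det M = 1 \<or> det M = - 1 \<or> det M = \<i> \<or> det M = - \<i>"
    using uv by (auto simp: complex_eq_iff power2_eq_1_iff)
  hence 4: "det M powi 4 = 1" by (auto simp: power4_eq_xxxx)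
  obtain j where "k = 4 * j" using k by blast
  thus ?thesis using 4 by (simp only: power_int_mult) simp
qed

lemma matrix_inv_eq:
  fixes X Y :: "complex^'n^'n"
  assumes "X ** Y = mat 1"
  shows "matrix_inv X = Y"
proof -
  have "Y ** X = mat 1" using assms matrix_left_right_inverse by blast
  hence "\<exists>Y. X ** Y = mat 1 \<and> Y ** X = mat 1" using assms by blast
  hence "matrix_inv X ** X = mat 1" unfolding matrix_inv_def by (rule someI2_ex) blast
  hence "(matrix_inv X ** X) ** Y = Y" by simp
  thus ?thesis by (simp add: matrix_mul_assoc[symmetric] assms)
qed

text \<open>The inverse of the automorphy factor is supplied explicitly as \<open>Y\<close>, and the
  character disappears by \<open>U2_det_powi\<close>.\<close>

lemma modular_blk:
  assumes F: "F \<in> hermitian_modular_forms k" and k: "4 dvd k" and M: "blk A B C D \<in> U2"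
    and Z: "Z \<in> hermitian_half_space" and Y: "(C ** Z + D) ** Y = mat 1"
  shows "F ((A ** Z + B) ** Y) = det (C ** Z + D) powi k * F Z"
proof -
  have "det (C ** Z + D) * det Y = 1" using det_mul[of "C ** Z + D" Y] by (simp add: Y)
  hence nz: "det (C ** Z + D) \<noteq> 0" by auto
  have "det (aut_factor (blk A B C D) Z) powi (- k) * F (moebius_act (blk A B C D) Z) = F Z"
    using F M Z U2_det_powi[OF M k] unfolding hermitian_modular_forms_def by simp
  hence "det (C ** Z + D) powi (- k) * F ((A ** Z + B) ** Y) = F Z"
    by (simp add: aut_factor_def moebius_act_def matrix_inv_eq[OF Y])
  thus ?thesis using nz by (simp add: power_int_minus field_simps)
qed

lemma U2_blkI:
  assumes "\<And>i j. A $ i $ j \<in> gaussian_ints" "\<And>i j. B $ i $ j \<in> gaussian_ints" "\<And>i j. C $ i $ j \<in> gaussian_ints" "\<And>i j. D $ i $ j \<in> gaussian_ints"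
    and "conj_transpose (blk A B C D) ** Jmat ** blk A B C D = Jmat"
  shows "blk A B C D \<in> U2"
proof -
  have "blk A B C D $ a $ b \<in> gaussian_ints" for a b
    using assms(1-4) by (cases a; cases b) auto
  thus ?thesis using assms(5) by (simp add: U2_def)
qed

lemma m2_gaussian: "a \<in> gaussian_ints \<Longrightarrow> b \<in> gaussian_ints \<Longrightarrow> c \<in> gaussian_ints \<Longrightarrow> d \<in> gaussian_ints \<Longrightarrow> m2 a b c d $ i $ j \<in> gaussian_ints"
  using exhaust_2[of i] exhaust_2[of j] by auto

lemmas U2_simps = vec_eq_iff forall_22 matrix_matrix_mult_def sum_22 Jmat_def conj_transpose_def

lemma U2_translation:
  assumes "a \<in> \<int>" "d \<in> \<int>" "b \<in> gaussian_ints"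
  shows "blk (m2 1 0 0 1) (m2 a b (cnj b) d) (m2 0 0 0 0) (m2 1 0 0 1) \<in> U2"
proof (rule U2_blkI; (rule m2_gaussian)?)
  show "conj_transpose (blk (m2 1 0 0 1) (m2 a b (cnj b) d) (m2 0 0 0 0) (m2 1 0 0 1)) ** Jmat **
      blk (m2 1 0 0 1) (m2 a b (cnj b) d) (m2 0 0 0 0) (m2 1 0 0 1) = Jmat"
    using assms by (auto simp: U2_simps elim: Ints_cases)
qed (use assms in \<open>auto simp: gaussian_ints_def elim: Ints_cases\<close>)

lemma U2_shear:
  assumes "l \<in> gaussian_ints"
  shows "blk (m2 1 0 l 1) (m2 0 0 0 0) (m2 0 0 0 0) (m2 1 (- cnj l) 0 1) \<in> U2"
proof (rule U2_blkI; (rule m2_gaussian)?)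
  show "conj_transpose (blk (m2 1 0 l 1) (m2 0 0 0 0) (m2 0 0 0 0) (m2 1 (- cnj l) 0 1)) ** Jmat **
      blk (m2 1 0 l 1) (m2 0 0 0 0) (m2 0 0 0 0) (m2 1 (- cnj l) 0 1) = Jmat"
    by (simp add: U2_simps)
qed (use assms in \<open>auto simp: gaussian_ints_def\<close>)

lemma U2_swap: "blk (m2 0 1 1 0) (m2 0 0 0 0) (m2 0 0 0 0) (m2 0 1 1 0) \<in> U2"
proof (rule U2_blkI; (rule m2_gaussian)?)
  show "conj_transpose (blk (m2 0 1 1 0) (m2 0 0 0 0) (m2 0 0 0 0) (m2 0 1 1 0)) ** Jmat **
      blk (m2 0 1 1 0) (m2 0 0 0 0) (m2 0 0 0 0) (m2 0 1 1 0) = Jmat"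
    by (simp add: U2_simps)
qed (auto simp: gaussian_ints_def)

lemma U2_inversion: "blk (m2 0 0 0 1) (m2 (- 1) 0 0 0) (m2 1 0 0 0) (m2 0 0 0 1) \<in> U2"
proof (rule U2_blkI; (rule m2_gaussian)?)
  show "conj_transpose (blk (m2 0 0 0 1) (m2 (- 1) 0 0 0) (m2 1 0 0 0) (m2 0 0 0 1)) ** Jmat **
      blk (m2 0 0 0 1) (m2 (- 1) 0 0 0) (m2 1 0 0 0) (m2 0 0 0 1) = Jmat"
    by (simp add: U2_simps)
qed (auto simp: gaussian_ints_def)

section \<open>Transfer of modular forms to the coordinates (a, b, x, y)\<close>

lemma linear_mk4: "linear mk4"
  by (rule linearI) (auto simp: mk4_def vec_eq_iff forall_2 complex_eq_iff algebra_simps)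

lemma nice_mk4:
  assumes F: "F \<in> hermitian_modular_forms k" and k: "4 dvd k"
  shows "q4.nice (\<lambda>q. F (mk4 q))"
proof -
  have bl: "bounded_linear mk4" by (rule linear_conv_bounded_linear[THEN iffD1, OF linear_mk4])
  have diff: "\<exists>F'. (F has_derivative F') (at Z) \<and> (\<forall>c X. F' (\<chi> i j. c * X $ i $ j) = c * F' X)" if "Z \<in> hermitian_half_space" for Z
    using F that unfolding hermitian_modular_forms_def holomorphic_mat_on_def by blast
  have "continuous_on hermitian_half_space F"
    using diff has_derivative_continuous by (fastforce intro: continuous_at_imp_continuous_on)
  moreover have "continuous_on T4 mk4" using bl by (rule linear_continuous_on)
  moreover have "mk4 ` T4 \<subseteq> hermitian_half_space" using half_space_iff by blast
  ultimately have 1: "continuous_on T4 (\<lambda>q. F (mk4 q))" by (rule continuous_on_compose2)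
  have 2: "(\<lambda>t. F (mk4 (Z + un4 i t))) holomorphic_on q4.slice i Z" for i Z
  proof (rule holomorphic_onI)
    fix t assume "t \<in> q4.slice i Z"
    hence "mk4 (Z + un4 i t) \<in> hermitian_half_space" by (simp add: half_space_iff q4.slice_def)
    from diff[OF this] obtain F' where F': "(F has_derivative F') (at (mk4 (Z + un4 i t)))"
      and lin: "\<And>c X. F' (\<chi> i j. c * X $ i $ j) = c * F' X" by blast
    have "bounded_linear (\<lambda>u. mk4 (un4 i u))" using bl q4.bl by (rule bounded_linear_compose)
    hence "((\<lambda>u. mk4 Z + mk4 (un4 i u)) has_derivative (\<lambda>u. mk4 (un4 i u))) (at t)"
      by (auto intro!: derivative_eq_intros bounded_linear_imp_has_derivative)
    moreover have "mk4 Z + mk4 (un4 i u) = mk4 (Z + un4 i u)" for u by (simp add: linear_add[OF linear_mk4])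
    ultimately have "((\<lambda>u. mk4 (Z + un4 i u)) has_derivative (\<lambda>u. mk4 (un4 i u))) (at t)" by simp
    from has_derivative_compose[OF this F']
    have D: "((\<lambda>u. F (mk4 (Z + un4 i u))) has_derivative (\<lambda>u. F' (mk4 (un4 i u)))) (at t)" .
    have "F' (mk4 (un4 i u)) = F' (mk4 (un4 i 1)) * u" for u
    proof -
      have "mk4 (un4 i u) = (\<chi> j l. u * mk4 (un4 i 1) $ j $ l)"
        by (simp add: un4_def vec_eq_iff forall_2)
      thus ?thesis by (simp add: lin mult.commute)
    qed
    hence "(\<lambda>u. F' (mk4 (un4 i u))) = (*) (F' (mk4 (un4 i 1)))" by (rule ext)
    from D[unfolded this] have "((\<lambda>u. F (mk4 (Z + un4 i u))) has_field_derivative F' (mk4 (un4 i 1))) (at t)"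
      unfolding has_field_derivative_def .
    thus "(\<lambda>t. F (mk4 (Z + un4 i t))) field_differentiable at t within q4.slice i Z"
      unfolding field_differentiable_def by (intro exI) (rule has_field_derivative_at_within)
  qed
  have 3: "F (mk4 (Z + un4 i 1)) = F (mk4 Z)" if Z: "Z \<in> T4" for i Z
  proof -
    \<comment> \<open>Each unit step is a Hermitian translation with Gaussian entries; the step in y
      has off-diagonal entries i and -i.\<close>
    define a d b :: complex where "a = (if i = 0 then 1 else 0)" and "d = (if i = 1 then 1 else 0)"
      and "b = (if i = 0 \<or> i = 1 then 0 else if i = 2 then 1 else \<i>)"
    have un: "mk4 (un4 i 1) = m2 a b (cnj b) d" by (simp add: un4_def a_def b_def d_def)
    have U: "blk (m2 1 0 0 1) (m2 a b (cnj b) d) (m2 0 0 0 0) (m2 1 0 0 1) \<in> U2"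
      by (rule U2_translation) (auto simp: a_def b_def d_def gaussian_ints_def)
    obtain z11 z12 z21 z22 where z: "mk4 Z = m2 z11 z12 z21 z22" using m2_eta by blast
    have hs: "mk4 Z \<in> hermitian_half_space" using Z by (simp only: half_space_iff)
    have "(m2 0 0 0 0 ** mk4 Z + m2 1 0 0 1) ** m2 1 0 0 1 = mat 1" by (simp add: z m2_arith)
    from modular_blk[OF F k U hs this]
    have "F ((m2 1 0 0 1 ** mk4 Z + m2 a b (cnj b) d) ** m2 1 0 0 1) = det (m2 0 0 0 0 ** mk4 Z + m2 1 0 0 1) powi k * F (mk4 Z)" .
    thus ?thesis unfolding linear_add[OF linear_mk4] un z by (simp add: m2_arith)
  qed
  show ?thesis unfolding q4.nice_def using 1 2 3 by blast
qed

lemma hermitian_quad_mk4: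
  assumes F: "F \<in> hermitian_modular_forms k" and k: "4 dvd k"
  shows "hermitian_quad (\<lambda>q. F (mk4 q)) k"
proof
  show "q4.nice (\<lambda>q. F (mk4 q))" by (rule nice_mk4[OF assms])
  fix a b x y assume Z: "(a, b, x, y) \<in> T4"
  note hs = Z[folded half_space_iff, unfolded mk4_simp]
  have shear: "F ((m2 1 0 l 1 ** m2 a (x + \<i> * y) (x - \<i> * y) b + m2 0 0 0 0) ** m2 1 (cnj l) 0 1) = F (m2 a (x + \<i> * y) (x - \<i> * y) b)"
    if "l \<in> gaussian_ints" for l
    using modular_blk[OF F k U2_shear[OF that] hs, of "m2 1 (cnj l) 0 1"] by (simp add: m2_arith)
  show "F (mk4 (a, b + 2 * x + a, x + a, y)) = F (mk4 (a, b, x, y))"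
    using shear[of 1] by (simp add: m2_arith gaussian_ints_def algebra_simps)
  have "\<i> * (\<i> * y) = - y" by (simp flip: mult.assoc)
  thus "F (mk4 (a, b + 2 * y + a, x, y + a)) = F (mk4 (a, b, x, y))"
    using shear[of "- \<i>"] by (simp add: m2_arith gaussian_ints_def algebra_simps)
  \<comment> \<open>This matrix exchanges the off-diagonal entries as well as the diagonal ones; the
    symmetry of F under transposition undoes the former. The determinant -1 of the automorphy factor
    is harmless since k is even.\<close>
  have "F ((m2 0 1 1 0 ** m2 a (x + \<i> * y) (x - \<i> * y) b + m2 0 0 0 0) ** m2 0 1 1 0) = F (m2 a (x + \<i> * y) (x - \<i> * y) b)"
    using modular_blk[OF F k U2_swap hs, of "m2 0 1 1 0"] k by (auto simp: m2_arith elim!: evenE)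
  hence "F (transpose (mk4 (b, a, x, y))) = F (mk4 (a, b, x, y))" by (simp add: m2_arith)
  moreover have "(b, a, x, y) \<in> T4"
    using Z posdef2_iff[of "Im a" "Im x" "Im y" "Im b"] by (simp add: mult.commute)
  hence "F (transpose (mk4 (b, a, x, y))) = F (mk4 (b, a, x, y))"
    using F unfolding hermitian_modular_forms_def by (simp add: half_space_iff del: mk4_simp)
  ultimately show "F (mk4 (b, a, x, y)) = F (mk4 (a, b, x, y))" by simp
  have a: "a \<noteq> 0" using Z by auto
  have "F ((m2 0 0 0 1 ** m2 a (x + \<i> * y) (x - \<i> * y) b + m2 (- 1) 0 0 0) ** m2 (1 / a) (- (x + \<i> * y) / a) 0 1)
      = a powi k * F (m2 a (x + \<i> * y) (x - \<i> * y) b)"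
    using modular_blk[OF F k U2_inversion hs, of "m2 (1 / a) (- (x + \<i> * y) / a) 0 1"] a by (simp add: m2_arith)
  moreover have "(m2 0 0 0 1 ** m2 a (x + \<i> * y) (x - \<i> * y) b + m2 (- 1) 0 0 0) ** m2 (1 / a) (- (x + \<i> * y) / a) 0 1
      = mk4 (- 1 / a, b - (x\<^sup>2 + y\<^sup>2) / a, x / a, y / a)"
    using a by (simp add: m2_arith m2_eq_iff field_simps power2_eq_square)
  ultimately show "F (mk4 (- 1 / a, b - (x\<^sup>2 + y\<^sup>2) / a, x / a, y / a)) = a powi k * F (mk4 (a, b, x, y))" by simp
qed

text \<open>The Koecher principle confines \<open>coef4\<close> to \<open>fourier_index\<close>, so
  it yields an expansion in the required sense; \<open>coef4_unique\<close> shows that no other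
  exists, as \<open>THE\<close> demands.\<close>

lemma fourier_coeff_ixm:
  assumes F: "F \<in> hermitian_modular_forms k" and k: "4 dvd k"
  shows "fourier_coeff F (ixm h) = coef4 (\<lambda>q. F (mk4 q)) h" "ixm h \<notin> fourier_index \<Longrightarrow> coef4 (\<lambda>q. F (mk4 q)) h = 0"
proof -
  interpret hermitian_quad "\<lambda>q. F (mk4 q)" k by (rule hermitian_quad_mk4[OF F k])
  let ?f = "\<lambda>q. F (mk4 q)"
  define a where "a H = (if H \<in> range ixm then coef4 ?f (inv ixm H) else 0)" for H
  have a_ixm: "a (ixm h) = coef4 ?f h" for h by (simp add: a_def inj_ixm)
  have zero: "coef4 ?f h = 0" if "ixm h \<notin> fourier_index" for h
  proof (rule ccontr)
    assume nz: "coef4 ?f h \<noteq> 0"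
    obtain m n r s where h: "h = (m, n, r, s)" by (cases h)
    show False using koecher[OF nz[unfolded h]] ixm_fourier_index[of m n r s] that by (simp add: h)
  qed
  have sub: "fourier_index \<subseteq> range ixm" using Lambda2_range by (auto simp: fourier_index_def)
  have transfer: "((\<lambda>H. b H * exp (2 * of_real pi * \<i> * trace (H ** mk4 q))) has_sum S) fourier_index
      \<longleftrightarrow> ((\<lambda>h. b (ixm h) * ee (lin4 h q)) has_sum S) UNIV" if "\<And>H. H \<notin> fourier_index \<Longrightarrow> b H = 0" for b S q
  proof -
    have "((\<lambda>H. b H * exp (2 * of_real pi * \<i> * trace (H ** mk4 q))) has_sum S) fourier_index
      \<longleftrightarrow> ((\<lambda>H. b H * exp (2 * of_real pi * \<i> * trace (H ** mk4 q))) has_sum S) (range ixm)"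
      using sub that by (intro has_sum_cong_neutral) auto
    also have "\<dots> \<longleftrightarrow> ((\<lambda>h. b (ixm h) * ee (lin4 h q)) has_sum S) UNIV"
      by (simp add: has_sum_reindex[OF inj_ixm] o_def trace_ixm ee_def)
    finally show ?thesis .
  qed
  have "is_fourier_expansion F a"
    unfolding is_fourier_expansion_def
  proof (intro conjI ballI allI impI)
    show az: "a H = 0" if "H \<notin> fourier_index" for H
      using that zero by (auto simp: a_def inj_ixm)
    fix Z assume Z: "Z \<in> hermitian_half_space"
    obtain q where q: "Z = mk4 q" using mk4_surj by blast
    show "((\<lambda>H. a H * exp (2 * of_real pi * \<i> * trace (H ** Z))) has_sum F Z) fourier_index"
    proof -
      have "((\<lambda>h. a (ixm h) * ee (lin4 h q)) has_sum F (mk4 q)) UNIV"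
        unfolding a_ixm using Z by (intro coef4_has_sum[OF local.F]) (simp add: q half_space_iff)
      thus ?thesis unfolding q by (rule transfer[OF az, THEN iffD2, rotated])
    qed
  qed
  moreover have "b = a" if b: "is_fourier_expansion F b" for b
  proof
    fix H
    have bz: "b H = 0" if "H \<notin> fourier_index" for H using b that by (simp add: is_fourier_expansion_def)
    have "((\<lambda>h. b (ixm h) * ee (lin4 h q)) has_sum F (mk4 q)) UNIV" if q: "q \<in> T4" for q
    proof -
      have "((\<lambda>H. b H * exp (2 * of_real pi * \<i> * trace (H ** mk4 q))) has_sum F (mk4 q)) fourier_index"
        using b q unfolding is_fourier_expansion_def by (simp only: half_space_iff)
      thus ?thesis by (rule transfer[OF bz, THEN iffD1, rotated])
    qed
    from coef4_unique[OF local.F this] have "(\<lambda>h. b (ixm h)) = coef4 ?f" .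
    hence eq: "b (ixm h) = a (ixm h)" for h unfolding a_ixm by (rule fun_cong)
    show "b H = a H"
    proof (cases "H \<in> range ixm")
      case True
      then obtain h where "H = ixm h" by blast
      thus ?thesis by (simp only: eq)
    next
      case False
      hence "H \<notin> fourier_index" using sub by blast
      thus ?thesis using bz False by (simp add: a_def)
    qed
  qed
  ultimately have "fourier_coeff F = a" unfolding fourier_coeff_def by (rule the_equality)
  thus "fourier_coeff F (ixm h) = coef4 ?f h" by (simp add: a_ixm)
  show "ixm h \<notin> fourier_index \<Longrightarrow> coef4 ?f h = 0" by (rule zero)
qed

theorem theorem8:
  fixes p :: nat and k :: int and F :: "complex^2^2 \<Rightarrow> complex"
  assumes "prime p"
    and "4 dvd k"
    and "F \<in> hermitian_modular_forms_over k \<int>"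
    and "\<And>m r s n :: int. index_mat m r s n \<in> fourier_index \<Longrightarrow>
           0 \<le> m \<Longrightarrow> m \<le> \<lfloor>real_of_int k / 8\<rfloor> \<Longrightarrow>
           0 \<le> n \<Longrightarrow> n \<le> \<lfloor>real_of_int k / 8\<rfloor> \<Longrightarrow>
           \<exists>c\<in>\<int>. fourier_coeff F (index_mat m r s n) = of_nat p * c"
  shows "\<forall>H\<in>fourier_index. \<exists>c\<in>\<int>. fourier_coeff F H = of_nat p * c"
proof
  have FM: "F \<in> hermitian_modular_forms k" and int: "\<And>H. H \<in> fourier_index \<Longrightarrow> fourier_coeff F H \<in> \<int>"
    using assms(3) by (auto simp: hermitian_modular_forms_over_def)
  interpret hermitian_quad "\<lambda>q. F (mk4 q)" k by (rule hermitian_quad_mk4[OF FM assms(2)])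
  note coeff = fourier_coeff_ixm[OF FM assms(2)]
  have "\<exists>z. of_int z = coef4 (\<lambda>q. F (mk4 q)) h" for h
  proof (cases "ixm h \<in> fourier_index")
    case True
    from int[OF this] show ?thesis unfolding coeff Ints_def by auto
  next
    case False
    from coeff(2)[OF this] show ?thesis by (intro exI[of _ 0]) simp
  qed
  then obtain cz where cz: "\<And>h. of_int (cz h) = coef4 (\<lambda>q. F (mk4 q)) h" by metis
  have fl: "\<lfloor>real_of_int k / 8\<rfloor> = k div 8" using floor_divide_of_int_eq[of k 8] by simp
  have hyp: "int p dvd cz (m, n, r, s)" if mn: "0 \<le> m" "m \<le> k div 8" "0 \<le> n" "n \<le> k div 8" for m n r s
  proof (cases "ixm (m, n, r, s) \<in> fourier_index")
    case True
    with assms(4)[of m r s n] mn obtain c where c: "c \<in> \<int>" "fourier_coeff F (ixm (m, n, r, s)) = of_nat p * c"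
      by (auto simp: ixm_def fl)
    then obtain z where "c = of_int z" unfolding Ints_def by blast
    hence "of_int (cz (m, n, r, s)) = (of_int (int p * z) :: complex)" using c(2) by (simp add: cz coeff)
    hence "cz (m, n, r, s) = int p * z" by (simp only: of_int_eq_iff)
    thus ?thesis by simp
  next
    case False
    from coeff(2)[OF this] show ?thesis using cz[of "(m, n, r, s)"] by simp
  qed
  fix H assume H: "H \<in> fourier_index"
  hence "H \<in> range ixm" by (intro Lambda2_range) (simp add: fourier_index_def)
  then obtain h where h: "H = ixm h" by blast
  obtain m n r s where hq: "h = (m, n, r, s)" by (cases h)
  have "int p dvd cz h" unfolding hq by (rule coef_congruence[OF assms(1) cz hyp])
  then obtain z where "cz h = int p * z" by blast
  hence "fourier_coeff F H = of_nat p * of_int z" unfolding h coeff cz[symmetric] by simp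
  thus "\<exists>c\<in>\<int>. fourier_coeff F H = of_nat p * c" by (intro bexI[of _ "of_int z"]) auto
qed

end
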